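(* Let $\Omega\subset\mathbb{R}^N$, $N\in\{2,3\}$, together with $\Gamma_M\subset\partial\Omega$, $\bar x$, $\varepsilon_0$, satisfy the geometric assumption of the context. For $i=1,2$ let the data $(a_i,b_i,c_i,d_i,u_{0,i})$ satisfy the coefficient assumption of the context, and suppose that the solvability assumption of the context holds for these data. Suppose in addition that for $i=1,2$ and every $g\in G$ the weak solution $u_i(g)$ of $$-\operatorname{div}\big(a_i(t,u)\nabla u+b_i(x,t,u)\big)+c_i(x,t,u,\nabla u)=\tfrac{d}{dt}d_i(t,u)\ \text{ in }\Omega\times(0,T),\quad u=g \text{ on }\partial\Omega\times(0,T),\quad u(0)=u_{0,i}\text{ in }\Omega$$ is unique and satisfies $\underline g\le u_i(g)\le\overline g$. Let $j_i(g)$ denote the corresponding Neumann flux. Assume that $b_1=b_2$, $c_1=c_2$, $d_1=d_2$ and $u_{0,1}=u_{0,2}$. Then $$a_1\equiv a_2\ \text{ on }(0,T)\times(\underline g,\overline g)\quad\Longleftrightarrow\quad j_1(g)\equiv j_2(g)\ \text{ on }\Gamma_M\times(0,T)\ \text{ for all }g\in G.$$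
   Context: Fixed are $T>0$, real numbers $\underline g<\overline g$, and positive constants $C_A,C_0,C_G,\underline a,\overline a$. $B_r(y)$ is the open ball of radius $r$ about $y$; $n$ is the outward unit normal on $\partial\Omega$; $(\cdot,\cdot)_\Omega$ is the $L^2(\Omega)$ inner product. The space dimension is denoted by $N$; $d_i$ denotes a coefficient function. Geometric assumption: $\Omega\subset\mathbb{R}^N$, $N\in\{2,3\}$, is a bounded Lipschitz domain and $\Gamma_M'\subset\partial\Omega$ is an open smooth part of the boundary with $|\Gamma_M'|\neq0$; $\bar x\in\Gamma_M'$ and $\varepsilon_0>0$ are such that $B_{\varepsilon_0}(\bar x+\varepsilon_0 n(\bar x))\cap\Omega=\emptyset$ and $\Gamma_M:=B_{\varepsilon_0}(\bar x)\cap\partial\Omega\subset\Gamma_M'$. Moreover $\Gamma_M$ is flat: $n(x)=n(\bar x)=e_N$ (the $N$-th unit vector) for $x\in\Gamma_M$. Coefficient assumption: the functions $a=a(t,u)$, $b=b(x,t,u)\in\mathbb{R}^N$, $c=c(x,t,u,p)$, $d=d(t,u)$ (with $x\in\Omega$, $t\in(0,T)$, $u\in\mathbb{R}$, $p\in\mathbb{R}^N$) lie in $W^{1,\infty}$ of their respective domains with norm bounded by $C_A$, $0<\underline a\le a(t,u)\le\overline a$, and $u_0\in L^2(\Omega)$ with $\|u_0\|_{L^2(\Omega)}\le C_0$. Dirichlet data: $G:=\{g\in H^1(0,T;H^1(\partial\Omega)):\ \underline g\le g\le\overline g,\ \|g\|_{H^1(0,T;H^1(\partial\Omega))}\le C_G\}$,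 where $C_G$ is chosen so large that for all $0\le t_1<t_2\le T$, all $\underline g\le g_1<g_2\le\overline g$ and all $0<\varepsilon\le\varepsilon_0$ the function $g_1+\gamma\varepsilon^{(3-N)/2}\chi^\varepsilon_{\bar x}(x)\chi(t)$ on $\partial\Omega\times(0,T)$ has $H^1(0,T;H^1(\partial\Omega))$-norm at most $C_G$; here $\gamma=4(g_2-g_1)\min(1,\varepsilon_0^{(N-3)/2})/T^2$, $\chi(t)=\max\{(t-t_1)(t_2-t),0\}$, and $\chi^\varepsilon_{\bar x}(x)=1$ for $|x-\bar x|\le\varepsilon/2$, $=2-2|x-\bar x|/\varepsilon$ for $\varepsilon/2<|x-\bar x|<\varepsilon$, $=0$ otherwise. Weak solution for data $(a,b,c,d,u_0)$ and $g\in G$: a function $u\in L^2(0,T;H^1(\Omega))\cap C([0,T];L^2(\Omega))$ with $u=g$ on $\partial\Omega\times(0,T)$ and $u(0)=u_0$ in the sense of traces, and $$\int_0^T(a(t,u)\nabla u+b(x,t,u),\nabla\varphi)_\Omega+(c(x,t,u,\nabla u),\varphi)_\Omega\,dt=-\int_0^T(d(t,u),\partial_t\varphi)_\Omega\,dt$$ for all $\varphi\in H^1_0(0,T;H^1_0(\Omega))$. Solvability assumption: for $i=1,2$ and every $g\in G$ a weak solution for the data $(a_i,b_i,c_i,d_i,u_{0,i})$ exists, and every such weak solution satisfies $\|u\|_{L^2(0,T;H^1(\Omega))}\le C_U$ with a constant $C_U$ independent of $i$ and of $g\in G$. Neumann flux: for a weak solution $u$, $j$ is the linear functional on $H^1_0(0,T;H^1(\Omega))$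 given by $$\int_0^T\langle j,\varphi\rangle_{\partial\Omega}\,dt:=\int_0^T(a(t,u)\nabla u+b(x,t,u),\nabla\varphi)_\Omega+(c(x,t,u,\nabla u),\varphi)_\Omega+(d(t,u),\partial_t\varphi)_\Omega\,dt .$$ One says $j\equiv0$ on $\Gamma_M\times(0,T)$ if $\int_0^T\langle j,\varphi\rangle_{\partial\Omega}\,dt=0$ for all $\varphi\in H^1_0(0,T;H^1(\Omega))$ with $\varphi=0$ on $(\partial\Omega\setminus\Gamma_M)\times(0,T)$ in the sense of traces; $j_1\equiv j_2$ on $\Gamma_M\times(0,T)$ means $j_1-j_2\equiv0$ there. *)

theory Defs
  imports "HOL-Analysis.Analysis"
begin

text \<open>
  Elements of function spaces are represented by functions, and all notions below are invariant
  under changes on null sets. Functions of space and time are written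
  \<open>u :: real \<Rightarrow> 'a \<Rightarrow> real\<close>, that is, \<open>u t\<close> represents an element of a space of functions of
  position. A normed function space is passed as a set \<open>X\<close> of functions together with a
  (semi)norm \<open>nrm\<close> that vanishes exactly on the functions that are zero almost everywhere.
\<close>

section \<open>Test functions and weak derivatives\<close>

primrec C_k :: "nat \<Rightarrow> ('a::real_normed_vector \<Rightarrow> 'b::real_normed_vector) \<Rightarrow> bool" where
  "C_k 0 f \<longleftrightarrow> continuous_on UNIV f"
| "C_k (Suc k) f \<longleftrightarrow>
     (\<forall>x. f differentiable (at x)) \<and> (\<forall>v. C_k k (\<lambda>x. frechet_derivative f (at x) v))"

definition smooth :: "('a::real_normed_vector \<Rightarrow> 'b::real_normed_vector) \<Rightarrow> bool" where
  "smooth f \<longleftrightarrow> (\<forall>k. C_k k f)"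

definition test_functions :: "'a::euclidean_space set \<Rightarrow> ('a \<Rightarrow> real) set" where
  "test_functions D = {\<phi>. smooth \<phi> \<and> (\<exists>K. compact K \<and> K \<subseteq> D \<and> (\<forall>x. x \<notin> K \<longrightarrow> \<phi> x = 0))}"

definition locally_integrable ::
  "'a::euclidean_space set \<Rightarrow> ('a \<Rightarrow> 'b::euclidean_space) \<Rightarrow> bool" where
  "locally_integrable D f \<longleftrightarrow> (\<forall>K. compact K \<and> K \<subseteq> D \<longrightarrow> integrable (lebesgue_on K) f)"

definition weak_partial ::
  "'a::euclidean_space set \<Rightarrow> 'a \<Rightarrow> ('a \<Rightarrow> 'b::euclidean_space) \<Rightarrow> ('a \<Rightarrow> 'b) \<Rightarrow> bool" where
  "weak_partial D e f h \<longleftrightarrow> locally_integrable D f \<and> locally_integrable D h \<and>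
     (\<forall>\<phi>\<in>test_functions D.
        (\<integral>x. frechet_derivative \<phi> (at x) e *\<^sub>R f x \<partial>lebesgue_on D)
          = - (\<integral>x. \<phi> x *\<^sub>R h x \<partial>lebesgue_on D))"

text \<open>
  Functions of \<open>W\<^sup>1\<^sup>,\<^sup>\<infinity>(D)\<close> with norm at most \<open>C\<close>, the norm being the maximum of the essential suprema of
  the function and of its weak partial derivatives. The continuous representative is required,
  since the coefficients of the equation are composed with other functions.
\<close>

definition W1inf_ball ::
  "'a::euclidean_space set \<Rightarrow> real \<Rightarrow> ('a \<Rightarrow> 'b::euclidean_space) set" where
  "W1inf_ball D C = {f. continuous_on D f \<and> (AE x in lebesgue_on D. norm (f x) \<le> C) \<and>
     (\<forall>e\<in>Basis. \<exists>h. weak_partial D e f h \<and> (AE x in lebesgue_on D. norm (h x) \<le> C))}"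


section \<open>The spaces \<open>L\<^sup>2\<close>, \<open>H\<^sup>1\<close> and \<open>H\<^sup>1\<^sub>0\<close>\<close>

definition L2 :: "'a measure \<Rightarrow> ('a \<Rightarrow> 'b::euclidean_space) set" where
  "L2 M = {f \<in> borel_measurable M. integrable M (\<lambda>x. (norm (f x))\<^sup>2)}"

definition L2_norm :: "'a measure \<Rightarrow> ('a \<Rightarrow> 'b::euclidean_space) \<Rightarrow> real" where
  "L2_norm M f = sqrt (\<integral>x. (norm (f x))\<^sup>2 \<partial>M)"

definition has_weak_grad ::
  "'a::euclidean_space set \<Rightarrow> ('a \<Rightarrow> real) \<Rightarrow> ('a \<Rightarrow> 'a) \<Rightarrow> bool" where
  "has_weak_grad D f G \<longleftrightarrow> G \<in> L2 (lebesgue_on D) \<and>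
     (\<forall>e\<in>Basis. weak_partial D e f (\<lambda>x. G x \<bullet> e))"

definition weak_grad :: "'a::euclidean_space set \<Rightarrow> ('a \<Rightarrow> real) \<Rightarrow> 'a \<Rightarrow> 'a" where
  "weak_grad D f = (SOME G. has_weak_grad D f G)"

definition H1 :: "'a::euclidean_space set \<Rightarrow> ('a \<Rightarrow> real) set" where
  "H1 D = {f \<in> L2 (lebesgue_on D). \<exists>G. has_weak_grad D f G}"

definition H1_norm :: "'a::euclidean_space set \<Rightarrow> ('a \<Rightarrow> real) \<Rightarrow> real" where
  "H1_norm D f =
     sqrt ((L2_norm (lebesgue_on D) f)\<^sup>2 + (L2_norm (lebesgue_on D) (weak_grad D f))\<^sup>2)"

definition H10 :: "'a::euclidean_space set \<Rightarrow> ('a \<Rightarrow> real) set" where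
  "H10 D = {f \<in> H1 D. \<exists>\<phi>. (\<forall>k::nat. \<phi> k \<in> test_functions D) \<and>
     (\<lambda>k. H1_norm D (\<lambda>x. \<phi> k x - f x)) \<longlonglongrightarrow> 0}"


section \<open>Lipschitz domains, outward normal and surface measure\<close>

text \<open>
  Near \<open>p\<close>, the set \<open>\<Omega>\<close> lies below the graph of a Lipschitz function over the hyperplane orthogonal
  to the unit vector \<open>\<nu>\<close>; only the values of \<open>h\<close> on that hyperplane matter.
\<close>

definition hyperplane_proj :: "'a::euclidean_space \<Rightarrow> 'a \<Rightarrow> 'a" where
  "hyperplane_proj \<nu> y = y - (y \<bullet> \<nu>) *\<^sub>R \<nu>"

definition lipschitz_chart ::
  "'a::euclidean_space set \<Rightarrow> 'a \<Rightarrow> 'a set \<Rightarrow> 'a \<Rightarrow> ('a \<Rightarrow> real) \<Rightarrow> bool" where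
  "lipschitz_chart \<Omega> p U \<nu> h \<longleftrightarrow> open U \<and> p \<in> U \<and> norm \<nu> = 1 \<and> (\<exists>L. L-lipschitz_on UNIV h) \<and>
     \<Omega> \<inter> U = {y \<in> U. y \<bullet> \<nu> < h (hyperplane_proj \<nu> y)}"

definition bounded_lipschitz_domain :: "'a::euclidean_space set \<Rightarrow> bool" where
  "bounded_lipschitz_domain \<Omega> \<longleftrightarrow> open \<Omega> \<and> connected \<Omega> \<and> bounded \<Omega> \<and> \<Omega> \<noteq> {} \<and>
     (\<forall>p\<in>frontier \<Omega>. \<exists>U \<nu> h. lipschitz_chart \<Omega> p U \<nu> h)"

text \<open>In a chart, \<open>\<Omega>\<close> is a sublevel set of \<open>\<rho> y = y \<bullet> \<nu> - h (hyperplane_proj \<nu> y)\<close>; the normal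
  is the normalized gradient \<open>w\<close> of \<open>\<rho>\<close>, which is nonzero because \<open>w \<bullet> \<nu> = 1\<close>.\<close>

definition is_outward_normal :: "'a::euclidean_space set \<Rightarrow> 'a \<Rightarrow> 'a \<Rightarrow> bool" where
  "is_outward_normal \<Omega> p n \<longleftrightarrow> p \<in> frontier \<Omega> \<and>
     (\<exists>U \<nu> h w. lipschitz_chart \<Omega> p U \<nu> h \<and>
        ((\<lambda>y. y \<bullet> \<nu> - h (hyperplane_proj \<nu> y)) has_derivative (\<lambda>v. v \<bullet> w)) (at p) \<and>
        n = sgn w)"

definition outward_normal :: "'a::euclidean_space set \<Rightarrow> 'a \<Rightarrow> 'a" where
  "outward_normal \<Omega> p = (THE n. is_outward_normal \<Omega> p n)"

definition smooth_boundary_part :: "'a::euclidean_space set \<Rightarrow> 'a set \<Rightarrow> bool" where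
  "smooth_boundary_part \<Omega> \<Gamma> \<longleftrightarrow> openin (top_of_set (frontier \<Omega>)) \<Gamma> \<and>
     (\<forall>p\<in>\<Gamma>. \<exists>U \<nu> h. lipschitz_chart \<Omega> p U \<nu> h \<and> smooth h)"

text \<open>
  The Hausdorff measure, normalized so that it agrees with Lebesgue measure in integer dimensions.
  The outer measure is a metric outer measure and hence countably additive on the Borel sets.
\<close>

definition hausdorff_premeasure :: "real \<Rightarrow> real \<Rightarrow> 'a::metric_space set \<Rightarrow> ennreal" where
  "hausdorff_premeasure s \<delta> A =
     (INF C \<in> {C :: nat \<Rightarrow> 'a set. A \<subseteq> (\<Union>i. C i) \<and> (\<forall>i. bounded (C i) \<and> diameter (C i) \<le> \<delta>)}.
        (\<Sum>i. ennreal (unit_ball_vol s * (diameter (C i) / 2) powr s)))"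

definition hausdorff_outer :: "real \<Rightarrow> 'a::metric_space set \<Rightarrow> ennreal" where
  "hausdorff_outer s A = (SUP \<delta> \<in> {0<..}. hausdorff_premeasure s \<delta> A)"

definition hausdorff_measure :: "real \<Rightarrow> 'a::metric_space measure" where
  "hausdorff_measure s = measure_of UNIV (sets borel) (hausdorff_outer s)"

definition surface_measure :: "'a::euclidean_space set \<Rightarrow> 'a measure" where
  "surface_measure \<Omega> =
     completion (restrict_space (hausdorff_measure (real (DIM('a)) - 1)) (frontier \<Omega>))"

definition has_trace ::
  "'a::euclidean_space set \<Rightarrow> ('a \<Rightarrow> real) \<Rightarrow> ('a \<Rightarrow> real) \<Rightarrow> bool" where
  "has_trace \<Omega> f g \<longleftrightarrow> f \<in> H1 \<Omega> \<and> g \<in> L2 (surface_measure \<Omega>) \<and>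
     (\<exists>\<phi>. (\<forall>k::nat. smooth (\<phi> k)) \<and>
        (\<lambda>k. H1_norm \<Omega> (\<lambda>x. \<phi> k x - f x)) \<longlonglongrightarrow> 0 \<and>
        (\<lambda>k. L2_norm (surface_measure \<Omega>) (\<lambda>x. \<phi> k x - g x)) \<longlonglongrightarrow> 0)"

text \<open>
  \<open>H\<^sup>1(\<partial>\<Omega>)\<close> on a Lipschitz boundary through the weak tangential derivatives
  \<open>n\<^sub>i \<partial>\<^sub>j - n\<^sub>j \<partial>\<^sub>i\<close>. Half of the sum of their squares over all \<open>i, j\<close> is the square of the length
  of the tangential gradient.
\<close>

definition tangential_deriv ::
  "'a::euclidean_space set \<Rightarrow> 'a \<Rightarrow> 'a \<Rightarrow> ('a \<Rightarrow> real) \<Rightarrow> 'a \<Rightarrow> real" where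
  "tangential_deriv \<Omega> e e' \<phi> x =
     (outward_normal \<Omega> x \<bullet> e) * frechet_derivative \<phi> (at x) e'
     - (outward_normal \<Omega> x \<bullet> e') * frechet_derivative \<phi> (at x) e"

definition has_weak_tangential_deriv ::
  "'a::euclidean_space set \<Rightarrow> 'a \<Rightarrow> 'a \<Rightarrow> ('a \<Rightarrow> real) \<Rightarrow> ('a \<Rightarrow> real) \<Rightarrow> bool" where
  "has_weak_tangential_deriv \<Omega> e e' f h \<longleftrightarrow> h \<in> L2 (surface_measure \<Omega>) \<and>
     (\<forall>\<phi>\<in>test_functions UNIV.
        (\<integral>x. f x * tangential_deriv \<Omega> e e' \<phi> x \<partial>surface_measure \<Omega>)
          = - (\<integral>x. h x * \<phi> x \<partial>surface_measure \<Omega>))"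

definition weak_tangential_deriv ::
  "'a::euclidean_space set \<Rightarrow> 'a \<Rightarrow> 'a \<Rightarrow> ('a \<Rightarrow> real) \<Rightarrow> 'a \<Rightarrow> real" where
  "weak_tangential_deriv \<Omega> e e' f = (SOME h. has_weak_tangential_deriv \<Omega> e e' f h)"

definition H1_boundary :: "'a::euclidean_space set \<Rightarrow> ('a \<Rightarrow> real) set" where
  "H1_boundary \<Omega> = {f \<in> L2 (surface_measure \<Omega>).
     \<forall>e\<in>Basis. \<forall>e'\<in>Basis. \<exists>h. has_weak_tangential_deriv \<Omega> e e' f h}"

definition H1_boundary_norm :: "'a::euclidean_space set \<Rightarrow> ('a \<Rightarrow> real) \<Rightarrow> real" where
  "H1_boundary_norm \<Omega> f = sqrt ((L2_norm (surface_measure \<Omega>) f)\<^sup>2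
     + (\<Sum>e\<in>Basis. \<Sum>e'\<in>Basis.
          (L2_norm (surface_measure \<Omega>) (weak_tangential_deriv \<Omega> e e' f))\<^sup>2) / 2)"


section \<open>Functions of time with values in a normed function space\<close>

definition simple_in_time :: "real \<Rightarrow> ('a \<Rightarrow> real) set \<Rightarrow> (real \<Rightarrow> 'a \<Rightarrow> real) \<Rightarrow> bool" where
  "simple_in_time T X s \<longleftrightarrow> finite (s ` {0<..<T}) \<and> s ` {0<..<T} \<subseteq> X \<and>
     (\<forall>w. {t \<in> {0<..<T}. s t = w} \<in> sets lebesgue)"

definition simple_time_integral :: "real \<Rightarrow> (real \<Rightarrow> 'a \<Rightarrow> real) \<Rightarrow> 'a \<Rightarrow> real" where
  "simple_time_integral T s x =
     (\<Sum>w \<in> s ` {0<..<T}. measure lebesgue {t \<in> {0<..<T}. s t = w} * w x)"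

definition strongly_measurable ::
  "real \<Rightarrow> ('a \<Rightarrow> real) set \<Rightarrow> (('a \<Rightarrow> real) \<Rightarrow> real) \<Rightarrow> (real \<Rightarrow> 'a \<Rightarrow> real) \<Rightarrow> bool" where
  "strongly_measurable T X nrm u \<longleftrightarrow>
     (\<exists>s. (\<forall>k::nat. simple_in_time T X (s k)) \<and>
        (AE t in lebesgue_on {0<..<T}. u t \<in> X \<and> (\<lambda>k. nrm (\<lambda>x. s k t x - u t x)) \<longlonglongrightarrow> 0))"

text \<open>The Bochner integral of \<open>u\<close> over \<open>(0,T)\<close> exists and is represented by \<open>w\<close>.\<close>

definition has_time_integral ::
  "real \<Rightarrow> ('a \<Rightarrow> real) set \<Rightarrow> (('a \<Rightarrow> real) \<Rightarrow> real) \<Rightarrow> (real \<Rightarrow> 'a \<Rightarrow> real) \<Rightarrow> ('a \<Rightarrow> real) \<Rightarrow> bool"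
  where
  "has_time_integral T X nrm u w \<longleftrightarrow> w \<in> X \<and> strongly_measurable T X nrm u \<and>
     (\<exists>s. (\<forall>k::nat. simple_in_time T X (s k)) \<and>
        (\<lambda>k. \<integral>\<^sup>+t. ennreal (nrm (\<lambda>x. s k t x - u t x)) \<partial>lebesgue_on {0<..<T}) \<longlonglongrightarrow> 0 \<and>
        (\<lambda>k. nrm (\<lambda>x. simple_time_integral T (s k) x - w x)) \<longlonglongrightarrow> 0)"

definition L2_time ::
  "real \<Rightarrow> ('a \<Rightarrow> real) set \<Rightarrow> (('a \<Rightarrow> real) \<Rightarrow> real) \<Rightarrow> (real \<Rightarrow> 'a \<Rightarrow> real) set" where
  "L2_time T X nrm = {u. strongly_measurable T X nrm u \<and>
     integrable (lebesgue_on {0<..<T}) (\<lambda>t. (nrm (u t))\<^sup>2)}"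

definition L2_time_norm ::
  "real \<Rightarrow> (('a \<Rightarrow> real) \<Rightarrow> real) \<Rightarrow> (real \<Rightarrow> 'a \<Rightarrow> real) \<Rightarrow> real" where
  "L2_time_norm T nrm u = sqrt (\<integral>t. (nrm (u t))\<^sup>2 \<partial>lebesgue_on {0<..<T})"

definition has_weak_time_deriv ::
  "real \<Rightarrow> ('a \<Rightarrow> real) set \<Rightarrow> (('a \<Rightarrow> real) \<Rightarrow> real) \<Rightarrow>
   (real \<Rightarrow> 'a \<Rightarrow> real) \<Rightarrow> (real \<Rightarrow> 'a \<Rightarrow> real) \<Rightarrow> bool" where
  "has_weak_time_deriv T X nrm u v \<longleftrightarrow> v \<in> L2_time T X nrm \<and>
     (\<forall>\<eta>\<in>test_functions {0<..<T}. \<exists>w.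
        has_time_integral T X nrm (\<lambda>t x. deriv \<eta> t * u t x) w \<and>
        has_time_integral T X nrm (\<lambda>t x. - (\<eta> t * v t x)) w)"

definition time_deriv ::
  "real \<Rightarrow> ('a \<Rightarrow> real) set \<Rightarrow> (('a \<Rightarrow> real) \<Rightarrow> real) \<Rightarrow>
   (real \<Rightarrow> 'a \<Rightarrow> real) \<Rightarrow> real \<Rightarrow> 'a \<Rightarrow> real" where
  "time_deriv T X nrm u = (SOME v. has_weak_time_deriv T X nrm u v)"

definition H1_time ::
  "real \<Rightarrow> ('a \<Rightarrow> real) set \<Rightarrow> (('a \<Rightarrow> real) \<Rightarrow> real) \<Rightarrow> (real \<Rightarrow> 'a \<Rightarrow> real) set" where
  "H1_time T X nrm = {u \<in> L2_time T X nrm. \<exists>v. has_weak_time_deriv T X nrm u v}"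

definition H1_time_norm ::
  "real \<Rightarrow> ('a \<Rightarrow> real) set \<Rightarrow> (('a \<Rightarrow> real) \<Rightarrow> real) \<Rightarrow> (real \<Rightarrow> 'a \<Rightarrow> real) \<Rightarrow> real" where
  "H1_time_norm T X nrm u =
     sqrt ((L2_time_norm T nrm u)\<^sup>2 + (L2_time_norm T nrm (time_deriv T X nrm u))\<^sup>2)"

definition C_time ::
  "real \<Rightarrow> ('a \<Rightarrow> real) set \<Rightarrow> (('a \<Rightarrow> real) \<Rightarrow> real) \<Rightarrow> (real \<Rightarrow> 'a \<Rightarrow> real) set" where
  "C_time T X nrm = {u. (\<forall>t\<in>{0..T}. u t \<in> X) \<and>
     (\<forall>s\<in>{0..T}. ((\<lambda>t. nrm (\<lambda>x. u t x - u s x)) \<longlongrightarrow> 0) (at s within {0..T}))}"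

text \<open>Elements of \<open>H\<^sup>1(0,T;X)\<close> whose continuous representative vanishes at both end points.\<close>

definition H10_time ::
  "real \<Rightarrow> ('a \<Rightarrow> real) set \<Rightarrow> (('a \<Rightarrow> real) \<Rightarrow> real) \<Rightarrow> (real \<Rightarrow> 'a \<Rightarrow> real) set" where
  "H10_time T X nrm = {u \<in> H1_time T X nrm. \<exists>w \<in> C_time T X nrm.
     (AE t in lebesgue_on {0<..<T}. nrm (\<lambda>x. w t x - u t x) = 0) \<and> nrm (w 0) = 0 \<and> nrm (w T) = 0}"


section \<open>The parabolic problem\<close>

record 'a pde_data =
  coeff_a :: "real \<Rightarrow> real \<Rightarrow> real"
  coeff_b :: "'a \<Rightarrow> real \<Rightarrow> real \<Rightarrow> 'a"
  coeff_c :: "'a \<Rightarrow> real \<Rightarrow> real \<Rightarrow> 'a \<Rightarrow> real"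
  coeff_d :: "real \<Rightarrow> real \<Rightarrow> real"
  init_u :: "'a \<Rightarrow> real"

definition geometric_assumption ::
  "'a::euclidean_space \<Rightarrow> 'a set \<Rightarrow> 'a set \<Rightarrow> 'a set \<Rightarrow> 'a \<Rightarrow> real \<Rightarrow> bool" where
  "geometric_assumption e\<^sub>N \<Omega> \<Gamma>' \<Gamma> xbar \<epsilon>\<^sub>0 \<longleftrightarrow>
     bounded_lipschitz_domain \<Omega> \<and>
     smooth_boundary_part \<Omega> \<Gamma>' \<and> emeasure (surface_measure \<Omega>) \<Gamma>' \<noteq> 0 \<and>
     xbar \<in> \<Gamma>' \<and> \<epsilon>\<^sub>0 > 0 \<and>
     ball (xbar + \<epsilon>\<^sub>0 *\<^sub>R outward_normal \<Omega> xbar) \<epsilon>\<^sub>0 \<inter> \<Omega> = {} \<and>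
     \<Gamma> = ball xbar \<epsilon>\<^sub>0 \<inter> frontier \<Omega> \<and> \<Gamma> \<subseteq> \<Gamma>' \<and>
     (\<forall>x\<in>\<Gamma>. outward_normal \<Omega> x = e\<^sub>N)"

definition coefficient_assumption ::
  "real \<Rightarrow> 'a::euclidean_space set \<Rightarrow> real \<Rightarrow> real \<Rightarrow> real \<Rightarrow> real \<Rightarrow> 'a pde_data \<Rightarrow> bool" where
  "coefficient_assumption T \<Omega> C\<^sub>A C\<^sub>0 alow aup P \<longleftrightarrow>
     (\<lambda>(t, u). coeff_a P t u) \<in> W1inf_ball ({0<..<T} \<times> UNIV) C\<^sub>A \<and>
     (\<lambda>(x, t, u). coeff_b P x t u) \<in> W1inf_ball (\<Omega> \<times> {0<..<T} \<times> UNIV) C\<^sub>A \<and>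
     (\<lambda>(x, t, u, p). coeff_c P x t u p) \<in> W1inf_ball (\<Omega> \<times> {0<..<T} \<times> UNIV \<times> UNIV) C\<^sub>A \<and>
     (\<lambda>(t, u). coeff_d P t u) \<in> W1inf_ball ({0<..<T} \<times> UNIV) C\<^sub>A \<and>
     (\<forall>t\<in>{0<..<T}. \<forall>u. alow \<le> coeff_a P t u \<and> coeff_a P t u \<le> aup) \<and>
     init_u P \<in> L2 (lebesgue_on \<Omega>) \<and> L2_norm (lebesgue_on \<Omega>) (init_u P) \<le> C\<^sub>0"

definition boundary_data ::
  "real \<Rightarrow> 'a::euclidean_space set \<Rightarrow> real \<Rightarrow> real \<Rightarrow> real \<Rightarrow> (real \<Rightarrow> 'a \<Rightarrow> real) set" where
  "boundary_data T \<Omega> glow gup C\<^sub>G =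
     {g \<in> H1_time T (H1_boundary \<Omega>) (H1_boundary_norm \<Omega>).
        (AE t in lebesgue_on {0<..<T}. AE x in surface_measure \<Omega>. glow \<le> g t x \<and> g t x \<le> gup) \<and>
        H1_time_norm T (H1_boundary \<Omega>) (H1_boundary_norm \<Omega>) g \<le> C\<^sub>G}"

definition space_bump :: "'a::real_normed_vector \<Rightarrow> real \<Rightarrow> 'a \<Rightarrow> real" where
  "space_bump xbar \<epsilon> x =
     (if norm (x - xbar) \<le> \<epsilon> / 2 then 1
      else if norm (x - xbar) < \<epsilon> then 2 - 2 * norm (x - xbar) / \<epsilon>
      else 0)"

definition time_bump :: "real \<Rightarrow> real \<Rightarrow> real \<Rightarrow> real" where
  "time_bump t1 t2 t = max ((t - t1) * (t2 - t)) 0"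

definition probe ::
  "real \<Rightarrow> real \<Rightarrow> 'a::euclidean_space \<Rightarrow> real \<Rightarrow> real \<Rightarrow> real \<Rightarrow> real \<Rightarrow> real \<Rightarrow> real \<Rightarrow> 'a \<Rightarrow> real" where
  "probe T \<epsilon>\<^sub>0 xbar \<epsilon> t1 t2 g1 g2 t x =
     (let N = real (DIM('a));
          \<gamma> = 4 * (g2 - g1) * min 1 (\<epsilon>\<^sub>0 powr ((N - 3) / 2)) / T\<^sup>2
      in g1 + \<gamma> * \<epsilon> powr ((3 - N) / 2) * space_bump xbar \<epsilon> x * time_bump t1 t2 t)"

definition C\<^sub>G_large ::
  "real \<Rightarrow> 'a::euclidean_space set \<Rightarrow> 'a \<Rightarrow> real \<Rightarrow> real \<Rightarrow> real \<Rightarrow> real \<Rightarrow> bool" where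
  "C\<^sub>G_large T \<Omega> xbar \<epsilon>\<^sub>0 glow gup C\<^sub>G \<longleftrightarrow>
     (\<forall>t1 t2 g1 g2 \<epsilon>. 0 \<le> t1 \<and> t1 < t2 \<and> t2 \<le> T \<and> glow \<le> g1 \<and> g1 < g2 \<and> g2 \<le> gup \<and>
        0 < \<epsilon> \<and> \<epsilon> \<le> \<epsilon>\<^sub>0 \<longrightarrow>
        probe T \<epsilon>\<^sub>0 xbar \<epsilon> t1 t2 g1 g2 \<in> H1_time T (H1_boundary \<Omega>) (H1_boundary_norm \<Omega>) \<and>
        H1_time_norm T (H1_boundary \<Omega>) (H1_boundary_norm \<Omega>)
          (probe T \<epsilon>\<^sub>0 xbar \<epsilon> t1 t2 g1 g2) \<le> C\<^sub>G)"

definition space_form ::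
  "'a::euclidean_space set \<Rightarrow> 'a pde_data \<Rightarrow> (real \<Rightarrow> 'a \<Rightarrow> real) \<Rightarrow> (real \<Rightarrow> 'a \<Rightarrow> real) \<Rightarrow> real \<Rightarrow> real"
  where
  "space_form \<Omega> P u \<phi> t =
     (\<integral>x. (coeff_a P t (u t x) *\<^sub>R weak_grad \<Omega> (u t) x + coeff_b P x t (u t x))
            \<bullet> weak_grad \<Omega> (\<phi> t) x \<partial>lebesgue_on \<Omega>)
     + (\<integral>x. coeff_c P x t (u t x) (weak_grad \<Omega> (u t) x) * \<phi> t x \<partial>lebesgue_on \<Omega>)"

text \<open>For \<open>\<phi>\<close> in \<open>H\<^sup>1\<^sub>0(0,T;H\<^sup>1\<^sub>0(\<Omega>))\<close> the derivative in the larger space \<open>H\<^sup>1(\<Omega>)\<close> is the same function.\<close>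

definition time_form ::
  "real \<Rightarrow> 'a::euclidean_space set \<Rightarrow> 'a pde_data \<Rightarrow>
   (real \<Rightarrow> 'a \<Rightarrow> real) \<Rightarrow> (real \<Rightarrow> 'a \<Rightarrow> real) \<Rightarrow> real \<Rightarrow> real" where
  "time_form T \<Omega> P u \<phi> t =
     (\<integral>x. coeff_d P t (u t x) * time_deriv T (H1 \<Omega>) (H1_norm \<Omega>) \<phi> t x \<partial>lebesgue_on \<Omega>)"

definition weak_solution ::
  "real \<Rightarrow> 'a::euclidean_space set \<Rightarrow> 'a pde_data \<Rightarrow> (real \<Rightarrow> 'a \<Rightarrow> real) \<Rightarrow>
   (real \<Rightarrow> 'a \<Rightarrow> real) \<Rightarrow> bool" where
  "weak_solution T \<Omega> P g u \<longleftrightarrow>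
     u \<in> L2_time T (H1 \<Omega>) (H1_norm \<Omega>) \<and>
     u \<in> C_time T (L2 (lebesgue_on \<Omega>)) (L2_norm (lebesgue_on \<Omega>)) \<and>
     (AE t in lebesgue_on {0<..<T}. has_trace \<Omega> (u t) (g t)) \<and>
     (AE x in lebesgue_on \<Omega>. u 0 x = init_u P x) \<and>
     (\<forall>\<phi> \<in> H10_time T (H10 \<Omega>) (H1_norm \<Omega>).
        (\<integral>t. space_form \<Omega> P u \<phi> t \<partial>lebesgue_on {0<..<T})
          = - (\<integral>t. time_form T \<Omega> P u \<phi> t \<partial>lebesgue_on {0<..<T}))"

definition solvability_assumption ::
  "real \<Rightarrow> 'a::euclidean_space set \<Rightarrow> (real \<Rightarrow> 'a \<Rightarrow> real) set \<Rightarrow> 'a pde_data set \<Rightarrow> bool" where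
  "solvability_assumption T \<Omega> G Ps \<longleftrightarrow>
     (\<exists>C\<^sub>U. \<forall>P\<in>Ps. \<forall>g\<in>G. (\<exists>u. weak_solution T \<Omega> P g u) \<and>
        (\<forall>u. weak_solution T \<Omega> P g u \<longrightarrow> L2_time_norm T (H1_norm \<Omega>) u \<le> C\<^sub>U))"

definition unique_weak_solution ::
  "real \<Rightarrow> 'a::euclidean_space set \<Rightarrow> 'a pde_data \<Rightarrow> (real \<Rightarrow> 'a \<Rightarrow> real) \<Rightarrow> bool" where
  "unique_weak_solution T \<Omega> P g \<longleftrightarrow>
     (\<exists>u. weak_solution T \<Omega> P g u) \<and>
     (\<forall>u v. weak_solution T \<Omega> P g u \<and> weak_solution T \<Omega> P g v \<longrightarrow>
        (\<forall>t\<in>{0..T}. AE x in lebesgue_on \<Omega>. u t x = v t x))"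

definition the_solution ::
  "real \<Rightarrow> 'a::euclidean_space set \<Rightarrow> 'a pde_data \<Rightarrow> (real \<Rightarrow> 'a \<Rightarrow> real) \<Rightarrow> real \<Rightarrow> 'a \<Rightarrow> real" where
  "the_solution T \<Omega> P g = (SOME u. weak_solution T \<Omega> P g u)"

definition neumann_flux ::
  "real \<Rightarrow> 'a::euclidean_space set \<Rightarrow> 'a pde_data \<Rightarrow> (real \<Rightarrow> 'a \<Rightarrow> real) \<Rightarrow>
   (real \<Rightarrow> 'a \<Rightarrow> real) \<Rightarrow> real" where
  "neumann_flux T \<Omega> P u \<phi> =
     (\<integral>t. space_form \<Omega> P u \<phi> t + time_form T \<Omega> P u \<phi> t \<partial>lebesgue_on {0<..<T})"

definition flux_vanishes_on ::
  "real \<Rightarrow> 'a::euclidean_space set \<Rightarrow> 'a set \<Rightarrow> ((real \<Rightarrow> 'a \<Rightarrow> real) \<Rightarrow> real) \<Rightarrow> bool" where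
  "flux_vanishes_on T \<Omega> \<Gamma> j \<longleftrightarrow>
     (\<forall>\<phi> \<in> H10_time T (H1 \<Omega>) (H1_norm \<Omega>).
        (AE t in lebesgue_on {0<..<T}. \<exists>\<psi>. has_trace \<Omega> (\<phi> t) \<psi> \<and>
           (AE x in surface_measure \<Omega>. x \<notin> \<Gamma> \<longrightarrow> \<psi> x = 0))
        \<longrightarrow> j \<phi> = 0)"

end

theory Submission
  imports Defs
begin

text \<open>
  Both fluxes are evaluated at \<open>\<theta>(t) \<lambda>(x)\<close>, where \<open>\<lambda>\<close> is a cutoff times the dipole potential with
  pole at distance \<open>\<epsilon>\<close> outside \<open>\<Omega>\<close>, above the centre of the flat boundary part. Writing \<open>A\<^sub>i\<close> for the primitive
  of \<open>a\<^sub>i(t, \<cdot>)\<close>, one has \<open>a\<^sub>i(t, u) \<nabla>u \<cdot> \<nabla>\<lambda> = \<nabla>(A\<^sub>i(t, u)) \<cdot> \<nabla>\<lambda>\<close>, so an integration by parts leaves the boundary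
  integral of \<open>A\<^sub>i(t, g) \<partial>\<^sub>n\<lambda>\<close>, which contains the Dirichlet data only, and the integral of \<open>A\<^sub>i(t, u) \<Delta>\<lambda>\<close>, where
  the potential is harmonic and only derivatives of the cutoff survive. This term and all lower order
  terms are bounded by the \<open>L\<^sup>1\<close> norms of \<open>\<lambda>\<close>, \<open>\<nabla>\<lambda>\<close>, \<open>\<Delta>\<lambda>\<close>, that is by \<open>O(log (1/\<epsilon>))\<close>, uniformly in \<open>g\<close>. If
  \<open>a\<^sub>1 > a\<^sub>2\<close> near some \<open>(t, u)\<close>, then for the bump of width \<open>\<epsilon>\<close> and height \<open>\<epsilon>\<^bsup>(3-N)/2\<^esup>\<close> as Dirichlet data the two
  boundary terms differ by at least a multiple of \<open>\<epsilon>\<^bsup>(1-N)/2\<^esup>\<close>, so equal fluxes are impossible for small \<open>\<epsilon>\<close>.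
\<close>

section \<open>Smooth functions\<close>

text \<open>The gradient of a solution is controlled in an energy norm only. Pairing it by
  Cauchy-Schwarz with \<nabla>\<lambda>, whose L2 norm grows like \<epsilon>^(-N/2), would swamp a
  boundary signal of order \<epsilon>^((1-N)/2). The primitive removes \<nabla>u altogether, and
  since A(t,u) is bounded while u stays in [\<open>glow\<close>, \<open>gup\<close>], L1 norms of
  \<lambda> suffice. The width of the bump is matched to the distance of the pole: on the flat
  boundary the normal derivative of the dipole has the sign of |z-p|^2 - (N-1)\<epsilon>^2, so for N
  >= 2 it keeps one sign on the bump and nothing cancels. The signal is an area \<epsilon>^(N-1)
  times a derivative \<epsilon>^(-N) times the height \<epsilon>^((3-N)/2). Boundary values are
  known in the trace sense only, and \<open>weak_grad\<close> and \<open>time_deriv\<close> are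
  arbitrary choices. Hence the need for uniqueness of weak derivatives and for a comparison of the
  surface measure with Lebesgue measure.\<close>

lemma C_k_Suc_differentiable: "C_k (Suc k) f \<Longrightarrow> f differentiable (at x)"
  by simp

lemma C_k_Suc_has_derivative:
  "C_k (Suc k) f \<Longrightarrow> (f has_derivative frechet_derivative f (at x)) (at x)"
  using frechet_derivative_works by auto

lemma C_k_continuous: "C_k k f \<Longrightarrow> continuous_on UNIV f"
  by (cases k)
     (auto simp: continuous_on_eq_continuous_at differentiable_imp_continuous_within)

lemma C_k_Suc_mono: "C_k (Suc k) f \<Longrightarrow> C_k k f"
proof (induction k arbitrary: f)
  case 0
  then show ?case using C_k_continuous by (metis C_k.simps(1))
next
  case (Suc k)
  then show ?case by (metis C_k.simps(2))
qed

lemma C_k_const: "C_k k (\<lambda>x. c)"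
  by (induction k arbitrary: c) simp_all

lemma frechet_derivative_eqI:
  "(f has_derivative f') (at x) \<Longrightarrow> frechet_derivative f (at x) v = f' v"
  using frechet_derivative_at by metis

lemma C_k_bounded_linear: "bounded_linear f \<Longrightarrow> C_k k f"
proof (cases k)
  case (Suc j)
  assume f: "bounded_linear f"
  have "frechet_derivative f (at x) v = f v" for x v
    using f by (intro frechet_derivative_eqI bounded_linear_imp_has_derivative)
  then show ?thesis
    using f Suc by (auto simp: C_k_const bounded_linear_imp_differentiable)
qed (auto intro: linear_continuous_on)

lemma C_k_add: "C_k k f \<Longrightarrow> C_k k g \<Longrightarrow> C_k k (\<lambda>x. f x + g x)"
proof (induction k arbitrary: f g)
  case (Suc k)
  have D: "frechet_derivative (\<lambda>x. f x + g x) (at x) v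
      = frechet_derivative f (at x) v + frechet_derivative g (at x) v" for x v
    using Suc.prems
    by (intro frechet_derivative_eqI has_derivative_add C_k_Suc_has_derivative)
  show ?case
    using Suc unfolding C_k.simps D by (auto intro: differentiable_add)
qed (auto intro: continuous_intros)

lemma C_k_mult:
  fixes f g :: "'a::real_normed_vector \<Rightarrow> real"
  shows "C_k k f \<Longrightarrow> C_k k g \<Longrightarrow> C_k k (\<lambda>x. f x * g x)"
proof (induction k arbitrary: f g)
  case (Suc k)
  have D: "frechet_derivative (\<lambda>x. f x * g x) (at x) v
      = f x * frechet_derivative g (at x) v + frechet_derivative f (at x) v * g x" for x v
    using Suc.prems
    by (intro frechet_derivative_eqI has_derivative_mult C_k_Suc_has_derivative)
  have "C_k k (\<lambda>x. f x * frechet_derivative g (at x) v + frechet_derivative f (at x) v * g x)" for v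
    using Suc.prems C_k_Suc_mono by (intro C_k_add Suc.IH) auto
  then show ?case
    using Suc.prems unfolding C_k.simps D by (auto intro: differentiable_mult)
qed (auto intro: continuous_intros)

text \<open>Differentiation produces a derivative of \<open>f\<close> times a composition of the
  derivative of \<open>h\<close> with the same \<open>f\<close>, so the induction generalises over
  \<open>h\<close> only.\<close>

lemma C_k_compose:
  fixes h :: "real \<Rightarrow> real" and f :: "'a::real_normed_vector \<Rightarrow> real"
  shows "C_k k h \<Longrightarrow> C_k k f \<Longrightarrow> C_k k (\<lambda>x. h (f x))"
proof (induction k arbitrary: h)
  case 0
  then show ?case using continuous_on_compose2[of UNIV h UNIV f] by simp
next
  case (Suc k)
  have dh: "(h has_derivative (\<lambda>s. s * frechet_derivative h (at y) 1)) (at y)" for y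
  proof -
    have h': "(h has_derivative frechet_derivative h (at y)) (at y)"
      using Suc.prems(1) C_k_Suc_has_derivative by blast
    have "frechet_derivative h (at y) s = s * frechet_derivative h (at y) 1" for s
      using linear_scale[OF has_derivative_linear[OF h'], of s 1] by simp
    then show ?thesis by (intro has_derivative_eq_rhs[OF h'] ext)
  qed
  have D: "((\<lambda>x. h (f x)) has_derivative
      (\<lambda>v. frechet_derivative f (at x) v * frechet_derivative h (at (f x)) 1)) (at x)" for x
    using has_derivative_compose[OF C_k_Suc_has_derivative dh] Suc.prems(2) by blast
  have "C_k k (\<lambda>x. frechet_derivative h (at (f x)) 1)"
    using Suc.prems(1) C_k_Suc_mono[OF Suc.prems(2)]
    by (intro Suc.IH[of "\<lambda>y. frechet_derivative h (at y) 1"]) simp_all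
  then have "C_k k (\<lambda>x. frechet_derivative f (at x) v * frechet_derivative h (at (f x)) 1)" for v
    using Suc.prems(2) by (intro C_k_mult) simp_all
  then show ?case
    unfolding C_k.simps frechet_derivative_eqI[OF D] using D differentiable_def by blast
qed

text \<open>Differentiation lowers the exponent by one, hence the induction over all
  \<open>p\<close>; positivity keeps \<open>powr\<close> away from its singularity at 0.\<close>

lemma C_k_powr:
  fixes f :: "'a::real_normed_vector \<Rightarrow> real"
  assumes "C_k k f" and pos: "\<And>x. f x > 0"
  shows "C_k k (\<lambda>x. f x powr p)"
  using assms(1)
proof (induction k arbitrary: p)
  case 0
  have "f x \<noteq> 0" for x
    using pos[of x] by simp
  with 0 show ?case
    by (auto intro: continuous_on_powr continuous_on_const)
next
  case (Suc k)
  have D: "((\<lambda>x. f x powr p) has_derivative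
      (\<lambda>v. frechet_derivative f (at x) v * (p * f x powr (p - 1)))) (at x)" for x
  proof -
    have "((\<lambda>y. y powr p) has_derivative (\<lambda>s. s * (p * f x powr (p - 1)))) (at (f x))"
      using has_real_derivative_powr[OF pos, of p x]
      unfolding has_field_derivative_def by (subst mult.commute)
    then show ?thesis
      by (rule has_derivative_compose[OF C_k_Suc_has_derivative[OF Suc.prems]])
  qed
  have "C_k k (\<lambda>x. frechet_derivative f (at x) v * (p * f x powr (p - 1)))" for v
    using Suc.prems by (intro C_k_mult Suc.IH[OF C_k_Suc_mono[OF Suc.prems]] C_k_const) simp
  then show ?case
    unfolding C_k.simps frechet_derivative_eqI[OF D] using D differentiable_def by blast
qed

lemma C_k_prod:
  fixes f :: "'i \<Rightarrow> 'a::real_normed_vector \<Rightarrow> real"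
  shows "finite I \<Longrightarrow> (\<And>i. i \<in> I \<Longrightarrow> C_k k (f i)) \<Longrightarrow> C_k k (\<lambda>x. \<Prod>i\<in>I. f i x)"
  by (induction rule: finite_induct) (auto intro: C_k_mult C_k_const)

lemma smooth_const: "smooth (\<lambda>x. c)"
  by (simp add: smooth_def C_k_const)

lemma smooth_bounded_linear: "bounded_linear f \<Longrightarrow> smooth f"
  by (simp add: smooth_def C_k_bounded_linear)

lemma smooth_add: "smooth f \<Longrightarrow> smooth g \<Longrightarrow> smooth (\<lambda>x. f x + g x)"
  by (simp add: smooth_def C_k_add)

lemma smooth_mult:
  fixes f g :: "'a::real_normed_vector \<Rightarrow> real"
  shows "smooth f \<Longrightarrow> smooth g \<Longrightarrow> smooth (\<lambda>x. f x * g x)"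
  by (simp add: smooth_def C_k_mult)

lemma smooth_cmult:
  fixes f :: "'a::real_normed_vector \<Rightarrow> real"
  shows "smooth f \<Longrightarrow> smooth (\<lambda>x. c * f x)"
  by (intro smooth_mult smooth_const)

lemma smooth_minus:
  fixes f :: "'a::real_normed_vector \<Rightarrow> real"
  shows "smooth f \<Longrightarrow> smooth (\<lambda>x. - f x)"
  using smooth_cmult[of f "-1"] by simp

lemma smooth_diff:
  fixes f :: "'a::real_normed_vector \<Rightarrow> real"
  shows "smooth f \<Longrightarrow> smooth g \<Longrightarrow> smooth (\<lambda>x. f x - g x)"
  using smooth_add[of f "\<lambda>x. - g x"] smooth_minus[of g] by simp

lemma smooth_prod:
  fixes f :: "'i \<Rightarrow> 'a::real_normed_vector \<Rightarrow> real"
  shows "finite I \<Longrightarrow> (\<And>i. i \<in> I \<Longrightarrow> smooth (f i)) \<Longrightarrow> smooth (\<lambda>x. \<Prod>i\<in>I. f i x)"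
  by (simp add: smooth_def C_k_prod)

lemma smooth_compose:
  fixes h :: "real \<Rightarrow> real" and f :: "'a::real_normed_vector \<Rightarrow> real"
  shows "smooth h \<Longrightarrow> smooth f \<Longrightarrow> smooth (\<lambda>x. h (f x))"
  by (simp add: smooth_def C_k_compose)

lemma smooth_powr:
  fixes f :: "'a::real_normed_vector \<Rightarrow> real"
  shows "smooth f \<Longrightarrow> (\<And>x. f x > 0) \<Longrightarrow> smooth (\<lambda>x. f x powr p)"
  by (simp add: smooth_def C_k_powr)

lemma smooth_ident: "smooth (\<lambda>x. x)"
  by (simp add: smooth_bounded_linear)

lemma smooth_inner_right: "smooth (\<lambda>x. (x - a) \<bullet> e)"
  using smooth_add[OF smooth_bounded_linear[OF bounded_linear_inner_left[of e]]
      smooth_const[of "- a \<bullet> e"]]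
  by (simp add: inner_diff_left)

lemma smooth_norm_square:
  fixes a :: "'a::euclidean_space"
  shows "smooth (\<lambda>x. (x - a) \<bullet> (x - a))"
proof -
  have "smooth (\<lambda>x::'a. \<Sum>i\<in>B. ((x - a) \<bullet> i) * ((x - a) \<bullet> i))" if "finite B" for B
    using that
  proof (induction B)
    case (insert i B)
    then show ?case
      by (simp only: sum.insert[OF insert(1,2)]) (intro smooth_add smooth_mult smooth_inner_right)
  qed (simp add: smooth_const)
  from this[OF finite_Basis] show ?thesis
    by (simp only: euclidean_inner[of "x - a" "x - a" for x])
qed

lemma smooth_differentiable: "smooth f \<Longrightarrow> f differentiable (at x)"
  using C_k_Suc_differentiable[of 0 f] smooth_def by blast

lemma smooth_has_derivative: "smooth f \<Longrightarrow> (f has_derivative frechet_derivative f (at x)) (at x)"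
  using smooth_differentiable frechet_derivative_works by blast

lemma smooth_frechet_derivative: "smooth f \<Longrightarrow> smooth (\<lambda>x. frechet_derivative f (at x) v)"
  unfolding smooth_def using C_k.simps(2) by metis

lemma smooth_continuous_on: "smooth f \<Longrightarrow> continuous_on S f"
  using C_k_continuous smooth_def continuous_on_subset by blast

lemma smooth_borel_measurable:
  "smooth f \<Longrightarrow> f \<in> borel_measurable borel"
  by (simp add: borel_measurable_continuous_onI smooth_continuous_on)

subsection \<open>A flat function and bumps\<close>

text \<open>The family is indexed by \<open>n\<close> to be closed under differentiation: each
  derivative is a combination of two later members. Member 0 is the classical flat function
  exp(-1/x).\<close>

definition flat_exp :: "nat \<Rightarrow> real \<Rightarrow> real" where
  "flat_exp n x = (if x > 0 then exp (- inverse x) * inverse x ^ n else 0)"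

lemma flat_exp_tendsto_0: "((\<lambda>x. flat_exp n x) \<longlongrightarrow> 0) (at 0)"
proof -
  have "((\<lambda>x. inverse x ^ n / exp (inverse x)) \<longlongrightarrow> (0::real)) (at_right 0)"
    by (rule filterlim_compose[OF tendsto_power_div_exp_0 filterlim_inverse_at_top_right])
  then have "((\<lambda>x. flat_exp n x) \<longlongrightarrow> 0) (at_right 0)"
    by (rule Lim_transform_eventually)
       (rule eventually_mono[OF eventually_at_right_less], simp add: flat_exp_def exp_minus field_simps)
  moreover have "((\<lambda>x. flat_exp n x) \<longlongrightarrow> 0) (at_left 0)"
    by (rule Lim_transform_eventually[OF tendsto_const])
       (rule eventually_at_leftI[of "-1"], simp_all add: flat_exp_def)
  ultimately show ?thesis
    by (simp add: filterlim_split_at)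
qed

lemma flat_exp_has_derivative:
  "(flat_exp n has_real_derivative flat_exp (n + 2) x - n * flat_exp (n + 1) x) (at x)"
proof -
  consider "x > 0" | "x < 0" | "x = 0" by linarith
  then show ?thesis
  proof cases
    case 1
    have "((\<lambda>x. exp (- inverse x) * inverse x ^ n) has_real_derivative
        exp (- inverse x) * inverse x ^ (n + 2) - n * (exp (- inverse x) * inverse x ^ (n + 1))) (at x)"
      using 1 power_Suc[of "inverse x" "n - 1"]
      by (auto intro!: derivative_eq_intros simp: power2_eq_square algebra_simps) (cases n; simp)
    then have "(flat_exp n has_real_derivative
        exp (- inverse x) * inverse x ^ (n + 2) - n * (exp (- inverse x) * inverse x ^ (n + 1))) (at x)"
      by (rule has_field_derivative_transform_within_open[where S = "{0<..}"])
         (use 1 in \<open>auto simp: flat_exp_def\<close>)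
    then show ?thesis using 1 by (simp add: flat_exp_def)
  next
    case 2
    have "((\<lambda>x. 0) has_real_derivative 0) (at x)" by simp
    then have "(flat_exp n has_real_derivative 0) (at x)"
      by (rule has_field_derivative_transform_within_open[where S = "{..<0}"])
         (use 2 in \<open>auto simp: flat_exp_def\<close>)
    then show ?thesis using 2 by (simp add: flat_exp_def)
  next
    case 3
    \<comment> \<open>The difference quotient at 0 is the next member of the family, whose limit is
      already known.\<close>
    have "flat_exp n h / h = flat_exp (n + 1) h" for h
      by (simp add: flat_exp_def divide_inverse)
    moreover have "flat_exp m 0 = 0" for m
      by (simp add: flat_exp_def)
    ultimately show ?thesis
      using 3 flat_exp_tendsto_0[of "n + 1"] by (simp add: DERIV_def)
  qed
qed

lemma C_k_flat_exp: "C_k k (flat_exp n)"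
proof (induction k arbitrary: n)
  case 0
  show ?case
    by (auto intro!: continuous_at_imp_continuous_on DERIV_isCont flat_exp_has_derivative)
next
  case (Suc k)
  have D: "(flat_exp n has_derivative (\<lambda>v. (flat_exp (n + 2) x + (- real n) * flat_exp (n + 1) x) * v)) (at x)" for x
    using flat_exp_has_derivative[of n x] by (simp add: has_field_derivative_def)
  have "C_k k (\<lambda>x. (flat_exp (n + 2) x + (- real n) * flat_exp (n + 1) x) * v)" for v
    by (intro C_k_mult C_k_add C_k_const Suc.IH)
  then show ?case
    unfolding C_k.simps frechet_derivative_eqI[OF D] using D differentiable_def by blast
qed

lemma smooth_flat_exp: "smooth (flat_exp n)"
  by (simp add: smooth_def C_k_flat_exp)

lemma flat_exp_nonneg: "flat_exp n x \<ge> 0"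
  and flat_exp_pos: "x > 0 \<Longrightarrow> flat_exp n x > 0"
  and flat_exp_0: "x \<le> 0 \<Longrightarrow> flat_exp n x = 0"
  by (auto simp: flat_exp_def)

text \<open>The upper faces are written with \<open>- i\<close> so that both factors contain an
  inner product of a difference, the form covered by \<open>smooth_inner_right\<close>.\<close>

definition box_bump :: "'a::euclidean_space \<Rightarrow> 'a \<Rightarrow> 'a \<Rightarrow> real" where
  "box_bump a b x = (\<Prod>i\<in>Basis. flat_exp 0 ((x - a) \<bullet> i) * flat_exp 0 (((x - b) \<bullet> (- i))))"

lemma smooth_box_bump: "smooth (box_bump a b)"
  unfolding box_bump_def
  by (intro smooth_prod smooth_mult smooth_compose[OF smooth_flat_exp] smooth_inner_right finite_Basis)

lemma box_bump_nonneg: "box_bump a b x \<ge> 0"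
  by (simp add: box_bump_def prod_nonneg flat_exp_nonneg)

lemma box_bump_pos_iff: "box_bump a b x > 0 \<longleftrightarrow> x \<in> box a b"
proof
  assume "x \<in> box a b"
  then show "box_bump a b x > 0"
    unfolding box_bump_def
    by (intro prod_pos) (auto simp: mem_box inner_diff_left intro!: mult_pos_pos flat_exp_pos)
next
  assume "box_bump a b x > 0"
  then have "flat_exp 0 ((x - a) \<bullet> i) * flat_exp 0 ((x - b) \<bullet> (- i)) \<noteq> 0" if "i \<in> Basis" for i
    using that unfolding box_bump_def by (metis finite_Basis less_irrefl prod_zero)
  then show "x \<in> box a b"
    using flat_exp_0[of _ 0] by (fastforce simp: mem_box inner_diff_left not_le[symmetric])
qed

lemma box_bump_outside: "x \<notin> box a b \<Longrightarrow> box_bump a b x = 0"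
  using box_bump_pos_iff[of a b x] box_bump_nonneg[of a b x] by linarith

text \<open>Exponential saturation of a nonnegative bump: the values stay in [0,1) and tend to 1
  exactly where the bump is positive. The indicator of the open box is thus a limit of smooth
  functions with supports in one closed box.\<close>

definition box_cutoff :: "'a::euclidean_space \<Rightarrow> 'a \<Rightarrow> nat \<Rightarrow> 'a \<Rightarrow> real" where
  "box_cutoff a b k x = 1 - exp (- (real k * box_bump a b x))"

lemma C_k_exp: "C_k k (exp :: real \<Rightarrow> real)"
proof (induction k)
  case 0
  show ?case by (auto intro: continuous_intros)
next
  case (Suc k)
  have D: "(exp has_derivative (\<lambda>v. exp x * v)) (at x)" for x :: real
    using DERIV_exp[of x] by (simp add: has_field_derivative_def)
  show ?case
    unfolding C_k.simps frechet_derivative_eqI[OF D]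
    using D Suc by (auto simp: differentiable_def intro!: C_k_mult C_k_const)
qed

lemma smooth_box_cutoff: "smooth (box_cutoff a b k)"
proof -
  have "smooth (exp :: real \<Rightarrow> real)"
    by (simp add: smooth_def C_k_exp)
  then have "smooth (\<lambda>x. exp (- (real k * box_bump a b x)))"
    by (rule smooth_compose) (intro smooth_minus smooth_cmult smooth_box_bump)
  then show ?thesis
    unfolding box_cutoff_def by (intro smooth_diff smooth_const)
qed

lemma box_cutoff_outside: "x \<notin> box a b \<Longrightarrow> box_cutoff a b k x = 0"
  by (simp add: box_cutoff_def box_bump_outside)

lemma box_cutoff_bounds: "0 \<le> box_cutoff a b k x" "box_cutoff a b k x \<le> 1"
  using box_bump_nonneg[of a b x] by (auto simp: box_cutoff_def)

lemma box_cutoff_tendsto: "(\<lambda>k. box_cutoff a b k x) \<longlonglongrightarrow> indicator (box a b) x"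
proof (cases "x \<in> box a b")
  case True
  then have "filterlim (\<lambda>k. real k * box_bump a b x) at_top sequentially"
    by (intro filterlim_at_top_mult_tendsto_pos[OF tendsto_const] filterlim_real_sequentially)
       (simp_all add: box_bump_pos_iff mult.commute)
  then have "(\<lambda>k. exp (- (real k * box_bump a b x))) \<longlonglongrightarrow> 0"
    by (intro filterlim_compose[OF exp_at_bot]) (simp add: filterlim_uminus_at_bot)
  then have "(\<lambda>k. 1 - exp (- (real k * box_bump a b x))) \<longlonglongrightarrow> 1 - 0"
    by (intro tendsto_intros)
  then show ?thesis using True by (simp add: box_cutoff_def)
qed (simp add: box_cutoff_outside)

lemma test_functionI:
  "smooth \<phi> \<Longrightarrow> compact K \<Longrightarrow> K \<subseteq> D \<Longrightarrow> (\<And>x. x \<notin> K \<Longrightarrow> \<phi> x = 0) \<Longrightarrow> \<phi> \<in> test_functions D"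
  unfolding test_functions_def by auto

lemma box_cutoff_test_function: "cbox a b \<subseteq> D \<Longrightarrow> box_cutoff a b k \<in> test_functions D"
  using box_subset_cbox[of a b]
  by (auto intro!: test_functionI[OF smooth_box_cutoff compact_cbox] box_cutoff_outside)

lemma box_bump_test_function: "cbox a b \<subseteq> D \<Longrightarrow> box_bump a b \<in> test_functions D"
  using box_subset_cbox[of a b]
  by (auto intro!: test_functionI[OF smooth_box_bump compact_cbox] box_bump_outside)

section \<open>Integration by parts in the whole space and in a half space\<close>

lemma integrable_continuous_bounded_support:
  fixes f :: "'a::euclidean_space \<Rightarrow> real"
  assumes "continuous_on UNIV f" "bounded S" "\<And>x. x \<notin> S \<Longrightarrow> f x = 0"
  shows "integrable lborel f"
proof -
  have "integrable lborel (\<lambda>x. indicator (closure S) x *\<^sub>R f x)"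
    using assms by (intro borel_integrable_compact) (auto intro: continuous_on_subset)
  moreover have "(\<lambda>x. indicator (closure S) x *\<^sub>R f x) = f"
    using assms(3) closure_subset[of S] by (fastforce simp: indicator_def)
  ultimately show ?thesis by simp
qed

lemma integrable_indicator_mult:
  "integrable lborel f \<Longrightarrow> E \<in> sets borel \<Longrightarrow> integrable lborel (\<lambda>x. indicator E x * (f x :: real))"
  using integrable_mult_indicator[of E lborel f] by simp

lemma integral_lborel_translate:
  fixes f :: "'a::euclidean_space \<Rightarrow> real"
  assumes "f \<in> borel_measurable borel"
  shows "(\<integral>x. f (x + a) \<partial>lborel) = (\<integral>x. f x \<partial>lborel)"
  using integral_distr[of "(+) a" lborel borel f] assms
  by (simp add: lborel_distr_plus add.commute)

lemma has_real_derivative_along_line: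
  assumes "f differentiable (at (x + s *\<^sub>R v))"
  shows "((\<lambda>s. f (x + s *\<^sub>R v)) has_real_derivative frechet_derivative f (at (x + s *\<^sub>R v)) v) (at s)"
proof -
  let ?f' = "frechet_derivative f (at (x + s *\<^sub>R v))"
  have f': "(f has_derivative ?f') (at (x + s *\<^sub>R v))"
    using assms frechet_derivative_works by blast
  have "((\<lambda>s. x + s *\<^sub>R v) has_derivative (\<lambda>t. t *\<^sub>R v)) (at s)"
    by (auto intro!: derivative_eq_intros)
  then have "((\<lambda>s. f (x + s *\<^sub>R v)) has_derivative (\<lambda>t. ?f' (t *\<^sub>R v))) (at s)"
    using f' by (rule has_derivative_compose)
  moreover have "(\<lambda>t. ?f' (t *\<^sub>R v)) = (*) (?f' v)"
    using linear_scale[OF has_derivative_linear[OF f']] by (simp add: fun_eq_iff mult.commute)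
  ultimately show ?thesis by (simp add: has_field_derivative_def)
qed

lemma frechet_derivative_outside_support:
  assumes "\<And>x. x \<notin> S \<Longrightarrow> f x = 0" "x \<notin> closure S"
  shows "frechet_derivative f (at x) v = 0"
proof -
  have "((\<lambda>x. 0) has_derivative (\<lambda>v. 0)) (at x)" by simp
  then have "(f has_derivative (\<lambda>v. 0)) (at x)"
    by (rule has_derivative_transform_within_open[where s = "- closure S"])
       (use assms closure_subset[of S] in auto)
  then show ?thesis by (rule frechet_derivative_eqI)
qed

lemma bounded_continuous_bounded_support:
  fixes f :: "'a::euclidean_space \<Rightarrow> real"
  assumes "continuous_on UNIV f" "bounded S" "\<And>x. x \<notin> S \<Longrightarrow> f x = 0"
  obtains M where "\<And>x. \<bar>f x\<bar> \<le> M"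
proof -
  have "compact (f ` closure S)"
    using assms by (intro compact_continuous_image) (auto intro: continuous_on_subset)
  then obtain M where M: "\<And>x. x \<in> closure S \<Longrightarrow> \<bar>f x\<bar> \<le> M"
    using compact_imp_bounded bounded_iff by (metis image_eqI real_norm_def)
  have "f x = 0" if "x \<notin> closure S" for x
    using assms(3) closure_subset[of S] that by blast
  then have "\<bar>f x\<bar> \<le> max M 0" for x
    using M[of x] by (cases "x \<in> closure S") auto
  then show ?thesis by (rule that)
qed

text \<open>Reduces integration by parts to translations of Lebesgue measure. The mean value theorem
  bounds every quotient by a bound of the derivative, and steps of length at most
  \<open>norm v\<close> keep all supports in one ball, so dominated convergence applies.\<close>

lemma difference_quotient_integral_tendsto:
  fixes f :: "'a::euclidean_space \<Rightarrow> real"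
  assumes df: "\<And>x. f differentiable (at x)"
    and cf: "continuous_on UNIV (\<lambda>x. frechet_derivative f (at x) v)"
    and S: "bounded S" "\<And>x. x \<notin> S \<Longrightarrow> f x = 0"
    and E [measurable]: "E \<in> sets borel"
  shows "(\<lambda>n. \<integral>x. indicator E x * ((f (x + inverse (real (Suc n)) *\<^sub>R v) - f x) * real (Suc n)) \<partial>lborel)
    \<longlonglongrightarrow> (\<integral>x. indicator E x * frechet_derivative f (at x) v \<partial>lborel)"
proof -
  let ?D = "\<lambda>x. frechet_derivative f (at x) v"
  have cont: "continuous_on UNIV f"
    using df by (simp add: continuous_at_imp_continuous_on differentiable_imp_continuous_within)
  then have [measurable]: "f \<in> borel_measurable borel" by (rule borel_measurable_continuous_onI)
  have [measurable]: "?D \<in> borel_measurable borel" using cf by (rule borel_measurable_continuous_onI)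
  obtain M where M: "\<And>x. \<bar>?D x\<bar> \<le> M"
    using bounded_continuous_bounded_support[OF cf, of "closure S"]
      frechet_derivative_outside_support[of S f, OF S(2)] S(1) by (metis bounded_closure)
  obtain R where R: "\<And>x. x \<in> S \<Longrightarrow> norm x \<le> R"
    using S(1) unfolding bounded_iff by auto
  define w where "w = (\<lambda>x::'a. indicator (cball 0 (R + norm v)) x * M)"
  have "integrable lborel w"
    unfolding w_def using emeasure_bounded_finite[of "cball (0::'a) (R + norm v)"]
    by (intro integrable_mult_left integrable_real_indicator) auto
  moreover have "\<bar>indicator E x * ((f (x + inverse (real (Suc n)) *\<^sub>R v) - f x) * real (Suc n))\<bar> \<le> w x" for n x
  proof (cases "norm x \<le> R + norm v")
    case True
    have "\<exists>z>0. z < inverse (real (Suc n)) \<and>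
        f (x + inverse (real (Suc n)) *\<^sub>R v) - f (x + 0 *\<^sub>R v) = (inverse (real (Suc n)) - 0) * ?D (x + z *\<^sub>R v)"
      by (rule MVT2) (auto intro!: has_real_derivative_along_line df)
    then obtain z where "f (x + inverse (real (Suc n)) *\<^sub>R v) - f x = inverse (real (Suc n)) * ?D (x + z *\<^sub>R v)"
      by auto
    then have "(f (x + inverse (real (Suc n)) *\<^sub>R v) - f x) * real (Suc n) = ?D (x + z *\<^sub>R v)"
      by (simp add: field_simps del: of_nat_Suc)
    then show ?thesis
      using M[of "x + z *\<^sub>R v"] M[of x] True by (auto simp: w_def indicator_def)
  next
    case False
    have "norm (inverse (real (Suc n)) *\<^sub>R v) \<le> norm v"
      by (simp add: mult_left_le_one_le inverse_le_1_iff)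
    then have "norm (x + inverse (real (Suc n)) *\<^sub>R v) > R" "norm x > R"
      using False norm_diff_ineq[of x "inverse (real (Suc n)) *\<^sub>R v"] norm_ge_zero[of v] by linarith+
    then have "x \<notin> S" "x + inverse (real (Suc n)) *\<^sub>R v \<notin> S"
      using R by fastforce+
    then show ?thesis
      using S(2) False by (simp add: w_def)
  qed
  moreover have "(\<lambda>n. indicator E x * ((f (x + inverse (real (Suc n)) *\<^sub>R v) - f x) * real (Suc n)))
      \<longlonglongrightarrow> indicator E x * ?D x" for x
  proof -
    have "((\<lambda>h. (f (x + (0 + h) *\<^sub>R v) - f (x + 0 *\<^sub>R v)) / h) \<longlongrightarrow> ?D (x + 0 *\<^sub>R v)) (at 0)"
      using has_real_derivative_along_line[of f x 0 v, OF df] unfolding DERIV_def .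
    moreover have "filterlim (\<lambda>n. inverse (real (Suc n))) (at 0) sequentially"
      using LIMSEQ_inverse_real_of_nat by (simp add: filterlim_at)
    ultimately have "(\<lambda>n. (f (x + inverse (real (Suc n)) *\<^sub>R v) - f x) / inverse (real (Suc n))) \<longlonglongrightarrow> ?D x"
      using filterlim_compose by fastforce
    then show ?thesis
      by (intro tendsto_mult tendsto_const) (simp add: divide_inverse)
  qed
  ultimately show ?thesis
    by (intro integral_dominated_convergence[where w = w]) simp_all
qed

text \<open>On a set invariant under translations along \<open>v\<close>, the integrals of
  \<open>f\<close> and of its translates coincide, so every difference quotient integrates to 0.
  Serves the whole space and the directions tangential to a half space.\<close>

lemma integral_derivative_invariant_set:
  fixes f :: "'a::euclidean_space \<Rightarrow> real"
  assumes df: "\<And>x. f differentiable (at x)"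
    and cf: "continuous_on UNIV (\<lambda>x. frechet_derivative f (at x) v)"
    and S: "bounded S" "\<And>x. x \<notin> S \<Longrightarrow> f x = 0"
    and E [measurable]: "E \<in> sets borel" and inv: "\<And>x s. x + s *\<^sub>R v \<in> E \<longleftrightarrow> x \<in> E"
  shows "(\<integral>x. indicator E x * frechet_derivative f (at x) v \<partial>lborel) = 0"
proof -
  have cont: "continuous_on UNIV f"
    using df by (simp add: continuous_at_imp_continuous_on differentiable_imp_continuous_within)
  then have m [measurable]: "f \<in> borel_measurable borel" by (rule borel_measurable_continuous_onI)
  have I: "integrable lborel (\<lambda>x. indicator E x * f x)"
    by (intro integrable_indicator_mult integrable_continuous_bounded_support[OF cont S] E)
  have "(\<integral>x. indicator E x * ((f (x + h *\<^sub>R v) - f x) * c) \<partial>lborel) = 0" for h c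
  proof -
    have I': "integrable lborel (\<lambda>x. indicator E x * f (x + h *\<^sub>R v))"
    proof -
      have "integrable (distr lborel borel ((+) (h *\<^sub>R v))) (\<lambda>x. indicator E x * f x)"
        using I by (simp add: lborel_distr_plus)
      then show ?thesis
        using inv by (simp add: integrable_distr_eq indicator_def add.commute)
    qed
    have "(\<integral>x. indicator E x * f (x + h *\<^sub>R v) \<partial>lborel) = (\<integral>x. indicator E x * f x \<partial>lborel)"
      using integral_lborel_translate[of "\<lambda>x. indicator E x * f x" "h *\<^sub>R v"] inv
      by (simp add: indicator_def)
    moreover have "(\<integral>x. indicator E x * ((f (x + h *\<^sub>R v) - f x) * c) \<partial>lborel)
        = ((\<integral>x. indicator E x * f (x + h *\<^sub>R v) \<partial>lborel) - (\<integral>x. indicator E x * f x \<partial>lborel)) * c"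
      using I I' by (simp add: algebra_simps)
    ultimately show ?thesis by simp
  qed
  moreover have "(\<lambda>n. \<integral>x. indicator E x * ((f (x + inverse (real (Suc n)) *\<^sub>R v) - f x) * real (Suc n)) \<partial>lborel)
    \<longlonglongrightarrow> (\<integral>x. indicator E x * frechet_derivative f (at x) v \<partial>lborel)"
    by (rule difference_quotient_integral_tendsto[OF df cf S E])
  ultimately have "(\<lambda>n::nat. 0) \<longlonglongrightarrow> (\<integral>x. indicator E x * frechet_derivative f (at x) v \<partial>lborel)"
    by (simp only:)
  then show ?thesis
    by (rule LIMSEQ_unique[OF _ tendsto_const])
qed

section \<open>Integrals over a hyperplane, written as integrals over a unit slab\<close>

definition flat_proj :: "real \<Rightarrow> 'a::euclidean_space \<Rightarrow> 'a \<Rightarrow> 'a" where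
  "flat_proj c e x = x + (c - x \<bullet> e) *\<^sub>R e"

lemma continuous_flat_proj: "continuous_on S (flat_proj c e)"
  unfolding flat_proj_def by (intro continuous_intros)

lemma borel_measurable_flat_proj [measurable]: "flat_proj c e \<in> borel_measurable borel"
  by (simp add: borel_measurable_continuous_onI continuous_flat_proj)

lemma flat_proj_inner: "e \<in> Basis \<Longrightarrow> i \<in> Basis \<Longrightarrow> flat_proj c e x \<bullet> i = (if i = e then c else x \<bullet> i)"
  by (auto simp: flat_proj_def inner_add_left inner_Basis)

text \<open>The affine map stretches by \<open>h\<close> in direction \<open>e\<close> and fixes the
  hyperplane x \<bullet> e = c, so its Jacobian is \<open>h\<close>.\<close>

lemma integral_lborel_scale_direction:
  fixes f :: "'a::euclidean_space \<Rightarrow> real"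
  assumes [measurable]: "f \<in> borel_measurable borel" and e: "e \<in> Basis" and h: "h > 0"
  shows "(\<integral>x. f x \<partial>lborel) = h * (\<integral>x. f (x + ((h - 1) * (x \<bullet> e - c)) *\<^sub>R e) \<partial>lborel)"
proof -
  let ?c = "\<lambda>j. if j = e then h else 1"
  let ?T = "\<lambda>x. ((1 - h) * c) *\<^sub>R e + (\<Sum>j\<in>Basis. (?c j * (x \<bullet> j)) *\<^sub>R j)"
  have T: "?T x = x + ((h - 1) * (x \<bullet> e - c)) *\<^sub>R e" for x
    by (rule euclidean_eqI) (use e in \<open>auto simp: inner_simps inner_sum_left_Basis inner_Basis algebra_simps\<close>)
  have p: "(\<Prod>j\<in>Basis. \<bar>?c j\<bar>) = h"
    using e h by (simp add: prod.delta if_distrib[of abs] cong: if_cong)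
  have "lborel = density (distr lborel borel ?T) (\<lambda>_. \<Prod>j\<in>Basis. \<bar>?c j\<bar>)"
    using h by (intro lborel_affine_euclidean) auto
  then have "lborel = density (distr lborel borel (\<lambda>x. x + ((h - 1) * (x \<bullet> e - c)) *\<^sub>R e)) (\<lambda>_. ennreal h)"
    unfolding T p .
  then have "(\<integral>x. f x \<partial>lborel)
      = (\<integral>x. f x \<partial>density (distr lborel borel (\<lambda>x. x + ((h - 1) * (x \<bullet> e - c)) *\<^sub>R e)) (\<lambda>_. ennreal h))"
    by simp
  also have "\<dots> = h * (\<integral>x. f (x + ((h - 1) * (x \<bullet> e - c)) *\<^sub>R e) \<partial>lborel)"
    using h by (simp add: integral_density integral_distr)
  finally show ?thesis .
qed

text \<open>Shifting the half space by \<open>h\<close> gains a slab of thickness \<open>h\<close>.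
  Stretching that slab to thickness 1 absorbs the factor 1/h of the difference quotient, and as
  \<open>h\<close> tends to 0 the points of evaluation collapse onto the hyperplane.\<close>

lemma integral_derivative_half_space:
  fixes f :: "'a::euclidean_space \<Rightarrow> real"
  assumes df: "\<And>x. f differentiable (at x)"
    and cf: "continuous_on UNIV (\<lambda>x. frechet_derivative f (at x) e)"
    and S: "bounded S" "\<And>x. x \<notin> S \<Longrightarrow> f x = 0" and e: "e \<in> Basis"
  shows "(\<integral>x. indicator {x. x \<bullet> e < c} x * frechet_derivative f (at x) e \<partial>lborel)
    = (\<integral>x. indicator {x. c \<le> x \<bullet> e \<and> x \<bullet> e < c + 1} x * f (flat_proj c e x) \<partial>lborel)"
proof -
  have cont: "continuous_on UNIV f"
    using df by (simp add: continuous_at_imp_continuous_on differentiable_imp_continuous_within)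
  then have m [measurable]: "f \<in> borel_measurable borel" by (rule borel_measurable_continuous_onI)
  have If: "integrable lborel f"
    by (rule integrable_continuous_bounded_support[OF cont S])
  let ?T = "\<lambda>h x. x + ((h - 1) * (x \<bullet> e - c)) *\<^sub>R e"
  let ?slab = "\<lambda>h. {x. c \<le> x \<bullet> e \<and> x \<bullet> e < c + h}"
  have eq: "(\<integral>x. indicator {x. x \<bullet> e < c} x * ((f (x + h *\<^sub>R e) - f x) * inverse h) \<partial>lborel)
      = (\<integral>x. indicator (?slab 1) x * f (?T h x) \<partial>lborel)" if h: "h > 0" for h
  proof -
    let ?L = "\<lambda>d. {x. x \<bullet> e < d}"
    have ind: "indicator (?L c) x = (indicator (?L (c + h)) (x + h *\<^sub>R e) :: real)" for x
      using e by (simp add: indicator_def inner_add_left)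
    have "integrable (distr lborel borel ((+) (h *\<^sub>R e))) (\<lambda>x. indicator (?L (c + h)) x * f x)"
      unfolding lborel_distr_plus by (intro integrable_indicator_mult If) measurable
    then have I1: "integrable lborel (\<lambda>x. indicator (?L c) x * f (x + h *\<^sub>R e))"
      unfolding ind by (subst (asm) integrable_distr_eq) (simp_all add: add.commute)
    have I2: "integrable lborel (\<lambda>x. indicator (?L d) x * f x)" for d
      by (intro integrable_indicator_mult If) measurable
    have "(\<integral>x. indicator (?L c) x * f (x + h *\<^sub>R e) \<partial>lborel) = (\<integral>x. indicator (?L (c + h)) x * f x \<partial>lborel)"
      unfolding ind by (rule integral_lborel_translate) measurable
    then have "(\<integral>x. indicator (?L c) x * ((f (x + h *\<^sub>R e) - f x) * inverse h) \<partial>lborel)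
        = ((\<integral>x. indicator (?L (c + h)) x * f x \<partial>lborel) - (\<integral>x. indicator (?L c) x * f x \<partial>lborel)) * inverse h"
      using I1 I2[of c] by (simp add: algebra_simps)
    also have "(\<integral>x. indicator (?L (c + h)) x * f x \<partial>lborel) - (\<integral>x. indicator (?L c) x * f x \<partial>lborel)
        = (\<integral>x. indicator (?slab h) x * f x \<partial>lborel)"
      using h by (subst Bochner_Integration.integral_diff[symmetric, OF I2 I2])
        (auto intro!: Bochner_Integration.integral_cong simp: indicator_def)
    also have "\<dots> = h * (\<integral>x. indicator (?slab h) (?T h x) * f (?T h x) \<partial>lborel)"
      by (rule integral_lborel_scale_direction[OF _ e h]) measurable
    also have "(\<lambda>x. indicator (?slab h) (?T h x) :: real) = indicator (?slab 1)"
    proof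
      fix x
      have "?T h x \<bullet> e = c + h * (x \<bullet> e - c)"
        using e by (simp add: inner_simps algebra_simps)
      moreover have "c + h * (x \<bullet> e - c) < c + h \<longleftrightarrow> x \<bullet> e - c < 1"
        using h mult_less_cancel_left_pos[of h "x \<bullet> e - c" 1] by simp
      moreover have "c \<le> c + h * (x \<bullet> e - c) \<longleftrightarrow> 0 \<le> x \<bullet> e - c"
        using h by (simp add: zero_le_mult_iff)
      ultimately show "indicator (?slab h) (?T h x) = (indicator (?slab 1) x :: real)"
        by (auto simp: indicator_def)
    qed
    finally show ?thesis using h by (simp add: fun_eq_iff)
  qed
  obtain M where M: "\<And>x. \<bar>f x\<bar> \<le> M"
    using bounded_continuous_bounded_support[OF cont S] by blast
  obtain R where R: "\<And>x. x \<in> S \<Longrightarrow> norm x \<le> R"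
    using S(1) unfolding bounded_iff by auto
  have lim1: "(\<lambda>n. \<integral>x. indicator (?slab 1) x * f (?T (inverse (real (Suc n))) x) \<partial>lborel)
      \<longlonglongrightarrow> (\<integral>x. indicator (?slab 1) x * f (flat_proj c e x) \<partial>lborel)"
  proof (rule integral_dominated_convergence[where w = "\<lambda>x. indicator (cball 0 (R + 1)) x * M"])
    show "integrable lborel (\<lambda>x::'a. indicator (cball 0 (R + 1)) x * M)"
      using emeasure_bounded_finite[of "cball (0::'a) (R + 1)"]
      by (intro integrable_mult_left integrable_real_indicator) auto
    show "AE x in lborel. (\<lambda>n. indicator (?slab 1) x * f (?T (inverse (real (Suc n))) x))
        \<longlonglongrightarrow> indicator (?slab 1) x * f (flat_proj c e x)"
    proof (rule AE_I2)
      fix x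
      have "(\<lambda>n. ?T (inverse (real (Suc n))) x) \<longlonglongrightarrow> x + ((0 - 1) * (x \<bullet> e - c)) *\<^sub>R e"
        by (intro tendsto_intros LIMSEQ_inverse_real_of_nat)
      then have "(\<lambda>n. f (?T (inverse (real (Suc n))) x)) \<longlonglongrightarrow> f (x + ((0 - 1) * (x \<bullet> e - c)) *\<^sub>R e)"
        using cont by (intro isCont_tendsto_compose[of _ f]) (simp_all add: continuous_on_eq_continuous_at)
      then show "(\<lambda>n. indicator (?slab 1) x * f (?T (inverse (real (Suc n))) x))
        \<longlonglongrightarrow> indicator (?slab 1) x * f (flat_proj c e x)"
        unfolding flat_proj_def by (intro tendsto_mult tendsto_const) simp
    qed
    show "AE x in lborel. norm (indicator (?slab 1) x * f (?T (inverse (real (Suc n))) x))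
        \<le> indicator (cball 0 (R + 1)) x * M" for n
    proof (rule AE_I2)
      fix x
      let ?h = "inverse (real (Suc n))"
      have M0: "0 \<le> M" using M[of x] by linarith
      show "norm (indicator (?slab 1) x * f (?T ?h x)) \<le> indicator (cball 0 (R + 1)) x * M"
      proof (cases "x \<in> ?slab 1 \<and> ?T ?h x \<in> S")
        case True
        have "0 < ?h" "?h \<le> 1" by (simp_all add: inverse_le_1_iff)
        then have "\<bar>(?h - 1) * (x \<bullet> e - c)\<bar> \<le> 1 * 1"
          unfolding abs_mult using True by (intro mult_mono) auto
        then have "norm (((?h - 1) * (x \<bullet> e - c)) *\<^sub>R e) \<le> 1" using e by simp
        then have "norm x \<le> R + 1"
          using R[of "?T ?h x"] True norm_diff_ineq[of x "((?h - 1) * (x \<bullet> e - c)) *\<^sub>R e"] by linarith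
        then show ?thesis using M True by simp
      qed (use S M0 in auto)
    qed
  qed measurable
  have lim2: "(\<lambda>n. \<integral>x. indicator (?slab 1) x * f (?T (inverse (real (Suc n))) x) \<partial>lborel)
      \<longlonglongrightarrow> (\<integral>x. indicator {x. x \<bullet> e < c} x * frechet_derivative f (at x) e \<partial>lborel)"
  proof -
    have "(\<lambda>n. \<integral>x. indicator {x. x \<bullet> e < c} x * ((f (x + inverse (real (Suc n)) *\<^sub>R e) - f x) * real (Suc n)) \<partial>lborel)
        \<longlonglongrightarrow> (\<integral>x. indicator {x. x \<bullet> e < c} x * frechet_derivative f (at x) e \<partial>lborel)"
      by (rule difference_quotient_integral_tendsto[of f e, OF df cf S]) measurable
    moreover have "(\<integral>x. indicator {x. x \<bullet> e < c} x * ((f (x + inverse (real (Suc n)) *\<^sub>R e) - f x) * real (Suc n)) \<partial>lborel)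
        = (\<integral>x. indicator (?slab 1) x * f (?T (inverse (real (Suc n))) x) \<partial>lborel)" for n
      using eq[of "inverse (real (Suc n))"] by (simp only: inverse_inverse_eq positive_imp_inverse_positive of_nat_0_less_iff zero_less_Suc)
    ultimately show ?thesis by (simp only:)
  qed
  show ?thesis
    by (rule LIMSEQ_unique[OF lim2 lim1])
qed

section \<open>The fundamental lemma and weak gradients\<close>

text \<open>A \<pi>-\<lambda> argument: boxes form an intersection-stable generator of the Borel
  sets, and vanishing integrals pass to disjoint countable unions and, through \<open>tot\<close>,
  to complements.\<close>

lemma AE_eq_0_if_box_integrals_eq_0:
  fixes g :: "'a::euclidean_space \<Rightarrow> real"
  assumes g: "integrable lebesgue g" and tot: "(\<integral>x. g x \<partial>lebesgue) = 0"
    and box: "\<And>a b. (\<integral>x. indicator (box a b) x * g x \<partial>lebesgue) = 0"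
  shows "AE x in lebesgue. g x = 0"
proof -
  let ?G = "range (\<lambda>(a, b). box a b :: 'a set)"
  have I: "integrable lebesgue (\<lambda>x. indicator A x * g x)" if "A \<in> sets lebesgue" for A
    using integrable_mult_indicator[OF that g] by simp
  have borel: "sets (borel :: 'a measure) = sigma_sets UNIV ?G"
    by (simp add: borel_eq_box)
  have main: "(\<integral>x. indicator A x * g x \<partial>lebesgue) = 0" if "A \<in> sets borel" for A
  proof -
    have "Int_stable ?G" "?G \<subseteq> Pow UNIV"
      by (auto simp: Int_stable_def box_Int_box)
    then show ?thesis using that[unfolded borel]
    proof (induction rule: sigma_sets_induct_disjoint)
      case (compl A)
      have A: "A \<in> sets lebesgue" using compl(1) borel by auto
      have "indicator (UNIV - A) x * g x = g x - indicator A x * g x" for x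
        by (auto simp: indicator_def)
      then show ?case using g I[OF A] compl(2) tot by simp
    next
      case (union A)
      have "A i \<in> sets borel" for i using union(2) borel by blast
      then have A: "A i \<in> sets lebesgue" for i by simp
      then have "(LINT x:(\<Union>i. A i)|lebesgue. g x) = (\<Sum>i. (LINT x:(A i)|lebesgue. g x))"
        using union(1) I by (intro lebesgue_integral_countable_add)
          (auto simp: disjoint_family_on_def set_integrable_def)
      then show ?case using union(3) by (simp add: set_lebesgue_integral_def)
    qed (use box in auto)
  qed
  \<comment> \<open>A Lebesgue set agrees with its Borel \<open>main_part\<close> up to a null
    set.\<close>
  have "(LINT x:A|lebesgue. g x) = (LINT x:A|lebesgue. 0)" if A: "A \<in> sets lebesgue" for A
  proof -
    have "AE x in lebesgue. x \<notin> null_part lborel A"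
      using AE_notin_null_part[OF A] AE_completion by blast
    then have "AE x in lebesgue. indicator A x * g x = indicator (main_part lborel A) x * g x"
    proof (eventually_elim)
      case (elim x)
      then show ?case using main_part_null_part_Un[OF A] by (auto simp: indicator_def)
    qed
    moreover have "main_part lborel A \<in> sets borel" using A main_part_sets by force
    ultimately have "(\<integral>x. indicator A x * g x \<partial>lebesgue) = (\<integral>x. indicator (main_part lborel A) x * g x \<partial>lebesgue)"
      using A I by (intro integral_cong_AE) (auto intro: borel_measurable_integrable)
    then show ?thesis
      using main[OF \<open>main_part lborel A \<in> sets borel\<close>] by (simp add: set_lebesgue_integral_def)
  qed
  then show ?thesis
    by (rule density_unique_real[OF g integrable_zero])
qed

section \<open>Restricted Lebesgue measure expressed by indicators\<close>

lemma integral_lebesgue_on: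
  fixes f :: "'a::euclidean_space \<Rightarrow> real"
  shows "D \<in> sets lebesgue \<Longrightarrow> (\<integral>x. f x \<partial>lebesgue_on D) = (\<integral>x. indicator D x * f x \<partial>lebesgue)"
  by (simp add: integral_restrict_space)

lemma integrable_lebesgue_on:
  fixes f :: "'a::euclidean_space \<Rightarrow> real"
  shows "D \<in> sets lebesgue \<Longrightarrow> integrable (lebesgue_on D) f \<longleftrightarrow> integrable lebesgue (\<lambda>x. indicator D x * f x)"
  by (simp add: integrable_restrict_space)

lemma AE_lebesgue_on:
  "D \<in> sets lebesgue \<Longrightarrow> (AE x in lebesgue_on D. P x) \<longleftrightarrow> (AE x in lebesgue. x \<in> D \<longrightarrow> P x)"
  by (simp add: AE_restrict_space_iff)

lemma integral_lebesgue_on_borel: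
  fixes f :: "'a::euclidean_space \<Rightarrow> real"
  assumes "f \<in> borel_measurable borel" "D \<in> sets borel"
  shows "(\<integral>x. f x \<partial>lebesgue_on D) = (\<integral>x. indicator D x * f x \<partial>lborel)"
proof -
  have "(\<integral>x. f x \<partial>lebesgue_on D) = (\<integral>x. indicator D x * f x \<partial>lebesgue)"
    using assms by (intro integral_lebesgue_on) simp
  also have "\<dots> = (\<integral>x. indicator D x * f x \<partial>lborel)"
    using assms by (intro integral_completion) simp
  finally show ?thesis .
qed

lemma test_function_smooth: "\<phi> \<in> test_functions D \<Longrightarrow> smooth \<phi>"
  by (simp add: test_functions_def)

lemma test_functionE:
  assumes "\<phi> \<in> test_functions D"
  obtains K where "compact K" "K \<subseteq> D" "\<And>x. x \<notin> K \<Longrightarrow> \<phi> x = 0"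
  using assms unfolding test_functions_def by blast

lemma test_function_frechet_derivative:
  assumes "\<phi> \<in> test_functions D"
  shows "(\<lambda>x. frechet_derivative \<phi> (at x) v) \<in> test_functions D"
proof -
  obtain K where K: "compact K" "K \<subseteq> D" "\<And>x. x \<notin> K \<Longrightarrow> \<phi> x = 0"
    using assms test_functionE by metis
  have "frechet_derivative \<phi> (at x) v = 0" if "x \<notin> K" for x
    by (rule frechet_derivative_outside_support[of K]) (use K that in \<open>auto simp: compact_imp_closed\<close>)
  then show ?thesis
    by (rule test_functionI[OF smooth_frechet_derivative[OF test_function_smooth[OF assms]] K(1,2)])
qed

lemma test_function_bounded:
  fixes \<phi> :: "'a::euclidean_space \<Rightarrow> real"
  assumes "\<phi> \<in> test_functions D"
  obtains M where "\<And>x. \<bar>\<phi> x\<bar> \<le> M"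
proof -
  obtain K where K: "compact K" "K \<subseteq> D" "\<And>x. x \<notin> K \<Longrightarrow> \<phi> x = 0"
    using assms test_functionE by metis
  show ?thesis
    by (rule bounded_continuous_bounded_support[of \<phi> K])
      (use K that assms in \<open>auto simp: compact_imp_bounded smooth_continuous_on test_function_smooth\<close>)
qed

lemma integrable_test_function_mult:
  fixes f :: "'a::euclidean_space \<Rightarrow> real"
  assumes D: "open D" and \<phi>: "\<phi> \<in> test_functions D" and f: "locally_integrable D f"
  shows "integrable (lebesgue_on D) (\<lambda>x. \<phi> x * f x)"
proof -
  obtain K where K: "compact K" "K \<subseteq> D" "\<And>x. x \<notin> K \<Longrightarrow> \<phi> x = 0"
    using \<phi> test_functionE by metis
  obtain M where M: "\<And>x. \<bar>\<phi> x\<bar> \<le> M"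
    using \<phi> test_function_bounded by blast
  have [measurable]: "K \<in> sets lebesgue" "D \<in> sets lebesgue"
    using K(1) D by (auto simp: compact_imp_closed)
  have fK: "integrable lebesgue (\<lambda>x. indicator K x * f x)"
    using f K integrable_lebesgue_on[of K f] unfolding locally_integrable_def by simp
  have [measurable]: "\<phi> \<in> borel_measurable lebesgue"
    using test_function_smooth[OF \<phi>] by (intro measurable_completion) (simp add: smooth_borel_measurable)
  have "integrable lebesgue (\<lambda>x. \<phi> x * (indicator K x * f x))"
  proof (rule Bochner_Integration.integrable_bound)
    show "integrable lebesgue (\<lambda>x. M * (indicator K x * f x))" using fK by simp
    show "(\<lambda>x. \<phi> x * (indicator K x * f x)) \<in> borel_measurable lebesgue"
      by (rule borel_measurable_times[OF _ borel_measurable_integrable[OF fK]]) measurable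
    show "AE x in lebesgue. norm (\<phi> x * (indicator K x * f x)) \<le> norm (M * (indicator K x * f x))"
      using M by (intro AE_I2) (auto simp: abs_mult intro!: mult_right_mono intro: order_trans[OF _ abs_ge_self])
  qed
  moreover have "\<phi> x * (indicator K x * f x) = indicator D x * (\<phi> x * f x)" for x
    using K by (auto simp: indicator_def)
  ultimately show ?thesis
    by (simp add: integrable_lebesgue_on)
qed

text \<open>Smooth cutoffs converge to indicators of boxes, so \<open>f\<close> has integral 0 over
  every box whose closed version lies in \<open>D\<close>. This makes \<open>f\<close> vanish almost
  everywhere on each such box, and countably many of them cover \<open>D\<close>.\<close>

lemma fundamental_lemma:
  fixes f :: "'a::euclidean_space \<Rightarrow> real"
  assumes D: "open D" and f: "locally_integrable D f"
    and zero: "\<And>\<phi>. \<phi> \<in> test_functions D \<Longrightarrow> (\<integral>x. \<phi> x * f x \<partial>lebesgue_on D) = 0"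
  shows "AE x in lebesgue_on D. f x = 0"
proof -
  have [measurable]: "D \<in> sets lebesgue" using D by auto
  have box0: "(\<integral>x. indicator (box a b) x * f x \<partial>lebesgue) = 0" if ab: "cbox a b \<subseteq> D" for a b
  proof -
    have fK: "integrable lebesgue (\<lambda>x. indicator (cbox a b) x * f x)"
      using f ab integrable_lebesgue_on[of "cbox a b" f] unfolding locally_integrable_def by simp
    have m: "box_cutoff a b k \<in> borel_measurable lebesgue" for k
      using smooth_box_cutoff[of a b k] by (intro measurable_completion) (simp add: smooth_borel_measurable)
    have "(\<lambda>k. \<integral>x. box_cutoff a b k x * (indicator (cbox a b) x * f x) \<partial>lebesgue)
        \<longlonglongrightarrow> (\<integral>x. indicator (box a b) x * (indicator (cbox a b) x * f x) \<partial>lebesgue)"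
    proof (rule integral_dominated_convergence[where w = "\<lambda>x. \<bar>indicator (cbox a b) x * f x\<bar>"])
      show "AE x in lebesgue. (\<lambda>k. box_cutoff a b k x * (indicator (cbox a b) x * f x))
          \<longlonglongrightarrow> indicator (box a b) x * (indicator (cbox a b) x * f x)"
        by (intro AE_I2 tendsto_mult box_cutoff_tendsto tendsto_const)
      show "AE x in lebesgue. norm (box_cutoff a b k x * (indicator (cbox a b) x * f x))
          \<le> \<bar>indicator (cbox a b) x * f x\<bar>" for k
        using box_cutoff_bounds[of a b k]
        by (intro AE_I2) (simp add: abs_mult mult_left_le_one_le)
      show "(\<lambda>x. indicator (box a b) x * (indicator (cbox a b) x * f x)) \<in> borel_measurable lebesgue"
        by (rule borel_measurable_times[OF _ borel_measurable_integrable[OF fK]])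
          (simp add: borel_measurable_indicator)
      show "(\<lambda>x. box_cutoff a b k x * (indicator (cbox a b) x * f x)) \<in> borel_measurable lebesgue" for k
        by (rule borel_measurable_times[OF m borel_measurable_integrable[OF fK]])
    qed (use fK in simp)
    moreover have "box_cutoff a b k x * (indicator (cbox a b) x * f x) = indicator D x * (box_cutoff a b k x * f x)" for k x
      using box_cutoff_outside[of x a b k] box_subset_cbox[of a b] ab by (auto simp: indicator_def)
    moreover have "(\<integral>x. indicator D x * (box_cutoff a b k x * f x) \<partial>lebesgue) = 0" for k
      using zero[OF box_cutoff_test_function[OF ab], of k] by (simp add: integral_lebesgue_on)
    moreover have "indicator (box a b) x * (indicator (cbox a b) x * f x) = indicator (box a b) x * f x" for x
      using box_subset_cbox[of a b] by (auto simp: indicator_def)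
    ultimately have "(\<lambda>k::nat. 0) \<longlonglongrightarrow> (\<integral>x. indicator (box a b) x * f x \<partial>lebesgue)"
      by (simp only:)
    then show ?thesis by (rule LIMSEQ_unique[OF _ tendsto_const])
  qed
  have AEbox: "AE x in lebesgue. x \<in> box a b \<longrightarrow> f x = 0" if ab: "cbox a b \<subseteq> D" for a b
  proof -
    have fK: "integrable lebesgue (\<lambda>x. indicator (cbox a b) x * f x)"
      using f ab integrable_lebesgue_on[of "cbox a b" f] unfolding locally_integrable_def by simp
    have "integrable lebesgue (\<lambda>x. indicator (box a b) x * (indicator (cbox a b) x * f x))"
      using integrable_mult_indicator[OF _ fK, of "box a b"] by simp
    moreover have "indicator (box a b) x * (indicator (cbox a b) x * f x) = indicator (box a b) x * f x" for x
      using box_subset_cbox[of a b] by (auto simp: indicator_def)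
    ultimately have "integrable lebesgue (\<lambda>x. indicator (box a b) x * f x)" by simp
    moreover have "(\<integral>x. indicator (box c d) x * (indicator (box a b) x * f x) \<partial>lebesgue) = 0" for c d
    proof -
      \<comment> \<open>The corners of the intersection of the two boxes; its closed version lies in
        \<open>cbox a b\<close>, hence in \<open>D\<close>.\<close>
      let ?l = "\<Sum>i\<in>Basis. max (a \<bullet> i) (c \<bullet> i) *\<^sub>R i" and ?u = "\<Sum>i\<in>Basis. min (b \<bullet> i) (d \<bullet> i) *\<^sub>R i"
      have "cbox ?l ?u \<subseteq> D"
        using ab unfolding Int_interval[of a b c d, symmetric] by blast
      from box0[OF this] show ?thesis
        by (simp add: box_Int_box[of a b c d, symmetric] indicator_inter_arith mult_ac)
    qed
    ultimately have "AE x in lebesgue. indicator (box a b) x * f x = 0"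
      using box0[OF ab] by (intro AE_eq_0_if_box_integrals_eq_0)
    then show ?thesis by eventually_elim (auto simp: indicator_def)
  qed
  obtain \<D> where "countable \<D>" "\<D> \<subseteq> Pow D" and \<D>: "\<And>X. X \<in> \<D> \<Longrightarrow> \<exists>a b. X = cbox a b" "\<Union>\<D> = D"
    using open_countable_Union_open_cbox[OF D] by blast
  have "AE x in lebesgue. x \<in> X \<longrightarrow> f x = 0" if X: "X \<in> \<D>" for X
  proof -
    obtain a b where ab: "X = cbox a b" using \<D> X by blast
    have "cbox a b - box a b \<in> null_sets lebesgue"
      using negligible_frontier_interval[of a b] by (simp add: negligible_iff_null_sets)
    then have "AE x in lebesgue. x \<notin> cbox a b - box a b" by (rule AE_not_in)
    moreover have "AE x in lebesgue. x \<in> box a b \<longrightarrow> f x = 0"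
      using X ab \<open>\<D> \<subseteq> Pow D\<close> by (intro AEbox) auto
    ultimately show ?thesis unfolding ab by eventually_elim auto
  qed
  then have "AE x in lebesgue. \<forall>X\<in>\<D>. x \<in> X \<longrightarrow> f x = 0"
    unfolding AE_ball_countable[OF \<open>countable \<D>\<close>] by blast
  then have "AE x in lebesgue. x \<in> D \<longrightarrow> f x = 0"
    by eventually_elim (use \<D>(2) in blast)
  then show ?thesis by (simp add: AE_lebesgue_on)
qed

section \<open>Linearity and uniqueness of weak partial derivatives\<close>

lemma locally_integrable_combination:
  fixes f g :: "'a::euclidean_space \<Rightarrow> real"
  shows "locally_integrable D f \<Longrightarrow> locally_integrable D g \<Longrightarrow> locally_integrable D (\<lambda>x. c * f x + d * g x)"
  unfolding locally_integrable_def by simp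

lemma weak_partial_combination:
  fixes f g :: "'a::euclidean_space \<Rightarrow> real"
  assumes "open D" "weak_partial D e f f'" "weak_partial D e g g'"
  shows "weak_partial D e (\<lambda>x. c * f x + d * g x) (\<lambda>x. c * f' x + d * g' x)"
proof -
  have *: "(\<integral>x. \<phi> x * (c * p x + d * q x) \<partial>lebesgue_on D)
      = c * (\<integral>x. \<phi> x * p x \<partial>lebesgue_on D) + d * (\<integral>x. \<phi> x * q x \<partial>lebesgue_on D)"
    if "\<phi> \<in> test_functions D" "locally_integrable D p" "locally_integrable D q" for \<phi> and p q :: "'a \<Rightarrow> real"
  proof -
    have "integrable (lebesgue_on D) (\<lambda>x. \<phi> x * p x)" "integrable (lebesgue_on D) (\<lambda>x. \<phi> x * q x)"
      using integrable_test_function_mult[OF assms(1)] that by blast+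
    moreover have "\<phi> x * (c * p x + d * q x) = c * (\<phi> x * p x) + d * (\<phi> x * q x)" for x
      by (simp add: algebra_simps)
    ultimately show ?thesis by simp
  qed
  show ?thesis
    using assms(2,3) unfolding weak_partial_def
    by (auto simp: locally_integrable_combination * test_function_frechet_derivative)
qed

lemma weak_partial_unique:
  fixes f :: "'a::euclidean_space \<Rightarrow> real"
  assumes "open D" "weak_partial D e f g" "weak_partial D e f h"
  shows "AE x in lebesgue_on D. g x = h x"
proof -
  have w: "weak_partial D e (\<lambda>x. 1 * f x + (-1) * f x) (\<lambda>x. 1 * g x + (-1) * h x)"
    by (rule weak_partial_combination[OF assms])
  have "AE x in lebesgue_on D. 1 * g x + (-1) * h x = 0"
    by (rule fundamental_lemma[OF assms(1)]) (use w in \<open>auto simp: weak_partial_def\<close>)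
  then show ?thesis by eventually_elim simp
qed

subsection \<open>Square integrable functions\<close>

lemma L2_combination:
  assumes f: "f \<in> L2 M" and g: "g \<in> L2 M"
  shows "(\<lambda>x. c *\<^sub>R f x + d *\<^sub>R g x) \<in> L2 M"
proof -
  have [measurable]: "f \<in> borel_measurable M" "g \<in> borel_measurable M"
    using f g by (auto simp: L2_def)
  have "integrable M (\<lambda>x. 2 * c\<^sup>2 * (norm (f x))\<^sup>2 + 2 * d\<^sup>2 * (norm (g x))\<^sup>2)"
    using f g by (auto simp: L2_def)
  then have "integrable M (\<lambda>x. (norm (c *\<^sub>R f x + d *\<^sub>R g x))\<^sup>2)"
  proof (rule Bochner_Integration.integrable_bound)
    show "AE x in M. norm ((norm (c *\<^sub>R f x + d *\<^sub>R g x))\<^sup>2)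
        \<le> norm (2 * c\<^sup>2 * (norm (f x))\<^sup>2 + 2 * d\<^sup>2 * (norm (g x))\<^sup>2)"
    proof (rule AE_I2)
      fix x
      have "(norm (c *\<^sub>R f x + d *\<^sub>R g x))\<^sup>2 \<le> (\<bar>c\<bar> * norm (f x) + \<bar>d\<bar> * norm (g x))\<^sup>2"
        by (intro power_mono order_trans[OF norm_triangle_ineq]) auto
      also have "\<dots> \<le> 2 * c\<^sup>2 * (norm (f x))\<^sup>2 + 2 * d\<^sup>2 * (norm (g x))\<^sup>2"
        using sum_squares_bound[of "\<bar>c\<bar> * norm (f x)" "\<bar>d\<bar> * norm (g x)"]
        by (simp add: power2_sum power_mult_distrib)
      finally show "norm ((norm (c *\<^sub>R f x + d *\<^sub>R g x))\<^sup>2)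
          \<le> norm (2 * c\<^sup>2 * (norm (f x))\<^sup>2 + 2 * d\<^sup>2 * (norm (g x))\<^sup>2)"
        by simp
    qed
  qed measurable
  then show ?thesis by (simp add: L2_def)
qed

lemma L2_norm_nonneg: "L2_norm M f \<ge> 0"
  by (simp add: L2_norm_def)

lemma L2_norm_square: "(L2_norm M f)\<^sup>2 = (\<integral>x. (norm (f x))\<^sup>2 \<partial>M)"
  by (simp add: L2_norm_def)

lemma L2_cong_AE:
  assumes "AE x in M. f x = g x" "f \<in> borel_measurable M" "g \<in> borel_measurable M"
  shows "f \<in> L2 M \<longleftrightarrow> g \<in> L2 M" "L2_norm M f = L2_norm M g"
proof -
  have "AE x in M. (norm (f x))\<^sup>2 = (norm (g x))\<^sup>2"
    using assms(1) by eventually_elim simp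
  then show "f \<in> L2 M \<longleftrightarrow> g \<in> L2 M" "L2_norm M f = L2_norm M g"
    using assms(2,3) integrable_cong_AE[of "\<lambda>x. (norm (f x))\<^sup>2" M "\<lambda>x. (norm (g x))\<^sup>2"]
      integral_cong_AE[of "\<lambda>x. (norm (f x))\<^sup>2" M "\<lambda>x. (norm (g x))\<^sup>2"]
    by (auto simp: L2_def L2_norm_def)
qed

text \<open>Cauchy-Schwarz against the constant 1, read off from the fact that the quadratic
  polynomial c \<mapsto> \<integral>(c |f| - 1)^2 is never negative.\<close>

lemma L2_imp_L1:
  assumes "finite_measure M" and f: "f \<in> L2 M"
  shows "integrable M f" "(\<integral>x. norm (f x) \<partial>M) \<le> sqrt (measure M (space M)) * L2_norm M f"
proof -
  interpret finite_measure M by fact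
  have [measurable]: "f \<in> borel_measurable M" using f by (simp add: L2_def)
  have sq: "integrable M (\<lambda>x. (norm (f x))\<^sup>2)" using f by (simp add: L2_def)
  have "integrable M (\<lambda>x. 1 + (norm (f x))\<^sup>2)" using sq by simp
  then show int: "integrable M f"
  proof (rule Bochner_Integration.integrable_bound)
    have "norm (f x) \<le> 1 + (norm (f x))\<^sup>2" for x
      using sum_squares_bound[of 1 "norm (f x)"] norm_ge_zero[of "f x"] by (simp del: norm_ge_zero)
    then show "AE x in M. norm (f x) \<le> norm (1 + (norm (f x))\<^sup>2)" by simp
  qed measurable
  let ?m = "measure M (space M)" and ?I = "\<integral>x. norm (f x) \<partial>M"
  have sq2: "0 \<le> c\<^sup>2 * (L2_norm M f)\<^sup>2 - 2 * c * ?I + ?m" for c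
  proof -
    have "0 \<le> (\<integral>x. (c * norm (f x) - 1)\<^sup>2 \<partial>M)" by simp
    also have "\<dots> = (\<integral>x. c\<^sup>2 * (norm (f x))\<^sup>2 - 2 * c * norm (f x) + 1 \<partial>M)"
      by (intro Bochner_Integration.integral_cong) (auto simp: power2_eq_square algebra_simps)
    also have "\<dots> = c\<^sup>2 * (L2_norm M f)\<^sup>2 - 2 * c * ?I + ?m"
      using sq int by (simp add: L2_norm_square)
    finally show ?thesis .
  qed
  have "?I\<^sup>2 \<le> ?m * (L2_norm M f)\<^sup>2"
  proof (cases "L2_norm M f = 0")
    case True
    have "?I = 0"
    proof (rule ccontr)
      assume "?I \<noteq> 0"
      \<comment> \<open>With vanishing quadratic coefficient this choice of \<open>c\<close> gives
        the polynomial the value -1.\<close>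
      then show False
        using sq2[of "(?m + 1) / (2 * ?I)"] True by (simp add: field_simps)
    qed
    then show ?thesis by simp
  next
    case False
    define N where "N = (L2_norm M f)\<^sup>2"
    have p: "N > 0" using False by (simp add: N_def)
    \<comment> \<open>The quadratic is evaluated at its minimiser \<open>?I / N\<close>.\<close>
    have "0 \<le> (?I / N)\<^sup>2 * N - 2 * (?I / N) * ?I + ?m"
      using sq2[of "?I / N"] by (simp only: N_def)
    also have "\<dots> = ?m - ?I\<^sup>2 / N"
      using p by (simp add: power2_eq_square)
    finally show ?thesis
      using p by (simp add: N_def[symmetric] field_simps)
  qed
  then have "?I \<le> sqrt (?m * (L2_norm M f)\<^sup>2)" by (rule real_le_rsqrt)
  then show "?I \<le> sqrt ?m * L2_norm M f"
    by (simp add: real_sqrt_mult L2_norm_nonneg)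
qed

section \<open>Weak gradients and \<open>H1\<close>\<close>

lemma has_weak_grad_unique:
  assumes "open D" "has_weak_grad D f G" "has_weak_grad D f H"
  shows "AE x in lebesgue_on D. G x = H x"
proof -
  have "AE x in lebesgue_on D. G x \<bullet> e = H x \<bullet> e" if "e \<in> Basis" for e
    by (rule weak_partial_unique[OF assms(1), of e f]) (use assms that in \<open>auto simp: has_weak_grad_def\<close>)
  then have "AE x in lebesgue_on D. \<forall>e\<in>Basis. G x \<bullet> e = H x \<bullet> e"
    by (subst AE_ball_countable) (simp_all add: countable_finite)
  then show ?thesis by eventually_elim (auto intro: euclidean_eqI)
qed

lemma weak_grad_works: "f \<in> H1 D \<Longrightarrow> has_weak_grad D f (weak_grad D f)"
  unfolding H1_def weak_grad_def by (auto intro: someI[of "has_weak_grad D f"])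

text \<open>\<open>weak_grad\<close> is an arbitrary choice among the weak gradients, so its
  identification with a concrete one can only hold almost everywhere.\<close>

lemma weak_grad_eq:
  assumes "open D" "has_weak_grad D f G"
  shows "AE x in lebesgue_on D. weak_grad D f x = G x"
proof -
  have "has_weak_grad D f (weak_grad D f)"
    using assms(2) unfolding weak_grad_def by (rule someI[of "has_weak_grad D f"])
  then show ?thesis by (rule has_weak_grad_unique[OF assms(1) _ assms(2)])
qed

lemma weak_grad_L2: "f \<in> H1 D \<Longrightarrow> weak_grad D f \<in> L2 (lebesgue_on D)"
  using weak_grad_works has_weak_grad_def by blast

lemma has_weak_grad_combination:
  assumes "open D" "has_weak_grad D f F" "has_weak_grad D g G"
  shows "has_weak_grad D (\<lambda>x. c * f x + d * g x) (\<lambda>x. c *\<^sub>R F x + d *\<^sub>R G x)"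
  using assms weak_partial_combination[OF assms(1)] unfolding has_weak_grad_def
  by (auto simp: L2_combination inner_add_left)

lemma H1_imp_L2: "f \<in> H1 D \<Longrightarrow> f \<in> L2 (lebesgue_on D)"
  by (simp add: H1_def)

lemma L2_measurable: "f \<in> L2 M \<Longrightarrow> f \<in> borel_measurable M"
  by (simp add: L2_def)

lemma H1_combination:
  assumes "open D" "f \<in> H1 D" "g \<in> H1 D"
  shows "(\<lambda>x. c * f x + d * g x) \<in> H1 D"
  using L2_combination[of f "lebesgue_on D" g c d] assms(2,3)
    has_weak_grad_combination[OF assms(1) weak_grad_works[OF assms(2)] weak_grad_works[OF assms(3)]]
  unfolding H1_def by auto

lemma weak_grad_combination:
  assumes "open D" "f \<in> H1 D" "g \<in> H1 D"
  shows "AE x in lebesgue_on D. weak_grad D (\<lambda>x. c * f x + d * g x) x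
    = c *\<^sub>R weak_grad D f x + d *\<^sub>R weak_grad D g x"
  using assms by (intro weak_grad_eq has_weak_grad_combination weak_grad_works)

lemma H1_diff: "open D \<Longrightarrow> f \<in> H1 D \<Longrightarrow> g \<in> H1 D \<Longrightarrow> (\<lambda>x. f x - g x) \<in> H1 D"
  using H1_combination[of D f g 1 "-1"] by simp

lemma H1_cmult: "open D \<Longrightarrow> f \<in> H1 D \<Longrightarrow> (\<lambda>x. c * f x) \<in> H1 D"
  using H1_combination[of D f f c 0] by simp

lemma weak_grad_diff:
  "open D \<Longrightarrow> f \<in> H1 D \<Longrightarrow> g \<in> H1 D \<Longrightarrow>
    AE x in lebesgue_on D. weak_grad D (\<lambda>x. f x - g x) x = weak_grad D f x - weak_grad D g x"
  using weak_grad_combination[of D f g 1 "-1"] by simp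

lemma weak_grad_cmult:
  "open D \<Longrightarrow> f \<in> H1 D \<Longrightarrow> AE x in lebesgue_on D. weak_grad D (\<lambda>x. c * f x) x = c *\<^sub>R weak_grad D f x"
  using weak_grad_combination[of D f f c 0] by simp

section \<open>Independence of the representative\<close>

lemma borel_measurable_lebesgue_on_borel:
  "f \<in> borel_measurable borel \<Longrightarrow> f \<in> borel_measurable (lebesgue_on D)"
  by (intro measurable_restrict_space1 measurable_completion) simp

lemma locally_integrable_cong_AE:
  fixes f g :: "'a::euclidean_space \<Rightarrow> real"
  assumes D: "open D" and eq: "AE x in lebesgue_on D. f x = g x"
    and f: "f \<in> borel_measurable (lebesgue_on D)" and g: "g \<in> borel_measurable (lebesgue_on D)"
  shows "locally_integrable D f \<longleftrightarrow> locally_integrable D g"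
proof -
  have "integrable (lebesgue_on K) f \<longleftrightarrow> integrable (lebesgue_on K) g" if K: "compact K" "K \<subseteq> D" for K
  proof (rule integrable_cong_AE)
    show "f \<in> borel_measurable (lebesgue_on K)" "g \<in> borel_measurable (lebesgue_on K)"
      using measurable_restrict_mono[OF f K(2)] measurable_restrict_mono[OF g K(2)] .
    have "AE x in lebesgue. x \<in> D \<longrightarrow> f x = g x"
      using eq D by (simp add: AE_lebesgue_on)
    then have "AE x in lebesgue. x \<in> K \<longrightarrow> f x = g x"
      by eventually_elim (use K in auto)
    then show "AE x in lebesgue_on K. f x = g x"
      using K by (simp add: AE_lebesgue_on compact_imp_closed)
  qed
  then show ?thesis unfolding locally_integrable_def by blast
qed

text \<open>Formulated as an equality of predicates: the choice operator behind
  \<open>weak_grad\<close> then returns the very same function for both representatives.\<close>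

lemma has_weak_grad_cong_AE:
  assumes D: "open D" and eq: "AE x in lebesgue_on D. f x = g x"
    and f: "f \<in> borel_measurable (lebesgue_on D)" and g: "g \<in> borel_measurable (lebesgue_on D)"
  shows "has_weak_grad D f = has_weak_grad D g"
proof -
  have "(\<integral>x. frechet_derivative \<phi> (at x) e *\<^sub>R f x \<partial>lebesgue_on D)
      = (\<integral>x. frechet_derivative \<phi> (at x) e *\<^sub>R g x \<partial>lebesgue_on D)" if "\<phi> \<in> test_functions D" for \<phi> e
  proof (rule integral_cong_AE)
    have [measurable]: "(\<lambda>x. frechet_derivative \<phi> (at x) e) \<in> borel_measurable (lebesgue_on D)"
      using smooth_frechet_derivative[OF test_function_smooth[OF that]]
      by (intro borel_measurable_lebesgue_on_borel) (rule smooth_borel_measurable)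
    show "(\<lambda>x. frechet_derivative \<phi> (at x) e *\<^sub>R f x) \<in> borel_measurable (lebesgue_on D)"
      "(\<lambda>x. frechet_derivative \<phi> (at x) e *\<^sub>R g x) \<in> borel_measurable (lebesgue_on D)"
      using f g by measurable
    show "AE x in lebesgue_on D. frechet_derivative \<phi> (at x) e *\<^sub>R f x = frechet_derivative \<phi> (at x) e *\<^sub>R g x"
      using eq by eventually_elim simp
  qed
  then have "weak_partial D e f h \<longleftrightarrow> weak_partial D e g h" for e h
    unfolding weak_partial_def using locally_integrable_cong_AE[OF assms] by auto
  then show ?thesis
    unfolding has_weak_grad_def[abs_def] by simp
qed

lemma weak_grad_cong_AE:
  assumes "open D" "AE x in lebesgue_on D. f x = g x"
    "f \<in> borel_measurable (lebesgue_on D)" "g \<in> borel_measurable (lebesgue_on D)"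
  shows "weak_grad D f = weak_grad D g"
  using has_weak_grad_cong_AE[OF assms] by (simp add: weak_grad_def[abs_def])

lemma H1_norm_nonneg: "H1_norm D f \<ge> 0"
  by (simp add: H1_norm_def)

lemma L2_norm_le_H1_norm: "L2_norm (lebesgue_on D) f \<le> H1_norm D f"
  and L2_norm_weak_grad_le_H1_norm: "L2_norm (lebesgue_on D) (weak_grad D f) \<le> H1_norm D f"
  by (simp_all add: H1_norm_def real_le_rsqrt)

lemma L2_norm_cmult: "L2_norm M (\<lambda>x. c *\<^sub>R f x) = \<bar>c\<bar> * L2_norm M f"
  by (simp add: L2_norm_def power_mult_distrib real_sqrt_mult)

lemma H1_norm_cmult:
  assumes "open D" "f \<in> H1 D"
  shows "H1_norm D (\<lambda>x. c * f x) = \<bar>c\<bar> * H1_norm D f"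
proof -
  have "weak_grad D (\<lambda>x. c * f x) \<in> borel_measurable (lebesgue_on D)"
    "weak_grad D f \<in> borel_measurable (lebesgue_on D)"
    using assms by (auto intro!: L2_measurable weak_grad_L2 H1_cmult)
  then have "L2_norm (lebesgue_on D) (weak_grad D (\<lambda>x. c * f x)) = L2_norm (lebesgue_on D) (\<lambda>x. c *\<^sub>R weak_grad D f x)"
    using weak_grad_cmult[OF assms] by (intro L2_cong_AE(2)) auto
  then show ?thesis
    using L2_norm_cmult[of "lebesgue_on D" c f]
    by (simp add: H1_norm_def L2_norm_cmult power_mult_distrib real_sqrt_mult flip: distrib_left)
qed

lemma weak_grad_0: "open D \<Longrightarrow> AE x in lebesgue_on D. weak_grad D (\<lambda>x. 0) x = 0"
  by (rule weak_grad_eq)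
    (auto simp: has_weak_grad_def L2_def weak_partial_def locally_integrable_def)

lemma H1_norm_0:
  assumes "open D" shows "H1_norm D (\<lambda>x. 0) = 0"
proof -
  have "(\<integral>x. (norm (weak_grad D (\<lambda>x. 0) x))\<^sup>2 \<partial>lebesgue_on D) = 0"
    by (rule integral_eq_zero_AE) (use weak_grad_0[OF assms] in eventually_elim, simp)
  then show ?thesis by (simp add: H1_norm_def L2_norm_def)
qed

subsection \<open>Classical gradients\<close>

definition gradient :: "('a::euclidean_space \<Rightarrow> real) \<Rightarrow> 'a \<Rightarrow> 'a" where
  "gradient f x = (\<Sum>e\<in>Basis. frechet_derivative f (at x) e *\<^sub>R e)"

lemma gradient_inner_Basis: "e \<in> Basis \<Longrightarrow> gradient f x \<bullet> e = frechet_derivative f (at x) e"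
  by (simp add: gradient_def)

lemma gradient_inner:
  assumes "f differentiable (at x)"
  shows "gradient f x \<bullet> v = frechet_derivative f (at x) v"
proof -
  have "linear (frechet_derivative f (at x))"
    using assms frechet_derivative_works has_derivative_linear by blast
  then have "frechet_derivative f (at x) (\<Sum>e\<in>Basis. (v \<bullet> e) *\<^sub>R e) = (\<Sum>e\<in>Basis. (v \<bullet> e) * frechet_derivative f (at x) e)"
    by (simp add: linear_sum linear_scale)
  then show ?thesis
    unfolding euclidean_representation
    by (simp add: gradient_def inner_sum_left inner_commute[of v] mult.commute)
qed

lemma continuous_gradient: "smooth f \<Longrightarrow> continuous_on S (gradient f)"
  unfolding gradient_def[abs_def]
  by (intro continuous_intros smooth_continuous_on smooth_frechet_derivative)

lemma borel_measurable_gradient: "smooth f \<Longrightarrow> gradient f \<in> borel_measurable borel"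
  by (intro borel_measurable_continuous_onI continuous_gradient)

lemma finite_measure_lebesgue_on_bounded:
  fixes D :: "'a::euclidean_space set"
  assumes "open D" "bounded D"
  shows "finite_measure (lebesgue_on D)"
  using assms by (intro finite_measure_lebesgue_on lmeasurable_open)

lemma continuous_on_imp_bounded_on:
  fixes f :: "'a::euclidean_space \<Rightarrow> 'b::real_normed_vector"
  assumes "continuous_on UNIV f" "bounded D"
  obtains M where "M \<ge> 0" "\<And>x. x \<in> D \<Longrightarrow> norm (f x) \<le> M"
proof -
  have "compact (f ` closure D)"
    using assms by (intro compact_continuous_image) (auto intro: continuous_on_subset)
  then obtain M where M: "\<And>x. x \<in> closure D \<Longrightarrow> norm (f x) \<le> M"
    using compact_imp_bounded bounded_iff by (metis image_eqI)
  show ?thesis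
    by (rule that[of "max M 0"]) (use M closure_subset[of D] in \<open>auto simp: le_max_iff_disj\<close>)
qed

lemma integrable_bounded_finite_measure:
  fixes f :: "'a \<Rightarrow> 'b::{banach, second_countable_topology}"
  assumes "finite_measure M" "f \<in> borel_measurable M" "\<And>x. x \<in> space M \<Longrightarrow> norm (f x) \<le> C"
  shows "integrable M f"
  using assms by (intro finite_measure.integrable_const_bound) (auto intro!: AE_I2)

lemma continuous_L2:
  fixes f :: "'a::euclidean_space \<Rightarrow> 'b::euclidean_space"
  assumes "continuous_on UNIV f" "open D" "bounded D"
  shows "f \<in> L2 (lebesgue_on D)"
proof -
  obtain M where M: "M \<ge> 0" "\<And>x. x \<in> D \<Longrightarrow> norm (f x) \<le> M"
    using continuous_on_imp_bounded_on assms by metis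
  have [measurable]: "f \<in> borel_measurable (lebesgue_on D)"
    using assms by (intro borel_measurable_lebesgue_on_borel borel_measurable_continuous_onI)
  have "integrable (lebesgue_on D) (\<lambda>x. (norm (f x))\<^sup>2)"
    by (rule integrable_bounded_finite_measure[where C = "M\<^sup>2"])
      (use M assms finite_measure_lebesgue_on_bounded in \<open>auto intro!: power_mono\<close>)
  then show ?thesis by (simp add: L2_def)
qed

lemma locally_integrable_continuous:
  fixes f :: "'a::euclidean_space \<Rightarrow> real"
  assumes "continuous_on UNIV f"
  shows "locally_integrable D f"
  unfolding locally_integrable_def
proof (intro allI impI)
  fix K assume K: "compact K \<and> K \<subseteq> D"
  obtain M where M: "M \<ge> 0" "\<And>x. x \<in> K \<Longrightarrow> norm (f x) \<le> M"
    using continuous_on_imp_bounded_on assms K compact_imp_bounded by metis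
  have "finite_measure (lebesgue_on K)"
    using K by (intro finite_measure_lebesgue_on lmeasurable_compact) auto
  then show "integrable (lebesgue_on K) f"
    by (rule integrable_bounded_finite_measure[where C = M])
      (use M assms in \<open>auto intro!: borel_measurable_lebesgue_on_borel borel_measurable_continuous_onI\<close>)
qed

lemma frechet_derivative_mult:
  fixes f g :: "'a::real_normed_vector \<Rightarrow> real"
  assumes "f differentiable (at x)" "g differentiable (at x)"
  shows "frechet_derivative (\<lambda>x. f x * g x) (at x) v
    = f x * frechet_derivative g (at x) v + frechet_derivative f (at x) v * g x"
  using assms by (intro frechet_derivative_eqI has_derivative_mult) (auto dest: frechet_derivative_works[THEN iffD1])

text \<open>The product of \<open>f\<close> with a test function has compact support, so its
  derivative integrates to 0 over the whole space; the product rule does the rest.\<close>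

lemma smooth_weak_partial:
  fixes f :: "'a::euclidean_space \<Rightarrow> real"
  assumes f: "smooth f" and D: "open D"
  shows "weak_partial D e f (\<lambda>x. frechet_derivative f (at x) e)"
  unfolding weak_partial_def
proof (intro conjI ballI)
  show lf: "locally_integrable D f" and lf': "locally_integrable D (\<lambda>x. frechet_derivative f (at x) e)"
    using f by (auto intro!: locally_integrable_continuous smooth_continuous_on smooth_frechet_derivative)
  fix \<phi> assume \<phi>: "\<phi> \<in> test_functions D"
  obtain K where K: "compact K" "K \<subseteq> D" "\<And>x. x \<notin> K \<Longrightarrow> \<phi> x = 0"
    using \<phi> test_functionE by metis
  note s = test_function_smooth[OF \<phi>]
  have p: "smooth (\<lambda>x. \<phi> x * f x)" by (intro smooth_mult s f)
  have K0: "\<phi> x * f x = 0" if "x \<notin> K" for x using K that by simp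
  have "(\<integral>x. indicator UNIV x * frechet_derivative (\<lambda>x. \<phi> x * f x) (at x) e \<partial>lborel) = 0"
    by (rule integral_derivative_invariant_set[where S = K])
      (use K p K0 in \<open>auto intro: smooth_differentiable smooth_continuous_on smooth_frechet_derivative compact_imp_bounded\<close>)
  moreover have "indicator UNIV x * frechet_derivative (\<lambda>x. \<phi> x * f x) (at x) e
      = indicator D x * frechet_derivative (\<lambda>x. \<phi> x * f x) (at x) e" for x
  proof (cases "x \<in> K")
    case False
    then have "frechet_derivative (\<lambda>x. \<phi> x * f x) (at x) e = 0"
      by (intro frechet_derivative_outside_support[of K]) (use K K0 in \<open>auto simp: compact_imp_closed\<close>)
    then show ?thesis by simp
  qed (use K in auto)
  ultimately have "(\<integral>x. indicator D x * frechet_derivative (\<lambda>x. \<phi> x * f x) (at x) e \<partial>lborel) = 0"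
    by (simp only:)
  then have "(\<integral>x. frechet_derivative (\<lambda>x. \<phi> x * f x) (at x) e \<partial>lebesgue_on D) = 0"
    using D by (subst integral_lebesgue_on_borel) (auto intro!: smooth_borel_measurable smooth_frechet_derivative p)
  moreover have "frechet_derivative (\<lambda>x. \<phi> x * f x) (at x) e
      = \<phi> x * frechet_derivative f (at x) e + frechet_derivative \<phi> (at x) e * f x" for x
    by (intro frechet_derivative_mult smooth_differentiable s f)
  ultimately have "(\<integral>x. \<phi> x * frechet_derivative f (at x) e + frechet_derivative \<phi> (at x) e * f x \<partial>lebesgue_on D) = 0"
    by simp
  then show "(\<integral>x. frechet_derivative \<phi> (at x) e *\<^sub>R f x \<partial>lebesgue_on D)
      = - (\<integral>x. \<phi> x *\<^sub>R frechet_derivative f (at x) e \<partial>lebesgue_on D)"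
    using integrable_test_function_mult[OF D \<phi> lf'] integrable_test_function_mult[OF D test_function_frechet_derivative[OF \<phi>] lf]
    by simp
qed

lemma smooth_has_weak_grad:
  assumes "smooth f" "open D" "bounded D"
  shows "has_weak_grad D f (gradient f)"
  unfolding has_weak_grad_def
  using assms smooth_weak_partial[OF assms(1,2)]
  by (auto simp: gradient_inner_Basis intro: continuous_L2 continuous_gradient)

lemma smooth_H1:
  assumes "smooth f" "open D" "bounded D"
  shows "f \<in> H1 D"
  using smooth_has_weak_grad[OF assms] continuous_L2[OF _ assms(2,3), of f] assms(1)
  unfolding H1_def by (auto intro: smooth_continuous_on)

lemma smooth_weak_grad:
  "smooth f \<Longrightarrow> open D \<Longrightarrow> bounded D \<Longrightarrow> AE x in lebesgue_on D. weak_grad D f x = gradient f x"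
  by (intro weak_grad_eq smooth_has_weak_grad)

section \<open>\<open>H1\<close> convergence as L1 convergence of functions and gradients\<close>

lemma L2_norm_tendsto_0_imp_L1:
  fixes f :: "nat \<Rightarrow> 'a \<Rightarrow> 'b::euclidean_space"
  assumes "finite_measure M" "\<And>k. f k \<in> L2 M" "(\<lambda>k. L2_norm M (f k)) \<longlonglongrightarrow> 0"
  shows "(\<lambda>k. \<integral>x. norm (f k x) \<partial>M) \<longlonglongrightarrow> 0"
proof (rule tendsto_sandwich[OF _ _ tendsto_const])
  show "(\<lambda>k. sqrt (measure M (space M)) * L2_norm M (f k)) \<longlonglongrightarrow> 0"
    using tendsto_mult[OF tendsto_const assms(3)] by simp
  show "\<forall>\<^sub>F k in sequentially. (\<integral>x. norm (f k x) \<partial>M) \<le> sqrt (measure M (space M)) * L2_norm M (f k)"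
    using L2_imp_L1(2)[OF assms(1,2)] by simp
qed simp

lemma H1_convergence:
  fixes D :: "'a::euclidean_space set"
  assumes D: "open D" "bounded D" and f: "\<And>k. f k \<in> H1 D" "g \<in> H1 D"
    and lim: "(\<lambda>k. H1_norm D (\<lambda>x. f k x - g x)) \<longlonglongrightarrow> 0"
  shows "(\<lambda>k. \<integral>x. norm (f k x - g x) \<partial>lebesgue_on D) \<longlonglongrightarrow> 0" (is ?L)
    and "(\<lambda>k. \<integral>x. norm (weak_grad D (f k) x - weak_grad D g x) \<partial>lebesgue_on D) \<longlonglongrightarrow> 0" (is ?G)
proof -
  have H: "(\<lambda>x. f k x - g x) \<in> H1 D" for k
    using D f by (simp add: H1_diff)
  note fin = finite_measure_lebesgue_on_bounded[OF D]
  have "(\<lambda>k. L2_norm (lebesgue_on D) (\<lambda>x. f k x - g x)) \<longlonglongrightarrow> 0"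
    by (rule tendsto_sandwich[OF _ _ tendsto_const lim]) (auto simp: L2_norm_nonneg L2_norm_le_H1_norm)
  then show ?L
    by (intro L2_norm_tendsto_0_imp_L1 fin H1_imp_L2 H)
  have "(\<lambda>k. L2_norm (lebesgue_on D) (weak_grad D (\<lambda>x. f k x - g x))) \<longlonglongrightarrow> 0"
    by (rule tendsto_sandwich[OF _ _ tendsto_const lim]) (auto simp: L2_norm_nonneg L2_norm_weak_grad_le_H1_norm)
  then have *: "(\<lambda>k. \<integral>x. norm (weak_grad D (\<lambda>x. f k x - g x) x) \<partial>lebesgue_on D) \<longlonglongrightarrow> 0"
    by (intro L2_norm_tendsto_0_imp_L1 fin weak_grad_L2 H)
  have [measurable]: "weak_grad D h \<in> borel_measurable (lebesgue_on D)" if "h \<in> H1 D" for h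
    using that by (intro L2_measurable weak_grad_L2)
  have "(\<integral>x. norm (weak_grad D (\<lambda>x. f k x - g x) x) \<partial>lebesgue_on D)
      = (\<integral>x. norm (weak_grad D (f k) x - weak_grad D g x) \<partial>lebesgue_on D)" for k
  proof (rule integral_cong_AE)
    show "AE x in lebesgue_on D. norm (weak_grad D (\<lambda>x. f k x - g x) x) = norm (weak_grad D (f k) x - weak_grad D g x)"
      using weak_grad_diff[OF D(1) f(1)[of k] f(2)] by eventually_elim simp
  qed (use f H in measurable)
  then show ?G using * by simp
qed

section \<open>The surface measure on a flat part of the boundary\<close>

text \<open>A set of diameter d has its slab preimage inside a box with side 1 along
  \<open>e\<close> and sides 2d in the other N - 1 directions, and (2d)^(N-1) is a fixed multiple of
  the Hausdorff weight of the set. Summing over a cover gives the bound. This one-sided comparison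
  is enough to carry L1 convergence from the surface to the slab.\<close>

lemma slab_measure_le_hausdorff_outer:
  fixes e :: "'a::euclidean_space"
  assumes e: "e \<in> Basis" and dim: "DIM('a) \<ge> 2"
  obtains C where "C \<ge> 0"
    "\<And>A :: 'a set. emeasure lborel {x. c \<le> x \<bullet> e \<and> x \<bullet> e < c + 1 \<and> flat_proj c e x \<in> A}
      \<le> ennreal C * hausdorff_outer (real DIM('a) - 1) A"
proof
  let ?s = "real DIM('a) - 1" and ?n = "DIM('a) - 1"
  \<comment> \<open>Comes from (2d)^n = 4^n (d/2)^n, compared with the weight
    \<open>unit_ball_vol ?s\<close> times (d/2)^n.\<close>
  define C where "C = 4 ^ ?n / unit_ball_vol ?s"
  have s: "?s = real ?n" "?n > 0" using dim by auto
  have ub: "unit_ball_vol ?s > 0" using s by simp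
  then show C: "C \<ge> 0" by (simp add: C_def)
  have C0: "C > 0" using ub by (simp add: C_def)
  fix A :: "'a set"
  define S where "S = (\<lambda>A. {x. c \<le> x \<bullet> e \<and> x \<bullet> e < c + 1 \<and> flat_proj c e x \<in> A})"
  have piece: "\<exists>B\<in>sets lborel. S E \<subseteq> B \<and>
      emeasure lborel B \<le> ennreal C * ennreal (unit_ball_vol ?s * (diameter E / 2) powr ?s)"
    if E: "bounded E" for E
  proof (cases "E = {}")
    case True
    then show ?thesis by (intro bexI[of _ "{}"]) (auto simp: S_def)
  next
    case False
    then obtain p where p: "p \<in> E" by blast
    define d where "d = diameter E"
    have d: "d \<ge> 0" using E by (simp add: d_def diameter_ge_0)
    let ?l = "\<Sum>j\<in>Basis. (if j = e then c else p \<bullet> j - d) *\<^sub>R j"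
    let ?u = "\<Sum>j\<in>Basis. (if j = e then c + 1 else p \<bullet> j + d) *\<^sub>R j"
    have "S E \<subseteq> cbox ?l ?u"
    proof
      fix x assume x: "x \<in> S E"
      have "\<bar>x \<bullet> j - p \<bullet> j\<bar> \<le> d" if j: "j \<in> Basis" "j \<noteq> e" for j
      proof -
        have "\<bar>(flat_proj c e x - p) \<bullet> j\<bar> \<le> norm (flat_proj c e x - p)"
          using j by (intro Basis_le_norm)
        also have "\<dots> \<le> d"
          using diameter_bounded_bound[OF E, of "flat_proj c e x" p] x p by (simp add: S_def d_def dist_norm)
        finally show ?thesis using flat_proj_inner[OF e j(1), of c x] j by (simp add: inner_diff_left)
      qed
      then show "x \<in> cbox ?l ?u"
        using x by (fastforce simp: mem_box S_def abs_le_iff)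
    qed
    moreover have "emeasure lborel (cbox ?l ?u) \<le> ennreal C * ennreal (unit_ball_vol ?s * (d / 2) powr ?s)"
    proof -
      have "emeasure lborel (cbox ?l ?u) = (\<Prod>j\<in>Basis. (?u - ?l) \<bullet> j)"
        using d by (subst emeasure_lborel_cbox) (auto simp: inner_diff_left)
      also have "(\<Prod>j\<in>Basis. (?u - ?l) \<bullet> j) = (\<Prod>j\<in>Basis. if j = e then 1 else 2 * d)"
        by (intro prod.cong) (auto simp: inner_diff_left)
      also have "\<dots> = (\<Prod>j\<in>Basis - {e}. 2 * d)"
        using e by (subst prod.remove[OF finite_Basis e]) (auto intro!: prod.cong)
      also have "\<dots> = (2 * d) ^ ?n"
        using e by (simp add: card_Diff_singleton)
      also have "(2 * d) ^ ?n = C * (unit_ball_vol ?s * (d / 2) powr ?s)"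
      \<comment> \<open>For d = 0 both sides vanish, since N - 1 > 0 and 0 to a real power is
        0.\<close>
      proof (cases "d = 0")
        case True
        then show ?thesis using s by simp
      next
        case False
        then have "(d / 2) powr ?s = (d / 2) ^ ?n"
          using d unfolding s(1) by (intro powr_realpow) simp
        moreover have "(2 * d) ^ ?n = 4 ^ ?n * (d / 2) ^ ?n"
          unfolding power_mult_distrib[symmetric] by simp
        moreover have "unit_ball_vol ?s \<noteq> 0" using ub by linarith
        ultimately show ?thesis by (simp add: C_def)
      qed
      finally show ?thesis using C by (simp add: ennreal_mult')
    qed
    ultimately show ?thesis
      by (intro bexI[of _ "cbox ?l ?u"]) (auto simp: d_def)
  qed
  have cover: "ennreal (inverse C) * emeasure lborel (S A)
      \<le> (\<Sum>i. ennreal (unit_ball_vol ?s * (diameter (E i) / 2) powr ?s))"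
    if E: "A \<subseteq> (\<Union>i. E i)" "\<And>i. bounded (E i)" for E :: "nat \<Rightarrow> 'a set"
  proof -
    obtain B where B: "\<And>i. B i \<in> sets lborel" "\<And>i. S (E i) \<subseteq> B i"
      "\<And>i. emeasure lborel (B i) \<le> ennreal C * ennreal (unit_ball_vol ?s * (diameter (E i) / 2) powr ?s)"
      using piece[OF E(2)] by metis
    have "S A \<subseteq> (\<Union>i. B i)"
      using E(1) B(2) unfolding S_def by blast
    then have "emeasure lborel (S A) \<le> emeasure lborel (\<Union>i. B i)"
      using B(1) by (intro emeasure_mono) auto
    also have "\<dots> \<le> (\<Sum>i. emeasure lborel (B i))"
      using B(1) by (intro emeasure_subadditive_countably) auto
    also have "\<dots> \<le> (\<Sum>i. ennreal C * ennreal (unit_ball_vol ?s * (diameter (E i) / 2) powr ?s))"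
      using B(3) by (intro suminf_le) auto
    also have "\<dots> = ennreal C * (\<Sum>i. ennreal (unit_ball_vol ?s * (diameter (E i) / 2) powr ?s))"
      by simp
    finally have "ennreal (inverse C) * emeasure lborel (S A)
        \<le> ennreal (inverse C) * (ennreal C * (\<Sum>i. ennreal (unit_ball_vol ?s * (diameter (E i) / 2) powr ?s)))"
      by (rule mult_left_mono) simp
    also have "\<dots> = (\<Sum>i. ennreal (unit_ball_vol ?s * (diameter (E i) / 2) powr ?s))"
      using C0 by (simp add: mult.assoc[symmetric] ennreal_mult'[symmetric])
    finally show ?thesis .
  qed
  \<comment> \<open>The estimate for covers does not depend on their mesh, so the premeasure at mesh
    1 can be taken.\<close>
  have "ennreal (inverse C) * emeasure lborel (S A) \<le> hausdorff_premeasure ?s 1 A"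
    unfolding hausdorff_premeasure_def by (intro INF_greatest cover) auto
  also have "\<dots> \<le> hausdorff_outer ?s A"
    unfolding hausdorff_outer_def by (rule SUP_upper) auto
  finally have "ennreal C * (ennreal (inverse C) * emeasure lborel (S A)) \<le> ennreal C * hausdorff_outer ?s A"
    by (rule mult_left_mono) simp
  then show "emeasure lborel {x. c \<le> x \<bullet> e \<and> x \<bullet> e < c + 1 \<and> flat_proj c e x \<in> A}
      \<le> ennreal C * hausdorff_outer ?s A"
    using C0 by (simp add: mult.assoc[symmetric] ennreal_mult'[symmetric] S_def)
qed

section \<open>The Hausdorff measure as a measure on the Borel sets\<close>

lemma sets_hausdorff_measure [measurable_cong, simp]: "sets (hausdorff_measure s) = sets borel"
  and space_hausdorff_measure [simp]: "space (hausdorff_measure s) = UNIV"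
  using sets.sigma_sets_eq[of borel] by (simp_all add: hausdorff_measure_def space_measure_of_conv)

text \<open>If the outer measure were not countably additive on the Borel sets, \<^const>\<open>measure_of\<close> would
  yield the zero measure.\<close>

lemma emeasure_hausdorff_measure:
  fixes \<Omega> :: "'a::euclidean_space set"
  assumes ne: "emeasure (surface_measure \<Omega>) X \<noteq> 0" and A: "A \<in> sets borel"
  shows "emeasure (hausdorff_measure (real DIM('a) - 1) :: 'a measure) A = hausdorff_outer (real DIM('a) - 1) A"
proof -
  let ?H = "hausdorff_measure (real DIM('a) - 1) :: 'a measure"
  let ?R = "restrict_space ?H (frontier \<Omega>)"
  have fr: "frontier \<Omega> \<in> sets ?H"
    using frontier_closed by simp
  \<comment> \<open>A set outside the \<sigma>-algebra would have measure 0.\<close>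
  have X: "X \<in> sets (completion ?R)"
    using ne emeasure_notin_sets unfolding surface_measure_def by blast
  then have "emeasure ?R (main_part ?R X) \<noteq> 0" "main_part ?R X \<in> sets ?R"
    using ne unfolding surface_measure_def by simp_all
  then have "emeasure ?H (main_part ?R X) \<noteq> 0"
    using fr by (simp add: emeasure_restrict_space sets_restrict_space_iff)
  then have "measure_space UNIV (sigma_sets UNIV (sets borel)) (hausdorff_outer (real DIM('a) - 1) :: 'a set \<Rightarrow> ennreal)"
    unfolding hausdorff_measure_def emeasure_measure_of_conv by (auto split: if_splits)
  then show ?thesis
    using A unfolding hausdorff_measure_def emeasure_measure_of_conv by auto
qed

text \<open>The image of Lebesgue measure on the slab under the projection is dominated, as a
  measure, by a multiple of the Hausdorff measure, so nonnegative integrals compare. The vanishing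
  condition on \<open>F\<close> confines the comparison to the part of the hyperplane that belongs
  to the boundary.\<close>

lemma slab_integral_le_surface_integral:
  fixes \<Omega> :: "'a::euclidean_space set" and e :: 'a
  assumes e: "e \<in> Basis" and dim: "DIM('a) \<ge> 2" and ne: "emeasure (surface_measure \<Omega>) X \<noteq> 0"
  obtains C where "C \<ge> 0"
    "\<And>F :: 'a \<Rightarrow> real. F \<in> borel_measurable borel \<Longrightarrow> (\<And>x. x \<bullet> e = c \<Longrightarrow> x \<notin> frontier \<Omega> \<Longrightarrow> F x = 0) \<Longrightarrow>
      integrable (surface_measure \<Omega>) F \<Longrightarrow>
      (\<integral>x. indicator {x. c \<le> x \<bullet> e \<and> x \<bullet> e < c + 1} x * \<bar>F (flat_proj c e x)\<bar> \<partial>lborel)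
        \<le> C * (\<integral>x. \<bar>F x\<bar> \<partial>surface_measure \<Omega>)"
proof -
  let ?H = "hausdorff_measure (real DIM('a) - 1) :: 'a measure"
  let ?slab = "{x. c \<le> x \<bullet> e \<and> x \<bullet> e < c + 1}"
  have [measurable]: "?slab \<in> sets borel" by measurable
  obtain C where C: "C \<ge> 0" "\<And>A :: 'a set. emeasure lborel {x. c \<le> x \<bullet> e \<and> x \<bullet> e < c + 1 \<and> flat_proj c e x \<in> A}
      \<le> ennreal C * hausdorff_outer (real DIM('a) - 1) A"
    using slab_measure_le_hausdorff_outer[OF e dim, of c] by blast
  show ?thesis
  proof (rule that[OF C(1)])
    fix F :: "'a \<Rightarrow> real"
    assume F [measurable]: "F \<in> borel_measurable borel" and F0: "\<And>x. x \<bullet> e = c \<Longrightarrow> x \<notin> frontier \<Omega> \<Longrightarrow> F x = 0"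
      and int: "integrable (surface_measure \<Omega>) F"
    define M where "M = distr (density lborel (indicator ?slab)) borel (flat_proj c e)"
    have "M \<le> scale_measure (ennreal C) ?H"
    proof (subst le_measure)
      show sM: "sets M = sets (scale_measure (ennreal C) ?H)" by (simp add: M_def)
      show "\<forall>A\<in>sets M. emeasure M A \<le> emeasure (scale_measure (ennreal C) ?H) A"
      proof
        fix A assume "A \<in> sets M"
        then have A: "A \<in> sets borel" by (simp add: M_def)
        then have m: "flat_proj c e -` A \<in> sets borel"
          using measurable_sets[OF borel_measurable_flat_proj A] by simp
        then have "emeasure M A = (\<integral>\<^sup>+x. indicator ?slab x * indicator (flat_proj c e -` A) x \<partial>lborel)"
          using A by (simp add: M_def emeasure_distr emeasure_density)
        also have "\<dots> = (\<integral>\<^sup>+x. indicator (?slab \<inter> (flat_proj c e -` A)) x \<partial>lborel)"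
          by (simp add: indicator_inter_arith)
        also have "\<dots> = emeasure lborel (?slab \<inter> (flat_proj c e -` A))"
          using m by (intro nn_integral_indicator) auto
        also have "?slab \<inter> (flat_proj c e -` A) = {x. c \<le> x \<bullet> e \<and> x \<bullet> e < c + 1 \<and> flat_proj c e x \<in> A}"
          by auto
        also have "emeasure lborel \<dots> \<le> ennreal C * emeasure ?H A"
          using C(2)[of A] emeasure_hausdorff_measure[OF ne A] by simp
        finally show "emeasure M A \<le> emeasure (scale_measure (ennreal C) ?H) A" by simp
      qed
    qed
    define F' where "F' = (\<lambda>x. ennreal \<bar>F x\<bar> * indicator (frontier \<Omega>) x)"
    have [measurable]: "frontier \<Omega> \<in> sets borel" using frontier_closed by simp
    have F' [measurable]: "F' \<in> borel_measurable borel" unfolding F'_def by measurable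
    have "(\<integral>\<^sup>+x. F' x \<partial>M) = (\<integral>\<^sup>+x. indicator ?slab x * F' (flat_proj c e x) \<partial>lborel)"
      by (simp add: M_def nn_integral_distr nn_integral_density)
    also have "\<dots> = (\<integral>\<^sup>+x. ennreal (indicator ?slab x * \<bar>F (flat_proj c e x)\<bar>) \<partial>lborel)"
    proof (rule nn_integral_cong)
      fix x
      have "flat_proj c e x \<bullet> e = c" using flat_proj_inner[OF e e, of c x] by simp
      then show "indicator ?slab x * F' (flat_proj c e x) = ennreal (indicator ?slab x * \<bar>F (flat_proj c e x)\<bar>)"
        using F0[of "flat_proj c e x"] by (auto simp: F'_def indicator_def)
    qed
    finally have "(\<integral>\<^sup>+x. ennreal (indicator ?slab x * \<bar>F (flat_proj c e x)\<bar>) \<partial>lborel) = (\<integral>\<^sup>+x. F' x \<partial>M)" ..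
    also have "\<dots> \<le> (\<integral>\<^sup>+x. F' x \<partial>scale_measure (ennreal C) ?H)"
      using \<open>M \<le> scale_measure (ennreal C) ?H\<close> by (intro nn_integral_mono_measure) (simp_all add: M_def)
    also have "\<dots> = ennreal C * (\<integral>\<^sup>+x. F' x \<partial>?H)"
      by (intro nn_integral_scale_measure) simp
    also have "(\<integral>\<^sup>+x. F' x \<partial>?H) = (\<integral>\<^sup>+x. ennreal \<bar>F x\<bar> \<partial>restrict_space ?H (frontier \<Omega>))"
      unfolding F'_def by (subst nn_integral_restrict_space) simp_all
    also have "\<dots> = (\<integral>\<^sup>+x. ennreal \<bar>F x\<bar> \<partial>surface_measure \<Omega>)"
      by (simp add: surface_measure_def nn_integral_completion)
    also have "\<dots> = ennreal (\<integral>x. \<bar>F x\<bar> \<partial>surface_measure \<Omega>)"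
      using int by (intro nn_integral_eq_integral) auto
    finally have "(\<integral>\<^sup>+x. ennreal (indicator ?slab x * \<bar>F (flat_proj c e x)\<bar>) \<partial>lborel)
        \<le> ennreal (C * (\<integral>x. \<bar>F x\<bar> \<partial>surface_measure \<Omega>))"
      using C(1) by (simp add: ennreal_mult)
    then show "(\<integral>x. indicator ?slab x * \<bar>F (flat_proj c e x)\<bar> \<partial>lborel) \<le> C * (\<integral>x. \<bar>F x\<bar> \<partial>surface_measure \<Omega>)"
      using C(1) by (intro integral_real_bounded) simp_all
  qed
qed

section \<open>Flatness of the boundary in terms of the outward normal\<close>

lemma hyperplane_proj_add: "norm \<nu> = 1 \<Longrightarrow> hyperplane_proj \<nu> (y + s *\<^sub>R \<nu>) = hyperplane_proj \<nu> y"
  by (simp add: hyperplane_proj_def inner_add_left algebra_simps dot_square_norm)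

lemma chart_function_line:
  fixes h :: "'a::euclidean_space \<Rightarrow> real"
  assumes "((\<lambda>y. y \<bullet> \<nu> - h (hyperplane_proj \<nu> y)) has_derivative (\<lambda>v. v \<bullet> w)) (at p)"
  shows "((\<lambda>s. (p + s *\<^sub>R v) \<bullet> \<nu> - h (hyperplane_proj \<nu> (p + s *\<^sub>R v))) has_real_derivative v \<bullet> w) (at 0)"
proof -
  let ?r = "\<lambda>y. y \<bullet> \<nu> - h (hyperplane_proj \<nu> y)"
  have d: "?r differentiable (at (p + 0 *\<^sub>R v))" using assms differentiable_def by auto
  show ?thesis
    using has_real_derivative_along_line[OF d] frechet_derivative_eqI[OF assms, of v] by simp
qed

text \<open>The graph height is invariant along \<open>\<nu>\<close>, so the chart function grows at
  unit rate in that direction.\<close>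

lemma chart_gradient_inner:
  fixes h :: "'a::euclidean_space \<Rightarrow> real"
  assumes "norm \<nu> = 1" "((\<lambda>y. y \<bullet> \<nu> - h (hyperplane_proj \<nu> y)) has_derivative (\<lambda>v. v \<bullet> w)) (at p)"
  shows "\<nu> \<bullet> w = 1"
proof -
  have "((\<lambda>s. (p + s *\<^sub>R \<nu>) \<bullet> \<nu> - h (hyperplane_proj \<nu> (p + s *\<^sub>R \<nu>))) has_real_derivative 1) (at 0)"
    unfolding hyperplane_proj_add[OF assms(1)]
    using assms(1) by (auto intro!: derivative_eq_intros simp: inner_add_left dot_square_norm)
  then show ?thesis
    using chart_function_line[OF assms(2), of \<nu>] DERIV_unique by blast
qed

text \<open>A positive value of the chart function would persist near \<open>x\<close> and keep
  \<Omega> away from a point of its closure; a negative one would put \<open>x\<close> into the open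
  set \<Omega>.\<close>

lemma chart_function_zero:
  assumes "open \<Omega>" "lipschitz_chart \<Omega> p U \<nu> h" "x \<in> U" "x \<in> frontier \<Omega>"
  shows "x \<bullet> \<nu> = h (hyperplane_proj \<nu> x)"
proof -
  let ?r = "\<lambda>y. y \<bullet> \<nu> - h (hyperplane_proj \<nu> y)"
  obtain L where "L-lipschitz_on UNIV h" and U: "open U" "\<Omega> \<inter> U = {y \<in> U. y \<bullet> \<nu> < h (hyperplane_proj \<nu> y)}"
    using assms(2) unfolding lipschitz_chart_def by blast
  then have "continuous_on UNIV h" by (blast intro: lipschitz_on_continuous_on)
  moreover have "continuous_on UNIV (hyperplane_proj \<nu>)"
    unfolding hyperplane_proj_def by (intro continuous_intros)
  ultimately have "continuous_on UNIV (\<lambda>y. h (hyperplane_proj \<nu> y))"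
    by (rule continuous_on_compose2) auto
  then have c: "continuous_on UNIV ?r"
    by (intro continuous_on_diff continuous_on_inner continuous_on_id continuous_on_const)
  have "x \<notin> \<Omega>" using assms(1,4) by (simp add: frontier_def interior_open)
  then have "\<not> ?r x < 0" using U assms(3) by force
  moreover have "\<not> ?r x > 0"
  proof
    assume "?r x > 0"
    have "open (U \<inter> {y. 0 < ?r y})"
      using U(1) c by (intro open_Int open_Collect_less continuous_on_const) auto
    moreover have "x \<in> closure \<Omega>" using assms(4) by (simp add: frontier_def)
    ultimately obtain y where "y \<in> U" "?r y > 0" "y \<in> \<Omega>"
      using \<open>?r x > 0\<close> assms(3) closure_iff_nhds_not_empty[of x \<Omega>] by blast
    then show False using U(2) by force
  qed
  ultimately show ?thesis by linarith
qed

lemma eventually_on_line: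
  fixes v :: "'a::real_normed_vector"
  assumes "open U" "p \<in> U"
  shows "\<forall>\<^sub>F s in at_right 0. p + s *\<^sub>R v \<in> U"
proof -
  have "((\<lambda>s. p + s *\<^sub>R v) \<longlongrightarrow> p + 0 *\<^sub>R v) (at_right 0)"
    by (intro tendsto_intros)
  then show ?thesis using topological_tendstoD[OF _ assms(1)] assms(2) by auto
qed

lemma closure_on_line:
  fixes v :: "'a::real_normed_vector"
  assumes "\<forall>\<^sub>F s in at_right 0. p + s *\<^sub>R v \<in> S"
  shows "p \<in> closure S"
proof -
  have "((\<lambda>s. p + s *\<^sub>R v) \<longlongrightarrow> p + 0 *\<^sub>R v) (at_right 0)"
    by (intro tendsto_intros)
  moreover have "\<forall>\<^sub>F s in at_right 0. p + s *\<^sub>R v \<in> closure S"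
    using assms by eventually_elim (use closure_subset in blast)
  ultimately show ?thesis
    using Lim_in_closed_set[OF closed_closure _ trivial_limit_at_right_real] by fastforce
qed

text \<open>Moving from \<open>p\<close> along \<open>v\<close> enters \<Omega> according to the
  first chart, whereas a positive slope in the second chart would mean leaving it.\<close>

lemma outward_normal_direction:
  fixes v :: "'a::euclidean_space"
  assumes op: "open \<Omega>" and p: "p \<in> frontier \<Omega>"
    and c1: "lipschitz_chart \<Omega> p U1 \<nu>1 h1"
    and d1: "((\<lambda>y. y \<bullet> \<nu>1 - h1 (hyperplane_proj \<nu>1 y)) has_derivative (\<lambda>v. v \<bullet> w1)) (at p)"
    and c2: "lipschitz_chart \<Omega> p U2 \<nu>2 h2"
    and d2: "((\<lambda>y. y \<bullet> \<nu>2 - h2 (hyperplane_proj \<nu>2 y)) has_derivative (\<lambda>v. v \<bullet> w2)) (at p)"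
    and neg: "v \<bullet> w1 < 0"
  shows "v \<bullet> w2 \<le> 0"
proof (rule ccontr)
  let ?r1 = "\<lambda>y. y \<bullet> \<nu>1 - h1 (hyperplane_proj \<nu>1 y)" and ?r2 = "\<lambda>y. y \<bullet> \<nu>2 - h2 (hyperplane_proj \<nu>2 y)"
  assume "\<not> v \<bullet> w2 \<le> 0"
  then have pos: "0 < v \<bullet> w2" by simp
  have U: "open U1" "p \<in> U1" "open U2" "p \<in> U2"
    "\<Omega> \<inter> U1 = {y \<in> U1. y \<bullet> \<nu>1 < h1 (hyperplane_proj \<nu>1 y)}"
    "\<Omega> \<inter> U2 = {y \<in> U2. y \<bullet> \<nu>2 < h2 (hyperplane_proj \<nu>2 y)}"
    using c1 c2 unfolding lipschitz_chart_def by blast+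
  have z: "?r1 p = 0" "?r2 p = 0"
    using chart_function_zero[OF op c1 U(2) p] chart_function_zero[OF op c2 U(4) p] by auto
  obtain a where "a > 0" "\<And>s. s > 0 \<Longrightarrow> s < a \<Longrightarrow> ?r1 (p + s *\<^sub>R v) < 0"
    using DERIV_neg_dec_right[OF chart_function_line[OF d1] neg] z(1) by auto
  then have e1: "\<forall>\<^sub>F s in at_right 0. ?r1 (p + s *\<^sub>R v) < 0"
    by (auto simp: eventually_at_right_field intro!: exI[of _ a])
  obtain b where "b > 0" "\<And>s. s > 0 \<Longrightarrow> s < b \<Longrightarrow> ?r2 (p + s *\<^sub>R v) > 0"
    using DERIV_pos_inc_right[OF chart_function_line[OF d2] pos] z(2) by auto
  then have e2: "\<forall>\<^sub>F s in at_right 0. ?r2 (p + s *\<^sub>R v) > 0"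
    by (auto simp: eventually_at_right_field intro!: exI[of _ b])
  have "\<forall>\<^sub>F s in at_right (0::real). False"
    using e1 e2 eventually_on_line[OF U(1,2), of v] eventually_on_line[OF U(3,4), of v]
  proof eventually_elim
    case (elim s)
    then have "p + s *\<^sub>R v \<in> \<Omega> \<inter> U1" using U(5) by auto
    then have "p + s *\<^sub>R v \<in> \<Omega> \<inter> U2" using elim by blast
    then show ?case using U(6) elim by auto
  qed
  then show False by (simp add: trivial_limit_at_right_real)
qed

text \<open>Comparing directions shows that the gradients of two charts are positive multiples of
  each other, and normalising removes the factor. This gives the description in
  \<open>outward_normal\<close> a definite value.\<close>

lemma is_outward_normal_unique:
  assumes op: "open \<Omega>" and n: "is_outward_normal \<Omega> p n" and m: "is_outward_normal \<Omega> p m"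
  shows "n = m"
proof -
  obtain U1 \<nu>1 h1 w1 where p: "p \<in> frontier \<Omega>" and c1: "lipschitz_chart \<Omega> p U1 \<nu>1 h1"
    and d1: "((\<lambda>y. y \<bullet> \<nu>1 - h1 (hyperplane_proj \<nu>1 y)) has_derivative (\<lambda>v. v \<bullet> w1)) (at p)" and n': "n = sgn w1"
    using n unfolding is_outward_normal_def by blast
  obtain U2 \<nu>2 h2 w2 where c2: "lipschitz_chart \<Omega> p U2 \<nu>2 h2"
    and d2: "((\<lambda>y. y \<bullet> \<nu>2 - h2 (hyperplane_proj \<nu>2 y)) has_derivative (\<lambda>v. v \<bullet> w2)) (at p)" and m': "m = sgn w2"
    using m unfolding is_outward_normal_def by blast
  have "\<nu>1 \<bullet> w1 = 1" "\<nu>2 \<bullet> w2 = 1"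
    using chart_gradient_inner[OF _ d1] chart_gradient_inner[OF _ d2] c1 c2 by (auto simp: lipschitz_chart_def)
  then have w0: "w1 \<noteq> 0" "w2 \<noteq> 0" by auto
  note dir = outward_normal_direction[OF op p c1 d1 c2 d2]
  \<comment> \<open>\<open>l *\<^sub>R w1\<close> is the orthogonal projection of \<open>w2\<close>
    to the line of \<open>w1\<close>. The remainder \<open>k\<close> vanishes because the directions
    \<open>k - \<delta> *\<^sub>R w1\<close> point into \<Omega> for every \<delta> > 0.\<close>
  define l where "l = (w2 \<bullet> w1) / (w1 \<bullet> w1)"
  define k where "k = w2 - l *\<^sub>R w1"
  have kw: "k \<bullet> w1 = 0" "k \<bullet> w2 = k \<bullet> k"
    using w0 by (simp_all add: k_def l_def inner_simps inner_commute)
  have le: "k \<bullet> k \<le> \<delta> * (w1 \<bullet> w2)" if "\<delta> > 0" for \<delta>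
    using dir[of "k - \<delta> *\<^sub>R w1"] kw that w0 by (simp add: inner_diff_left)
  have "k = 0"
  proof (rule ccontr)
    assume "k \<noteq> 0"
    then have kk: "k \<bullet> k > 0" by simp
    then have "w1 \<bullet> w2 > 0" using le[of 1] by linarith
    then show False using le[of "(k \<bullet> k) / (2 * (w1 \<bullet> w2))"] kk by simp
  qed
  then have w2: "w2 = l *\<^sub>R w1" by (simp add: k_def)
  have "w1 \<bullet> w2 \<ge> 0" using dir[of "- w1"] w0 by simp
  then have "l \<ge> 0" by (simp add: l_def inner_commute)
  moreover have "l \<noteq> 0" using w0 w2 by auto
  ultimately show ?thesis using n' m' w2 by (simp add: sgn_scaleR)
qed

lemma outward_normal_eq:
  "open \<Omega> \<Longrightarrow> is_outward_normal \<Omega> p n \<Longrightarrow> outward_normal \<Omega> p = n"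
  unfolding outward_normal_def by (blast intro: the_equality is_outward_normal_unique)

text \<open>The normal is prescribed at boundary points only. The height \<open>H\<close> is
  invariant along \<open>\<nu>\<close>, and every point near \<open>p\<close> reaches the boundary
  along \<open>\<nu>\<close>, so the prescribed normal fixes the gradient of \<open>H\<close> on a
  full ball. There \<open>H\<close> is affine, and the chart describes a half space.\<close>

lemma flat_boundary_half_ball:
  fixes e :: "'a::euclidean_space"
  assumes op: "open \<Omega>" and chart: "lipschitz_chart \<Omega> p U \<nu> h" and sm: "smooth h" and p: "p \<in> frontier \<Omega>"
    and eps: "\<epsilon> > 0" and n: "\<And>x. x \<in> ball p \<epsilon> \<inter> frontier \<Omega> \<Longrightarrow> outward_normal \<Omega> x = e"
  obtains r where "0 < r" "r \<le> \<epsilon>" "\<And>x. x \<in> ball p r \<Longrightarrow> x \<in> \<Omega> \<longleftrightarrow> x \<bullet> e < p \<bullet> e"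
proof -
  define H where "H = (\<lambda>y. h (hyperplane_proj \<nu> y))"
  have U: "open U" "p \<in> U" "norm \<nu> = 1" "\<Omega> \<inter> U = {y \<in> U. y \<bullet> \<nu> < H y}" "\<exists>L. L-lipschitz_on UNIV h"
    using chart unfolding lipschitz_chart_def H_def by blast+
  have lin: "bounded_linear (hyperplane_proj \<nu>)"
    unfolding hyperplane_proj_def[abs_def] by (intro bounded_linear_intros)
  have Hd: "H differentiable (at x)" for x
    unfolding H_def
    by (rule differentiable_chain_at[of "hyperplane_proj \<nu>" x h, unfolded o_def])
      (auto simp: lin bounded_linear_imp_differentiable smooth_differentiable[OF sm])
  have Hc: "continuous_on UNIV H"
    using Hd by (simp add: continuous_at_imp_continuous_on differentiable_imp_continuous_within)
  have Hs: "H (y + s *\<^sub>R \<nu>) = H y" for y s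
    by (simp add: H_def hyperplane_proj_add[OF U(3)])
  \<comment> \<open>\<open>Q\<close> pushes a point along \<open>\<nu>\<close> onto the graph of the
    chart.\<close>
  define Q where "Q = (\<lambda>y. y + (H y - y \<bullet> \<nu>) *\<^sub>R \<nu>)"
  have Hp: "p \<bullet> \<nu> = H p"
    using chart_function_zero[OF op chart U(2) p] by (simp add: H_def)
  have Qc: "isCont Q p"
    using Hc unfolding Q_def by (intro continuous_intros) (simp add: continuous_on_eq_continuous_at)
  have "Q p = p" by (simp add: Q_def Hp)
  obtain r1 where r1: "r1 > 0" "\<And>y. dist y p < r1 \<Longrightarrow> Q y \<in> U \<inter> ball p \<epsilon>"
  proof -
    have "open (U \<inter> ball p \<epsilon>)" "Q p \<in> U \<inter> ball p \<epsilon>"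
      using U eps \<open>Q p = p\<close> by auto
    then have "\<forall>\<^sub>F y in nhds p. Q y \<in> U \<inter> ball p \<epsilon>"
      using topological_tendstoD[OF Qc[unfolded continuous_at tendsto_at_iff_tendsto_nhds]] by blast
    then show ?thesis using that by (auto simp: eventually_nhds_metric)
  qed
  obtain r2 where r2: "r2 > 0" "ball p r2 \<subseteq> U"
    using U(1,2) open_contains_ball by blast
  define r where "r = min (min r1 r2) \<epsilon>"
  have QU: "Q y \<in> U" "Q y \<in> frontier \<Omega>" "Q y \<in> ball p \<epsilon>" if "y \<in> ball p r" for y
  proof -
    show QU: "Q y \<in> U" "Q y \<in> ball p \<epsilon>" using r1(2)[of y] that by (auto simp: r_def dist_commute)
    have Qn: "Q y \<bullet> \<nu> = H (Q y)"
      using U(3) Hs[of y] by (simp add: Q_def inner_add_left dot_square_norm)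
    have "Q y \<notin> \<Omega>"
    proof
      assume "Q y \<in> \<Omega>"
      then have "Q y \<in> {y \<in> U. y \<bullet> \<nu> < H y}" using U(4) QU(1) by blast
      then show False using Qn by simp
    qed
    moreover have "Q y \<in> closure \<Omega>"
    proof -
      have "\<forall>\<^sub>F s in at_right 0. Q y + s *\<^sub>R (- \<nu>) \<in> \<Omega>"
        using eventually_on_line[OF U(1) QU(1), of "- \<nu>"] eventually_at_right_less[of 0]
      proof eventually_elim
        case (elim s)
        have "(Q y + s *\<^sub>R (- \<nu>)) \<bullet> \<nu> = H (Q y) - s"
          using Qn U(3) by (simp add: inner_diff_left dot_square_norm)
        moreover have "H (Q y + s *\<^sub>R (- \<nu>)) = H (Q y)" using Hs[of "Q y" "- s"] by simp
        ultimately have "Q y + s *\<^sub>R (- \<nu>) \<in> {y \<in> U. y \<bullet> \<nu> < H y}" using elim by simp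
        then show ?case using U(4) by blast
      qed
      then show ?thesis by (rule closure_on_line)
    qed
    ultimately show "Q y \<in> frontier \<Omega>" using op by (simp add: frontier_def interior_open)
  qed
  have grad: "\<nu> \<bullet> e > 0 \<and> frechet_derivative H (at y) v = v \<bullet> (\<nu> - e /\<^sub>R (\<nu> \<bullet> e))" if y: "y \<in> ball p r" for y v
  proof -
    let ?x = "Q y"
    define w where "w = \<nu> - gradient H ?x"
    have Hx: "(H has_derivative (\<lambda>v. v \<bullet> gradient H ?x)) (at ?x)"
      using gradient_inner[OF Hd] frechet_derivative_works[THEN iffD1, OF Hd[of ?x]]
      by (metis (no_types, lifting) ext inner_commute)
    have dx: "((\<lambda>y. y \<bullet> \<nu> - h (hyperplane_proj \<nu> y)) has_derivative (\<lambda>v. v \<bullet> w)) (at ?x)"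
      unfolding w_def inner_diff_right H_def[symmetric]
      by (intro has_derivative_diff Hx[unfolded H_def[symmetric]] bounded_linear_imp_has_derivative bounded_linear_inner_left)
        (use Hx in \<open>simp add: H_def\<close>)
    have "lipschitz_chart \<Omega> ?x U \<nu> h"
      using chart QU(1)[OF y] by (simp add: lipschitz_chart_def)
    then have "is_outward_normal \<Omega> ?x (sgn w)"
      unfolding is_outward_normal_def using QU(2)[OF y] dx by blast
    then have we: "sgn w = e"
      using outward_normal_eq[OF op, of ?x "sgn w"] n[of ?x] QU(2,3)[OF y] by simp
    have "\<nu> \<bullet> w = 1" by (rule chart_gradient_inner[OF U(3) dx])
    moreover have w: "w = norm w *\<^sub>R e" unfolding we[symmetric] by (cases "w = 0") (simp_all add: sgn_div_norm)
    \<comment> \<open>The length of the chart gradient is recovered from its direction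
      \<open>e\<close> and its component 1 along \<open>\<nu>\<close>.\<close>
    ultimately have nw: "norm w * (\<nu> \<bullet> e) = 1" by (metis inner_scaleR_right)
    have pos: "\<nu> \<bullet> e > 0"
      using nw mult_nonneg_nonpos[of "norm w" "\<nu> \<bullet> e"] by (cases "\<nu> \<bullet> e > 0") auto
    then have "norm w = inverse (\<nu> \<bullet> e)" using nw by (simp add: field_simps)
    then have "w = e /\<^sub>R (\<nu> \<bullet> e)" using w by metis
    then have g: "gradient H ?x = \<nu> - e /\<^sub>R (\<nu> \<bullet> e)" unfolding w_def by (simp add: algebra_simps)
    have "((\<lambda>z. H (z + (H y - y \<bullet> \<nu>) *\<^sub>R \<nu>)) has_derivative (\<lambda>v. v \<bullet> gradient H ?x)) (at y)"
      using has_derivative_compose[of "\<lambda>z. z + (H y - y \<bullet> \<nu>) *\<^sub>R \<nu>" "\<lambda>v. v" y UNIV H] Hx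
      by (simp add: Q_def has_derivative_add_const)
    then have "(H has_derivative (\<lambda>v. v \<bullet> gradient H ?x)) (at y)" by (simp add: Hs)
    then show ?thesis using pos g frechet_derivative_eqI by metis
  qed
  define k where "k = \<nu> - e /\<^sub>R (\<nu> \<bullet> e)"
  have rpos: "r > 0" "r \<le> \<epsilon>" "ball p r \<subseteq> U" using r1 r2 eps by (auto simp: r_def)
  have pos: "\<nu> \<bullet> e > 0" using grad[of p] rpos by simp
  have const: "H y - y \<bullet> k = H p - p \<bullet> k" if y: "y \<in> ball p r" for y
  proof (rule has_derivative_zero_unique[of "ball p r" "\<lambda>y. H y - y \<bullet> k"])
    fix x assume x: "x \<in> ball p r"
    have "(H has_derivative (\<lambda>v. v \<bullet> k)) (at x)"
      using frechet_derivative_works[THEN iffD1, OF Hd[of x]] grad[OF x] unfolding k_def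
      by (metis (no_types, lifting) ext)
    then have "((\<lambda>y. H y - y \<bullet> k) has_derivative (\<lambda>v. v \<bullet> k - v \<bullet> k)) (at x)"
      by (intro has_derivative_diff bounded_linear_imp_has_derivative bounded_linear_inner_left)
    then show "((\<lambda>y. H y - y \<bullet> k) has_derivative (\<lambda>v. 0)) (at x within ball p r)"
      by (simp add: has_derivative_at_withinI)
  qed (use y rpos in auto)
  show ?thesis
  proof (rule that[OF rpos(1,2)])
    fix x assume x: "x \<in> ball p r"
    have "x \<bullet> \<nu> - H x = (x - p) \<bullet> (\<nu> - k)"
      using const[OF x] Hp by (simp add: inner_diff_left inner_diff_right)
    also have "\<dots> = ((x - p) \<bullet> e) / (\<nu> \<bullet> e)" by (simp add: k_def divide_inverse mult.commute)
    finally have "x \<bullet> \<nu> < H x \<longleftrightarrow> (x - p) \<bullet> e < 0"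
      using pos by (metis diff_less_0_iff_less divide_less_0_iff not_less_iff_gr_or_eq)
    moreover have "x \<in> \<Omega> \<longleftrightarrow> x \<bullet> \<nu> < H x" using U(4) x rpos(3) by blast
    ultimately show "x \<in> \<Omega> \<longleftrightarrow> x \<bullet> e < p \<bullet> e" by (simp add: inner_diff_left)
  qed
qed

lemma half_ball_frontier:
  fixes e :: "'a::euclidean_space"
  assumes op: "open \<Omega>" and e: "norm e = 1" and half: "\<And>x. x \<in> ball p r \<Longrightarrow> x \<in> \<Omega> \<longleftrightarrow> x \<bullet> e < p \<bullet> e"
    and x: "x \<in> ball p r" "x \<bullet> e = p \<bullet> e"
  shows "x \<in> frontier \<Omega>"
proof -
  have "x \<notin> \<Omega>" using half x by simp
  moreover have "x \<in> closure \<Omega>"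
  proof -
    have "\<forall>\<^sub>F s in at_right 0. x + s *\<^sub>R (- e) \<in> \<Omega>"
      using eventually_on_line[OF open_ball x(1), of "- e"] eventually_at_right_less[of 0]
    proof eventually_elim
      case (elim s)
      then show ?case using half[OF elim(1)] x e by (simp add: inner_diff_left dot_square_norm)
    qed
    then show ?thesis by (rule closure_on_line)
  qed
  ultimately show ?thesis using op by (simp add: frontier_def interior_open)
qed

section \<open>A divergence identity for functions with given trace\<close>

definition laplacian :: "('a::euclidean_space \<Rightarrow> real) \<Rightarrow> 'a \<Rightarrow> real" where
  "laplacian f x = (\<Sum>i\<in>Basis. frechet_derivative (\<lambda>y. frechet_derivative f (at y) i) (at x) i)"

lemma smooth_laplacian_continuous: "smooth f \<Longrightarrow> continuous_on S (laplacian f)"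
  unfolding laplacian_def[abs_def]
  by (intro continuous_on_sum smooth_continuous_on smooth_frechet_derivative)

lemma integrable_continuous_lebesgue_on:
  fixes f :: "'a::euclidean_space \<Rightarrow> 'b::euclidean_space"
  assumes "continuous_on UNIV f" "open D" "bounded D"
  shows "integrable (lebesgue_on D) f"
  using L2_imp_L1(1)[OF finite_measure_lebesgue_on_bounded continuous_L2] assms by blast

lemma integrable_slab:
  fixes G :: "'a::euclidean_space \<Rightarrow> real"
  assumes G: "continuous_on UNIV G" and S: "bounded S" "\<And>x. x \<notin> S \<Longrightarrow> G x = 0" and e: "e \<in> Basis"
  shows "integrable lborel (\<lambda>x. indicator {x. c \<le> x \<bullet> e \<and> x \<bullet> e < c + 1} x * G (flat_proj c e x))"
proof -
  have [measurable]: "G \<in> borel_measurable borel" using G by (rule borel_measurable_continuous_onI)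
  obtain M where M: "\<And>x. \<bar>G x\<bar> \<le> M"
    using bounded_continuous_bounded_support[OF G S] by blast
  obtain R where R: "\<And>x. x \<in> S \<Longrightarrow> norm x \<le> R"
    using S(1) unfolding bounded_iff by auto
  have "integrable lborel (\<lambda>x::'a. indicator (cball 0 (R + 1)) x * M)"
    using emeasure_bounded_finite[of "cball (0::'a) (R + 1)"]
    by (intro integrable_mult_left integrable_real_indicator) auto
  then show ?thesis
  proof (rule Bochner_Integration.integrable_bound)
    show "AE x in lborel. norm (indicator {x. c \<le> x \<bullet> e \<and> x \<bullet> e < c + 1} x * G (flat_proj c e x))
        \<le> norm (indicator (cball 0 (R + 1)) x * M)"
    proof (rule AE_I2)
      fix x :: 'a
      have M0: "0 \<le> M" using M[of x] by linarith
      show "norm (indicator {x. c \<le> x \<bullet> e \<and> x \<bullet> e < c + 1} x * G (flat_proj c e x))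
          \<le> norm (indicator (cball 0 (R + 1)) x * M)"
      proof (cases "c \<le> x \<bullet> e \<and> x \<bullet> e < c + 1 \<and> flat_proj c e x \<in> S")
        case True
        then have "norm (x + (c - x \<bullet> e) *\<^sub>R e) \<le> R" using R unfolding flat_proj_def by blast
        moreover have "norm ((c - x \<bullet> e) *\<^sub>R e) \<le> 1" using e True by simp
        ultimately have "norm x \<le> R + 1"
          using norm_diff_ineq[of x "(c - x \<bullet> e) *\<^sub>R e"] by linarith
        then show ?thesis using M[of "flat_proj c e x"] M0 True by simp
      qed (use S M0 in auto)
    qed
  qed measurable
qed

text \<open>\<open>surface_nonzero\<close> excludes the zero measure that \<open>measure_of\<close>
  yields by default, and so ties the surface measure to the Hausdorff outer measure;
  \<open>finite_surface\<close> makes continuous functions square integrable on the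
  boundary.\<close>

locale flat_boundary_point =
  fixes \<Omega> :: "'a::euclidean_space set" and e p :: 'a and r :: real
  assumes open_domain: "open \<Omega>" and bounded_domain: "bounded \<Omega>"
    and e_Basis: "e \<in> Basis" and dim: "DIM('a) \<ge> 2" and r_pos: "r > 0"
    and half_ball: "\<And>x. x \<in> ball p r \<Longrightarrow> x \<in> \<Omega> \<longleftrightarrow> x \<bullet> e < p \<bullet> e"
    and finite_surface: "finite_measure (surface_measure \<Omega>)"
    and surface_nonzero: "\<exists>X. emeasure (surface_measure \<Omega>) X \<noteq> 0"
begin

text \<open>Functions of \<open>proj x\<close> are constant in the direction \<open>e\<close>, and the slab has thickness 1; hence their
  Lebesgue integral over the slab is the integral over the hyperplane through \<open>p\<close> orthogonal to \<open>e\<close>.\<close>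

abbreviation "slab \<equiv> {x. p \<bullet> e \<le> x \<bullet> e \<and> x \<bullet> e < p \<bullet> e + 1}"
abbreviation "proj \<equiv> flat_proj (p \<bullet> e) e"

text \<open>The divergence theorem for the field A(\<phi>) \<nabla>l. Its support meets \<Omega> in
  a half ball, so the tangential components integrate to 0 and the component along \<open>e\<close>
  leaves the hyperplane integral.\<close>

lemma divergence_identity_smooth:
  assumes \<phi>: "smooth \<phi>" and l: "smooth l" "\<And>x. x \<notin> ball p (r / 2) \<Longrightarrow> l x = 0"
    and A: "\<And>s. (A has_real_derivative a s) (at s)" and a: "continuous_on UNIV a"
  shows "(\<integral>x. a (\<phi> x) * (gradient \<phi> x \<bullet> gradient l x) + A (\<phi> x) * laplacian l x \<partial>lebesgue_on \<Omega>)
    = (\<integral>x. indicator slab x * (A (\<phi> (proj x)) * frechet_derivative l (at (proj x)) e) \<partial>lborel)"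
proof -
  let ?c = "p \<bullet> e"
  let ?dl = "\<lambda>i x. frechet_derivative l (at x) i"
  let ?F = "\<lambda>i x. A (\<phi> x) * ?dl i x"
  let ?D = "\<lambda>i x. A (\<phi> x) * frechet_derivative (?dl i) (at x) i + a (\<phi> x) * frechet_derivative \<phi> (at x) i * ?dl i x"
  have c\<phi>: "continuous_on UNIV \<phi>" and cd\<phi>: "continuous_on UNIV (\<lambda>x. frechet_derivative \<phi> (at x) i)" for i
    using \<phi> by (auto intro: smooth_continuous_on smooth_frechet_derivative)
  have cl: "continuous_on UNIV (?dl i)" and cdl: "continuous_on UNIV (\<lambda>x. frechet_derivative (?dl i) (at x) i)" for i
    using l(1) by (auto intro!: smooth_continuous_on smooth_frechet_derivative)
  have cA: "continuous_on UNIV A"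
    using A by (auto intro!: continuous_at_imp_continuous_on DERIV_isCont)
  have cA\<phi>: "continuous_on UNIV (\<lambda>x. A (\<phi> x))" and ca\<phi>: "continuous_on UNIV (\<lambda>x. a (\<phi> x))"
    using continuous_on_compose2[OF cA c\<phi>] continuous_on_compose2[OF a c\<phi>] by auto
  have dl0: "?dl i x = 0" if "x \<notin> cball p (r / 2)" for i x
    by (rule frechet_derivative_outside_support[of "ball p (r / 2)"]) (use l that r_pos in auto)
  have dF: "(?F i has_derivative (\<lambda>v. A (\<phi> x) * frechet_derivative (?dl i) (at x) v
      + a (\<phi> x) * frechet_derivative \<phi> (at x) v * ?dl i x)) (at x)" for i x
  proof -
    have "((\<lambda>x. A (\<phi> x)) has_derivative (\<lambda>v. a (\<phi> x) * frechet_derivative \<phi> (at x) v)) (at x)"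
      using has_derivative_compose[OF smooth_has_derivative[OF \<phi>] A[unfolded has_field_derivative_def]] .
    from has_derivative_mult[OF this smooth_has_derivative[OF smooth_frechet_derivative[OF l(1), of i]]]
    show ?thesis .
  qed
  have DF: "frechet_derivative (?F i) (at x) i = ?D i x" for i x
    by (rule frechet_derivative_eqI[OF dF])
  have F: "?F i differentiable (at x)" "bounded (cball p (r / 2))" "x \<notin> cball p (r / 2) \<Longrightarrow> ?F i x = 0"
    "continuous_on UNIV (\<lambda>x. frechet_derivative (?F i) (at x) i)" for i x
    using dF dl0 unfolding DF
    by (auto simp: differentiable_def intro!: continuous_intros cA\<phi> ca\<phi> cd\<phi> cl cdl)
  have E: "{x. x \<bullet> e < ?c} \<in> sets (borel :: 'a measure)" by measurable
  have cD: "continuous_on UNIV (?D i)" for i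
    using F(4)[of i] unfolding DF .
  have half: "(\<integral>x. ?D i x \<partial>lebesgue_on \<Omega>) = (\<integral>x. indicator {x. x \<bullet> e < ?c} x * frechet_derivative (?F i) (at x) i \<partial>lborel)" for i
  proof -
    have "(\<integral>x. ?D i x \<partial>lebesgue_on \<Omega>) = (\<integral>x. indicator \<Omega> x * ?D i x \<partial>lborel)"
      using open_domain cD by (intro integral_lebesgue_on_borel borel_measurable_continuous_onI) auto
    also have "\<dots> = (\<integral>x. indicator {x. x \<bullet> e < ?c} x * frechet_derivative (?F i) (at x) i \<partial>lborel)"
    proof (rule Bochner_Integration.integral_cong[OF refl])
      fix x
      show "indicator \<Omega> x * ?D i x = indicator {x. x \<bullet> e < ?c} x * frechet_derivative (?F i) (at x) i"
      proof (cases "x \<in> cball p (r / 2)")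
        case True
        then have "x \<in> ball p r" using r_pos by auto
        then show ?thesis using half_ball unfolding DF by (simp add: indicator_def)
      next
        case False
        have "frechet_derivative (?dl i) (at x) i = 0"
          by (rule frechet_derivative_outside_support[of "cball p (r / 2)"]) (use dl0 False in auto)
        then show ?thesis using dl0[OF False] unfolding DF by simp
      qed
    qed
    finally show ?thesis .
  qed
  have tang: "(\<integral>x. indicator {x. x \<bullet> e < ?c} x * frechet_derivative (?F i) (at x) i \<partial>lborel) = 0"
    if i: "i \<in> Basis" "i \<noteq> e" for i
    using e_Basis i
    by (intro integral_derivative_invariant_set[OF F(1) F(4) F(2) F(3) E]) (auto simp: inner_add_left inner_Basis)
  have norm: "(\<integral>x. indicator {x. x \<bullet> e < ?c} x * frechet_derivative (?F e) (at x) e \<partial>lborel)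
      = (\<integral>x. indicator slab x * ?F e (proj x) \<partial>lborel)"
    by (rule integral_derivative_half_space[OF F(1) F(4) F(2) F(3) e_Basis])
  have "gradient \<phi> x \<bullet> gradient l x = (\<Sum>i\<in>Basis. frechet_derivative \<phi> (at x) i * ?dl i x)" for x
    by (subst euclidean_inner) (simp add: gradient_inner_Basis)
  then have "a (\<phi> x) * (gradient \<phi> x \<bullet> gradient l x) + A (\<phi> x) * laplacian l x = (\<Sum>i\<in>Basis. ?D i x)" for x
    by (simp add: laplacian_def sum.distrib sum_distrib_left mult.assoc add.commute)
  then have "(\<integral>x. a (\<phi> x) * (gradient \<phi> x \<bullet> gradient l x) + A (\<phi> x) * laplacian l x \<partial>lebesgue_on \<Omega>)
      = (\<Sum>i\<in>Basis. \<integral>x. ?D i x \<partial>lebesgue_on \<Omega>)"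
    using integrable_continuous_lebesgue_on[OF cD open_domain bounded_domain]
    by (simp add: Bochner_Integration.integral_sum)
  also have "\<dots> = (\<Sum>i\<in>Basis. if i = e then \<integral>x. indicator slab x * ?F e (proj x) \<partial>lborel else 0)"
    unfolding half using tang norm by (intro sum.cong) auto
  finally show ?thesis using e_Basis by simp
qed

lemma continuous_L2_surface:
  assumes "continuous_on UNIV f"
  shows "f \<in> L2 (surface_measure \<Omega>)"
proof -
  have "bounded (frontier \<Omega>)" using bounded_domain frontier_subset_closed[OF closed_closure, of \<Omega>]
    by (metis bounded_closure bounded_subset frontier_def Diff_subset)
  then obtain M where M: "M \<ge> 0" "\<And>x. x \<in> frontier \<Omega> \<Longrightarrow> norm (f x) \<le> M"
    using continuous_on_imp_bounded_on[OF assms] by metis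
  have f: "f \<in> borel_measurable (surface_measure \<Omega>)"
    unfolding surface_measure_def
    using borel_measurable_continuous_onI[OF assms]
    by (intro measurable_completion measurable_restrict_space1) (simp add: measurable_cong_sets[OF sets_hausdorff_measure refl])
  have "space (surface_measure \<Omega>) = frontier \<Omega>"
    by (simp add: surface_measure_def space_restrict_space)
  then have "integrable (surface_measure \<Omega>) (\<lambda>x. (norm (f x))\<^sup>2)"
    using f M by (intro integrable_bounded_finite_measure[OF finite_surface, where C = "M\<^sup>2"]) (auto intro!: power_mono)
  then show ?thesis using f by (simp add: L2_def)
qed

lemma smooth_has_trace:
  assumes "smooth f"
  shows "has_trace \<Omega> f f"
  unfolding has_trace_def
  using assms smooth_H1[OF assms open_domain bounded_domain] continuous_L2_surface[OF smooth_continuous_on[OF assms]]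
  by (auto simp: H1_norm_0[OF open_domain] L2_norm_def intro!: exI[of _ "\<lambda>k. f"])

text \<open>A trace is known only through smooth functions that converge in \<open>H1\<close> and,
  on the boundary, in L2, so each term of the smooth identity is passed to the limit. As
  \<open>a\<close> is merely continuous, the gradient term is split: \<open>T1\<close> exchanges the
  gradient by L1 convergence, \<open>T2\<close> exchanges the argument of \<open>a\<close> by
  dominated convergence. The Lipschitz property of \<open>A\<close> settles \<open>T3\<close> and
  the boundary term.\<close>

lemma divergence_identity:
  assumes tr: "has_trace \<Omega> f \<gamma>" and \<gamma>: "continuous_on UNIV \<gamma>"
    and l: "smooth l" "\<And>x. x \<notin> ball p (r / 2) \<Longrightarrow> l x = 0"
    and A: "\<And>s. (A has_real_derivative a s) (at s)" and a: "continuous_on UNIV a" and K: "\<And>s. \<bar>a s\<bar> \<le> K"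
  shows "(\<integral>x. a (f x) * (weak_grad \<Omega> f x \<bullet> gradient l x) \<partial>lebesgue_on \<Omega>)
      + (\<integral>x. A (f x) * laplacian l x \<partial>lebesgue_on \<Omega>)
    = (\<integral>x. indicator slab x * (A (\<gamma> (proj x)) * frechet_derivative l (at (proj x)) e) \<partial>lborel)"
proof -
  note D = open_domain bounded_domain
  let ?M = "lebesgue_on \<Omega>"
  note fin = finite_measure_lebesgue_on_bounded[OF D]
  obtain \<psi> where f: "f \<in> H1 \<Omega>" and \<psi>: "\<And>k::nat. smooth (\<psi> k)"
    "(\<lambda>k. H1_norm \<Omega> (\<lambda>x. \<psi> k x - f x)) \<longlonglongrightarrow> 0"
    "(\<lambda>k. L2_norm (surface_measure \<Omega>) (\<lambda>x. \<psi> k x - \<gamma> x)) \<longlonglongrightarrow> 0"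
    using tr unfolding has_trace_def by blast
  have H: "\<psi> k \<in> H1 \<Omega>" for k using smooth_H1[OF \<psi>(1) D] .
  have fm [measurable]: "f \<in> borel_measurable ?M" and gm [measurable]: "weak_grad \<Omega> f \<in> borel_measurable ?M"
    using f by (auto intro: L2_measurable H1_imp_L2 weak_grad_L2)
  have \<psi>m [measurable]: "\<psi> k \<in> borel_measurable ?M" and g\<psi>m [measurable]: "gradient (\<psi> k) \<in> borel_measurable ?M" for k
    by (rule borel_measurable_lebesgue_on_borel[OF smooth_borel_measurable[OF \<psi>(1)]],
        rule borel_measurable_lebesgue_on_borel[OF borel_measurable_gradient[OF \<psi>(1)]])
  have [measurable]: "a \<in> borel_measurable borel" using a by (rule borel_measurable_continuous_onI)
  have cA: "continuous_on UNIV A"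
    using A by (auto intro!: continuous_at_imp_continuous_on DERIV_isCont)
  then have [measurable]: "A \<in> borel_measurable borel" by (rule borel_measurable_continuous_onI)
  have glm [measurable]: "gradient l \<in> borel_measurable ?M" and lapm [measurable]: "laplacian l \<in> borel_measurable ?M"
    by (rule borel_measurable_lebesgue_on_borel[OF borel_measurable_gradient[OF l(1)]],
        rule borel_measurable_lebesgue_on_borel[OF borel_measurable_continuous_onI[OF smooth_laplacian_continuous[OF l(1)]]])
  obtain M1 where M1: "M1 \<ge> 0" "\<And>x. x \<in> \<Omega> \<Longrightarrow> norm (gradient l x) \<le> M1"
    using continuous_on_imp_bounded_on[OF continuous_gradient[OF l(1)] D(2)] by metis
  obtain M2 where M2: "M2 \<ge> 0" "\<And>x. x \<in> \<Omega> \<Longrightarrow> norm (laplacian l x) \<le> M2"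
    using continuous_on_imp_bounded_on[OF smooth_laplacian_continuous[OF l(1)] D(2)] by metis
  have K0: "K \<ge> 0" using K[of 0] by linarith
  have lipA: "\<bar>A s - A t\<bar> \<le> K * \<bar>s - t\<bar>" for s t
    using field_differentiable_bound[of UNIV A a K t s] A K by (simp add: abs_minus_commute)
  have intf: "integrable ?M f" and intgf: "integrable ?M (weak_grad \<Omega> f)"
    using f by (auto intro: L2_imp_L1(1)[OF fin] H1_imp_L2 weak_grad_L2)
  have intg\<psi>: "integrable ?M (gradient (\<psi> k))" and int\<psi>: "integrable ?M (\<psi> k)" for k
    by (rule integrable_continuous_lebesgue_on[OF continuous_gradient[OF \<psi>(1)] D],
        rule integrable_continuous_lebesgue_on[OF smooth_continuous_on[OF \<psi>(1)] D])
  have bd: "\<bar>a s * (v \<bullet> gradient l x)\<bar> \<le> K * M1 * norm v" if "x \<in> \<Omega>" for s v x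
  proof -
    have "\<bar>v \<bullet> gradient l x\<bar> \<le> norm v * M1"
      using Cauchy_Schwarz_ineq2[of v "gradient l x"] mult_left_mono[OF M1(2)[OF that], of "norm v"] by simp
    from mult_mono[OF K[of s] this K0 abs_ge_zero] show ?thesis
      by (simp add: abs_mult mult_ac)
  qed
  have bl: "\<bar>s * laplacian l x\<bar> \<le> M2 * \<bar>s\<bar>" if "x \<in> \<Omega>" for s x
    using mult_left_mono[OF M2(2)[OF that], of "\<bar>s\<bar>"] by (simp add: abs_mult mult.commute)
  have L1: "(\<lambda>k. \<integral>x. norm (\<psi> k x - f x) \<partial>?M) \<longlonglongrightarrow> 0"
    and G1w: "(\<lambda>k. \<integral>x. norm (weak_grad \<Omega> (\<psi> k) x - weak_grad \<Omega> f x) \<partial>?M) \<longlonglongrightarrow> 0"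
    using H1_convergence[OF D H f \<psi>(2)] by auto
  have wm [measurable]: "weak_grad \<Omega> (\<psi> k) \<in> borel_measurable ?M" for k
    using H by (intro L2_measurable weak_grad_L2)
  have "(\<integral>x. norm (weak_grad \<Omega> (\<psi> k) x - weak_grad \<Omega> f x) \<partial>?M)
      = (\<integral>x. norm (gradient (\<psi> k) x - weak_grad \<Omega> f x) \<partial>?M)" for k
  proof (rule integral_cong_AE)
    show "AE x in ?M. norm (weak_grad \<Omega> (\<psi> k) x - weak_grad \<Omega> f x) = norm (gradient (\<psi> k) x - weak_grad \<Omega> f x)"
      using smooth_weak_grad[OF \<psi>(1) D, of k] by eventually_elim simp
  qed measurable
  then have G1: "(\<lambda>k. \<integral>x. norm (gradient (\<psi> k) x - weak_grad \<Omega> f x) \<partial>?M) \<longlonglongrightarrow> 0"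
    using G1w by simp
  \<comment> \<open>The argument of \<open>a\<close> needs pointwise convergence, which L1
    convergence provides along a subsequence.\<close>
  obtain \<rho> :: "nat \<Rightarrow> nat" where \<rho>: "strict_mono \<rho>" "AE x in ?M. (\<lambda>k. \<psi> (\<rho> k) x - f x) \<longlonglongrightarrow> 0"
    using tendsto_L1_AE_subseq[of ?M "\<lambda>k x. \<psi> k x - f x"] L1 int\<psi> intf by auto
  define T1 where "T1 = (\<lambda>k. \<integral>x. a (\<psi> k x) * ((gradient (\<psi> k) x - weak_grad \<Omega> f x) \<bullet> gradient l x) \<partial>?M)"
  define T2 where "T2 = (\<lambda>k. \<integral>x. a (\<psi> k x) * (weak_grad \<Omega> f x \<bullet> gradient l x) \<partial>?M)"
  define T3 where "T3 = (\<lambda>k. \<integral>x. A (\<psi> k x) * laplacian l x \<partial>?M)"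
  have i1: "integrable ?M (\<lambda>x. a (\<psi> k x) * ((gradient (\<psi> k) x - weak_grad \<Omega> f x) \<bullet> gradient l x))" for k
    by (rule Bochner_Integration.integrable_bound[of _ "\<lambda>x. K * M1 * norm (gradient (\<psi> k) x - weak_grad \<Omega> f x)"])
      (use intg\<psi>[of k] intgf bd K0 M1(1) in \<open>auto intro!: AE_I2 simp: abs_mult\<close>)
  have i2: "integrable ?M (\<lambda>x. a (\<psi> k x) * (weak_grad \<Omega> f x \<bullet> gradient l x))" for k
    by (rule Bochner_Integration.integrable_bound[of _ "\<lambda>x. K * M1 * norm (weak_grad \<Omega> f x)"])
      (use intgf bd K0 M1(1) in \<open>auto intro!: AE_I2 simp: abs_mult\<close>)
  have iA: "integrable ?M (\<lambda>x. A (g x) * laplacian l x)" if "integrable ?M g" for g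
  proof -
    have [measurable]: "g \<in> borel_measurable ?M" using that by auto
    have "integrable ?M (\<lambda>x. M2 * (K * \<bar>g x\<bar> + \<bar>A 0\<bar>))"
      using that fin by (auto intro!: integrable_add integrable_mult_right simp: finite_measure.integrable_const)
    then show ?thesis
    proof (rule Bochner_Integration.integrable_bound)
      show "AE x in ?M. norm (A (g x) * laplacian l x) \<le> norm (M2 * (K * \<bar>g x\<bar> + \<bar>A 0\<bar>))"
      proof (rule AE_I2)
        fix x assume "x \<in> space ?M"
        then have "\<bar>A (g x) * laplacian l x\<bar> \<le> M2 * \<bar>A (g x)\<bar>" using bl by simp
        also have "\<dots> \<le> M2 * (K * \<bar>g x\<bar> + \<bar>A 0\<bar>)"
          using lipA[of "g x" 0] M2(1) by (intro mult_left_mono) auto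
        finally show "norm (A (g x) * laplacian l x) \<le> norm (M2 * (K * \<bar>g x\<bar> + \<bar>A 0\<bar>))" by simp
      qed
    qed measurable
  qed
  have T1: "T1 \<longlonglongrightarrow> 0"
  proof (rule Lim_null_comparison)
    show "\<forall>\<^sub>F k in sequentially. norm (T1 k) \<le> K * M1 * (\<integral>x. norm (gradient (\<psi> k) x - weak_grad \<Omega> f x) \<partial>?M)"
    proof (rule always_eventually, rule allI)
      fix k
      have "norm (T1 k) \<le> (\<integral>x. norm (a (\<psi> k x) * ((gradient (\<psi> k) x - weak_grad \<Omega> f x) \<bullet> gradient l x)) \<partial>?M)"
        unfolding T1_def by (rule integral_norm_bound)
      also have "\<dots> \<le> (\<integral>x. K * M1 * norm (gradient (\<psi> k) x - weak_grad \<Omega> f x) \<partial>?M)"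
        using i1[of k] intg\<psi>[of k] intgf bd by (intro integral_mono) auto
      finally show "norm (T1 k) \<le> K * M1 * (\<integral>x. norm (gradient (\<psi> k) x - weak_grad \<Omega> f x) \<partial>?M)" by simp
    qed
    show "(\<lambda>k. K * M1 * (\<integral>x. norm (gradient (\<psi> k) x - weak_grad \<Omega> f x) \<partial>?M)) \<longlonglongrightarrow> 0"
      using tendsto_mult[OF tendsto_const G1, of "K * M1"] by simp
  qed
  have T2: "(\<lambda>k. T2 (\<rho> k)) \<longlonglongrightarrow> (\<integral>x. a (f x) * (weak_grad \<Omega> f x \<bullet> gradient l x) \<partial>?M)"
    unfolding T2_def
  proof (rule integral_dominated_convergence[where w = "\<lambda>x. K * M1 * norm (weak_grad \<Omega> f x)"])
    show "AE x in ?M. (\<lambda>k. a (\<psi> (\<rho> k) x) * (weak_grad \<Omega> f x \<bullet> gradient l x))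
        \<longlonglongrightarrow> a (f x) * (weak_grad \<Omega> f x \<bullet> gradient l x)"
      using \<rho>(2)
    proof eventually_elim
      case (elim x)
      then have "(\<lambda>k. \<psi> (\<rho> k) x) \<longlonglongrightarrow> f x" by (simp add: LIM_zero_iff)
      then have "(\<lambda>k. a (\<psi> (\<rho> k) x)) \<longlonglongrightarrow> a (f x)"
        using a by (intro isCont_tendsto_compose[of _ a]) (simp_all add: continuous_on_eq_continuous_at)
      then show ?case by (intro tendsto_mult tendsto_const)
    qed
  qed (use intgf bd in \<open>auto intro!: AE_I2\<close>)
  have T3: "T3 \<longlonglongrightarrow> (\<integral>x. A (f x) * laplacian l x \<partial>?M)"
  proof -
    have "(\<lambda>k. T3 k - (\<integral>x. A (f x) * laplacian l x \<partial>?M)) \<longlonglongrightarrow> 0"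
    proof (rule Lim_null_comparison)
      show "\<forall>\<^sub>F k in sequentially. norm (T3 k - (\<integral>x. A (f x) * laplacian l x \<partial>?M)) \<le> M2 * K * (\<integral>x. norm (\<psi> k x - f x) \<partial>?M)"
      proof (rule always_eventually, rule allI)
        fix k
        have "T3 k - (\<integral>x. A (f x) * laplacian l x \<partial>?M) = (\<integral>x. (A (\<psi> k x) - A (f x)) * laplacian l x \<partial>?M)"
          using iA[OF int\<psi>, of k] iA[OF intf] by (simp add: T3_def left_diff_distrib)
        also have "norm \<dots> \<le> (\<integral>x. norm ((A (\<psi> k x) - A (f x)) * laplacian l x) \<partial>?M)"
          by (rule integral_norm_bound)
        also have "\<dots> \<le> (\<integral>x. M2 * K * norm (\<psi> k x - f x) \<partial>?M)"
        proof (rule integral_mono)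
          show "integrable ?M (\<lambda>x. norm ((A (\<psi> k x) - A (f x)) * laplacian l x))"
            using iA[OF int\<psi>, of k] iA[OF intf] by (simp add: left_diff_distrib)
          show "integrable ?M (\<lambda>x. M2 * K * norm (\<psi> k x - f x))" using int\<psi>[of k] intf by simp
          fix x assume "x \<in> space ?M"
          then have "norm ((A (\<psi> k x) - A (f x)) * laplacian l x) \<le> M2 * \<bar>A (\<psi> k x) - A (f x)\<bar>" using bl by simp
          also have "\<dots> \<le> M2 * (K * \<bar>\<psi> k x - f x\<bar>)" using lipA M2(1) by (intro mult_left_mono) auto
          finally show "norm ((A (\<psi> k x) - A (f x)) * laplacian l x) \<le> M2 * K * norm (\<psi> k x - f x)" by simp
        qed
        finally show "norm (T3 k - (\<integral>x. A (f x) * laplacian l x \<partial>?M)) \<le> M2 * K * (\<integral>x. norm (\<psi> k x - f x) \<partial>?M)" by simp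
      qed
      show "(\<lambda>k. M2 * K * (\<integral>x. norm (\<psi> k x - f x) \<partial>?M)) \<longlonglongrightarrow> 0"
        using tendsto_mult[OF tendsto_const L1, of "M2 * K"] by simp
    qed
    then show ?thesis by (simp add: LIM_zero_iff)
  qed
  let ?dl = "\<lambda>x. frechet_derivative l (at x) e"
  let ?B = "\<lambda>g. \<integral>x. indicator slab x * (A (g (proj x)) * ?dl (proj x)) \<partial>lborel"
  have dl0: "?dl x = 0" if "x \<notin> cball p (r / 2)" for x
    by (rule frechet_derivative_outside_support[of "ball p (r / 2)"]) (use l that r_pos in auto)
  have cdl: "continuous_on UNIV ?dl" using l(1) by (intro smooth_continuous_on smooth_frechet_derivative)
  obtain M3 where M3: "\<And>x. \<bar>?dl x\<bar> \<le> M3"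
    using bounded_continuous_bounded_support[OF cdl bounded_cball dl0] by metis
  have iB: "integrable lborel (\<lambda>x. indicator slab x * (A (g (proj x)) * ?dl (proj x)))" if "continuous_on UNIV g" for g
    using dl0 by (intro integrable_slab[OF _ bounded_cball[of p "r / 2"] _ e_Basis] continuous_intros cdl
        continuous_on_compose2[OF cA that]) auto
  have B: "(\<lambda>k. ?B (\<psi> k)) \<longlonglongrightarrow> ?B \<gamma>"
  proof -
    obtain X where X: "emeasure (surface_measure \<Omega>) X \<noteq> 0" using surface_nonzero by blast
    obtain C where C: "C \<ge> 0"
      "\<And>F :: 'a \<Rightarrow> real. F \<in> borel_measurable borel \<Longrightarrow> (\<And>x. x \<bullet> e = p \<bullet> e \<Longrightarrow> x \<notin> frontier \<Omega> \<Longrightarrow> F x = 0) \<Longrightarrow>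
      integrable (surface_measure \<Omega>) F \<Longrightarrow>
      (\<integral>x. indicator slab x * \<bar>F (proj x)\<bar> \<partial>lborel) \<le> C * (\<integral>x. \<bar>F x\<bar> \<partial>surface_measure \<Omega>)"
      using slab_integral_le_surface_integral[OF e_Basis dim X, of "p \<bullet> e"] by blast
    define F where "F = (\<lambda>k x. (\<psi> k x - \<gamma> x) * ?dl x)"
    have cd: "continuous_on UNIV (\<lambda>x. \<psi> k x - \<gamma> x)" for k
      by (rule continuous_on_diff[OF smooth_continuous_on[OF \<psi>(1)] \<gamma>])
    have cF: "continuous_on UNIV (F k)" for k
      unfolding F_def by (intro continuous_on_mult cd cdl)
    have d2: "(\<lambda>x. \<psi> k x - \<gamma> x) \<in> L2 (surface_measure \<Omega>)" for k
      using cd by (rule continuous_L2_surface)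
    have bound: "\<bar>?B (\<psi> k) - ?B \<gamma>\<bar> \<le> K * C * M3 * (\<integral>x. norm (\<psi> k x - \<gamma> x) \<partial>surface_measure \<Omega>)" for k
    proof -
      have iB\<psi>: "integrable lborel (\<lambda>x. indicator slab x * (A (\<psi> k (proj x)) * ?dl (proj x)))"
        by (rule iB[OF smooth_continuous_on[OF \<psi>(1)]])
      have iB\<gamma>: "integrable lborel (\<lambda>x. indicator slab x * (A (\<gamma> (proj x)) * ?dl (proj x)))"
        by (rule iB[OF \<gamma>])
      have diff: "?B (\<psi> k) - ?B \<gamma> = (\<integral>x. indicator slab x * (A (\<psi> k (proj x)) * ?dl (proj x))
          - indicator slab x * (A (\<gamma> (proj x)) * ?dl (proj x)) \<partial>lborel)"
        by (rule Bochner_Integration.integral_diff[OF iB\<psi> iB\<gamma>, symmetric])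
      have "\<bar>?B (\<psi> k) - ?B \<gamma>\<bar> \<le> (\<integral>x. \<bar>indicator slab x * (A (\<psi> k (proj x)) * ?dl (proj x))
          - indicator slab x * (A (\<gamma> (proj x)) * ?dl (proj x))\<bar> \<partial>lborel)"
        unfolding diff by (rule integral_abs_bound)
      also have "\<dots> \<le> (\<integral>x. K * (indicator slab x * \<bar>F k (proj x)\<bar>) \<partial>lborel)"
      proof (rule integral_mono)
        show "integrable lborel (\<lambda>x. \<bar>indicator slab x * (A (\<psi> k (proj x)) * ?dl (proj x))
          - indicator slab x * (A (\<gamma> (proj x)) * ?dl (proj x))\<bar>)"
          by (rule integrable_abs, rule Bochner_Integration.integrable_diff, rule iB\<psi>, rule iB\<gamma>)
        show "integrable lborel (\<lambda>x. K * (indicator slab x * \<bar>F k (proj x)\<bar>))"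
          by (rule integrable_mult_right, rule integrable_slab[OF continuous_on_rabs[OF cF[of k]] bounded_cball[of p "r / 2"] _ e_Basis])
            (simp add: F_def dl0)
        fix x
        have "\<bar>A (\<psi> k (proj x)) * ?dl (proj x) - A (\<gamma> (proj x)) * ?dl (proj x)\<bar>
            = \<bar>A (\<psi> k (proj x)) - A (\<gamma> (proj x))\<bar> * \<bar>?dl (proj x)\<bar>"
          by (simp flip: abs_mult left_diff_distrib)
        also have "\<dots> \<le> (K * \<bar>\<psi> k (proj x) - \<gamma> (proj x)\<bar>) * \<bar>?dl (proj x)\<bar>"
          by (intro mult_right_mono lipA) simp
        finally show "\<bar>indicator slab x * (A (\<psi> k (proj x)) * ?dl (proj x))
          - indicator slab x * (A (\<gamma> (proj x)) * ?dl (proj x))\<bar> \<le> K * (indicator slab x * \<bar>F k (proj x)\<bar>)"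
          by (auto simp: F_def abs_mult indicator_def)
      qed
      also have "\<dots> = K * (\<integral>x. indicator slab x * \<bar>F k (proj x)\<bar> \<partial>lborel)" by simp
      also have "\<dots> \<le> K * (C * (\<integral>x. \<bar>F k x\<bar> \<partial>surface_measure \<Omega>))"
      proof (intro mult_left_mono C(2) K0)
        show "F k \<in> borel_measurable borel" using cF by (rule borel_measurable_continuous_onI)
        show "integrable (surface_measure \<Omega>) (F k)"
          by (rule L2_imp_L1(1)[OF finite_surface continuous_L2_surface[OF cF]])
        fix x assume x: "x \<bullet> e = p \<bullet> e" "x \<notin> frontier \<Omega>"
        \<comment> \<open>Inside the ball the hyperplane consists of boundary points, so
          \<open>x\<close> lies outside, where the derivative of \<open>l\<close> vanishes.\<close>
        have "x \<notin> ball p r"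
          using half_ball_frontier[OF open_domain _ half_ball _ x(1)] x(2) e_Basis by auto
        then show "F k x = 0" using dl0[of x] r_pos by (simp add: F_def)
      qed
      finally have b1: "\<bar>?B (\<psi> k) - ?B \<gamma>\<bar> \<le> K * (C * (\<integral>x. \<bar>F k x\<bar> \<partial>surface_measure \<Omega>))" .
      have b2: "(\<integral>x. \<bar>F k x\<bar> \<partial>surface_measure \<Omega>) \<le> (\<integral>x. M3 * norm (\<psi> k x - \<gamma> x) \<partial>surface_measure \<Omega>)"
      proof (rule integral_mono)
        show "integrable (surface_measure \<Omega>) (\<lambda>x. \<bar>F k x\<bar>)"
          using L2_imp_L1(1)[OF finite_surface continuous_L2_surface[OF cF]] by simp
        show "integrable (surface_measure \<Omega>) (\<lambda>x. M3 * norm (\<psi> k x - \<gamma> x))"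
          using L2_imp_L1(1)[OF finite_surface d2] by simp
        show "\<bar>F k x\<bar> \<le> M3 * norm (\<psi> k x - \<gamma> x)" for x
          using mult_left_mono[OF M3[of x], of "\<bar>\<psi> k x - \<gamma> x\<bar>"] by (simp add: F_def abs_mult mult.commute)
      qed
      have "K * (C * (\<integral>x. \<bar>F k x\<bar> \<partial>surface_measure \<Omega>)) \<le> K * (C * (\<integral>x. M3 * norm (\<psi> k x - \<gamma> x) \<partial>surface_measure \<Omega>))"
        by (intro mult_left_mono b2 C(1) K0)
      with b1 show ?thesis by (simp add: mult_ac)
    qed
    have "(\<lambda>k. ?B (\<psi> k) - ?B \<gamma>) \<longlonglongrightarrow> 0"
    proof (rule Lim_null_comparison)
      show "\<forall>\<^sub>F k in sequentially. norm (?B (\<psi> k) - ?B \<gamma>) \<le> K * C * M3 * (\<integral>x. norm (\<psi> k x - \<gamma> x) \<partial>surface_measure \<Omega>)"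
        using bound by simp
      show "(\<lambda>k. K * C * M3 * (\<integral>x. norm (\<psi> k x - \<gamma> x) \<partial>surface_measure \<Omega>)) \<longlonglongrightarrow> 0"
        using tendsto_mult[OF tendsto_const L2_norm_tendsto_0_imp_L1[OF finite_surface d2 \<psi>(3)], of "K * C * M3"] by simp
    qed
    then show ?thesis by (simp add: LIM_zero_iff)
  qed
  have "T1 k + T2 k + T3 k = ?B (\<psi> k)" for k
  proof -
    have "T1 k + T2 k + T3 k = (\<integral>x. a (\<psi> k x) * ((gradient (\<psi> k) x - weak_grad \<Omega> f x) \<bullet> gradient l x)
        + a (\<psi> k x) * (weak_grad \<Omega> f x \<bullet> gradient l x) + A (\<psi> k x) * laplacian l x \<partial>?M)"
      using i1[of k] i2[of k] iA[OF int\<psi>, of k] by (simp add: T1_def T2_def T3_def)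
    also have "\<dots> = (\<integral>x. a (\<psi> k x) * (gradient (\<psi> k) x \<bullet> gradient l x) + A (\<psi> k x) * laplacian l x \<partial>?M)"
      by (intro Bochner_Integration.integral_cong refl) (simp add: inner_diff_left algebra_simps)
    finally show ?thesis
      using divergence_identity_smooth[OF \<psi>(1) l A a] by simp
  qed
  then have "(\<lambda>k. ?B (\<psi> (\<rho> k))) \<longlonglongrightarrow> 0 + (\<integral>x. a (f x) * (weak_grad \<Omega> f x \<bullet> gradient l x) \<partial>?M)
      + (\<integral>x. A (f x) * laplacian l x \<partial>?M)"
    using tendsto_add[OF tendsto_add[OF LIMSEQ_subseq_LIMSEQ[OF T1 \<rho>(1)] T2] LIMSEQ_subseq_LIMSEQ[OF T3 \<rho>(1)]]
    by (simp add: o_def)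
  from LIMSEQ_unique[OF this LIMSEQ_subseq_LIMSEQ[OF B \<rho>(1), unfolded o_def]]
  show ?thesis by simp
qed

end

section \<open>A regularised dipole potential\<close>

text \<open>Written with \<open>powr (-1)\<close> to fall under the smoothness of real powers of
  positive functions. The transition ends at 1/2, so a regularisation at scale \<epsilon> leaves all
  points with squared distance at least \<epsilon>^2 / 2 unaffected.\<close>

definition smooth_step :: "real \<Rightarrow> real" where
  "smooth_step s = flat_exp 0 s * (flat_exp 0 s + flat_exp 0 (1/2 - s)) powr (-1)"

lemma smooth_step_denominator: "flat_exp 0 s + flat_exp 0 (1/2 - s) > 0"
  using flat_exp_pos[of s 0] flat_exp_pos[of "1/2 - s" 0] flat_exp_nonneg[of 0 s] flat_exp_nonneg[of 0 "1/2 - s"]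
  by (cases "s > 0") linarith+

lemma smooth_smooth_step: "smooth smooth_step"
proof -
  have "smooth (\<lambda>s::real. flat_exp 0 (1/2 - s))"
    by (rule smooth_compose[OF smooth_flat_exp smooth_diff[OF smooth_const smooth_ident]])
  then show ?thesis
    unfolding smooth_step_def[abs_def]
    by (rule smooth_mult[OF smooth_flat_exp smooth_powr[OF smooth_add[OF smooth_flat_exp] smooth_step_denominator]])
qed

lemma smooth_step_bounds: "0 \<le> smooth_step s" "smooth_step s \<le> 1"
  and smooth_step_eq_1: "s \<ge> 1/2 \<Longrightarrow> smooth_step s = 1"
  and smooth_step_eq_0: "s \<le> 0 \<Longrightarrow> smooth_step s = 0"
  using smooth_step_denominator[of s] flat_exp_nonneg[of 0 s] flat_exp_nonneg[of 0 "1/2 - s"]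
    flat_exp_0[of "1/2 - s" 0] flat_exp_0[of s 0]
  by (auto simp: smooth_step_def powr_minus_divide)

text \<open>Interpolates between the constant 1 and the identity, which keeps it positive; negative
  powers of it are therefore smooth even across the pole.\<close>

definition positive_id :: "real \<Rightarrow> real" where
  "positive_id s = s * smooth_step s + (1 - smooth_step s)"

lemma smooth_positive_id: "smooth positive_id"
  unfolding positive_id_def[abs_def]
  by (rule smooth_add[OF smooth_mult[OF smooth_ident smooth_smooth_step] smooth_diff[OF smooth_const smooth_smooth_step]])

lemma positive_id_pos: "positive_id s > 0"
proof (cases "s > 0")
  case True
  show ?thesis
  proof (cases "smooth_step s = 0")
    case False
    then have "0 < s * smooth_step s" using True smooth_step_bounds(1)[of s] by simp
    then show ?thesis using smooth_step_bounds(2)[of s] by (simp add: positive_id_def)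
  qed (simp add: positive_id_def)
qed (simp add: positive_id_def smooth_step_eq_0)

lemma positive_id_eq: "s \<ge> 1/2 \<Longrightarrow> positive_id s = s"
  by (simp add: positive_id_def smooth_step_eq_1)

text \<open>The harmonic dipole potential \<open>(x - q) \<bullet> e / |x - q|\<^sup>N\<close>, altered close to the pole to be smooth everywhere.\<close>

definition dipole :: "'a::euclidean_space \<Rightarrow> 'a \<Rightarrow> real \<Rightarrow> 'a \<Rightarrow> real" where
  "dipole e q \<epsilon> x = ((x - q) \<bullet> e) *
     (\<epsilon>\<^sup>2 * positive_id (inverse (\<epsilon>\<^sup>2) * ((x - q) \<bullet> (x - q)))) powr (- real DIM('a) / 2)"

lemma smooth_dipole:
  assumes "\<epsilon> > 0"
  shows "smooth (dipole e q \<epsilon>)"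
proof -
  have "smooth (\<lambda>x. \<epsilon>\<^sup>2 * positive_id (inverse (\<epsilon>\<^sup>2) * ((x - q) \<bullet> (x - q))))"
    by (rule smooth_cmult[OF smooth_compose[OF smooth_positive_id smooth_cmult[OF smooth_norm_square]]])
  then show ?thesis
    unfolding dipole_def[abs_def]
    by (rule smooth_mult[OF smooth_inner_right smooth_powr]) (use assms positive_id_pos in auto)
qed

lemma dipole_eq:
  assumes "\<epsilon> > 0" "(x - q) \<bullet> (x - q) \<ge> \<epsilon>\<^sup>2 / 2"
  shows "dipole e q \<epsilon> (x :: 'a::euclidean_space) = ((x - q) \<bullet> e) * ((x - q) \<bullet> (x - q)) powr (- real DIM('a) / 2)"
  using assms positive_id_eq[of "inverse (\<epsilon>\<^sup>2) * ((x - q) \<bullet> (x - q))"]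
  by (simp add: dipole_def field_simps)

lemma has_derivative_powr_const:
  fixes f :: "'a::real_normed_vector \<Rightarrow> real"
  assumes "(f has_derivative f') (at x)" "f x > 0"
  shows "((\<lambda>x. f x powr s) has_derivative (\<lambda>v. f' v * (s * f x powr (s - 1)))) (at x)"
proof -
  have "((\<lambda>y. y powr s) has_derivative (\<lambda>t. t * (s * f x powr (s - 1)))) (at (f x))"
    using has_real_derivative_powr[OF assms(2), of s]
    unfolding has_field_derivative_def by (subst mult.commute)
  then show ?thesis
    by (rule has_derivative_compose[OF assms(1)])
qed

text \<open>On \<open>U\<close> the regularisation is inactive, and every point at distance at least
  \<epsilon> from the pole lies in \<open>U\<close>.\<close>

context
  fixes e q :: "'a::euclidean_space" and \<epsilon> s N :: real
  assumes e: "e \<in> Basis" and \<epsilon>: "\<epsilon> > 0" and N: "N = real DIM('a)" and s: "s = - N / 2"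
begin

private abbreviation (input) "Q x \<equiv> (x - q) \<bullet> (x - q)"
private abbreviation (input) "U \<equiv> {x. \<epsilon>\<^sup>2 / 2 < (x - q) \<bullet> (x - q)}"

lemma open_U: "open U"
  by (intro open_Collect_less continuous_intros)

lemma Q_pos: "x \<in> U \<Longrightarrow> Q x > 0"
  using \<epsilon> zero_less_power[of \<epsilon> 2] by (auto intro: less_trans[rotated])

lemma Q_powr_derivative: "x \<in> U \<Longrightarrow>
    ((\<lambda>x. Q x powr k) has_derivative (\<lambda>v. (2 * ((x - q) \<bullet> v)) * (k * Q x powr (k - 1)))) (at x)"
  by (rule has_derivative_powr_const)
    (auto intro!: derivative_eq_intros Q_pos simp: inner_commute)

lemma dipole_derivative:
  assumes x: "x \<in> U"
  shows "frechet_derivative (dipole e q \<epsilon>) (at x) v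
    = (v \<bullet> e) * Q x powr s + ((x - q) \<bullet> e) * (2 * s * ((x - q) \<bullet> v) * Q x powr (s - 1))"
proof -
  have "((\<lambda>x. ((x - q) \<bullet> e) * Q x powr s) has_derivative
      (\<lambda>v. ((x - q) \<bullet> e) * ((2 * ((x - q) \<bullet> v)) * (s * Q x powr (s - 1))) + (v \<bullet> e) * Q x powr s)) (at x)"
    by (rule has_derivative_mult[OF _ Q_powr_derivative[OF x]]) (auto intro!: derivative_eq_intros)
  then have "(dipole e q \<epsilon> has_derivative
      (\<lambda>v. ((x - q) \<bullet> e) * ((2 * ((x - q) \<bullet> v)) * (s * Q x powr (s - 1))) + (v \<bullet> e) * Q x powr s)) (at x)"
    by (rule has_derivative_transform_within_open[OF _ open_U x]) (simp add: dipole_eq[OF \<epsilon>] s N)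
  from frechet_derivative_eqI[OF this, of v] show ?thesis by (simp add: algebra_simps)
qed

lemma dipole_second_derivative:
  assumes x: "x \<in> U"
  shows "frechet_derivative (\<lambda>x. frechet_derivative (dipole e q \<epsilon>) (at x) v) (at x) v
    = 4 * s * ((v \<bullet> e) * ((x - q) \<bullet> v)) * Q x powr (s - 1)
      + ((x - q) \<bullet> e) * (2 * s * ((v \<bullet> v) * Q x powr (s - 1)
        + 2 * (s - 1) * ((x - q) \<bullet> v)\<^sup>2 * Q x powr (s - 2)))"
proof -
  let ?f = "\<lambda>x. (v \<bullet> e) * Q x powr s + ((x - q) \<bullet> e) * ((2 * s * ((x - q) \<bullet> v)) * Q x powr (s - 1))"
  have l1: "((\<lambda>x. (v \<bullet> e) * Q x powr s) has_derivative (\<lambda>w. (v \<bullet> e) * ((2 * ((x - q) \<bullet> w)) * (s * Q x powr (s - 1))))) (at x)"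
    by (rule has_derivative_mult_right[OF Q_powr_derivative[OF x]])
  have l2: "((\<lambda>x. 2 * s * ((x - q) \<bullet> v)) has_derivative (\<lambda>w. 2 * s * (w \<bullet> v))) (at x)"
    by (rule has_derivative_mult_right) (auto intro!: derivative_eq_intros)
  have l3: "((\<lambda>x. (x - q) \<bullet> e) has_derivative (\<lambda>w. w \<bullet> e)) (at x)"
    by (auto intro!: derivative_eq_intros)
  note has_derivative_add[OF l1 has_derivative_mult[OF l3 has_derivative_mult[OF l2 Q_powr_derivative[OF x, of "s - 1"]]]]
  then have "((\<lambda>x. frechet_derivative (dipole e q \<epsilon>) (at x) v) has_derivative
      (\<lambda>w. (v \<bullet> e) * ((2 * ((x - q) \<bullet> w)) * (s * Q x powr (s - 1)))
        + (((x - q) \<bullet> e) * ((2 * s * ((x - q) \<bullet> v)) * ((2 * ((x - q) \<bullet> w)) * ((s - 1) * Q x powr (s - 1 - 1)))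
            + 2 * s * (w \<bullet> v) * Q x powr (s - 1))
          + (w \<bullet> e) * ((2 * s * ((x - q) \<bullet> v)) * Q x powr (s - 1))))) (at x)"
    by (rule has_derivative_transform_within_open[OF _ open_U x]) (simp add: dipole_derivative)
  from frechet_derivative_eqI[OF this, of v] show ?thesis
    by (simp add: algebra_simps power2_eq_square)
qed

text \<open>Summation over the basis leaves the factor 2s(N + 2s), which vanishes for s =
  -N/2.\<close>

lemma laplacian_dipole:
  assumes x: "x \<in> U"
  shows "laplacian (dipole e q \<epsilon>) x = 0"
proof -
  define y where "y = x - q"
  have S1: "(\<Sum>v\<in>Basis. (v \<bullet> e) * (y \<bullet> v)) = y \<bullet> e"
    by (subst (2) euclidean_inner) (simp add: inner_commute mult.commute)
  have S2: "(\<Sum>v\<in>Basis. (y \<bullet> v)\<^sup>2) = Q x"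
    unfolding y_def[symmetric] by (subst euclidean_inner) (simp add: power2_eq_square)
  have S3: "(\<Sum>v\<in>Basis. (v :: 'a) \<bullet> v) = N" by (simp add: N)
  have P: "Q x powr (s - 2) * Q x = Q x powr (s - 1)"
    using Q_pos[OF x] powr_mult_base[of "Q x" "s - 2"] by (simp add: mult.commute)
  have "laplacian (dipole e q \<epsilon>) x = (\<Sum>v\<in>Basis. 4 * s * Q x powr (s - 1) * ((v \<bullet> e) * (y \<bullet> v))
      + (y \<bullet> e) * (2 * s) * Q x powr (s - 1) * (v \<bullet> v)
      + (y \<bullet> e) * (2 * s) * (2 * (s - 1)) * Q x powr (s - 2) * (y \<bullet> v)\<^sup>2)"
    unfolding laplacian_def dipole_second_derivative[OF x] y_def
    by (intro sum.cong refl) (simp add: algebra_simps)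
  also have "\<dots> = 4 * s * Q x powr (s - 1) * (y \<bullet> e) + (y \<bullet> e) * (2 * s) * Q x powr (s - 1) * N
      + (y \<bullet> e) * (2 * s) * (2 * (s - 1)) * (Q x powr (s - 2) * Q x)"
    unfolding sum.distrib sum_distrib_left[symmetric] S1 S2 S3 by (simp add: mult.assoc)
  also have "\<dots> = 0" unfolding P by (simp add: s field_simps)
  finally show ?thesis .
qed

text \<open>\<open>Q x powr s\<close> is |x - q|^(-N), the borderline weight whose integral diverges
  only logarithmically at the pole.\<close>

lemma dipole_bounds:
  assumes x: "x \<in> U"
  shows "\<bar>dipole e q \<epsilon> x\<bar> \<le> norm (x - q) * Q x powr s"
    and "v \<in> Basis \<Longrightarrow> \<bar>frechet_derivative (dipole e q \<epsilon>) (at x) v\<bar> \<le> (1 + N) * Q x powr s"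
proof -
  have y: "\<bar>(x - q) \<bullet> v\<bar> \<le> norm (x - q)" if "v \<in> Basis" for v
    using that by (rule Basis_le_norm)
  show "\<bar>dipole e q \<epsilon> x\<bar> \<le> norm (x - q) * Q x powr s"
    using y[OF e] x dipole_eq[OF \<epsilon>, of x q e] by (simp add: abs_mult mult_right_mono s N)
  assume v: "v \<in> Basis"
  have "\<bar>(x - q) \<bullet> e\<bar> * \<bar>(x - q) \<bullet> v\<bar> \<le> norm (x - q) * norm (x - q)"
    by (intro mult_mono y e v) auto
  then have yy: "\<bar>(x - q) \<bullet> e\<bar> * \<bar>(x - q) \<bullet> v\<bar> \<le> Q x" by (simp add: dot_square_norm power2_eq_square)
  have P: "Q x * Q x powr (s - 1) = Q x powr s"
    using Q_pos[OF x] powr_mult_base[of "Q x" "s - 1"] by simp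
  have "\<bar>((x - q) \<bullet> e) * (2 * s * ((x - q) \<bullet> v) * Q x powr (s - 1))\<bar>
      = N * ((\<bar>(x - q) \<bullet> e\<bar> * \<bar>(x - q) \<bullet> v\<bar>) * Q x powr (s - 1))"
    using N by (simp add: abs_mult s)
  also have "\<dots> \<le> N * (Q x * Q x powr (s - 1))"
    by (intro mult_left_mono mult_right_mono yy) (auto simp: N)
  finally have "\<bar>((x - q) \<bullet> e) * (2 * s * ((x - q) \<bullet> v) * Q x powr (s - 1))\<bar> \<le> N * Q x powr s"
    unfolding P .
  moreover have "\<bar>(v \<bullet> e) * Q x powr s\<bar> \<le> 1 * Q x powr s"
    unfolding abs_mult using e v by (intro mult_mono) (auto simp: inner_Basis)
  ultimately show "\<bar>frechet_derivative (dipole e q \<epsilon>) (at x) v\<bar> \<le> (1 + N) * Q x powr s"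
    unfolding dipole_derivative[OF x] by (simp add: algebra_simps)
qed

end

section \<open>The singular test functions\<close>

text \<open>Being radial about \<open>p\<close>, it has zero derivative along \<open>e\<close> on
  the hyperplane through \<open>p\<close>, so there it multiplies the normal derivative of the
  dipole without adding a term. A positive lower bound near \<open>p\<close> takes the place of a
  plateau.\<close>

definition radial_cutoff :: "'a::euclidean_space \<Rightarrow> real \<Rightarrow> 'a \<Rightarrow> real" where
  "radial_cutoff p r x = flat_exp 0 ((r / 2)\<^sup>2 - (x - p) \<bullet> (x - p))"

lemma smooth_radial_cutoff: "smooth (radial_cutoff p r)"
  unfolding radial_cutoff_def[abs_def]
  by (rule smooth_compose[OF smooth_flat_exp smooth_diff[OF smooth_const smooth_norm_square]])

lemma radial_cutoff_outside:
  assumes "x \<notin> ball p (r / 2)" "r > 0"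
  shows "radial_cutoff p r x = 0"
proof -
  have "r / 2 \<le> norm (x - p)" using assms(1) by (simp add: dist_norm norm_minus_commute)
  then have "(r / 2)\<^sup>2 \<le> (norm (x - p))\<^sup>2" using assms(2) by (intro power_mono) auto
  then show ?thesis by (simp add: radial_cutoff_def dot_square_norm flat_exp_0)
qed

lemma radial_cutoff_derivative:
  "frechet_derivative (radial_cutoff p r) (at x) v
    = (- 2 * ((x - p) \<bullet> v)) * frechet_derivative (flat_exp 0) (at ((r / 2)\<^sup>2 - (x - p) \<bullet> (x - p))) 1"
proof -
  let ?g = "\<lambda>x. (r / 2)\<^sup>2 - (x - p) \<bullet> (x - p)"
  let ?d = "frechet_derivative (flat_exp 0) (at (?g x))"
  have "(?g has_derivative (\<lambda>v. - 2 * ((x - p) \<bullet> v))) (at x)"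
    by (auto intro!: derivative_eq_intros simp: inner_commute)
  from has_derivative_compose[OF this smooth_has_derivative[OF smooth_flat_exp[of 0]]]
  have "(radial_cutoff p r has_derivative (\<lambda>v. ?d (- 2 * ((x - p) \<bullet> v)))) (at x)"
    unfolding radial_cutoff_def[abs_def] .
  moreover have "?d t = t * ?d 1" for t
    using linear_scale[OF has_derivative_linear[OF smooth_has_derivative[OF smooth_flat_exp[of 0]]], of "?g x" t 1] by simp
  ultimately show ?thesis by (metis frechet_derivative_eqI)
qed

text \<open>r / 2^n is at once the distance of the pole from the hyperplane and the scale of the
  regularisation, so the dipole is unaltered on the near side of the hyperplane. Dyadic distances
  turn the logarithm of the bounds into a count of shells.\<close>

definition singular_test :: "'a::euclidean_space \<Rightarrow> 'a \<Rightarrow> real \<Rightarrow> nat \<Rightarrow> 'a \<Rightarrow> real" where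
  "singular_test e p r n x = radial_cutoff p r x * dipole e (p + (r / 2 ^ n) *\<^sub>R e) (r / 2 ^ n) x"

lemma smooth_singular_test: "r > 0 \<Longrightarrow> smooth (singular_test e p r n)"
  unfolding singular_test_def[abs_def] by (rule smooth_mult[OF smooth_radial_cutoff smooth_dipole]) simp

lemma singular_test_outside:
  "x \<notin> ball p (r / 2) \<Longrightarrow> r > 0 \<Longrightarrow> singular_test e p r n x = 0"
  by (simp add: singular_test_def radial_cutoff_outside)

text \<open>Grouped so that \<open>laplacian g\<close> stands alone; it drops out where
  \<open>g\<close> is the dipole.\<close>

lemma laplacian_mult:
  fixes f g :: "'a::euclidean_space \<Rightarrow> real"
  assumes "smooth f" "smooth g"
  shows "laplacian (\<lambda>x. f x * g x) x = f x * laplacian g x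
    + (\<Sum>i\<in>Basis. 2 * (frechet_derivative f (at x) i * frechet_derivative g (at x) i)
        + frechet_derivative (\<lambda>x. frechet_derivative f (at x) i) (at x) i * g x)"
proof -
  note d = smooth_differentiable[OF assms(1)] smooth_differentiable[OF assms(2)]
    smooth_differentiable[OF smooth_frechet_derivative[OF assms(1)]] smooth_differentiable[OF smooth_frechet_derivative[OF assms(2)]]
  have "frechet_derivative (\<lambda>x. frechet_derivative (\<lambda>x. f x * g x) (at x) i) (at x) i
      = f x * frechet_derivative (\<lambda>x. frechet_derivative g (at x) i) (at x) i
        + (2 * (frechet_derivative f (at x) i * frechet_derivative g (at x) i)
        + frechet_derivative (\<lambda>x. frechet_derivative f (at x) i) (at x) i * g x)" for i
  proof -
    have 1: "frechet_derivative (\<lambda>x. f x * g x) (at x) i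
        = f x * frechet_derivative g (at x) i + frechet_derivative f (at x) i * g x" for x
      by (rule frechet_derivative_mult[OF d(1,2)])
    have "((\<lambda>x. f x * frechet_derivative g (at x) i + frechet_derivative f (at x) i * g x) has_derivative
        (\<lambda>v. (f x * frechet_derivative (\<lambda>x. frechet_derivative g (at x) i) (at x) v + frechet_derivative f (at x) v * frechet_derivative g (at x) i)
          + (frechet_derivative f (at x) i * frechet_derivative g (at x) v + frechet_derivative (\<lambda>x. frechet_derivative f (at x) i) (at x) v * g x))) (at x)"
      by (intro has_derivative_add has_derivative_mult smooth_has_derivative[OF assms(1)] smooth_has_derivative[OF assms(2)]
          smooth_has_derivative[OF smooth_frechet_derivative[OF assms(1)]] smooth_has_derivative[OF smooth_frechet_derivative[OF assms(2)]])
    from frechet_derivative_eqI[OF this, of i] show ?thesis unfolding 1 by simp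
  qed
  then show ?thesis
    by (simp add: laplacian_def sum.distrib sum_distrib_left)
qed

lemma uniform_bound_Basis:
  fixes F :: "'a::euclidean_space \<Rightarrow> 'a \<Rightarrow> real"
  assumes "\<And>i. i \<in> Basis \<Longrightarrow> \<exists>M. \<forall>x. \<bar>F i x\<bar> \<le> M"
  shows "\<exists>M\<ge>0. \<forall>i\<in>Basis. \<forall>x. \<bar>F i x\<bar> \<le> M"
proof -
  obtain M where M: "\<And>i x. i \<in> Basis \<Longrightarrow> \<bar>F i x\<bar> \<le> M i" using assms by metis
  have M0: "M i \<ge> 0" if "i \<in> Basis" for i using M[OF that, of 0] by linarith
  have "\<bar>F i x\<bar> \<le> sum M Basis" if "i \<in> Basis" for i x
    using M[OF that, of x] member_le_sum[of i Basis M] that M0 by fastforce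
  moreover have "sum M Basis \<ge> 0" using M0 by (simp add: sum_nonneg)
  ultimately show ?thesis by blast
qed

text \<open>First derivatives of the dipole have the critical size |x - q|^(-N), and the dipole
  itself is smaller by a factor |x - q| < 2r. The Laplacian obeys the same bound because harmonicity
  removes the second derivatives and leaves only products with derivatives of the cutoff.\<close>

lemma singular_test_pointwise_bounds:
  fixes e p :: "'a::euclidean_space"
  assumes e: "e \<in> Basis" and r: "r > 0"
  obtains M where "M \<ge> 0"
    "\<And>n x. x \<bullet> e \<le> p \<bullet> e \<Longrightarrow> x \<in> cball p (r / 2) \<Longrightarrow>
      \<bar>singular_test e p r n x\<bar> \<le> M * ((x - (p + (r / 2 ^ n) *\<^sub>R e)) \<bullet> (x - (p + (r / 2 ^ n) *\<^sub>R e))) powr (- real DIM('a) / 2) \<and>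
      norm (gradient (singular_test e p r n) x) \<le> M * ((x - (p + (r / 2 ^ n) *\<^sub>R e)) \<bullet> (x - (p + (r / 2 ^ n) *\<^sub>R e))) powr (- real DIM('a) / 2) \<and>
      \<bar>laplacian (singular_test e p r n) x\<bar> \<le> M * ((x - (p + (r / 2 ^ n) *\<^sub>R e)) \<bullet> (x - (p + (r / 2 ^ n) *\<^sub>R e))) powr (- real DIM('a) / 2) \<and>
      r / 2 ^ n \<le> norm (x - (p + (r / 2 ^ n) *\<^sub>R e)) \<and> norm (x - (p + (r / 2 ^ n) *\<^sub>R e)) < 2 * r"
proof -
  let ?\<eta> = "radial_cutoff p r" and ?N = "real DIM('a)"
  note sm = smooth_radial_cutoff[of p r]
  have bd: "\<exists>M. \<forall>x. \<bar>f x\<bar> \<le> M" if f: "smooth f" "\<And>x. x \<notin> cball p (r / 2) \<Longrightarrow> f x = 0" for f :: "'a \<Rightarrow> real"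
    using bounded_continuous_bounded_support[OF smooth_continuous_on[OF f(1)] bounded_cball f(2)] by metis
  have z0: "?\<eta> x = 0" if "x \<notin> cball p (r / 2)" for x
    using that radial_cutoff_outside[of x p r] r by auto
  have z1: "frechet_derivative ?\<eta> (at x) i = 0" if "x \<notin> cball p (r / 2)" for x i
    by (rule frechet_derivative_outside_support[of "cball p (r / 2)"]) (use that z0 in auto)
  have z2: "frechet_derivative (\<lambda>x. frechet_derivative ?\<eta> (at x) i) (at x) i = 0" if "x \<notin> cball p (r / 2)" for x i
    by (rule frechet_derivative_outside_support[of "cball p (r / 2)"]) (use that z1 in auto)
  obtain M0 where M0: "\<And>x. \<bar>?\<eta> x\<bar> \<le> M0" using bd[OF sm z0] by blast
  obtain M1 where M1: "M1 \<ge> 0" "\<And>x i. i \<in> Basis \<Longrightarrow> \<bar>frechet_derivative ?\<eta> (at x) i\<bar> \<le> M1"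
    using uniform_bound_Basis[of "\<lambda>i x. frechet_derivative ?\<eta> (at x) i"] bd[OF smooth_frechet_derivative[OF sm] z1] by blast
  obtain M2 where M2: "M2 \<ge> 0" "\<And>x i. i \<in> Basis \<Longrightarrow> \<bar>frechet_derivative (\<lambda>x. frechet_derivative ?\<eta> (at x) i) (at x) i\<bar> \<le> M2"
    using uniform_bound_Basis[of "\<lambda>i x. frechet_derivative (\<lambda>x. frechet_derivative ?\<eta> (at x) i) (at x) i"]
      bd[OF smooth_frechet_derivative[OF smooth_frechet_derivative[OF sm]] z2] by blast
  have M00: "M0 \<ge> 0" using M0[of p] by linarith
  \<comment> \<open>One summand each for the function, the gradient and the Laplacian;
    \<open>?N\<close> counts the basis directions and 2r bounds the distance to the pole.\<close>
  define M where "M = M0 * (2 * r) + ?N * (M0 * (1 + ?N) + M1 * (2 * r)) + ?N * (2 * (M1 * (1 + ?N)) + M2 * (2 * r))"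
  have parts: "M0 * (2 * r) \<ge> 0" "?N * (M0 * (1 + ?N) + M1 * (2 * r)) \<ge> 0" "?N * (2 * (M1 * (1 + ?N)) + M2 * (2 * r)) \<ge> 0"
    using M00 M1(1) M2(1) r by auto
  show ?thesis
  proof (rule that[of M])
    show "M \<ge> 0" using parts by (simp add: M_def)
    fix n x assume x: "x \<bullet> e \<le> p \<bullet> e" "x \<in> cball p (r / 2)"
    define \<epsilon> where "\<epsilon> = r / 2 ^ n"
    define q where "q = p + \<epsilon> *\<^sub>R e"
    have \<epsilon>: "0 < \<epsilon>" "\<epsilon> \<le> r" using r by (auto simp: \<epsilon>_def divide_le_eq)
    let ?Q = "(x - q) \<bullet> (x - q)"
    have "(x - q) \<bullet> e \<le> - \<epsilon>" using x(1) e by (simp add: q_def inner_diff_left inner_add_left)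
    then have "\<epsilon> \<le> \<bar>(x - q) \<bullet> e\<bar>" using \<epsilon> by linarith
    also have "\<dots> \<le> norm (x - q)" using e by (rule Basis_le_norm)
    finally have ny: "\<epsilon> \<le> norm (x - q)" .
    then have "\<epsilon>\<^sup>2 \<le> ?Q" using \<epsilon> by (simp add: dot_square_norm power_mono)
    moreover have "\<epsilon>\<^sup>2 > 0" using \<epsilon> by simp
    ultimately have "\<epsilon>\<^sup>2 / 2 < ?Q" by linarith
    then have U: "x \<in> {x. \<epsilon>\<^sup>2 / 2 < (x - q) \<bullet> (x - q)}" by simp
    have "norm (x - q) \<le> norm (x - p) + norm (\<epsilon> *\<^sub>R e)"
      unfolding q_def using norm_triangle_ineq4[of "x - p" "\<epsilon> *\<^sub>R e"] by (simp add: algebra_simps)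
    also have "\<dots> \<le> r / 2 + r" using x(2) \<epsilon> e by (simp add: dist_norm norm_minus_commute)
    finally have ny2: "norm (x - q) < 2 * r" using r by simp
    define T where "T = ?Q powr (- ?N / 2)"
    have T0: "T \<ge> 0" by (simp add: T_def)
    let ?d = "dipole e q \<epsilon>"
    have d0: "\<bar>?d x\<bar> \<le> 2 * r * T"
      using dipole_bounds(1)[OF e \<epsilon>(1) refl refl U] mult_right_mono[OF less_imp_le[OF ny2] T0] by (simp add: T_def)
    have d1: "\<bar>frechet_derivative ?d (at x) i\<bar> \<le> (1 + ?N) * T" if "i \<in> Basis" for i
      using dipole_bounds(2)[OF e \<epsilon>(1) refl refl U that] by (simp add: T_def)
    have l: "singular_test e p r n = (\<lambda>x. ?\<eta> x * ?d x)"
      by (simp add: singular_test_def[abs_def] q_def \<epsilon>_def)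
    have sd: "smooth ?d" using \<epsilon> by (simp add: smooth_dipole)
    have dl: "frechet_derivative (singular_test e p r n) (at x) i
        = ?\<eta> x * frechet_derivative ?d (at x) i + frechet_derivative ?\<eta> (at x) i * ?d x" for i
      unfolding l by (rule frechet_derivative_mult[OF smooth_differentiable[OF sm] smooth_differentiable[OF sd]])
    have b0: "\<bar>singular_test e p r n x\<bar> \<le> M * T"
    proof -
      have "\<bar>singular_test e p r n x\<bar> \<le> M0 * (2 * r * T)"
        unfolding l abs_mult by (intro mult_mono M0 d0) (use M00 in auto)
      also have "\<dots> = (M0 * (2 * r)) * T" by simp
      also have "\<dots> \<le> M * T" by (rule mult_right_mono[OF _ T0]) (unfold M_def, use parts in linarith)
      finally show ?thesis .
    qed
    have b1: "norm (gradient (singular_test e p r n) x) \<le> M * T"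
    proof -
      have "norm (gradient (singular_test e p r n) x) \<le> (\<Sum>i\<in>Basis. \<bar>gradient (singular_test e p r n) x \<bullet> i\<bar>)"
        by (rule norm_le_l1)
      also have "\<dots> \<le> (\<Sum>i\<in>(Basis::'a set). M0 * ((1 + ?N) * T) + M1 * (2 * r * T))"
      proof (rule sum_mono)
        fix i :: 'a assume i: "i \<in> Basis"
        have "\<bar>gradient (singular_test e p r n) x \<bullet> i\<bar> \<le> \<bar>?\<eta> x\<bar> * \<bar>frechet_derivative ?d (at x) i\<bar> + \<bar>frechet_derivative ?\<eta> (at x) i\<bar> * \<bar>?d x\<bar>"
          unfolding gradient_inner_Basis[OF i] dl abs_mult[symmetric] by (rule abs_triangle_ineq)
        also have "\<dots> \<le> M0 * ((1 + ?N) * T) + M1 * (2 * r * T)"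
          by (intro add_mono mult_mono M0 d0 d1[OF i] M1(2)[OF i]) (use M00 M1(1) in auto)
        finally show "\<bar>gradient (singular_test e p r n) x \<bullet> i\<bar> \<le> M0 * ((1 + ?N) * T) + M1 * (2 * r * T)" .
      qed
      also have "\<dots> = (?N * (M0 * (1 + ?N) + M1 * (2 * r))) * T" by (simp add: algebra_simps)
      also have "\<dots> \<le> M * T" by (rule mult_right_mono[OF _ T0]) (unfold M_def, use parts in linarith)
      finally show ?thesis .
    qed
    have b2: "\<bar>laplacian (singular_test e p r n) x\<bar> \<le> M * T"
    proof -
      have "laplacian (singular_test e p r n) x = (\<Sum>i\<in>Basis. 2 * (frechet_derivative ?\<eta> (at x) i * frechet_derivative ?d (at x) i)
        + frechet_derivative (\<lambda>x. frechet_derivative ?\<eta> (at x) i) (at x) i * ?d x)"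
        unfolding l laplacian_mult[OF sm sd] laplacian_dipole[OF e \<epsilon>(1) refl refl U] by simp
      also have "\<bar>\<dots>\<bar> \<le> (\<Sum>i\<in>(Basis::'a set). 2 * (M1 * ((1 + ?N) * T)) + M2 * (2 * r * T))"
      proof (rule sum_abs[THEN order_trans], rule sum_mono)
        fix i :: 'a assume i: "i \<in> Basis"
        have "\<bar>2 * (frechet_derivative ?\<eta> (at x) i * frechet_derivative ?d (at x) i)
            + frechet_derivative (\<lambda>x. frechet_derivative ?\<eta> (at x) i) (at x) i * ?d x\<bar>
          \<le> 2 * (\<bar>frechet_derivative ?\<eta> (at x) i\<bar> * \<bar>frechet_derivative ?d (at x) i\<bar>)
            + \<bar>frechet_derivative (\<lambda>x. frechet_derivative ?\<eta> (at x) i) (at x) i\<bar> * \<bar>?d x\<bar>"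
          by (rule order_trans[OF abs_triangle_ineq]) (simp add: abs_mult)
        also have "\<dots> \<le> 2 * (M1 * ((1 + ?N) * T)) + M2 * (2 * r * T)"
          by (intro add_mono mult_mono d0 d1[OF i] M1(2)[OF i] M2(2)[OF i] order_refl) (use M1(1) M2(1) in auto)
        finally show "\<bar>2 * (frechet_derivative ?\<eta> (at x) i * frechet_derivative ?d (at x) i)
            + frechet_derivative (\<lambda>x. frechet_derivative ?\<eta> (at x) i) (at x) i * ?d x\<bar> \<le> 2 * (M1 * ((1 + ?N) * T)) + M2 * (2 * r * T)" .
      qed
      also have "\<dots> = (?N * (2 * (M1 * (1 + ?N)) + M2 * (2 * r))) * T" by (simp add: algebra_simps)
      also have "\<dots> \<le> M * T" by (rule mult_right_mono[OF _ T0]) (unfold M_def, use parts in linarith)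
      finally show ?thesis .
    qed
    show "\<bar>singular_test e p r n x\<bar> \<le> M * ((x - (p + (r / 2 ^ n) *\<^sub>R e)) \<bullet> (x - (p + (r / 2 ^ n) *\<^sub>R e))) powr (- real DIM('a) / 2) \<and>
      norm (gradient (singular_test e p r n) x) \<le> M * ((x - (p + (r / 2 ^ n) *\<^sub>R e)) \<bullet> (x - (p + (r / 2 ^ n) *\<^sub>R e))) powr (- real DIM('a) / 2) \<and>
      \<bar>laplacian (singular_test e p r n) x\<bar> \<le> M * ((x - (p + (r / 2 ^ n) *\<^sub>R e)) \<bullet> (x - (p + (r / 2 ^ n) *\<^sub>R e))) powr (- real DIM('a) / 2) \<and>
      r / 2 ^ n \<le> norm (x - (p + (r / 2 ^ n) *\<^sub>R e)) \<and> norm (x - (p + (r / 2 ^ n) *\<^sub>R e)) < 2 * r"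
      using b0 b1 b2 ny ny2 unfolding T_def q_def \<epsilon>_def by blast
  qed
qed

section \<open>A logarithmic majorant of the singular weight\<close>

lemma power2_powr_half: "s > 0 \<Longrightarrow> (s\<^sup>2) powr (- real k / 2) = inverse (s ^ k)"
proof -
  assume s: "s > 0"
  then have "(s\<^sup>2) powr (- real k / 2) = (s powr 2) powr (- real k / 2)" by simp
  also have "\<dots> = s powr (2 * (- real k / 2))" by (rule powr_powr)
  also have "\<dots> = inverse (s ^ k)" using s by (simp add: powr_minus powr_realpow)
  finally show ?thesis .
qed

lemma inner_self_powr_le:
  fixes y :: "'a::euclidean_space"
  assumes "0 < s" "s \<le> norm y"
  shows "(y \<bullet> y) powr (- real k / 2) \<le> inverse (s ^ k)"
proof -
  have "s\<^sup>2 \<le> y \<bullet> y" using assms by (simp add: dot_square_norm power_mono)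
  then have "(y \<bullet> y) powr (- real k / 2) \<le> (s\<^sup>2) powr (- real k / 2)"
    using assms by (intro powr_mono2') auto
  also have "\<dots> = inverse (s ^ k)" using assms(1) by (rule power2_powr_half)
  finally show ?thesis .
qed

lemma dyadic_shell:
  fixes \<epsilon> t :: real
  assumes "\<epsilon> \<le> t" "t < 2 ^ (n + 1) * \<epsilon>"
  shows "\<exists>k\<le>n. 2 ^ k * \<epsilon> \<le> t \<and> t < 2 ^ (k + 1) * \<epsilon>"
  using assms(2)
proof (induction n)
  case 0
  then show ?case using assms(1) by auto
next
  case (Suc n)
  then show ?case
    by (cases "t < 2 ^ (n + 1) * \<epsilon>") (auto intro: le_SucI)
qed

text \<open>Summing over dyadic shells gives a bound that is logarithmic in the distance of the pole.\<close>

lemma singular_weight_majorant: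
  fixes q :: "'a::euclidean_space" and n :: nat
  assumes r: "r > 0"
  obtains w where "integrable lborel w" "\<And>x. w x \<ge> 0"
    "\<And>x. r / 2 ^ n \<le> norm (x - q) \<Longrightarrow> norm (x - q) < 2 * r \<Longrightarrow>
      ((x - q) \<bullet> (x - q)) powr (- real DIM('a) / 2) \<le> w x"
    "(\<integral>x. w x \<partial>lborel) = (unit_ball_vol (real DIM('a)) * 2 ^ DIM('a)) * real (n + 1)"
proof -
  let ?N = "DIM('a)"
  define \<epsilon> where "\<epsilon> = r / 2 ^ n"
  have \<epsilon>: "\<epsilon> > 0" using r by (simp add: \<epsilon>_def)
  \<comment> \<open>The ball of radius 2^(k+1) \<epsilon> has volume \<open>unit_ball_vol\<close>
    times 2^N (2^k \<epsilon>)^N, so each of the n + 1 terms has the same integral, whatever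
    \<open>k\<close> is. The last ball has radius 2r.\<close>
  define w where "w = (\<lambda>x. \<Sum>k\<le>n. indicator (ball q (2 ^ (k + 1) * \<epsilon>)) x * inverse ((2 ^ k * \<epsilon>) ^ ?N))"
  have fin: "emeasure lborel (ball q s) < \<infinity>" for s :: real
    by (rule emeasure_bounded_finite) simp
  have int: "integrable lborel (\<lambda>x. indicator (ball q s) x * (c :: real))" for s c
    using fin[of s] by (intro integrable_mult_left integrable_real_indicator) auto
  show ?thesis
  proof
    show "integrable lborel w" unfolding w_def by (intro Bochner_Integration.integrable_sum int)
    show "w x \<ge> 0" for x unfolding w_def using \<epsilon> by (intro sum_nonneg) simp
    show "((x - q) \<bullet> (x - q)) powr (- real ?N / 2) \<le> w x"
      if x: "r / 2 ^ n \<le> norm (x - q)" "norm (x - q) < 2 * r" for x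
    proof -
      obtain k where k: "k \<le> n" "2 ^ k * \<epsilon> \<le> norm (x - q)" "norm (x - q) < 2 ^ (k + 1) * \<epsilon>"
        using dyadic_shell[of \<epsilon> "norm (x - q)" n] x by (auto simp: \<epsilon>_def)
      have "((x - q) \<bullet> (x - q)) powr (- real ?N / 2) \<le> inverse ((2 ^ k * \<epsilon>) ^ ?N)"
        by (rule inner_self_powr_le[OF _ k(2)]) (use \<epsilon> in simp)
      also have "\<dots> = indicator (ball q (2 ^ (k + 1) * \<epsilon>)) x * inverse ((2 ^ k * \<epsilon>) ^ ?N)"
        using k(3) by (simp add: dist_norm norm_minus_commute)
      also have "\<dots> \<le> w x"
        unfolding w_def using k(1) \<epsilon> by (intro member_le_sum) auto
      finally show ?thesis .
    qed
    have "(\<integral>x. w x \<partial>lborel) = (\<Sum>k\<le>n. measure lborel (ball q (2 ^ (k + 1) * \<epsilon>)) * inverse ((2 ^ k * \<epsilon>) ^ ?N))"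
      unfolding w_def by (subst Bochner_Integration.integral_sum[OF int]) simp
    also have "\<dots> = (\<Sum>k\<le>n. unit_ball_vol (real ?N) * 2 ^ ?N)"
    proof (rule sum.cong[OF refl])
      fix k
      have "measure lborel (ball q (2 ^ (k + 1) * \<epsilon>)) = unit_ball_vol (real ?N) * (2 * (2 ^ k * \<epsilon>)) ^ ?N"
        using \<epsilon> by (subst content_ball) (auto simp: mult.assoc)
      also have "\<dots> = unit_ball_vol (real ?N) * 2 ^ ?N * (2 ^ k * \<epsilon>) ^ ?N"
        unfolding power_mult_distrib[of 2] by simp
      finally show "measure lborel (ball q (2 ^ (k + 1) * \<epsilon>)) * inverse ((2 ^ k * \<epsilon>) ^ ?N) = unit_ball_vol (real ?N) * 2 ^ ?N"
        using \<epsilon> by simp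
    qed
    finally show "(\<integral>x. w x \<partial>lborel) = (unit_ball_vol (real ?N) * 2 ^ ?N) * real (n + 1)" by simp
  qed
qed

lemma flat_exp_0_mono: "0 < x \<Longrightarrow> x \<le> y \<Longrightarrow> flat_exp 0 x \<le> flat_exp 0 y"
  by (simp add: flat_exp_def le_imp_inverse_le)

text \<open>The cutoff has no normal derivative on the hyperplane, where \<open>Q\<close> is the
  squared distance to the pole. The second factor is |z - p|^2 - (N - 1) \<epsilon>^2 up to a
  positive power of \<open>Q\<close>, so for N >= 2 the derivative is not positive over a bump of
  width \<epsilon>.\<close>

lemma singular_test_normal_derivative:
  fixes e p z :: "'a::euclidean_space" and n :: nat
  assumes e: "e \<in> Basis" and r: "r > 0" and z: "z \<bullet> e = p \<bullet> e"
  defines "\<epsilon> \<equiv> r / 2 ^ n" and "s \<equiv> - real DIM('a) / 2"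
  defines "Q \<equiv> (z - p) \<bullet> (z - p) + \<epsilon>\<^sup>2"
  shows "frechet_derivative (singular_test e p r n) (at z) e
    = radial_cutoff p r z * (Q powr (s - 1) * (Q - real DIM('a) * \<epsilon>\<^sup>2))"
proof -
  define q where "q = p + \<epsilon> *\<^sub>R e"
  have \<epsilon>: "\<epsilon> > 0" using r by (simp add: \<epsilon>_def)
  have pe: "(z - p) \<bullet> e = 0" using z by (simp add: inner_diff_left)
  have qe: "(z - q) \<bullet> e = - \<epsilon>" using z e by (simp add: q_def inner_diff_left inner_add_left)
  have Q: "(z - q) \<bullet> (z - q) = Q"
  proof -
    have "(y - \<epsilon> *\<^sub>R e) \<bullet> (y - \<epsilon> *\<^sub>R e) = y \<bullet> y + \<epsilon>\<^sup>2" if "y \<bullet> e = 0" for y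
    proof -
      have "e \<bullet> y = 0" using that by (subst inner_commute)
      then show ?thesis
        using that e by (simp add: inner_diff_left inner_diff_right power2_eq_square)
    qed
    from this[OF pe] show ?thesis by (simp add: Q_def q_def diff_diff_add)
  qed
  have "\<epsilon>\<^sup>2 > 0" using \<epsilon> by simp
  moreover have "Q \<ge> \<epsilon>\<^sup>2" by (simp add: Q_def)
  ultimately have Q0: "Q > 0" "\<epsilon>\<^sup>2 / 2 < Q" by linarith+
  have U: "z \<in> {x. \<epsilon>\<^sup>2 / 2 < (x - q) \<bullet> (x - q)}" using Q0 Q by simp
  have P: "Q * Q powr (s - 1) = Q powr s"
    using Q0 powr_mult_base[of Q "s - 1"] by simp
  have "frechet_derivative (dipole e q \<epsilon>) (at z) e = Q powr s + - \<epsilon> * (2 * s * - \<epsilon> * Q powr (s - 1))"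
    using dipole_derivative[OF e \<epsilon> refl s_def[unfolded atomize_eq] U, of e] e by (simp only: Q qe) simp
  also have "\<dots> = Q powr (s - 1) * (Q - real DIM('a) * \<epsilon>\<^sup>2)"
    unfolding P[symmetric] by (simp add: s_def algebra_simps power2_eq_square)
  finally have 1: "frechet_derivative (dipole e q \<epsilon>) (at z) e = Q powr (s - 1) * (Q - real DIM('a) * \<epsilon>\<^sup>2)" .
  have l: "singular_test e p r n = (\<lambda>x. radial_cutoff p r x * dipole e q \<epsilon> x)"
    by (simp add: singular_test_def[abs_def] q_def \<epsilon>_def)
  have "frechet_derivative (radial_cutoff p r) (at z) e = 0"
    unfolding radial_cutoff_derivative pe by simp
  then show ?thesis
    unfolding l frechet_derivative_mult[OF smooth_differentiable[OF smooth_radial_cutoff] smooth_differentiable[OF smooth_dipole[OF \<epsilon>]]] 1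
    by simp
qed

section \<open>Size of the test functions in the domain and on the flat boundary\<close>

context flat_boundary_point
begin

abbreviation "test_fn n \<equiv> singular_test e p r n"

text \<open>n + 1 counts the dyadic shells between the distance \<epsilon> = r / 2^n of the pole and
  2r; it is the logarithm of 1/\<epsilon> up to constants.\<close>

lemma test_fn_L1_bounds:
  obtains M where "M \<ge> 0"
    "\<And>n. (\<integral>x. \<bar>test_fn n x\<bar> \<partial>lebesgue_on \<Omega>) \<le> M * real (n + 1)"
    "\<And>n. (\<integral>x. norm (gradient (test_fn n) x) \<partial>lebesgue_on \<Omega>) \<le> M * real (n + 1)"
    "\<And>n. (\<integral>x. \<bar>laplacian (test_fn n) x\<bar> \<partial>lebesgue_on \<Omega>) \<le> M * real (n + 1)"
proof -
  obtain M where M: "M \<ge> 0" and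
    bd: "\<And>n x. x \<bullet> e \<le> p \<bullet> e \<Longrightarrow> x \<in> cball p (r / 2) \<Longrightarrow>
      \<bar>test_fn n x\<bar> \<le> M * ((x - (p + (r / 2 ^ n) *\<^sub>R e)) \<bullet> (x - (p + (r / 2 ^ n) *\<^sub>R e))) powr (- real DIM('a) / 2) \<and>
      norm (gradient (test_fn n) x) \<le> M * ((x - (p + (r / 2 ^ n) *\<^sub>R e)) \<bullet> (x - (p + (r / 2 ^ n) *\<^sub>R e))) powr (- real DIM('a) / 2) \<and>
      \<bar>laplacian (test_fn n) x\<bar> \<le> M * ((x - (p + (r / 2 ^ n) *\<^sub>R e)) \<bullet> (x - (p + (r / 2 ^ n) *\<^sub>R e))) powr (- real DIM('a) / 2) \<and>
      r / 2 ^ n \<le> norm (x - (p + (r / 2 ^ n) *\<^sub>R e)) \<and> norm (x - (p + (r / 2 ^ n) *\<^sub>R e)) < 2 * r"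
    using singular_test_pointwise_bounds[OF e_Basis r_pos, of p] by blast
  let ?V = "unit_ball_vol (real DIM('a)) * 2 ^ DIM('a)"
  have main: "(\<integral>x. f x \<partial>lebesgue_on \<Omega>) \<le> (M * ?V) * real (n + 1)"
    if f: "continuous_on UNIV f" "\<And>x. x \<notin> cball p (r / 2) \<Longrightarrow> f x = 0"
      "\<And>x. x \<bullet> e \<le> p \<bullet> e \<Longrightarrow> x \<in> cball p (r / 2) \<Longrightarrow> f x \<le>
        M * ((x - (p + (r / 2 ^ n) *\<^sub>R e)) \<bullet> (x - (p + (r / 2 ^ n) *\<^sub>R e))) powr (- real DIM('a) / 2)" for f n
  proof -
    obtain w :: "'a \<Rightarrow> real" where w: "integrable lborel w" "\<And>x. w x \<ge> 0"
      "\<And>x. r / 2 ^ n \<le> norm (x - (p + (r / 2 ^ n) *\<^sub>R e)) \<Longrightarrow> norm (x - (p + (r / 2 ^ n) *\<^sub>R e)) < 2 * r \<Longrightarrow>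
        ((x - (p + (r / 2 ^ n) *\<^sub>R e)) \<bullet> (x - (p + (r / 2 ^ n) *\<^sub>R e))) powr (- real DIM('a) / 2) \<le> w x"
      "(\<integral>x. w x \<partial>lborel) = ?V * real (n + 1)"
      using singular_weight_majorant[OF r_pos, of n "p + (r / 2 ^ n) *\<^sub>R e"] by blast
    have "(\<integral>x. f x \<partial>lebesgue_on \<Omega>) = (\<integral>x. indicator \<Omega> x * f x \<partial>lborel)"
      using f(1) open_domain by (intro integral_lebesgue_on_borel borel_measurable_continuous_onI) auto
    also have "\<dots> \<le> (\<integral>x. M * w x \<partial>lborel)"
    proof (rule integral_mono)
      show "integrable lborel (\<lambda>x. indicator \<Omega> x * f x)"
        by (rule integrable_indicator_mult[OF integrable_continuous_bounded_support[OF f(1) bounded_cball[of p "r / 2"] f(2)]])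
          (use open_domain in auto)
      show "integrable lborel (\<lambda>x. M * w x)" using w(1) by simp
      fix x
      show "indicator \<Omega> x * f x \<le> M * w x"
      proof (cases "x \<in> \<Omega> \<and> x \<in> cball p (r / 2)")
        case True
        then have x: "x \<bullet> e \<le> p \<bullet> e" "x \<in> cball p (r / 2)" using half_ball[of x] r_pos by auto
        have "f x \<le> M * ((x - (p + (r / 2 ^ n) *\<^sub>R e)) \<bullet> (x - (p + (r / 2 ^ n) *\<^sub>R e))) powr (- real DIM('a) / 2)"
          by (rule f(3)[OF x])
        also have "\<dots> \<le> M * w x" using bd[OF x] by (intro mult_left_mono[OF w(3) M]) auto
        finally show ?thesis using True by simp
      next
        case False
        have "0 \<le> M * w x" using w(2) M by simp
        then show ?thesis using False f(2)[of x] by (auto simp: indicator_def)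
      qed
    qed
    also have "\<dots> = (M * ?V) * real (n + 1)" using w(4) by simp
    finally show ?thesis .
  qed
  have z: "test_fn n x = 0" if "x \<notin> cball p (r / 2)" for n x
    using that singular_test_outside[of x p r] r_pos by auto
  have z1: "frechet_derivative (test_fn n) (at x) i = 0" if "x \<notin> cball p (r / 2)" for n x i
    by (rule frechet_derivative_outside_support[of "cball p (r / 2)"]) (use that z in auto)
  have z2: "frechet_derivative (\<lambda>x. frechet_derivative (test_fn n) (at x) i) (at x) i = 0" if "x \<notin> cball p (r / 2)" for n x i
    by (rule frechet_derivative_outside_support[of "cball p (r / 2)"]) (use that z1 in auto)
  note sm = smooth_singular_test[OF r_pos, of e p]
  show ?thesis
  proof (rule that[of "M * ?V"])
    show "0 \<le> M * ?V" using M by simp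
    show "(\<integral>x. \<bar>test_fn n x\<bar> \<partial>lebesgue_on \<Omega>) \<le> M * ?V * real (n + 1)" for n
      by (rule main[OF continuous_on_rabs[OF smooth_continuous_on[OF sm]]]) (use z bd in auto)
    show "(\<integral>x. norm (gradient (test_fn n) x) \<partial>lebesgue_on \<Omega>) \<le> M * ?V * real (n + 1)" for n
      by (rule main[OF continuous_on_norm[OF continuous_gradient[OF sm]]]) (use z1 bd in \<open>auto simp: gradient_def\<close>)
    show "(\<integral>x. \<bar>laplacian (test_fn n) x\<bar> \<partial>lebesgue_on \<Omega>) \<le> M * ?V * real (n + 1)" for n
      by (rule main[OF continuous_on_rabs[OF smooth_laplacian_continuous[OF sm]]]) (use z2 bd in \<open>auto simp: laplacian_def\<close>)
  qed
qed

text \<open>On the hyperplane \<open>W\<close> lives where the normal derivative is not positive, so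
  discarding everything outside a small cube only increases the integral. On the cube the derivative
  is of size \<epsilon>^(-N) over an area of size \<epsilon>^(N-1), and 2^n is r /
  \<epsilon>.\<close>

lemma test_fn_normal_flux:
  obtains c where "c > 0"
    "\<And>n W w. n \<ge> 1 \<Longrightarrow> continuous_on UNIV W \<Longrightarrow> (\<And>x. 0 \<le> W x) \<Longrightarrow> (\<And>x. r / 2 ^ n \<le> norm (x - p) \<Longrightarrow> W x = 0) \<Longrightarrow>
      0 \<le> w \<Longrightarrow> (\<And>x. norm (x - p) \<le> r / 2 ^ n / 2 \<Longrightarrow> w \<le> W x) \<Longrightarrow>
      (\<integral>x. indicator slab x * (W (proj x) * frechet_derivative (test_fn n) (at (proj x)) e) \<partial>lborel) \<le> - (c * w * 2 ^ n)"
proof -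
  let ?N = "DIM('a)"
  define s where "s = - real ?N / 2"
  \<comment> \<open>For |z - p| <= r/4 the argument of the cutoff is at least (r/2)^2 - (r/4)^2 = 3
    r^2 / 16. This covers |z - p| <= \<epsilon>/2, because n >= 1 gives \<epsilon> <= r/2.\<close>
  define \<eta> where "\<eta> = flat_exp 0 (3 * r\<^sup>2 / 16)"
  have \<eta>: "\<eta> > 0" unfolding \<eta>_def using r_pos by (intro flat_exp_pos) simp
  define c where "c = \<eta> * (3 / 4) * 2 powr (s - 1) / (real ?N ^ (?N - 1) * r)"
  have N: "real ?N \<ge> 2" using dim by simp
  show ?thesis
  proof (rule that)
    show "c > 0" unfolding c_def using \<eta> r_pos by simp
    fix n :: nat and W :: "'a \<Rightarrow> real" and w :: real
    assume n: "n \<ge> 1" and W: "continuous_on UNIV W" "\<And>x. 0 \<le> W x" "\<And>x. r / 2 ^ n \<le> norm (x - p) \<Longrightarrow> W x = 0"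
      and w: "0 \<le> w" "\<And>x. norm (x - p) \<le> r / 2 ^ n / 2 \<Longrightarrow> w \<le> W x"
    define \<epsilon> where "\<epsilon> = r / 2 ^ n"
    have "(2::real) ^ n \<ge> 2 ^ 1" using n by (intro power_increasing) auto
    then have \<epsilon>: "\<epsilon> > 0" "\<epsilon> \<le> r / 2" using r_pos by (auto simp: \<epsilon>_def field_simps)
    let ?D = "\<lambda>z. frechet_derivative (test_fn n) (at z) e"
    \<comment> \<open>A lower bound for minus the integrand on |z - p| <= \<epsilon>/2: there Q <=
      5/4 \<epsilon>^2 <= 2 \<epsilon>^2, and N >= 2 gives N \<epsilon>^2 - Q >= 3/4
      \<epsilon>^2.\<close>
    define \<kappa> where "\<kappa> = w * (\<eta> * ((2 * \<epsilon>\<^sup>2) powr (s - 1) * (3 / 4 * \<epsilon>\<^sup>2)))"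
    \<comment> \<open>Half sides of length \<epsilon>/(2N) add up to at most \<epsilon>/2 in the l1
      norm, so the cube projects into the ball of radius \<epsilon>/2. Along \<open>e\<close> the
      box fills the slab.\<close>
    let ?lo = "\<Sum>j\<in>Basis. (if j = e then p \<bullet> e else p \<bullet> j - \<epsilon> / (2 * real ?N)) *\<^sub>R j"
    let ?hi = "\<Sum>j\<in>Basis. (if j = e then p \<bullet> e + 1 else p \<bullet> j + \<epsilon> / (2 * real ?N)) *\<^sub>R j"
    have pz: "proj x \<bullet> e = p \<bullet> e" for x using flat_proj_inner[OF e_Basis e_Basis] by simp
    have sgn: "W z * ?D z \<le> 0" if z: "z \<bullet> e = p \<bullet> e" for z
    proof (cases "\<epsilon> \<le> norm (z - p)")
      case True
      then show ?thesis using W(3)[of z] by (simp add: \<epsilon>_def)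
    next
      case False
      then have "(norm (z - p))\<^sup>2 \<le> \<epsilon>\<^sup>2" by (intro power_mono) auto
      then have "(z - p) \<bullet> (z - p) + \<epsilon>\<^sup>2 \<le> 2 * \<epsilon>\<^sup>2" by (simp add: dot_square_norm)
      also have "\<dots> \<le> real ?N * \<epsilon>\<^sup>2" using N by (intro mult_right_mono) auto
      finally have "?D z \<le> 0"
        unfolding singular_test_normal_derivative[OF e_Basis r_pos z] \<epsilon>_def[symmetric]
        by (intro mult_nonneg_nonpos) (auto simp: radial_cutoff_def flat_exp_nonneg)
      then show ?thesis using W(2)[of z] by (simp add: mult_nonneg_nonpos)
    qed
    have low: "W z * ?D z \<le> - \<kappa>" if z: "z \<bullet> e = p \<bullet> e" "norm (z - p) \<le> \<epsilon> / 2" for z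
    proof -
      let ?Q = "(z - p) \<bullet> (z - p) + \<epsilon>\<^sup>2"
      have nz: "(norm (z - p))\<^sup>2 \<le> (\<epsilon> / 2)\<^sup>2" using z(2) by (intro power_mono) auto
      then have Q: "?Q \<le> 5 / 4 * \<epsilon>\<^sup>2" by (simp add: dot_square_norm power_divide)
      have e2: "\<epsilon>\<^sup>2 > 0" using \<epsilon> by simp
      have Q0: "?Q > 0" using e2 by (simp add: add_nonneg_pos)
      have "(\<epsilon> / 2)\<^sup>2 \<le> (r / 4)\<^sup>2" using \<epsilon> by (intro power_mono) auto
      then have "3 * r\<^sup>2 / 16 \<le> (r / 2)\<^sup>2 - (z - p) \<bullet> (z - p)"
        using nz by (simp add: dot_square_norm power_divide)
      then have \<eta>z: "\<eta> \<le> radial_cutoff p r z"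
        using r_pos unfolding \<eta>_def radial_cutoff_def by (intro flat_exp_0_mono) auto
      have "3 / 4 * \<epsilon>\<^sup>2 \<le> real ?N * \<epsilon>\<^sup>2 - ?Q"
        using Q mult_right_mono[OF N, of "\<epsilon>\<^sup>2"] by simp
      moreover have "(2 * \<epsilon>\<^sup>2) powr (s - 1) \<le> ?Q powr (s - 1)"
      proof (rule powr_mono2')
        show "?Q \<le> 2 * \<epsilon>\<^sup>2" using Q e2 by linarith
      qed (use Q0 in \<open>auto simp: s_def\<close>)
      ultimately have "\<eta> * ((2 * \<epsilon>\<^sup>2) powr (s - 1) * (3 / 4 * \<epsilon>\<^sup>2)) \<le> radial_cutoff p r z * (?Q powr (s - 1) * (real ?N * \<epsilon>\<^sup>2 - ?Q))"
        using \<eta>z \<eta> e2 by (intro mult_mono) auto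
      also have "\<dots> = - ?D z"
        unfolding singular_test_normal_derivative[OF e_Basis r_pos z(1)] \<epsilon>_def[symmetric] s_def[symmetric]
        by (simp add: algebra_simps)
      finally have "w * (\<eta> * ((2 * \<epsilon>\<^sup>2) powr (s - 1) * (3 / 4 * \<epsilon>\<^sup>2))) \<le> W z * - ?D z"
        using w(2)[of z] z(2) w(1) W(2)[of z] \<eta> by (intro mult_mono) (auto simp: \<epsilon>_def)
      then show ?thesis by (simp add: \<kappa>_def)
    qed
    have cube: "x \<in> slab \<and> norm (proj x - p) \<le> \<epsilon> / 2" if x: "x \<in> box ?lo ?hi" for x
    proof
      show "x \<in> slab" using x e_Basis by (auto simp: mem_box dest!: bspec[of _ _ e])
      have "norm (proj x - p) \<le> (\<Sum>j\<in>Basis. \<bar>(proj x - p) \<bullet> j\<bar>)" by (rule norm_le_l1)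
      also have "\<dots> \<le> (\<Sum>j\<in>(Basis::'a set). \<epsilon> / (2 * real ?N))"
      proof (rule sum_mono)
        fix j :: 'a assume j: "j \<in> Basis"
        show "\<bar>(proj x - p) \<bullet> j\<bar> \<le> \<epsilon> / (2 * real ?N)"
        proof (cases "j = e")
          case True
          then show ?thesis using \<epsilon> pz by (simp add: inner_diff_left)
        next
          case False
          have "?lo \<bullet> j < x \<bullet> j" "x \<bullet> j < ?hi \<bullet> j" using x j by (auto simp: mem_box)
          then show ?thesis
            using False j flat_proj_inner[OF e_Basis j] by (simp add: inner_diff_left abs_le_iff)
        qed
      qed
      also have "\<dots> = \<epsilon> / 2" by simp
      finally show "norm (proj x - p) \<le> \<epsilon> / 2" .
    qed
    have z0: "test_fn n x = 0" if "x \<notin> cball p (r / 2)" for x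
      using that singular_test_outside[of x p r] r_pos by auto
    have z1: "?D x = 0" if "x \<notin> cball p (r / 2)" for x
      by (rule frechet_derivative_outside_support[of "cball p (r / 2)"]) (use that z0 in auto)
    have "(\<integral>x. indicator slab x * (W (proj x) * ?D (proj x)) \<partial>lborel) \<le> (\<integral>x. - \<kappa> * indicator (box ?lo ?hi) x \<partial>lborel)"
    proof (rule integral_mono)
      show "integrable lborel (\<lambda>x. indicator slab x * (W (proj x) * ?D (proj x)))"
        by (rule integrable_slab[OF continuous_on_mult[OF W(1) smooth_continuous_on[OF smooth_frechet_derivative[OF smooth_singular_test[OF r_pos]]]] bounded_cball[of p "r / 2"] _ e_Basis])
          (simp add: z1)
      have "emeasure lborel (box ?lo ?hi) < \<infinity>" by (rule emeasure_bounded_finite) simp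
      then show "integrable lborel (\<lambda>x. - \<kappa> * indicator (box ?lo ?hi) x)"
        by (intro integrable_mult_right integrable_real_indicator) auto
      fix x
      show "indicator slab x * (W (proj x) * ?D (proj x)) \<le> - \<kappa> * indicator (box ?lo ?hi) x"
        using cube[of x] sgn[OF pz, of x] low[OF pz, of x] by (cases "x \<in> box ?lo ?hi") (auto simp: indicator_def)
    qed
    also have "\<dots> = - (\<kappa> * measure lborel (box ?lo ?hi))" by simp
    also have "measure lborel (box ?lo ?hi) = (\<epsilon> / real ?N) ^ (?N - 1)"
    proof -
      have "?lo \<bullet> j \<le> ?hi \<bullet> j" if "j \<in> Basis" for j using that \<epsilon> by simp
      then have "measure lborel (box ?lo ?hi) = (\<Prod>j\<in>Basis. (?hi - ?lo) \<bullet> j)"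
        by (rule measure_lborel_box)
      also have "\<dots> = (\<Prod>j\<in>Basis. if j = e then 1 else \<epsilon> / real ?N)"
        by (intro prod.cong) (auto simp: inner_diff_left field_simps)
      also have "\<dots> = (\<Prod>j\<in>Basis - {e}. \<epsilon> / real ?N)"
        using e_Basis by (subst prod.remove[OF finite_Basis e_Basis]) (auto intro!: prod.cong)
      also have "\<dots> = (\<epsilon> / real ?N) ^ (?N - 1)"
        using e_Basis by (simp add: card_Diff_singleton)
      finally show ?thesis .
    qed
    also have "\<kappa> * (\<epsilon> / real ?N) ^ (?N - 1) = c * w * 2 ^ n"
    proof -
      have "(\<epsilon>\<^sup>2) powr (s - 1) * \<epsilon>\<^sup>2 = (\<epsilon>\<^sup>2) powr s"
        using \<epsilon> powr_mult_base[of "\<epsilon>\<^sup>2" "s - 1"] by (simp add: mult.commute)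
      also have "\<dots> = inverse (\<epsilon> ^ ?N)" unfolding s_def using \<epsilon>(1) by (rule power2_powr_half)
      finally have A: "(\<epsilon>\<^sup>2) powr (s - 1) * \<epsilon>\<^sup>2 = inverse (\<epsilon> ^ ?N)" .
      have B: "(2 * \<epsilon>\<^sup>2) powr (s - 1) = 2 powr (s - 1) * (\<epsilon>\<^sup>2) powr (s - 1)"
        by (rule powr_mult)
      have C: "\<epsilon> ^ ?N = \<epsilon> * \<epsilon> ^ (?N - 1)" using power_Suc[of \<epsilon> "?N - 1"] dim by simp
      have "\<kappa> * (\<epsilon> / real ?N) ^ (?N - 1) = w * \<eta> * (3 / 4) * 2 powr (s - 1) * ((\<epsilon>\<^sup>2) powr (s - 1) * \<epsilon>\<^sup>2) * (\<epsilon> ^ (?N - 1) / real ?N ^ (?N - 1))"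
        unfolding \<kappa>_def B by (simp add: power_divide mult_ac)
      also have "\<dots> = w * \<eta> * (3 / 4) * 2 powr (s - 1) * (1 / \<epsilon>) / real ?N ^ (?N - 1)"
        unfolding A C using \<epsilon> by (simp add: field_simps)
      also have "1 / \<epsilon> = 2 ^ n / r" by (simp add: \<epsilon>_def)
      finally show ?thesis by (simp add: c_def field_simps)
    qed
    finally show "(\<integral>x. indicator slab x * (W (proj x) * ?D (proj x)) \<partial>lborel) \<le> - (c * w * 2 ^ n)" .
  qed
qed

end

section \<open>Functions of time\<close>

text \<open>Rests on the completeness of Lebesgue measure.\<close>

lemma borel_measurable_lebesgue_on_AE:
  fixes f g :: "'a::euclidean_space \<Rightarrow> real"
  assumes f: "f \<in> borel_measurable (lebesgue_on S)" and eq: "AE x in lebesgue_on S. f x = g x"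
    and S: "S \<in> sets lebesgue"
  shows "g \<in> borel_measurable (lebesgue_on S)"
proof -
  have "(\<lambda>x. indicator S x *\<^sub>R f x) \<in> borel_measurable lebesgue"
    using f S by (simp add: borel_measurable_restrict_space_iff)
  moreover have "AE x in lebesgue. x \<in> S \<longrightarrow> f x = g x"
    using eq S by (simp add: AE_lebesgue_on)
  then have "AE x in lebesgue. indicator S x *\<^sub>R f x = indicator S x *\<^sub>R g x"
    by eventually_elim (auto simp: indicator_def)
  ultimately have "(\<lambda>x. indicator S x *\<^sub>R g x) \<in> borel_measurable lebesgue"
    by (rule borel_measurable_AE)
  then show ?thesis
    using S by (simp add: borel_measurable_restrict_space_iff)
qed

lemma borel_measurable_lebesgue_on_LIMSEQ_AE:
  fixes f :: "nat \<Rightarrow> 'a::euclidean_space \<Rightarrow> real"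
  assumes f: "\<And>k. f k \<in> borel_measurable (lebesgue_on S)"
    and lim: "AE x in lebesgue_on S. (\<lambda>k. f k x) \<longlonglongrightarrow> g x" and S: "S \<in> sets lebesgue"
  shows "g \<in> borel_measurable (lebesgue_on S)"
proof (rule borel_measurable_lebesgue_on_AE[OF _ _ S])
  show "(\<lambda>x. lim (\<lambda>k. f k x)) \<in> borel_measurable (lebesgue_on S)"
    by (rule borel_measurable_lim_metric[OF f])
  show "AE x in lebesgue_on S. lim (\<lambda>k. f k x) = g x"
    using lim by eventually_elim (rule limI)
qed

text \<open>For limits that are accessible only through almost everywhere convergent
  subsequences.\<close>

lemma tendsto_subseq_principle:
  fixes X :: "nat \<Rightarrow> 'a::metric_space"
  assumes "\<And>\<rho> :: nat \<Rightarrow> nat. strict_mono \<rho> \<Longrightarrow> \<exists>\<sigma> :: nat \<Rightarrow> nat. strict_mono \<sigma> \<and> (\<lambda>k. X (\<rho> (\<sigma> k))) \<longlonglongrightarrow> L"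
  shows "X \<longlonglongrightarrow> L"
proof (rule ccontr)
  assume "\<not> X \<longlonglongrightarrow> L"
  then obtain \<epsilon> where \<epsilon>: "\<epsilon> > 0" "\<And>n. \<exists>k\<ge>n. \<not> dist (X k) L < \<epsilon>"
    unfolding lim_sequentially by blast
  then have "\<exists>\<^sub>\<infinity>k. \<not> dist (X k) L < \<epsilon>"
    by (simp add: INFM_nat_le)
  then have "infinite {k. \<not> dist (X k) L < \<epsilon>}"
    by (simp add: INFM_iff_infinite)
  then obtain \<rho> :: "nat \<Rightarrow> nat" where \<rho>: "strict_mono \<rho>" "\<And>k. \<not> dist (X (\<rho> k)) L < \<epsilon>"
    using infinite_enumerate by blast
  obtain \<sigma> where "(\<lambda>k. X (\<rho> (\<sigma> k))) \<longlonglongrightarrow> L" using assms[OF \<rho>(1)] by blast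
  then obtain n where "dist (X (\<rho> (\<sigma> n))) L < \<epsilon>"
    using \<epsilon>(1) unfolding lim_sequentially by blast
  then show False using \<rho>(2) by blast
qed

text \<open>A simple function takes finitely many values on measurable sets of finite measure, so
  its composition with an arbitrary functional \<open>h\<close> is a finite combination of
  indicators.\<close>

lemma simple_in_time_integral:
  fixes h :: "('a \<Rightarrow> real) \<Rightarrow> real"
  assumes s: "simple_in_time T X s"
  shows "integrable (lebesgue_on {0<..<T}) (\<lambda>t. h (s t))"
    and "(\<integral>t. h (s t) \<partial>lebesgue_on {0<..<T})
      = (\<Sum>w\<in>s ` {0<..<T}. measure lebesgue {t \<in> {0<..<T}. s t = w} * h w)"
proof -
  let ?I = "{0<..<T}"
  let ?E = "\<lambda>w. {t \<in> ?I. s t = w}"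
  have fin: "finite (s ` ?I)" and E: "?E w \<in> sets lebesgue" for w
    using s by (auto simp: simple_in_time_def)
  have lm: "?E w \<in> lmeasurable" for w
    by (rule bounded_set_imp_lmeasurable[OF bounded_subset[of ?I] E]) auto
  have fE: "emeasure lebesgue (?E w) < \<infinity>" for w
    unfolding infinity_ennreal_def less_top[symmetric] by (rule fmeasurableD2[OF lm])
  have eq: "indicator ?I t * h (s t) = (\<Sum>w\<in>s ` ?I. indicator (?E w) t * h w)" for t
  proof (cases "t \<in> ?I")
    case True
    have "(\<Sum>w\<in>s ` ?I. indicator (?E w) t * h w) = (\<Sum>w\<in>s ` ?I. if w = s t then h (s t) else 0)"
      using True by (intro sum.cong) (auto simp: indicator_def)
    then show ?thesis using True fin by simp
  next
    case False
    then show ?thesis by (subst sum.neutral) auto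
  qed
  have int: "integrable lebesgue (\<lambda>t. indicator (?E w) t * h w)" for w
    using E fE by (intro integrable_mult_left integrable_real_indicator) auto
  show "integrable (lebesgue_on ?I) (\<lambda>t. h (s t))"
    by (subst integrable_lebesgue_on, simp) (unfold eq, rule Bochner_Integration.integrable_sum, rule int)
  show "(\<integral>t. h (s t) \<partial>lebesgue_on ?I) = (\<Sum>w\<in>s ` ?I. measure lebesgue (?E w) * h w)"
    by (subst integral_lebesgue_on, simp) (unfold eq, subst Bochner_Integration.integral_sum[OF int], simp)
qed

lemma simple_time_integral_eq:
  "simple_in_time T X s \<Longrightarrow> simple_time_integral T s x = (\<integral>t. s t x \<partial>lebesgue_on {0<..<T})"
  using simple_in_time_integral(2)[of T X s "\<lambda>w. w x"] by (simp add: simple_time_integral_def)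

lemma finite_measure_time: "finite_measure (lebesgue_on {0<..<T :: real})"
  by (intro finite_measure_lebesgue_on_bounded) auto

lemma integrable_time_continuous:
  fixes f :: "real \<Rightarrow> real"
  shows "continuous_on UNIV f \<Longrightarrow> integrable (lebesgue_on {0<..<T}) f"
  by (rule integrable_continuous_lebesgue_on) auto

lemma deriv_eq_frechet_derivative:
  fixes f :: "real \<Rightarrow> real"
  assumes "f differentiable (at x)"
  shows "deriv f x = frechet_derivative f (at x) 1"
proof -
  have "((\<lambda>s. f (0 + s *\<^sub>R 1)) has_real_derivative frechet_derivative f (at (0 + x *\<^sub>R 1)) 1) (at x)"
    by (rule has_real_derivative_along_line) (use assms in simp)
  then show ?thesis by (intro DERIV_imp_deriv) simp
qed

context
  fixes \<Omega> :: "'a::euclidean_space set" and T :: real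
  assumes op: "open \<Omega>" and bd: "bounded \<Omega>"
begin

private abbreviation (input) "I \<equiv> {0<..<T}"
private abbreviation (input) "nrm \<equiv> H1_norm \<Omega>"

section \<open>Products of a function of time and a function of space\<close>

lemma quantize_measurable:
  fixes \<rho> :: "real \<Rightarrow> real"
  assumes "continuous_on UNIV \<rho>"
  shows "(\<lambda>t. of_int \<lfloor>real (Suc k) * \<rho> t\<rfloor> / real (Suc k) :: real) \<in> borel_measurable borel"
  using borel_measurable_continuous_onI[OF assms] by measurable

text \<open>Rounding \<rho> down to multiples of 1/(k+1) leaves finitely many values, as a
  continuous \<rho> is bounded on (0,T).\<close>

lemma quantized_simple_in_time:
  fixes \<rho> :: "real \<Rightarrow> real" and l :: "'a \<Rightarrow> real"
  assumes \<rho>: "continuous_on UNIV \<rho>" and l: "l \<in> H1 \<Omega>"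
  shows "simple_in_time T (H1 \<Omega>) (\<lambda>t x. (of_int \<lfloor>real (Suc k) * \<rho> t\<rfloor> / real (Suc k)) * l x)"
proof -
  let ?c = "\<lambda>t. of_int \<lfloor>real (Suc k) * \<rho> t\<rfloor> / real (Suc k)"
  note m = quantize_measurable[OF \<rho>, of k]
  obtain M where M: "\<And>t. t \<in> I \<Longrightarrow> \<bar>\<rho> t\<bar> \<le> M"
    using continuous_on_imp_bounded_on[OF \<rho>, of I] by (auto simp: real_norm_def)
  have "\<lfloor>real (Suc k) * \<rho> t\<rfloor> \<in> {\<lfloor>- (real (Suc k) * M)\<rfloor>..\<lfloor>real (Suc k) * M\<rfloor>}" if "t \<in> I" for t
  proof -
    have "real (Suc k) * \<rho> t \<le> real (Suc k) * M" "real (Suc k) * (- \<rho> t) \<le> real (Suc k) * M"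
      using M[OF that] by (intro mult_left_mono; simp)+
    then show ?thesis by (simp add: floor_mono)
  qed
  then have "?c ` I \<subseteq> (\<lambda>z. of_int z / real (Suc k)) ` {\<lfloor>- (real (Suc k) * M)\<rfloor>..\<lfloor>real (Suc k) * M\<rfloor>}"
    by blast
  then have fin: "finite (?c ` I)" by (rule finite_subset) simp
  have "(\<lambda>t x. ?c t * l x) ` I = (\<lambda>c x. c * l x) ` (?c ` I)" unfolding image_image ..
  then have "finite ((\<lambda>t x. ?c t * l x) ` I)" using fin by simp
  moreover have "{t \<in> I. (\<lambda>x. ?c t * l x) = w} \<in> sets lebesgue" for w
  proof -
    have eq: "{t \<in> I. (\<lambda>x. ?c t * l x) = w} = (\<Union>c\<in>{c \<in> ?c ` I. (\<lambda>x. c * l x) = w}. ?c -` {c} \<inter> I)"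
      by auto
    have "?c -` {c} \<inter> I \<in> sets borel" for c
      using measurable_sets[OF m, of "{c}"] by simp
    then have "{t \<in> I. (\<lambda>x. ?c t * l x) = w} \<in> sets borel"
      unfolding eq by (intro sets.finite_UN) (use fin in auto)
    then show ?thesis by simp
  qed
  moreover have "(\<lambda>x. ?c t * l x) \<in> H1 \<Omega>" for t
    by (rule H1_cmult[OF op l])
  then have "(\<lambda>t x. ?c t * l x) ` I \<subseteq> H1 \<Omega>" by blast
  ultimately show ?thesis
    unfolding simple_in_time_def by blast
qed

lemma quantize_error: "\<bar>of_int \<lfloor>real (Suc k) * r\<rfloor> / real (Suc k) - r\<bar> \<le> inverse (real (Suc k))"
proof -
  have "\<bar>of_int \<lfloor>real (Suc k) * r\<rfloor> - real (Suc k) * r\<bar> \<le> 1" by linarith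
  then have "\<bar>of_int \<lfloor>real (Suc k) * r\<rfloor> - real (Suc k) * r\<bar> / real (Suc k) \<le> 1 / real (Suc k)"
    by (intro divide_right_mono) auto
  moreover have "of_int \<lfloor>real (Suc k) * r\<rfloor> / real (Suc k) - r = (of_int \<lfloor>real (Suc k) * r\<rfloor> - real (Suc k) * r) / real (Suc k)"
    by (simp add: field_simps del: of_nat_Suc)
  ultimately show ?thesis by (simp add: inverse_eq_divide del: of_nat_Suc)
qed

lemma H1_norm_difference: "l \<in> H1 \<Omega> \<Longrightarrow> nrm (\<lambda>x. a * l x - b * l x) = \<bar>a - b\<bar> * nrm l"
  using H1_norm_cmult[OF op, of l "a - b"] by (simp add: left_diff_distrib)

lemma product_strongly_measurable:
  assumes \<rho>: "continuous_on UNIV \<rho>" and l: "l \<in> H1 \<Omega>"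
  shows "strongly_measurable T (H1 \<Omega>) nrm (\<lambda>t x. \<rho> t * l x)"
proof -
  let ?c = "\<lambda>k t. of_int \<lfloor>real (Suc k) * \<rho> t\<rfloor> / real (Suc k)"
  have "(\<lambda>k. nrm (\<lambda>x. ?c k t * l x - \<rho> t * l x)) \<longlonglongrightarrow> 0" for t
  proof (rule Lim_null_comparison)
    show "\<forall>\<^sub>F k in sequentially. norm (nrm (\<lambda>x. ?c k t * l x - \<rho> t * l x)) \<le> inverse (real (Suc k)) * nrm l"
      unfolding H1_norm_difference[OF l]
      using quantize_error H1_norm_nonneg[of \<Omega> l]
      by (intro always_eventually allI) (simp add: mult_right_mono abs_mult del: of_nat_Suc)
    show "(\<lambda>k. inverse (real (Suc k)) * nrm l) \<longlonglongrightarrow> 0"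
      using tendsto_mult[OF LIMSEQ_inverse_real_of_nat tendsto_const, of "nrm l"] by simp
  qed
  then show ?thesis
    unfolding strongly_measurable_def
    using quantized_simple_in_time[OF \<rho> l] H1_cmult[OF op l]
    by (intro exI[of _ "\<lambda>k t x. ?c k t * l x"]) simp
qed

lemma product_L2_time:
  assumes \<rho>: "continuous_on UNIV \<rho>" and l: "l \<in> H1 \<Omega>"
  shows "(\<lambda>t x. \<rho> t * l x) \<in> L2_time T (H1 \<Omega>) nrm"
proof -
  have "integrable (lebesgue_on I) (\<lambda>t. (\<bar>\<rho> t\<bar> * nrm l)\<^sup>2)"
    by (rule integrable_time_continuous) (intro continuous_intros \<rho>)
  then show ?thesis
    unfolding L2_time_def using product_strongly_measurable[OF assms] H1_norm_cmult[OF op l] by simp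
qed

text \<open>The quantised products are uniformly close in time, with error at most
  \<open>nrm l\<close> / (k+1). This controls both the integrated error and the distance of the
  elementary integrals from the limit.\<close>

lemma product_has_time_integral:
  assumes \<rho>: "continuous_on UNIV \<rho>" and l: "l \<in> H1 \<Omega>"
  shows "has_time_integral T (H1 \<Omega>) nrm (\<lambda>t x. \<rho> t * l x) (\<lambda>x. (\<integral>t. \<rho> t \<partial>lebesgue_on I) * l x)"
  unfolding has_time_integral_def
proof (intro conjI exI[of _ "\<lambda>k t x. of_int \<lfloor>real (Suc k) * \<rho> t\<rfloor> / real (Suc k) * l x"] allI)
  let ?c = "\<lambda>k t. of_int \<lfloor>real (Suc k) * \<rho> t\<rfloor> / real (Suc k)"
  interpret finite_measure "lebesgue_on I" by (rule finite_measure_time)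
  show "(\<lambda>x. (\<integral>t. \<rho> t \<partial>lebesgue_on I) * l x) \<in> H1 \<Omega>" by (rule H1_cmult[OF op l])
  show "strongly_measurable T (H1 \<Omega>) nrm (\<lambda>t x. \<rho> t * l x)" by (rule product_strongly_measurable[OF assms])
  show simple: "simple_in_time T (H1 \<Omega>) (\<lambda>t x. ?c k t * l x)" for k by (rule quantized_simple_in_time[OF assms])
  have lim: "(\<lambda>k. C * inverse (real (Suc k))) \<longlonglongrightarrow> 0" for C
    using tendsto_mult[OF tendsto_const LIMSEQ_inverse_real_of_nat, of C] by simp
  show "(\<lambda>k. \<integral>\<^sup>+t. ennreal (nrm (\<lambda>x. ?c k t * l x - \<rho> t * l x)) \<partial>lebesgue_on I) \<longlonglongrightarrow> 0"
  proof (rule tendsto_sandwich[OF _ _ tendsto_const])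
    show "\<forall>\<^sub>F k in sequentially. (\<integral>\<^sup>+t. ennreal (nrm (\<lambda>x. ?c k t * l x - \<rho> t * l x)) \<partial>lebesgue_on I)
        \<le> ennreal (measure (lebesgue_on I) I * nrm l * inverse (real (Suc k)))"
    proof (rule always_eventually, rule allI)
      fix k
      have "(\<integral>\<^sup>+t. ennreal (nrm (\<lambda>x. ?c k t * l x - \<rho> t * l x)) \<partial>lebesgue_on I)
          \<le> (\<integral>\<^sup>+t. ennreal (inverse (real (Suc k)) * nrm l) \<partial>lebesgue_on I)"
        unfolding H1_norm_difference[OF l]
        by (intro nn_integral_mono ennreal_leI mult_right_mono quantize_error H1_norm_nonneg)
      also have "\<dots> = ennreal (inverse (real (Suc k)) * nrm l) * emeasure (lebesgue_on I) I"
        by (simp add: nn_integral_const)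
      also have "\<dots> = ennreal (measure (lebesgue_on I) I * nrm l * inverse (real (Suc k)))"
        using H1_norm_nonneg[of \<Omega> l] unfolding emeasure_eq_measure
        by (subst ennreal_mult[symmetric]) (simp_all add: mult_ac del: of_nat_Suc)
      finally show "(\<integral>\<^sup>+t. ennreal (nrm (\<lambda>x. ?c k t * l x - \<rho> t * l x)) \<partial>lebesgue_on I)
        \<le> ennreal (measure (lebesgue_on I) I * nrm l * inverse (real (Suc k)))" .
    qed
    show "(\<lambda>k. ennreal (measure (lebesgue_on I) I * nrm l * inverse (real (Suc k)))) \<longlonglongrightarrow> 0"
      using tendsto_ennrealI[OF lim] by simp
  qed simp
  have ic: "integrable (lebesgue_on I) (?c k)" for k
  proof (rule Bochner_Integration.integrable_bound)
    show "integrable (lebesgue_on I) (\<lambda>t. \<bar>\<rho> t\<bar> + 1)"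
      using integrable_time_continuous[OF \<rho>, of T] by simp
    show "?c k \<in> borel_measurable (lebesgue_on I)"
      by (rule borel_measurable_lebesgue_on_borel[OF quantize_measurable[OF \<rho>]])
    have "inverse (real (Suc k)) \<le> 1" by (simp add: inverse_le_1_iff)
    then have "\<bar>?c k t\<bar> \<le> \<bar>\<rho> t\<bar> + 1" for t
      using quantize_error[of k "\<rho> t"] by linarith
    then show "AE t in lebesgue_on I. norm (?c k t) \<le> norm (\<bar>\<rho> t\<bar> + 1)"
      by (intro AE_I2) (simp del: of_nat_Suc)
  qed
  show "(\<lambda>k. nrm (\<lambda>x. simple_time_integral T (\<lambda>t x. ?c k t * l x) x - (\<integral>t. \<rho> t \<partial>lebesgue_on I) * l x)) \<longlonglongrightarrow> 0"
  proof (rule Lim_null_comparison[OF _ lim])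
    show "\<forall>\<^sub>F k in sequentially. norm (nrm (\<lambda>x. simple_time_integral T (\<lambda>t x. ?c k t * l x) x - (\<integral>t. \<rho> t \<partial>lebesgue_on I) * l x))
        \<le> (measure (lebesgue_on I) I * nrm l) * inverse (real (Suc k))"
    proof (rule always_eventually, rule allI)
      fix k
      have "\<bar>(\<integral>t. ?c k t \<partial>lebesgue_on I) - (\<integral>t. \<rho> t \<partial>lebesgue_on I)\<bar> = \<bar>\<integral>t. ?c k t - \<rho> t \<partial>lebesgue_on I\<bar>"
        by (subst Bochner_Integration.integral_diff[OF ic integrable_time_continuous[OF \<rho>]]) simp
      also have "\<dots> \<le> (\<integral>t. \<bar>?c k t - \<rho> t\<bar> \<partial>lebesgue_on I)" by (rule integral_abs_bound)
      also have "\<dots> \<le> (\<integral>t. inverse (real (Suc k)) \<partial>lebesgue_on I)"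
        by (intro integral_mono integrable_abs Bochner_Integration.integrable_diff ic integrable_time_continuous[OF \<rho>] integrable_const quantize_error)
      also have "\<dots> = measure (lebesgue_on I) I * inverse (real (Suc k))" by simp
      finally have "\<bar>(\<integral>t. ?c k t \<partial>lebesgue_on I) - (\<integral>t. \<rho> t \<partial>lebesgue_on I)\<bar> * nrm l
          \<le> measure (lebesgue_on I) I * inverse (real (Suc k)) * nrm l"
        by (rule mult_right_mono) (rule H1_norm_nonneg)
      moreover have "simple_time_integral T (\<lambda>t x. ?c k t * l x) x = (\<integral>t. ?c k t \<partial>lebesgue_on I) * l x" for x
        unfolding simple_time_integral_eq[OF simple] by (rule integral_mult_left_zero)
      then have "nrm (\<lambda>x. simple_time_integral T (\<lambda>t x. ?c k t * l x) x - (\<integral>t. \<rho> t \<partial>lebesgue_on I) * l x)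
          = \<bar>(\<integral>t. ?c k t \<partial>lebesgue_on I) - (\<integral>t. \<rho> t \<partial>lebesgue_on I)\<bar> * nrm l"
        by (simp only: H1_norm_difference[OF l])
      ultimately have "nrm (\<lambda>x. simple_time_integral T (\<lambda>t x. ?c k t * l x) x - (\<integral>t. \<rho> t \<partial>lebesgue_on I) * l x)
          \<le> (measure (lebesgue_on I) I * nrm l) * inverse (real (Suc k))"
        by (simp only: mult_ac)
      then show "norm (nrm (\<lambda>x. simple_time_integral T (\<lambda>t x. ?c k t * l x) x - (\<integral>t. \<rho> t \<partial>lebesgue_on I) * l x))
        \<le> (measure (lebesgue_on I) I * nrm l) * inverse (real (Suc k))"
        by (simp only: real_norm_def abs_of_nonneg[OF H1_norm_nonneg])
    qed
  qed
qed

text \<open>The space factor comes out of the Bochner integral, which leaves scalar integration by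
  parts on (0,T).\<close>

lemma product_has_weak_time_deriv:
  assumes \<theta>: "smooth \<theta>" and l: "l \<in> H1 \<Omega>"
  shows "has_weak_time_deriv T (H1 \<Omega>) nrm (\<lambda>t x. \<theta> t * l x) (\<lambda>t x. frechet_derivative \<theta> (at t) 1 * l x)"
  unfolding has_weak_time_deriv_def
proof (intro conjI ballI)
  have c: "continuous_on UNIV \<theta>" and c': "continuous_on UNIV (\<lambda>t. frechet_derivative \<theta> (at t) 1)"
    using \<theta> by (auto intro!: smooth_continuous_on smooth_frechet_derivative)
  show "(\<lambda>t x. frechet_derivative \<theta> (at t) 1 * l x) \<in> L2_time T (H1 \<Omega>) nrm"
    by (rule product_L2_time[OF c' l])
  fix \<eta> :: "real \<Rightarrow> real" assume \<eta>: "\<eta> \<in> test_functions {0<..<T}"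
  note s\<eta> = test_function_smooth[OF \<eta>]
  have d: "deriv \<eta> t = frechet_derivative \<eta> (at t) 1" for t
    by (rule deriv_eq_frechet_derivative[OF smooth_differentiable[OF s\<eta>]])
  have c\<eta>: "continuous_on UNIV \<eta>" and c\<eta>': "continuous_on UNIV (deriv \<eta>)"
    unfolding d[abs_def] using s\<eta> by (auto intro!: smooth_continuous_on smooth_frechet_derivative)
  have "(\<integral>t. deriv \<eta> t * \<theta> t \<partial>lebesgue_on I) = - (\<integral>t. \<eta> t * frechet_derivative \<theta> (at t) 1 \<partial>lebesgue_on I)"
    using smooth_weak_partial[OF \<theta>, of I 1] \<eta> by (simp add: weak_partial_def d)
  then have eq: "(\<integral>t. deriv \<eta> t * \<theta> t \<partial>lebesgue_on I) = (\<integral>t. - (\<eta> t * frechet_derivative \<theta> (at t) 1) \<partial>lebesgue_on I)"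
    by simp
  show "\<exists>w. has_time_integral T (H1 \<Omega>) nrm (\<lambda>t x. deriv \<eta> t * (\<theta> t * l x)) w \<and>
      has_time_integral T (H1 \<Omega>) nrm (\<lambda>t x. - (\<eta> t * (frechet_derivative \<theta> (at t) 1 * l x))) w"
    using product_has_time_integral[OF continuous_on_mult[OF c\<eta>' c] l]
      product_has_time_integral[OF continuous_on_minus[OF continuous_on_mult[OF c\<eta> c']] l]
    unfolding eq by (intro exI conjI) (simp_all add: mult.assoc)
qed

text \<open>\<theta> vanishes at both ends, so the product serves as its own continuous
  representative.\<close>

lemma product_H10_time:
  assumes \<theta>: "\<theta> \<in> test_functions I" and l: "l \<in> H1 \<Omega>"
  shows "(\<lambda>t x. \<theta> t * l x) \<in> H10_time T (H1 \<Omega>) nrm"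
proof -
  note s = test_function_smooth[OF \<theta>]
  have c: "continuous_on UNIV \<theta>" using s by (rule smooth_continuous_on)
  obtain K where K: "K \<subseteq> I" "\<And>t. t \<notin> K \<Longrightarrow> \<theta> t = 0" using \<theta> test_functionE by metis
  then have z: "\<theta> 0 = 0" "\<theta> T = 0" by fastforce+
  have "(\<lambda>t x. \<theta> t * l x) \<in> C_time T (H1 \<Omega>) nrm"
    unfolding C_time_def
  proof (intro CollectI conjI ballI H1_cmult[OF op l])
    fix s
    have "(\<theta> \<longlongrightarrow> \<theta> s) (at s within {0..T})"
      using continuous_on_subset[OF c, of "insert s {0..T}"] unfolding continuous_on_def
      by (meson insertI1 subset_UNIV subset_insertI tendsto_within_subset)
    then have "((\<lambda>t. \<bar>\<theta> t - \<theta> s\<bar> * nrm l) \<longlongrightarrow> \<bar>\<theta> s - \<theta> s\<bar> * nrm l) (at s within {0..T})"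
      by (intro tendsto_intros)
    then show "((\<lambda>t. nrm (\<lambda>x. \<theta> t * l x - \<theta> s * l x)) \<longlongrightarrow> 0) (at s within {0..T})"
      by (simp add: H1_norm_difference[OF l])
  qed
  then show ?thesis
    unfolding H10_time_def H1_time_def
    using product_L2_time[OF c l] product_has_weak_time_deriv[OF s l]
    by (auto simp: z H1_norm_0[OF op] intro!: bexI[of _ "\<lambda>t x. \<theta> t * l x"])
qed

subsection \<open>Uniqueness of the weak time derivative\<close>

text \<open>Integration over \<open>B\<close> is a bounded linear functional on \<open>H1\<close>.
  Such functionals turn statements about Bochner integrals into scalar ones, and together they
  separate functions up to null sets.\<close>

lemma integral_on_subset_le_H1_norm:
  assumes f: "f \<in> H1 \<Omega>" and B: "B \<in> sets lebesgue"
  shows "integrable (lebesgue_on \<Omega>) (\<lambda>x. indicator B x * f x)"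
    and "\<bar>\<integral>x. indicator B x * f x \<partial>lebesgue_on \<Omega>\<bar> \<le> sqrt (measure (lebesgue_on \<Omega>) \<Omega>) * nrm f"
proof -
  note fin = finite_measure_lebesgue_on_bounded[OF op bd]
  have f1: "integrable (lebesgue_on \<Omega>) f" by (rule L2_imp_L1(1)[OF fin H1_imp_L2[OF f]])
  have "\<Omega> \<in> sets lebesgue" using op by auto
  then have "B \<inter> \<Omega> \<in> sets (lebesgue_on \<Omega>)" using B by (simp add: sets_restrict_space_iff sets.Int)
  then have "integrable (lebesgue_on \<Omega>) (\<lambda>x. indicator (B \<inter> \<Omega>) x *\<^sub>R f x)"
    using f1 by (rule integrable_mult_indicator)
  moreover have "integrable (lebesgue_on \<Omega>) (\<lambda>x. indicator (B \<inter> \<Omega>) x *\<^sub>R f x) = integrable (lebesgue_on \<Omega>) (\<lambda>x. indicator B x * f x)"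
    by (intro Bochner_Integration.integrable_cong) (auto simp: indicator_def)
  ultimately show i: "integrable (lebesgue_on \<Omega>) (\<lambda>x. indicator B x * f x)" by simp
  have "\<bar>\<integral>x. indicator B x * f x \<partial>lebesgue_on \<Omega>\<bar> \<le> (\<integral>x. \<bar>indicator B x * f x\<bar> \<partial>lebesgue_on \<Omega>)"
    by (rule integral_abs_bound)
  also have "\<dots> \<le> (\<integral>x. norm (f x) \<partial>lebesgue_on \<Omega>)"
    using i f1 by (intro integral_mono) (auto simp: indicator_def)
  also have "\<dots> \<le> sqrt (measure (lebesgue_on \<Omega>) \<Omega>) * L2_norm (lebesgue_on \<Omega>) f"
    using L2_imp_L1(2)[OF fin H1_imp_L2[OF f]] by simp
  also have "\<dots> \<le> sqrt (measure (lebesgue_on \<Omega>) \<Omega>) * nrm f"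
    by (intro mult_left_mono L2_norm_le_H1_norm) simp
  finally show "\<bar>\<integral>x. indicator B x * f x \<partial>lebesgue_on \<Omega>\<bar> \<le> sqrt (measure (lebesgue_on \<Omega>) \<Omega>) * nrm f" .
qed

lemma integral_on_subset_diff:
  assumes "f \<in> H1 \<Omega>" "g \<in> H1 \<Omega>" "B \<in> sets lebesgue"
  shows "\<bar>(\<integral>x. indicator B x * f x \<partial>lebesgue_on \<Omega>) - (\<integral>x. indicator B x * g x \<partial>lebesgue_on \<Omega>)\<bar>
    \<le> sqrt (measure (lebesgue_on \<Omega>) \<Omega>) * nrm (\<lambda>x. f x - g x)"
  using integral_on_subset_le_H1_norm(2)[OF H1_diff[OF op assms(1,2)] assms(3)]
    integral_on_subset_le_H1_norm(1)[OF assms(1,3)] integral_on_subset_le_H1_norm(1)[OF assms(2,3)]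
  by (simp add: right_diff_distrib)

lemma strongly_measurable_functional:
  assumes u: "strongly_measurable T (H1 \<Omega>) nrm u" and B: "B \<in> sets lebesgue"
  shows "(\<lambda>t. \<integral>x. indicator B x * u t x \<partial>lebesgue_on \<Omega>) \<in> borel_measurable (lebesgue_on I)"
proof -
  obtain s where s: "\<And>k::nat. simple_in_time T (H1 \<Omega>) (s k)"
    "AE t in lebesgue_on I. u t \<in> H1 \<Omega> \<and> (\<lambda>k. nrm (\<lambda>x. s k t x - u t x)) \<longlonglongrightarrow> 0"
    using u unfolding strongly_measurable_def by blast
  let ?l = "\<lambda>f. \<integral>x. indicator B x * f x \<partial>lebesgue_on \<Omega>"
  show ?thesis
  proof (rule borel_measurable_lebesgue_on_LIMSEQ_AE)
    show "(\<lambda>t. ?l (s k t)) \<in> borel_measurable (lebesgue_on I)" for k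
      using simple_in_time_integral(1)[OF s(1), of ?l k] by (rule borel_measurable_integrable)
    have "AE t in lebesgue_on I. t \<in> I" by (rule AE_I2) simp
    then show "AE t in lebesgue_on I. (\<lambda>k. ?l (s k t)) \<longlonglongrightarrow> ?l (u t)"
      using s(2)
    proof eventually_elim
      case (elim t)
      have sH: "s k t \<in> H1 \<Omega>" for k using s(1)[of k] elim(1) by (auto simp: simple_in_time_def)
      have "(\<lambda>k. ?l (s k t) - ?l (u t)) \<longlonglongrightarrow> 0"
      proof (rule Lim_null_comparison)
        show "\<forall>\<^sub>F k in sequentially. norm (?l (s k t) - ?l (u t)) \<le> sqrt (measure (lebesgue_on \<Omega>) \<Omega>) * nrm (\<lambda>x. s k t x - u t x)"
          using integral_on_subset_diff[OF sH _ B] elim by (intro always_eventually allI) simp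
        show "(\<lambda>k. sqrt (measure (lebesgue_on \<Omega>) \<Omega>) * nrm (\<lambda>x. s k t x - u t x)) \<longlonglongrightarrow> 0"
          using tendsto_mult[OF tendsto_const conjunct2[OF elim(2)], of "sqrt (measure (lebesgue_on \<Omega>) \<Omega>)"] by simp
      qed
      then show ?case by (simp add: LIM_zero_iff)
    qed
  qed simp
qed

text \<open>A bounded linear functional commutes with the Bochner integral: for simple functions by
  linearity, and both sides depend continuously on the approximation.\<close>

lemma time_integral_functional:
  assumes w: "has_time_integral T (H1 \<Omega>) nrm u w" and B: "B \<in> sets lebesgue"
  shows "integrable (lebesgue_on I) (\<lambda>t. \<integral>x. indicator B x * u t x \<partial>lebesgue_on \<Omega>)"
    and "(\<integral>t. (\<integral>x. indicator B x * u t x \<partial>lebesgue_on \<Omega>) \<partial>lebesgue_on I) = (\<integral>x. indicator B x * w x \<partial>lebesgue_on \<Omega>)"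
proof -
  let ?l = "\<lambda>f. \<integral>x. indicator B x * f x \<partial>lebesgue_on \<Omega>"
  obtain s where wH: "w \<in> H1 \<Omega>" and u: "strongly_measurable T (H1 \<Omega>) nrm u" and s: "\<And>k::nat. simple_in_time T (H1 \<Omega>) (s k)"
    "(\<lambda>k. \<integral>\<^sup>+t. ennreal (nrm (\<lambda>x. s k t x - u t x)) \<partial>lebesgue_on I) \<longlonglongrightarrow> 0"
    "(\<lambda>k. nrm (\<lambda>x. simple_time_integral T (s k) x - w x)) \<longlonglongrightarrow> 0"
    using w unfolding has_time_integral_def by blast
  have uH: "AE t in lebesgue_on I. u t \<in> H1 \<Omega>"
    using u unfolding strongly_measurable_def by auto
  have um [measurable]: "(\<lambda>t. ?l (u t)) \<in> borel_measurable (lebesgue_on I)"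
    by (rule strongly_measurable_functional[OF u B])
  have si: "integrable (lebesgue_on I) (\<lambda>t. ?l (s k t))" for k
    by (rule simple_in_time_integral(1)[OF s(1)])
  note sm [measurable] = borel_measurable_integrable[OF si]
  \<comment> \<open>The summand 1 makes \<open>C\<close> invertible even if \<Omega> has measure
    0.\<close>
  define C where "C = sqrt (measure (lebesgue_on \<Omega>) \<Omega>) + 1"
  have C: "C > 0" by (simp add: C_def add_nonneg_pos)
  have nn: "(\<integral>\<^sup>+t. ennreal (\<bar>?l (s k t) - ?l (u t)\<bar>) \<partial>lebesgue_on I)
      \<le> ennreal C * (\<integral>\<^sup>+t. ennreal (nrm (\<lambda>x. s k t x - u t x)) \<partial>lebesgue_on I)" for k
  proof -
    have "AE t in lebesgue_on I. t \<in> I" by (rule AE_I2) simp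
    then have ae: "AE t in lebesgue_on I. ennreal (inverse C * \<bar>?l (s k t) - ?l (u t)\<bar>) \<le> ennreal (nrm (\<lambda>x. s k t x - u t x))"
      using uH
    proof eventually_elim
      case (elim t)
      have sH: "s k t \<in> H1 \<Omega>" using s(1)[of k] elim(1) by (auto simp: simple_in_time_def)
      have "\<bar>?l (s k t) - ?l (u t)\<bar> \<le> sqrt (measure (lebesgue_on \<Omega>) \<Omega>) * nrm (\<lambda>x. s k t x - u t x)"
        by (rule integral_on_subset_diff[OF sH elim(2) B])
      also have "\<dots> \<le> C * nrm (\<lambda>x. s k t x - u t x)"
        by (intro mult_right_mono H1_norm_nonneg) (simp add: C_def)
      finally have "inverse C * \<bar>?l (s k t) - ?l (u t)\<bar> \<le> inverse C * (C * nrm (\<lambda>x. s k t x - u t x))"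
        using C by (intro mult_left_mono) auto
      then show ?case using C by (intro ennreal_leI) (simp add: mult.assoc[symmetric])
    qed
    \<comment> \<open>The constant is moved through the integral of the scalar difference, which is
      known to be measurable in \<open>t\<close>; the norm enters only through monotonicity.\<close>
    have "(\<integral>\<^sup>+t. ennreal (\<bar>?l (s k t) - ?l (u t)\<bar>) \<partial>lebesgue_on I)
        = ennreal C * (\<integral>\<^sup>+t. ennreal (inverse C * \<bar>?l (s k t) - ?l (u t)\<bar>) \<partial>lebesgue_on I)"
      using C by (subst nn_integral_cmult[symmetric]) (auto simp: ennreal_mult'[symmetric] mult.assoc[symmetric])
    also have "\<dots> \<le> ennreal C * (\<integral>\<^sup>+t. ennreal (nrm (\<lambda>x. s k t x - u t x)) \<partial>lebesgue_on I)"
      by (intro mult_left_mono nn_integral_mono_AE ae) simp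
    finally show ?thesis .
  qed
  have lim0: "(\<lambda>k. \<integral>\<^sup>+t. ennreal (\<bar>?l (s k t) - ?l (u t)\<bar>) \<partial>lebesgue_on I) \<longlonglongrightarrow> 0"
  proof (rule tendsto_sandwich[OF _ _ tendsto_const])
    show "(\<lambda>k. ennreal C * (\<integral>\<^sup>+t. ennreal (nrm (\<lambda>x. s k t x - u t x)) \<partial>lebesgue_on I)) \<longlonglongrightarrow> 0"
      using ennreal_tendsto_cmult[OF _ s(2), of "ennreal C"] by simp
  qed (use nn in auto)
  then have "\<forall>\<^sub>F k in sequentially. (\<integral>\<^sup>+t. ennreal (\<bar>?l (s k t) - ?l (u t)\<bar>) \<partial>lebesgue_on I) < 1"
    by (rule order_tendstoD) simp
  then obtain k0 where k0: "(\<integral>\<^sup>+t. ennreal (\<bar>?l (s k0 t) - ?l (u t)\<bar>) \<partial>lebesgue_on I) < 1"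
    by (auto simp: eventually_sequentially)
  have "integrable (lebesgue_on I) (\<lambda>t. ?l (s k0 t) - ?l (u t))"
  proof (rule integrableI_bounded)
    show "(\<integral>\<^sup>+t. ennreal (norm (?l (s k0 t) - ?l (u t))) \<partial>lebesgue_on I) < \<infinity>"
      using k0 by (simp add: order_less_trans[OF k0 ennreal_one_less_top])
  qed measurable
  from Bochner_Integration.integrable_diff[OF si[of k0] this]
  show ui: "integrable (lebesgue_on I) (\<lambda>t. ?l (u t))" by simp
  have "(\<lambda>k. \<integral>t. ?l (s k t) \<partial>lebesgue_on I) \<longlonglongrightarrow> (\<integral>t. ?l (u t) \<partial>lebesgue_on I)"
    by (rule tendsto_L1_int[OF si ui]) (use lim0 in simp)
  moreover have "(\<integral>t. ?l (s k t) \<partial>lebesgue_on I) = ?l (simple_time_integral T (s k))" for k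
  proof -
    have H: "w \<in> H1 \<Omega>" if "w \<in> s k ` I" for w using that s(1)[of k] by (auto simp: simple_in_time_def)
    have "?l (simple_time_integral T (s k))
        = (\<integral>x. (\<Sum>w\<in>s k ` I. measure lebesgue {t \<in> I. s k t = w} * (indicator B x * w x)) \<partial>lebesgue_on \<Omega>)"
      by (simp add: simple_time_integral_def sum_distrib_left mult_ac)
    also have "\<dots> = (\<Sum>w\<in>s k ` I. measure lebesgue {t \<in> I. s k t = w} * ?l w)"
      using integral_on_subset_le_H1_norm(1)[OF H B] by (subst Bochner_Integration.integral_sum) auto
    finally show ?thesis using simple_in_time_integral(2)[OF s(1), of ?l k] by simp
  qed
  moreover have "(\<lambda>k. ?l (simple_time_integral T (s k))) \<longlonglongrightarrow> ?l w"
  proof -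
    have H: "simple_time_integral T (s k) \<in> H1 \<Omega>" for k
    proof -
      have fin: "finite (s k ` I)" and H: "w \<in> s k ` I \<Longrightarrow> w \<in> H1 \<Omega>" for w
        using s(1)[of k] by (auto simp: simple_in_time_def)
      have z: "(\<lambda>x. 0) \<in> H1 \<Omega>" using H1_cmult[OF op wH, of 0] by simp
      have lin: "(\<lambda>x. \<Sum>w\<in>W. c w * w x) \<in> H1 \<Omega>" if "finite W" "W \<subseteq> H1 \<Omega>" for W and c :: "('a \<Rightarrow> real) \<Rightarrow> real"
        using that
      proof (induction W)
        case (insert v W)
        then show ?case using H1_combination[OF op, of v "\<lambda>x. \<Sum>w\<in>W. c w * w x" "c v" 1] by simp
      qed (simp add: z)
      have "s k ` I \<subseteq> H1 \<Omega>" using H by blast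
      from lin[OF fin this] show ?thesis unfolding simple_time_integral_def[abs_def] .
    qed
    have "(\<lambda>k. ?l (simple_time_integral T (s k)) - ?l w) \<longlonglongrightarrow> 0"
    proof (rule Lim_null_comparison)
      show "\<forall>\<^sub>F k in sequentially. norm (?l (simple_time_integral T (s k)) - ?l w)
          \<le> sqrt (measure (lebesgue_on \<Omega>) \<Omega>) * nrm (\<lambda>x. simple_time_integral T (s k) x - w x)"
        using integral_on_subset_diff[OF H wH B] by (intro always_eventually allI) simp
      show "(\<lambda>k. sqrt (measure (lebesgue_on \<Omega>) \<Omega>) * nrm (\<lambda>x. simple_time_integral T (s k) x - w x)) \<longlonglongrightarrow> 0"
        using tendsto_mult[OF tendsto_const s(3), of "sqrt (measure (lebesgue_on \<Omega>) \<Omega>)"] by simp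
    qed
    then show ?thesis by (simp add: LIM_zero_iff)
  qed
  ultimately show "(\<integral>t. ?l (u t) \<partial>lebesgue_on I) = ?l w"
    by (simp only:) (rule LIMSEQ_unique)
qed

end

text \<open>Corners of countably many test boxes. Each box brings its own null set of exceptional
  times, and countably many of these can be united.\<close>

definition rational_points :: "'a::euclidean_space set" where
  "rational_points = (\<lambda>q. \<Sum>i\<in>Basis. q i *\<^sub>R i) ` (PiE Basis (\<lambda>_. \<rat>))"

lemma countable_rational_points: "countable (rational_points :: 'a::euclidean_space set)"
  unfolding rational_points_def by (intro countable_image countable_PiE finite_Basis countable_rat)

lemma rational_points_I:
  assumes "\<And>i. i \<in> Basis \<Longrightarrow> q i \<in> \<rat>"
  shows "(\<Sum>i\<in>(Basis :: 'a::euclidean_space set). q i *\<^sub>R i) \<in> rational_points"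
proof -
  have "(\<Sum>i\<in>(Basis :: 'a set). q i *\<^sub>R i) = (\<Sum>i\<in>Basis. restrict q Basis i *\<^sub>R i)"
    by (intro sum.cong) auto
  then show ?thesis
    unfolding rational_points_def using assms by (intro image_eqI[of _ _ "restrict q Basis"]) auto
qed

text \<open>Every box is exhausted from inside by boxes with rational corners, so dominated
  convergence transfers the hypothesis to all boxes.\<close>

lemma AE_eq_0_if_rational_box_integrals_eq_0:
  fixes g :: "'a::euclidean_space \<Rightarrow> real"
  assumes g: "integrable lebesgue g" and bd: "bounded S" "\<And>x. x \<notin> S \<Longrightarrow> g x = 0"
    and rat: "\<And>a b. a \<in> rational_points \<Longrightarrow> b \<in> rational_points \<Longrightarrow> (\<integral>x. indicator (box a b) x * g x \<partial>lebesgue) = 0"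
  shows "AE x in lebesgue. g x = 0"
proof -
  have box: "(\<integral>x. indicator (box a b) x * g x \<partial>lebesgue) = 0" for a b
  proof -
    \<comment> \<open>Floor plus 1 and ceiling minus 1 put \<open>A k\<close> strictly above
      \<open>a\<close> and \<open>B k\<close> strictly below \<open>b\<close> in each coordinate, by
      at most 1/(k+1). Strictness keeps the inner box inside \<open>box a b\<close>.\<close>
    define A where "A = (\<lambda>k::nat. \<Sum>i\<in>Basis. ((of_int \<lfloor>real (Suc k) * (a \<bullet> i)\<rfloor> + 1) / real (Suc k)) *\<^sub>R i)"
    define B where "B = (\<lambda>k::nat. \<Sum>i\<in>Basis. ((of_int \<lceil>real (Suc k) * (b \<bullet> i)\<rceil> - 1) / real (Suc k)) *\<^sub>R i)"
    have AB: "A k \<in> rational_points" "B k \<in> rational_points" for k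
      unfolding A_def B_def by (intro rational_points_I; simp)+
    have A: "a \<bullet> i < A k \<bullet> i" "A k \<bullet> i \<le> a \<bullet> i + inverse (real (Suc k))" if "i \<in> Basis" for i k
    proof -
      have Ai: "A k \<bullet> i = (of_int \<lfloor>real (Suc k) * (a \<bullet> i)\<rfloor> + 1) / real (Suc k)" using that by (simp add: A_def)
      have "real (Suc k) * (a \<bullet> i) < of_int \<lfloor>real (Suc k) * (a \<bullet> i)\<rfloor> + 1"
        "of_int \<lfloor>real (Suc k) * (a \<bullet> i)\<rfloor> + 1 \<le> real (Suc k) * (a \<bullet> i) + 1" by linarith+
      then show "a \<bullet> i < A k \<bullet> i" "A k \<bullet> i \<le> a \<bullet> i + inverse (real (Suc k))"
        unfolding Ai by (simp_all add: field_simps del: of_nat_Suc)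
    qed
    have B: "B k \<bullet> i < b \<bullet> i" "b \<bullet> i - inverse (real (Suc k)) \<le> B k \<bullet> i" if "i \<in> Basis" for i k
    proof -
      have Bi: "B k \<bullet> i = (of_int \<lceil>real (Suc k) * (b \<bullet> i)\<rceil> - 1) / real (Suc k)" using that by (simp add: B_def)
      have "of_int \<lceil>real (Suc k) * (b \<bullet> i)\<rceil> - 1 < real (Suc k) * (b \<bullet> i)"
        "real (Suc k) * (b \<bullet> i) - 1 \<le> of_int \<lceil>real (Suc k) * (b \<bullet> i)\<rceil> - 1" by linarith+
      then show "B k \<bullet> i < b \<bullet> i" "b \<bullet> i - inverse (real (Suc k)) \<le> B k \<bullet> i"
        unfolding Bi by (simp_all add: field_simps del: of_nat_Suc)
    qed
    have ind: "(\<lambda>k. indicator (box (A k) (B k)) x) \<longlonglongrightarrow> (indicator (box a b) x :: real)" for x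
    proof (cases "x \<in> box a b")
      case True
      have "\<forall>\<^sub>F k in sequentially. \<forall>i\<in>Basis. A k \<bullet> i < x \<bullet> i \<and> x \<bullet> i < B k \<bullet> i"
      proof (intro eventually_ball_finite ballI finite_Basis)
        fix i :: 'a assume i: "i \<in> Basis"
        then have "min (x \<bullet> i - a \<bullet> i) (b \<bullet> i - x \<bullet> i) > 0" using True by (auto simp: mem_box)
        then have "\<forall>\<^sub>F k in sequentially. inverse (real (Suc k)) < min (x \<bullet> i - a \<bullet> i) (b \<bullet> i - x \<bullet> i)"
          by (rule order_tendstoD(2)[OF LIMSEQ_inverse_real_of_nat])
        then show "\<forall>\<^sub>F k in sequentially. A k \<bullet> i < x \<bullet> i \<and> x \<bullet> i < B k \<bullet> i"
        proof eventually_elim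
          case (elim k)
          then show ?case using A(2)[OF i, of k] B(2)[OF i, of k] by linarith
        qed
      qed
      then have "\<forall>\<^sub>F k in sequentially. indicator (box (A k) (B k)) x = (indicator (box a b) x :: real)"
        by eventually_elim (use True in \<open>simp add: mem_box indicator_def\<close>)
      then show ?thesis by (rule tendsto_eventually)
    next
      case False
      then obtain i where i: "i \<in> Basis" "x \<bullet> i \<le> a \<bullet> i \<or> b \<bullet> i \<le> x \<bullet> i" by (force simp: mem_box)
      have "x \<notin> box (A k) (B k)" for k
        using i A(1)[OF i(1), of k] B(1)[OF i(1), of k] by (auto simp: mem_box intro!: bexI[of _ i])
      then show ?thesis using False by simp
    qed
    have "(\<lambda>k. \<integral>x. indicator (box (A k) (B k)) x * g x \<partial>lebesgue) \<longlonglongrightarrow> (\<integral>x. indicator (box a b) x * g x \<partial>lebesgue)"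
    proof (rule integral_dominated_convergence[where w = "\<lambda>x. \<bar>g x\<bar>"])
      show "AE x in lebesgue. (\<lambda>k. indicator (box (A k) (B k)) x * g x) \<longlonglongrightarrow> indicator (box a b) x * g x"
        by (intro AE_I2 tendsto_mult ind tendsto_const)
      have gm: "g \<in> borel_measurable lebesgue" using g by (rule borel_measurable_integrable)
      have im: "(\<lambda>x. indicator (box c d) x * g x) \<in> borel_measurable lebesgue" for c d :: 'a
        by (intro borel_measurable_times[OF _ gm] borel_measurable_indicator) simp
      show "(\<lambda>x. indicator (box a b) x * g x) \<in> borel_measurable lebesgue"
        "(\<lambda>x. indicator (box (A k) (B k)) x * g x) \<in> borel_measurable lebesgue" for k
        by (rule im)+
    qed (use g in \<open>auto intro!: AE_I2 simp: indicator_def\<close>)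
    then have "(\<lambda>k::nat. 0) \<longlonglongrightarrow> (\<integral>x. indicator (box a b) x * g x \<partial>lebesgue)"
      unfolding rat[OF AB] .
    then show ?thesis by (rule LIMSEQ_unique[OF _ tendsto_const])
  qed
  obtain a b where ab: "S \<subseteq> box a b" using bounded_subset_box_symmetric[OF bd(1)] by metis
  have "(\<integral>x. g x \<partial>lebesgue) = (\<integral>x. indicator (box a b) x * g x \<partial>lebesgue)"
    using ab bd(2) by (intro Bochner_Integration.integral_cong) (auto simp: indicator_def)
  then have "(\<integral>x. g x \<partial>lebesgue) = 0" using box[of a b] by simp
  then show ?thesis by (rule AE_eq_0_if_box_integrals_eq_0[OF g _ box])
qed

lemma integrable_imp_locally_integrable:
  fixes f :: "'a::euclidean_space \<Rightarrow> real"
  assumes D: "D \<in> sets lebesgue" and f: "integrable (lebesgue_on D) f"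
  shows "locally_integrable D f"
  unfolding locally_integrable_def
proof (intro allI impI)
  fix K assume K: "compact K \<and> K \<subseteq> D"
  then have KL: "K \<in> sets lebesgue" by (auto simp: compact_imp_closed)
  have "integrable lebesgue (\<lambda>t. indicator K t *\<^sub>R (indicator D t * f t))"
    using f by (intro integrable_mult_indicator KL) (simp add: integrable_lebesgue_on[OF D])
  moreover have "(\<lambda>t. indicator K t *\<^sub>R (indicator D t * f t)) = (\<lambda>t. indicator K t * f t)"
    using K by (auto simp: indicator_def fun_eq_iff)
  ultimately show "integrable (lebesgue_on K) f"
    by (simp add: integrable_lebesgue_on[OF KL])
qed

text \<open>\<open>time_deriv\<close> is an arbitrary choice, so it has to be identified with the
  explicit derivative of the product. The difference is tested in space by integrals over boxes and
  in time by the fundamental lemma; rational boxes leave one null set of times for all of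
  them.\<close>

lemma time_deriv_product:
  fixes \<Omega> :: "'a::euclidean_space set"
  assumes op: "open \<Omega>" and bd: "bounded \<Omega>" and \<theta>: "smooth \<theta>" and l: "l \<in> H1 \<Omega>"
  shows "AE t in lebesgue_on {0<..<T}. AE x in lebesgue_on \<Omega>.
    time_deriv T (H1 \<Omega>) (H1_norm \<Omega>) (\<lambda>t x. \<theta> t * l x) t x = frechet_derivative \<theta> (at t) 1 * l x"
proof -
  let ?I = "{0<..<T}" and ?nrm = "H1_norm \<Omega>"
  define v where "v = time_deriv T (H1 \<Omega>) ?nrm (\<lambda>t x. \<theta> t * l x)"
  let ?d\<theta> = "\<lambda>t. frechet_derivative \<theta> (at t) 1"
  let ?l = "\<lambda>B f. \<integral>x. indicator B x * f x \<partial>lebesgue_on \<Omega>"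
  have v: "has_weak_time_deriv T (H1 \<Omega>) ?nrm (\<lambda>t x. \<theta> t * l x) v"
    unfolding v_def time_deriv_def
    by (rule someI[of "has_weak_time_deriv T (H1 \<Omega>) (H1_norm \<Omega>) (\<lambda>t x. \<theta> t * l x)"])
      (rule product_has_weak_time_deriv[OF op bd \<theta> l])
  then have v2: "v \<in> L2_time T (H1 \<Omega>) ?nrm"
    and vw: "\<And>\<eta>. \<eta> \<in> test_functions ?I \<Longrightarrow> \<exists>w. has_time_integral T (H1 \<Omega>) ?nrm (\<lambda>t x. deriv \<eta> t * (\<theta> t * l x)) w \<and>
        has_time_integral T (H1 \<Omega>) ?nrm (\<lambda>t x. - (\<eta> t * v t x)) w"
    unfolding has_weak_time_deriv_def by blast+
  have vs: "strongly_measurable T (H1 \<Omega>) ?nrm v" and vi: "integrable (lebesgue_on ?I) (\<lambda>t. (?nrm (v t))\<^sup>2)"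
    using v2 by (auto simp: L2_time_def)
  have vH: "AE t in lebesgue_on ?I. v t \<in> H1 \<Omega>"
    using vs unfolding strongly_measurable_def by auto
  have zero: "AE t in lebesgue_on ?I. ?l B (v t) - ?d\<theta> t * ?l B l = 0" if B: "B \<in> sets lebesgue" for B
  proof (rule fundamental_lemma)
    have m: "(\<lambda>t. ?l B (v t)) \<in> borel_measurable (lebesgue_on ?I)"
      by (rule strongly_measurable_functional[OF op bd vs B])
    define C where "C = sqrt (measure (lebesgue_on \<Omega>) \<Omega>)"
    have "integrable (lebesgue_on ?I) (\<lambda>t. (norm (?l B (v t)))\<^sup>2)"
    proof (rule Bochner_Integration.integrable_bound)
      show "integrable (lebesgue_on ?I) (\<lambda>t. C\<^sup>2 * (?nrm (v t))\<^sup>2)" using vi by simp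
      show "(\<lambda>t. (norm (?l B (v t)))\<^sup>2) \<in> borel_measurable (lebesgue_on ?I)" using m by measurable
      show "AE t in lebesgue_on ?I. norm ((norm (?l B (v t)))\<^sup>2) \<le> norm (C\<^sup>2 * (?nrm (v t))\<^sup>2)"
        using vH
      proof eventually_elim
        case (elim t)
        have "\<bar>?l B (v t)\<bar> \<le> C * ?nrm (v t)"
          unfolding C_def by (rule integral_on_subset_le_H1_norm(2)[OF op bd elim B])
        from power_mono[OF this, of 2] show ?case by (simp add: power_mult_distrib)
      qed
    qed
    then have "(\<lambda>t. ?l B (v t)) \<in> L2 (lebesgue_on ?I)" using m by (simp add: L2_def)
    then have i: "integrable (lebesgue_on ?I) (\<lambda>t. ?l B (v t))"
      by (rule L2_imp_L1(1)[OF finite_measure_time])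
    have i': "integrable (lebesgue_on ?I) ?d\<theta>"
      using \<theta> by (intro integrable_time_continuous smooth_continuous_on smooth_frechet_derivative)
    have iz: "integrable (lebesgue_on ?I) (\<lambda>t. ?l B (v t) - ?d\<theta> t * ?l B l)" using i i' by simp
    show lz: "locally_integrable ?I (\<lambda>t. ?l B (v t) - ?d\<theta> t * ?l B l)"
      by (rule integrable_imp_locally_integrable[OF _ iz]) simp
    show "open ?I" by simp
    fix \<eta> :: "real \<Rightarrow> real" assume \<eta>: "\<eta> \<in> test_functions ?I"
    obtain w where w: "has_time_integral T (H1 \<Omega>) ?nrm (\<lambda>t x. deriv \<eta> t * (\<theta> t * l x)) w"
        "has_time_integral T (H1 \<Omega>) ?nrm (\<lambda>t x. - (\<eta> t * v t x)) w"
      using vw[OF \<eta>] by blast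
    have d: "deriv \<eta> t = frechet_derivative \<eta> (at t) 1" for t
      by (rule deriv_eq_frechet_derivative[OF smooth_differentiable[OF test_function_smooth[OF \<eta>]]])
    have "?l B (\<lambda>x. - (\<eta> t * v t x)) = - (\<eta> t * ?l B (v t))" for t
      by (simp add: mult.left_commute)
    then have e1: "integrable (lebesgue_on ?I) (\<lambda>t. - (\<eta> t * ?l B (v t)))"
      "(\<integral>t. - (\<eta> t * ?l B (v t)) \<partial>lebesgue_on ?I) = ?l B w"
      using time_integral_functional[OF op bd w(2) B] by simp_all
    have "?l B (\<lambda>x. deriv \<eta> t * (\<theta> t * l x)) = (deriv \<eta> t * \<theta> t) * ?l B l" for t
      by (simp add: mult.left_commute mult.assoc)
    then have e2: "(\<integral>t. deriv \<eta> t * \<theta> t \<partial>lebesgue_on ?I) * ?l B l = ?l B w"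
      using time_integral_functional(2)[OF op bd w(1) B] by simp
    have e3: "(\<integral>t. deriv \<eta> t * \<theta> t \<partial>lebesgue_on ?I) = - (\<integral>t. \<eta> t * ?d\<theta> t \<partial>lebesgue_on ?I)"
      using smooth_weak_partial[OF \<theta>, of ?I 1] \<eta> by (simp add: weak_partial_def d)
    have i4: "integrable (lebesgue_on ?I) (\<lambda>t. \<eta> t * ?d\<theta> t)"
      by (intro integrable_time_continuous continuous_on_mult smooth_continuous_on[OF test_function_smooth[OF \<eta>]]
          smooth_continuous_on[OF smooth_frechet_derivative[OF \<theta>]])
    have "(\<integral>t. \<eta> t * (?l B (v t) - ?d\<theta> t * ?l B l) \<partial>lebesgue_on ?I)
        = (\<integral>t. \<eta> t * ?l B (v t) - (\<eta> t * ?d\<theta> t) * ?l B l \<partial>lebesgue_on ?I)"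
      by (simp add: algebra_simps)
    also have "\<dots> = (\<integral>t. \<eta> t * ?l B (v t) \<partial>lebesgue_on ?I) - (\<integral>t. \<eta> t * ?d\<theta> t \<partial>lebesgue_on ?I) * ?l B l"
      using e1(1) i4 by simp
    also have "\<dots> = 0" using e1(2) e2 unfolding e3 by simp
    finally show "(\<integral>t. \<eta> t * (?l B (v t) - ?d\<theta> t * ?l B l) \<partial>lebesgue_on ?I) = 0" .
  qed
  have all: "AE t in lebesgue_on ?I. \<forall>a\<in>rational_points. \<forall>b\<in>rational_points.
      ?l (box a b) (v t) - ?d\<theta> t * ?l (box a b) l = 0"
    unfolding AE_ball_countable[OF countable_rational_points]
    by (intro ballI zero) simp
  show ?thesis
    unfolding v_def[symmetric] using all vH
  proof eventually_elim
    case (elim t)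
    let ?f = "\<lambda>x. v t x - ?d\<theta> t * l x"
    note fin = finite_measure_lebesgue_on_bounded[OF op bd]
    have \<Omega>: "\<Omega> \<in> sets lebesgue" using op by auto
    have fH: "?f \<in> H1 \<Omega>" by (intro H1_diff[OF op elim(2)] H1_cmult[OF op l])
    have "integrable (lebesgue_on \<Omega>) ?f" by (rule L2_imp_L1(1)[OF fin H1_imp_L2[OF fH]])
    then have g: "integrable lebesgue (\<lambda>x. indicator \<Omega> x * ?f x)" by (simp add: integrable_lebesgue_on[OF \<Omega>])
    have "AE x in lebesgue. indicator \<Omega> x * ?f x = 0"
    proof (rule AE_eq_0_if_rational_box_integrals_eq_0[OF g bd])
      fix a b :: 'a assume ab: "a \<in> rational_points" "b \<in> rational_points"
      have B: "box a b \<in> sets lebesgue" by simp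
      note i = integral_on_subset_le_H1_norm(1)[OF op bd _ B]
      have "(\<integral>x. indicator (box a b) x * (indicator \<Omega> x * ?f x) \<partial>lebesgue) = ?l (box a b) ?f"
        by (simp add: integral_lebesgue_on[OF \<Omega>] mult.left_commute)
      also have "\<dots> = (\<integral>x. indicator (box a b) x * v t x - ?d\<theta> t * (indicator (box a b) x * l x) \<partial>lebesgue_on \<Omega>)"
        by (simp add: algebra_simps)
      also have "\<dots> = ?l (box a b) (v t) - ?d\<theta> t * ?l (box a b) l"
        using i[OF elim(2)] i[OF l] by simp
      also have "\<dots> = 0" using elim(1) ab by blast
      finally show "(\<integral>x. indicator (box a b) x * (indicator \<Omega> x * ?f x) \<partial>lebesgue) = 0" .
    qed simp
    then have "AE x in lebesgue. x \<in> \<Omega> \<longrightarrow> v t x = ?d\<theta> t * l x"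
      by eventually_elim auto
    then show ?case by (simp add: AE_lebesgue_on[OF \<Omega>])
  qed
qed

subsection \<open>Measurability in time of integrals over the domain\<close>

text \<open>\<open>F\<close> is continuous only over the open set \<Omega>; extended by 0 it is a
  Borel function on the whole product and can be composed with measurable ones.\<close>

lemma composite_measurable:
  fixes F :: "'a::euclidean_space \<Rightarrow> real \<Rightarrow> 'a \<Rightarrow> real"
  assumes op: "open \<Omega>" and F: "continuous_on (\<Omega> \<times> UNIV \<times> UNIV) (\<lambda>(x, s, v). F x s v)"
    and w: "w \<in> borel_measurable (lebesgue_on \<Omega>)" and p: "p \<in> borel_measurable (lebesgue_on \<Omega>)"
  shows "(\<lambda>x. F x (w x) (p x)) \<in> borel_measurable (lebesgue_on \<Omega>)"
proof -
  let ?D = "\<Omega> \<times> (UNIV :: real set) \<times> (UNIV :: 'a set)"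
  have "?D \<in> sets borel" using op by (intro borel_open open_Times) auto
  then have H: "(\<lambda>z. indicator ?D z *\<^sub>R (case z of (x, s, v) \<Rightarrow> F x s v)) \<in> borel_measurable borel"
    by (rule borel_measurable_continuous_on_indicator[OF _ F])
  have "(\<lambda>x. x) \<in> borel_measurable (lebesgue_on \<Omega>)"
    by (rule borel_measurable_lebesgue_on_borel) simp
  then have "(\<lambda>x. (x, w x, p x)) \<in> borel_measurable (lebesgue_on \<Omega>)"
    using w p by (intro borel_measurable_Pair)
  from measurable_compose[OF this H]
  show ?thesis by (rule measurable_cong[THEN iffD1, rotated]) simp
qed

text \<open>Every subsequence has a further one along which values and gradients converge almost
  everywhere, and there boundedness and continuity of \<open>F\<close> allow dominated
  convergence.\<close>

lemma integral_composite_tendsto: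
  fixes F :: "'a::euclidean_space \<Rightarrow> real \<Rightarrow> 'a \<Rightarrow> real"
  assumes op: "open \<Omega>" and bd: "bounded \<Omega>" and F: "continuous_on (\<Omega> \<times> UNIV \<times> UNIV) (\<lambda>(x, s, v). F x s v)"
    and C: "\<And>x s v. x \<in> \<Omega> \<Longrightarrow> \<bar>F x s v\<bar> \<le> C"
    and f: "\<And>k. f k \<in> H1 \<Omega>" "g \<in> H1 \<Omega>" and lim: "(\<lambda>k. H1_norm \<Omega> (\<lambda>x. f k x - g x)) \<longlonglongrightarrow> 0"
  shows "(\<lambda>k. \<integral>x. F x (f k x) (weak_grad \<Omega> (f k) x) \<partial>lebesgue_on \<Omega>)
    \<longlonglongrightarrow> (\<integral>x. F x (g x) (weak_grad \<Omega> g x) \<partial>lebesgue_on \<Omega>)"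
proof (rule tendsto_subseq_principle)
  let ?M = "lebesgue_on \<Omega>"
  note fin = finite_measure_lebesgue_on_bounded[OF op bd]
  fix \<rho> :: "nat \<Rightarrow> nat" assume \<rho>: "strict_mono \<rho>"
  have i: "integrable ?M h" "integrable ?M (weak_grad \<Omega> h)" "h \<in> borel_measurable ?M" "weak_grad \<Omega> h \<in> borel_measurable ?M"
    if "h \<in> H1 \<Omega>" for h
    using L2_imp_L1(1)[OF fin H1_imp_L2[OF that]] L2_imp_L1(1)[OF fin weak_grad_L2[OF that]] by auto
  have lim\<rho>: "(\<lambda>k. H1_norm \<Omega> (\<lambda>x. f (\<rho> k) x - g x)) \<longlonglongrightarrow> 0"
    using LIMSEQ_subseq_LIMSEQ[OF lim \<rho>] by (simp add: o_def)
  note L = H1_convergence[OF op bd f(1) f(2) lim\<rho>]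
  obtain \<sigma>1 :: "nat \<Rightarrow> nat" where \<sigma>1: "strict_mono \<sigma>1" "AE x in ?M. (\<lambda>k. f (\<rho> (\<sigma>1 k)) x - g x) \<longlonglongrightarrow> 0"
    using tendsto_L1_AE_subseq[OF _ L(1)] i(1)[OF f(1)] i(1)[OF f(2)] by auto
  have L2: "(\<lambda>k. \<integral>x. norm (weak_grad \<Omega> (f (\<rho> (\<sigma>1 k))) x - weak_grad \<Omega> g x) \<partial>?M) \<longlonglongrightarrow> 0"
    using LIMSEQ_subseq_LIMSEQ[OF L(2) \<sigma>1(1)] by (simp add: o_def)
  obtain \<sigma>2 :: "nat \<Rightarrow> nat" where \<sigma>2: "strict_mono \<sigma>2"
    "AE x in ?M. (\<lambda>k. weak_grad \<Omega> (f (\<rho> (\<sigma>1 (\<sigma>2 k)))) x - weak_grad \<Omega> g x) \<longlonglongrightarrow> 0"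
    using tendsto_L1_AE_subseq[OF _ L2] i(2)[OF f(1)] i(2)[OF f(2)] by auto
  let ?r = "\<lambda>k. \<rho> (\<sigma>1 (\<sigma>2 k))"
  have "(\<lambda>k. \<integral>x. F x (f (?r k) x) (weak_grad \<Omega> (f (?r k)) x) \<partial>?M) \<longlonglongrightarrow> (\<integral>x. F x (g x) (weak_grad \<Omega> g x) \<partial>?M)"
  proof (rule integral_dominated_convergence[where w = "\<lambda>x. C"])
    show "(\<lambda>x. F x (g x) (weak_grad \<Omega> g x)) \<in> borel_measurable ?M"
      "(\<lambda>x. F x (f (?r k) x) (weak_grad \<Omega> (f (?r k)) x)) \<in> borel_measurable ?M" for k
      by (intro composite_measurable[OF op F] i f)+
    show "integrable ?M (\<lambda>x. C)" using fin by (simp add: finite_measure.integrable_const)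
    show "AE x in ?M. norm (F x (f (?r k) x) (weak_grad \<Omega> (f (?r k)) x)) \<le> C" for k
      using C by (intro AE_I2) simp
    have "AE x in ?M. x \<in> \<Omega>" by (rule AE_I2) simp
    then show "AE x in ?M. (\<lambda>k. F x (f (?r k) x) (weak_grad \<Omega> (f (?r k)) x)) \<longlonglongrightarrow> F x (g x) (weak_grad \<Omega> g x)"
      using \<sigma>1(2) \<sigma>2(2)
    proof eventually_elim
      case (elim x)
      have "(\<lambda>k. f (?r k) x) \<longlonglongrightarrow> g x"
        using LIMSEQ_subseq_LIMSEQ[OF elim(2) \<sigma>2(1)] by (simp add: o_def LIM_zero_iff)
      moreover have "(\<lambda>k. weak_grad \<Omega> (f (?r k)) x) \<longlonglongrightarrow> weak_grad \<Omega> g x"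
        using elim(3) by (simp add: LIM_zero_iff)
      ultimately have "(\<lambda>k. (x, f (?r k) x, weak_grad \<Omega> (f (?r k)) x)) \<longlonglongrightarrow> (x, g x, weak_grad \<Omega> g x)"
        by (intro tendsto_Pair tendsto_const)
      from continuous_on_tendsto_compose[OF F this] elim(1) show ?case by simp
    qed
  qed
  then show "\<exists>\<sigma> :: nat \<Rightarrow> nat. strict_mono \<sigma> \<and> (\<lambda>k. \<integral>x. F x (f (\<rho> (\<sigma> k)) x) (weak_grad \<Omega> (f (\<rho> (\<sigma> k))) x) \<partial>?M)
      \<longlonglongrightarrow> (\<integral>x. F x (g x) (weak_grad \<Omega> g x) \<partial>?M)"
    using strict_mono_o[OF \<sigma>1(1) \<sigma>2(1)] by (intro exI[of _ "\<lambda>k. \<sigma>1 (\<sigma>2 k)"]) (simp add: o_def)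
qed

text \<open>For a frozen \<open>w\<close> the space integral is continuous in \<open>t\<close>. A
  simple \<open>u\<close> selects finitely many such functions on measurable sets, and a strongly
  measurable \<open>u\<close> is a limit of simple ones.\<close>

lemma space_integral_integrable:
  fixes F :: "real \<Rightarrow> 'a::euclidean_space \<Rightarrow> real \<Rightarrow> 'a \<Rightarrow> real"
  assumes op: "open \<Omega>" and bd: "bounded \<Omega>"
    and F: "continuous_on ({0<..<T} \<times> \<Omega> \<times> UNIV \<times> UNIV) (\<lambda>(t, x, s, v). F t x s v)"
    and C: "\<And>t x s v. t \<in> {0<..<T} \<Longrightarrow> x \<in> \<Omega> \<Longrightarrow> \<bar>F t x s v\<bar> \<le> C"
    and u: "strongly_measurable T (H1 \<Omega>) (H1_norm \<Omega>) u"
  shows "integrable (lebesgue_on {0<..<T}) (\<lambda>t. \<integral>x. F t x (u t x) (weak_grad \<Omega> (u t) x) \<partial>lebesgue_on \<Omega>)"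
proof -
  let ?I = "{0<..<T}" and ?M = "lebesgue_on \<Omega>"
  let ?h = "\<lambda>w t. \<integral>x. F t x (w x) (weak_grad \<Omega> w x) \<partial>?M"
  note fin = finite_measure_lebesgue_on_bounded[OF op bd]
  have Ft: "continuous_on (\<Omega> \<times> UNIV \<times> UNIV) (\<lambda>(x, s, v). F t x s v)" if "t \<in> ?I" for t
  proof -
    have "continuous_on (\<Omega> \<times> (UNIV :: real set) \<times> (UNIV :: 'a set)) (\<lambda>z. (\<lambda>(t, x, s, v). F t x s v) (t, z))"
      by (rule continuous_on_compose2[OF F]) (use that in \<open>auto intro!: continuous_intros\<close>)
    then show ?thesis by (simp add: case_prod_beta')
  qed
  have m: "w \<in> borel_measurable ?M" "weak_grad \<Omega> w \<in> borel_measurable ?M" if "w \<in> H1 \<Omega>" for w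
    using that by (auto intro: L2_measurable H1_imp_L2 weak_grad_L2)
  have hc: "continuous_on ?I (?h w)" if w: "w \<in> H1 \<Omega>" for w
  proof (rule continuous_on_sequentiallyI)
    fix \<tau> :: "nat \<Rightarrow> real" and t assume \<tau>: "\<forall>n. \<tau> n \<in> ?I" "t \<in> ?I" "\<tau> \<longlonglongrightarrow> t"
    show "(\<lambda>n. ?h w (\<tau> n)) \<longlonglongrightarrow> ?h w t"
    proof (rule integral_dominated_convergence[where w = "\<lambda>x. C"])
      show "(\<lambda>x. F t x (w x) (weak_grad \<Omega> w x)) \<in> borel_measurable ?M"
        "(\<lambda>x. F (\<tau> n) x (w x) (weak_grad \<Omega> w x)) \<in> borel_measurable ?M" for n
        by (rule composite_measurable[OF op Ft m[OF w]], use \<tau>(1,2) in simp)+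
      show "integrable ?M (\<lambda>x. C)" using fin by (simp add: finite_measure.integrable_const)
      show "AE x in ?M. norm (F (\<tau> n) x (w x) (weak_grad \<Omega> w x)) \<le> C" for n
        using C \<tau>(1) by (intro AE_I2) simp
      show "AE x in ?M. (\<lambda>n. F (\<tau> n) x (w x) (weak_grad \<Omega> w x)) \<longlonglongrightarrow> F t x (w x) (weak_grad \<Omega> w x)"
      proof (rule AE_I2)
        fix x assume x: "x \<in> space ?M"
        have "(\<lambda>n. (\<tau> n, x, w x, weak_grad \<Omega> w x)) \<longlonglongrightarrow> (t, x, w x, weak_grad \<Omega> w x)"
          by (intro tendsto_Pair tendsto_const \<tau>(3))
        from continuous_on_tendsto_compose[OF F this] x \<tau>(1,2)
        show "(\<lambda>n. F (\<tau> n) x (w x) (weak_grad \<Omega> w x)) \<longlonglongrightarrow> F t x (w x) (weak_grad \<Omega> w x)" by simp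
      qed
    qed
  qed
  have hm: "?h w \<in> borel_measurable (lebesgue_on ?I)" if "w \<in> H1 \<Omega>" for w
    using continuous_imp_measurable_on_sets_lebesgue[OF hc[OF that]] by simp
  obtain s where s: "\<And>k::nat. simple_in_time T (H1 \<Omega>) (s k)"
    "AE t in lebesgue_on ?I. u t \<in> H1 \<Omega> \<and> (\<lambda>k. H1_norm \<Omega> (\<lambda>x. s k t x - u t x)) \<longlonglongrightarrow> 0"
    using u unfolding strongly_measurable_def by blast
  have meas: "(\<lambda>t. ?h (u t) t) \<in> borel_measurable (lebesgue_on ?I)"
  proof (rule borel_measurable_lebesgue_on_LIMSEQ_AE)
    fix k
    let ?E = "\<lambda>w. {t \<in> ?I. s k t = w}"
    have fins: "finite (s k ` ?I)" and H: "\<And>w. w \<in> s k ` ?I \<Longrightarrow> w \<in> H1 \<Omega>" and E: "\<And>w. ?E w \<in> sets lebesgue"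
      using s(1)[of k] by (auto simp: simple_in_time_def)
    have "?E w \<in> sets (lebesgue_on ?I)" for w
      using E by (subst sets_restrict_space_iff) auto
    then have "(\<lambda>t. \<Sum>w\<in>s k ` ?I. indicator (?E w) t * ?h w t) \<in> borel_measurable (lebesgue_on ?I)"
      by (intro borel_measurable_sum borel_measurable_times borel_measurable_indicator hm H)
    moreover have "(\<Sum>w\<in>s k ` ?I. indicator (?E w) t * ?h w t) = ?h (s k t) t" if "t \<in> ?I" for t
    proof -
      have "(\<Sum>w\<in>s k ` ?I. indicator (?E w) t * ?h w t) = (\<Sum>w\<in>s k ` ?I. if w = s k t then ?h (s k t) t else 0)"
        using that by (intro sum.cong) (auto simp: indicator_def)
      then show ?thesis using that fins by simp
    qed
    ultimately show "(\<lambda>t. ?h (s k t) t) \<in> borel_measurable (lebesgue_on ?I)"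
      by (rule measurable_cong[THEN iffD1, rotated]) simp
  next
    have "AE t in lebesgue_on ?I. t \<in> ?I" by (rule AE_I2) simp
    then show "AE t in lebesgue_on ?I. (\<lambda>k. ?h (s k t) t) \<longlonglongrightarrow> ?h (u t) t"
      using s(2)
    proof eventually_elim
      case (elim t)
      have sH: "s k t \<in> H1 \<Omega>" for k using s(1)[of k] elim(1) by (auto simp: simple_in_time_def)
      show ?case
        by (rule integral_composite_tendsto[OF op bd Ft[OF elim(1)] C[OF elim(1)] sH conjunct1[OF elim(2)] conjunct2[OF elim(2)]])
    qed
  qed simp
  show ?thesis
  proof (rule finite_measure.integrable_const_bound[OF finite_measure_time _ meas])
    have uH: "AE t in lebesgue_on ?I. u t \<in> H1 \<Omega>" using s(2) by eventually_elim simp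
    have "AE t in lebesgue_on ?I. t \<in> ?I" by (rule AE_I2) simp
    then show "AE t in lebesgue_on ?I. norm (?h (u t) t) \<le> C * measure ?M \<Omega>"
      using uH
    proof eventually_elim
      case (elim t)
      interpret finite_measure ?M by (rule fin)
      have i: "integrable ?M (\<lambda>x. F t x (u t x) (weak_grad \<Omega> (u t) x))"
        by (rule integrable_bounded_finite_measure[OF fin composite_measurable[OF op Ft], where C = C])
          (use elim C m in auto)
      have "norm (?h (u t) t) \<le> (\<integral>x. norm (F t x (u t x) (weak_grad \<Omega> (u t) x)) \<partial>?M)" by (rule integral_norm_bound)
      also have "\<dots> \<le> (\<integral>x. C \<partial>?M)" using i C elim(1) by (intro integral_mono) auto
      finally show ?case by (simp add: mult.commute)
    qed
  qed
qed

section \<open>Coefficients and their primitives\<close>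

lemma W1inf_ball_continuous: "f \<in> W1inf_ball D C \<Longrightarrow> continuous_on D f"
  by (simp add: W1inf_ball_def)

text \<open>The set where the bound fails is open by continuity and null, hence empty. Bounds at
  every point matter because coefficients are evaluated along solutions, whose range may meet null
  sets.\<close>

lemma W1inf_ball_bound:
  assumes D: "open D" and f: "f \<in> W1inf_ball D C" and x: "x \<in> D"
  shows "norm (f x) \<le> C"
proof (rule ccontr)
  let ?N = "{x \<in> D. C < norm (f x)}"
  assume "\<not> norm (f x) \<le> C"
  then have ne: "?N \<noteq> {}" using x by auto
  have c: "continuous_on D (\<lambda>x. norm (f x))" using f by (intro continuous_on_norm W1inf_ball_continuous)
  have "?N = D \<inter> (\<lambda>x. norm (f x)) -` {C<..}" by auto
  then have N: "open ?N" using continuous_open_preimage[OF c D open_greaterThan, of C] by simp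
  have "AE x in lebesgue_on D. norm (f x) \<le> C" using f by (simp add: W1inf_ball_def)
  then have "AE x in lebesgue. x \<in> D \<longrightarrow> norm (f x) \<le> C" using D by (simp add: AE_lebesgue_on)
  then have "AE x in lebesgue. x \<notin> ?N" by eventually_elim auto
  then have "?N \<in> null_sets lebesgue" using N by (subst AE_iff_null_sets) auto
  then show False using open_not_negligible[OF N ne] by (simp add: negligible_iff_null_sets)
qed

text \<open>The integral from \<open>g\<close> to \<open>u\<close>, parametrised over the unit interval to cover \<open>u < g\<close> as well.\<close>

definition primitive_from :: "real \<Rightarrow> (real \<Rightarrow> real) \<Rightarrow> real \<Rightarrow> real" where
  "primitive_from g a u = integral {0..1} (\<lambda>s. a (g + s * (u - g)) * (u - g))"

lemma primitive_from_eq: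
  assumes "\<And>u. (A has_real_derivative a u) (at u)"
  shows "primitive_from g a u = A u - A g"
proof -
  have "((\<lambda>s. a (g + s * (u - g)) * (u - g)) has_integral A (g + 1 * (u - g)) - A (g + 0 * (u - g))) {0..1}"
  proof (rule fundamental_theorem_of_calculus)
    fix s :: real
    have "((\<lambda>s. A (g + s * (u - g))) has_real_derivative a (g + s * (u - g)) * (u - g)) (at s)"
      by (rule DERIV_chain2[OF assms]) (auto intro!: derivative_eq_intros)
    then show "((\<lambda>s. A (g + s * (u - g))) has_vector_derivative a (g + s * (u - g)) * (u - g)) (at s within {0..1})"
      by (simp add: has_real_derivative_iff_has_vector_derivative[symmetric] has_field_derivative_at_within)
  qed simp
  from integral_unique[OF this] show ?thesis unfolding primitive_from_def by simp
qed

lemma ex_antiderivative: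
  fixes a :: "real \<Rightarrow> real"
  assumes "continuous_on UNIV a"
  shows "\<exists>A. \<forall>u. (A has_real_derivative a u) (at u)"
proof (intro exI allI)
  fix u :: real
  let ?l = "min 0 u - 1" and ?h = "max 0 u + 1"
  have "((\<lambda>u. LBINT y=ereal 0..ereal u. a y) has_vector_derivative a u) (at u within {?l..?h})"
    by (rule interval_integral_FTC2) (use assms in \<open>auto intro: continuous_on_subset\<close>)
  then have "((\<lambda>u. LBINT y=ereal 0..ereal u. a y) has_vector_derivative a u) (at u within {?l<..<?h})"
    by (rule has_vector_derivative_within_subset) auto
  then show "((\<lambda>u. LBINT y=ereal 0..ereal u. a y) has_real_derivative a u) (at u)"
    by (subst (asm) at_within_open) (auto simp: has_real_derivative_iff_has_vector_derivative)
qed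

lemma primitive_from_derivative:
  assumes "continuous_on UNIV a"
  shows "(primitive_from g a has_real_derivative a u) (at u)"
proof -
  obtain A where A: "\<And>u. (A has_real_derivative a u) (at u)" using ex_antiderivative[OF assms] by blast
  have "primitive_from g a = (\<lambda>u. A u - A g)" using primitive_from_eq[OF A] by blast
  then show ?thesis using A[of u] by (auto intro!: derivative_eq_intros)
qed

lemma primitive_from_base: "primitive_from g a g = 0"
  by (simp add: primitive_from_def)

lemma primitive_from_bound:
  assumes "continuous_on UNIV a" "\<And>s. \<bar>a s\<bar> \<le> K"
  shows "\<bar>primitive_from g a u\<bar> \<le> K * \<bar>u - g\<bar>"
  using field_differentiable_bound[of UNIV "primitive_from g a" a K u g] primitive_from_derivative[OF assms(1)] assms(2)
  by (simp add: primitive_from_base)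

lemma primitive_from_diff_ge:
  assumes a: "continuous_on UNIV a1" "continuous_on UNIV a2" and u: "g \<le> u"
    and ge: "\<And>s. g \<le> s \<Longrightarrow> s \<le> u \<Longrightarrow> \<delta> \<le> a1 s - a2 s"
  shows "\<delta> * (u - g) \<le> primitive_from g a1 u - primitive_from g a2 u"
proof (cases "g = u")
  case False
  have "\<exists>z>g. z < u \<and> (primitive_from g a1 u - primitive_from g a2 u) - (primitive_from g a1 g - primitive_from g a2 g)
      = (u - g) * (a1 z - a2 z)"
    using u False by (intro MVT2) (auto intro!: derivative_eq_intros primitive_from_derivative a)
  then obtain z where z: "g < z" "z < u" "primitive_from g a1 u - primitive_from g a2 u = (u - g) * (a1 z - a2 z)"
    by (auto simp: primitive_from_base)
  then show ?thesis using mult_left_mono[OF ge[of z], of "u - g"] by (simp add: mult.commute)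
qed (simp add: primitive_from_base)

text \<open>The fixed interval of integration makes this a case of continuity of parameter
  integrals.\<close>

lemma primitive_from_continuous:
  fixes a :: "real \<Rightarrow> real \<Rightarrow> real"
  assumes "continuous_on (J \<times> UNIV) (\<lambda>(t, u). a t u)"
  shows "continuous_on (J \<times> UNIV) (\<lambda>(t, u). primitive_from g (a t) u)"
proof -
  have "continuous_on ((J \<times> UNIV) \<times> cbox 0 (1::real)) (\<lambda>z. (\<lambda>(t, u). a t u) (fst (fst z), g + snd z * (snd (fst z) - g)))"
    by (rule continuous_on_compose2[OF assms]) (auto intro!: continuous_intros)
  then have "continuous_on ((J \<times> UNIV) \<times> cbox 0 (1::real)) (\<lambda>z. a (fst (fst z)) (g + snd z * (snd (fst z) - g)) * (snd (fst z) - g))"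
    by (intro continuous_on_mult) (auto intro!: continuous_intros)
  then have "continuous_on ((J \<times> UNIV) \<times> cbox 0 (1::real)) (\<lambda>(p, s). a (fst p) (g + s * (snd p - g)) * (snd p - g))"
    by (simp add: case_prod_beta')
  from integral_continuous_on_param[OF this] show ?thesis
    by (simp add: primitive_from_def case_prod_beta')
qed

section \<open>The flux tested with a product function\<close>

text \<open>By completeness \<open>f\<close> and \<open>g\<close> are measurable together; if they
  are not, both integrals have the default value 0.\<close>

lemma integral_lebesgue_on_cong_AE:
  fixes f g :: "'a::euclidean_space \<Rightarrow> real"
  assumes S: "S \<in> sets lebesgue" and eq: "AE x in lebesgue_on S. f x = g x"
  shows "(\<integral>x. f x \<partial>lebesgue_on S) = (\<integral>x. g x \<partial>lebesgue_on S)"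
proof (cases "f \<in> borel_measurable (lebesgue_on S)")
  case True
  then show ?thesis
    using borel_measurable_lebesgue_on_AE[OF True eq S] eq by (intro integral_cong_AE)
next
  case False
  have "AE x in lebesgue_on S. g x = f x" using eq by eventually_elim simp
  then have "g \<notin> borel_measurable (lebesgue_on S)"
    using False borel_measurable_lebesgue_on_AE[OF _ _ S] by blast
  then have "\<not> integrable (lebesgue_on S) f" "\<not> integrable (lebesgue_on S) g"
    using False borel_measurable_integrable by blast+
  then show ?thesis by (simp add: not_integrable_integral_eq)
qed

text \<open>If \<open>f\<close> is not integrable, its integral is 0 by convention and the
  right-hand side is nonnegative.\<close>

lemma abs_integral_mult_le:
  fixes f h :: "'a \<Rightarrow> real"
  assumes h: "integrable M h" and f: "\<And>x. x \<in> space M \<Longrightarrow> \<bar>f x\<bar> \<le> C * \<bar>h x\<bar>"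
  shows "\<bar>\<integral>x. f x \<partial>M\<bar> \<le> C * (\<integral>x. \<bar>h x\<bar> \<partial>M)"
proof (cases "integrable M f")
  case True
  have "\<bar>\<integral>x. f x \<partial>M\<bar> \<le> (\<integral>x. \<bar>f x\<bar> \<partial>M)" by (rule integral_abs_bound)
  also have "\<dots> \<le> (\<integral>x. C * \<bar>h x\<bar> \<partial>M)" using True h f by (intro integral_mono) auto
  finally show ?thesis by simp
next
  case False
  have "0 \<le> (\<integral>x. C * \<bar>h x\<bar> \<partial>M)"
    by (rule Bochner_Integration.integral_nonneg) (use f abs_ge_zero order_trans in blast)
  then show ?thesis using False by (simp add: not_integrable_integral_eq)
qed

lemma coefficient_assumptionD:
  fixes \<Omega> :: "'a::euclidean_space set"
  assumes c: "coefficient_assumption T \<Omega> C C0 alow aup P" and op: "open \<Omega>"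
  shows "continuous_on ({0<..<T} \<times> UNIV) (\<lambda>(t, u). coeff_a P t u)"
    and "continuous_on (\<Omega> \<times> {0<..<T} \<times> UNIV) (\<lambda>(x, t, u). coeff_b P x t u)"
    and "continuous_on (\<Omega> \<times> {0<..<T} \<times> UNIV \<times> UNIV) (\<lambda>(x, t, u, p). coeff_c P x t u p)"
    and "continuous_on ({0<..<T} \<times> UNIV) (\<lambda>(t, u). coeff_d P t u)"
    and "x \<in> \<Omega> \<Longrightarrow> t \<in> {0<..<T} \<Longrightarrow> norm (coeff_b P x t u) \<le> C"
    and "x \<in> \<Omega> \<Longrightarrow> t \<in> {0<..<T} \<Longrightarrow> \<bar>coeff_c P x t u v\<bar> \<le> C"
    and "t \<in> {0<..<T} \<Longrightarrow> \<bar>coeff_d P t u\<bar> \<le> C"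
    and "t \<in> {0<..<T} \<Longrightarrow> alow \<le> coeff_a P t u \<and> coeff_a P t u \<le> aup"
proof -
  have a: "(\<lambda>(t, u). coeff_a P t u) \<in> W1inf_ball ({0<..<T} \<times> UNIV) C"
    and b: "(\<lambda>(x, t, u). coeff_b P x t u) \<in> W1inf_ball (\<Omega> \<times> {0<..<T} \<times> UNIV) C"
    and cc: "(\<lambda>(x, t, u, p). coeff_c P x t u p) \<in> W1inf_ball (\<Omega> \<times> {0<..<T} \<times> UNIV \<times> UNIV) C"
    and d: "(\<lambda>(t, u). coeff_d P t u) \<in> W1inf_ball ({0<..<T} \<times> UNIV) C"
    and bd: "\<forall>t\<in>{0<..<T}. \<forall>u. alow \<le> coeff_a P t u \<and> coeff_a P t u \<le> aup"
    using c unfolding coefficient_assumption_def by blast+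
  show "continuous_on ({0<..<T} \<times> UNIV) (\<lambda>(t, u). coeff_a P t u)"
    "continuous_on (\<Omega> \<times> {0<..<T} \<times> UNIV) (\<lambda>(x, t, u). coeff_b P x t u)"
    "continuous_on (\<Omega> \<times> {0<..<T} \<times> UNIV \<times> UNIV) (\<lambda>(x, t, u, p). coeff_c P x t u p)"
    "continuous_on ({0<..<T} \<times> UNIV) (\<lambda>(t, u). coeff_d P t u)"
    using a b cc d by (auto intro: W1inf_ball_continuous)
  have o2: "open ({0<..<T} \<times> (UNIV :: real set))" "open (\<Omega> \<times> {0<..<T} \<times> (UNIV :: real set))"
    "open (\<Omega> \<times> {0<..<T} \<times> (UNIV :: real set) \<times> (UNIV :: 'a set))"
    using op by (auto intro!: open_Times)
  show "x \<in> \<Omega> \<Longrightarrow> t \<in> {0<..<T} \<Longrightarrow> norm (coeff_b P x t u) \<le> C"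
    using W1inf_ball_bound[OF o2(2) b, of "(x, t, u)"] by simp
  show "x \<in> \<Omega> \<Longrightarrow> t \<in> {0<..<T} \<Longrightarrow> \<bar>coeff_c P x t u v\<bar> \<le> C"
    using W1inf_ball_bound[OF o2(3) cc, of "(x, t, u, v)"] by simp
  show "t \<in> {0<..<T} \<Longrightarrow> \<bar>coeff_d P t u\<bar> \<le> C"
    using W1inf_ball_bound[OF o2(1) d, of "(t, u)"] by simp
  show "t \<in> {0<..<T} \<Longrightarrow> alow \<le> coeff_a P t u \<and> coeff_a P t u \<le> aup" using bd by blast
qed

lemma coeff_a_continuous:
  assumes "continuous_on (J \<times> UNIV) (\<lambda>(t, u). a t u)" "t \<in> J"
  shows "continuous_on UNIV (a t :: real \<Rightarrow> real)"
proof -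
  have "continuous_on UNIV (\<lambda>u. (\<lambda>(t, u). a t u) (t, u))"
    by (rule continuous_on_compose2[OF assms(1)]) (use assms(2) in \<open>auto intro!: continuous_intros\<close>)
  then show ?thesis by simp
qed

context flat_boundary_point
begin

definition boundary_flux :: "(real \<Rightarrow> real) \<Rightarrow> ('a \<Rightarrow> real) \<Rightarrow> ('a \<Rightarrow> real) \<Rightarrow> real" where
  "boundary_flux A g l = (\<integral>x. indicator slab x * (A (g (proj x)) * frechet_derivative l (at (proj x)) e) \<partial>lborel)"

lemma boundary_flux_integrable:
  fixes A :: "real \<Rightarrow> real" and g l :: "'a \<Rightarrow> real"
  assumes "continuous_on UNIV A" "continuous_on UNIV g" "smooth l" "\<And>x. x \<notin> ball p (r / 2) \<Longrightarrow> l x = 0"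
  shows "integrable lborel (\<lambda>x. indicator slab x * (A (g (proj x)) * frechet_derivative l (at (proj x)) e))"
proof (rule integrable_slab[where G = "\<lambda>x. A (g x) * frechet_derivative l (at x) e" and S = "cball p (r / 2)", OF _ bounded_cball _ e_Basis])
  show "continuous_on UNIV (\<lambda>x. A (g x) * frechet_derivative l (at x) e)"
    using continuous_on_compose2[OF assms(1,2)] smooth_continuous_on[OF smooth_frechet_derivative[OF assms(3)]]
    by (intro continuous_on_mult) auto
  fix x assume "x \<notin> cball p (r / 2)"
  then have "frechet_derivative l (at x) e = 0"
    by (intro frechet_derivative_outside_support[of "ball p (r / 2)"]) (use assms(4) r_pos in auto)
  then show "A (g x) * frechet_derivative l (at x) e = 0" by simp
qed

lemma boundary_flux_time_integrable:
  fixes a :: "real \<Rightarrow> real \<Rightarrow> real" and \<gamma> :: "real \<Rightarrow> 'a \<Rightarrow> real"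
  assumes a: "continuous_on ({0<..<T} \<times> UNIV) (\<lambda>(t, u). a t u)" and K: "\<And>t s. t \<in> {0<..<T} \<Longrightarrow> \<bar>a t s\<bar> \<le> K"
    and \<gamma>: "\<And>t. continuous_on UNIV (\<gamma> t)" "\<And>x. continuous_on UNIV (\<lambda>t. \<gamma> t x)" and b: "\<And>t x. \<bar>\<gamma> t x - g1\<bar> \<le> L"
    and l: "smooth l" "\<And>x. x \<notin> ball p (r / 2) \<Longrightarrow> l x = 0"
  shows "integrable (lebesgue_on {0<..<T}) (\<lambda>t. boundary_flux (primitive_from g1 (a t)) (\<gamma> t) l)"
proof (cases "T > 0")
  case True
  let ?I = "{0<..<T}"
  \<comment> \<open>The factor 1 makes \<open>?d\<close> the integrand of
    \<open>boundary_flux\<close> for the constant function 1, which yields its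
    integrability.\<close>
  let ?d = "\<lambda>x. indicator slab x * (1 * frechet_derivative l (at (proj x)) e)"
  let ?B = "\<lambda>t. boundary_flux (primitive_from g1 (a t)) (\<gamma> t) l"
  note at = coeff_a_continuous[OF a]
  have K0: "K \<ge> 0" using K[of "T / 2" 0] True by auto
  have cP: "continuous_on UNIV (primitive_from g1 (a t))" if "t \<in> ?I" for t
    using primitive_from_derivative[OF at[OF that]] by (intro continuous_at_imp_continuous_on ballI DERIV_isCont)
  have di: "integrable lborel ?d"
    using boundary_flux_integrable[of "\<lambda>_. 1", OF _ \<gamma>(1) l] by simp
  have ii: "integrable lborel (\<lambda>x. indicator slab x * (primitive_from g1 (a t) (\<gamma> t (proj x)) * frechet_derivative l (at (proj x)) e))"
    if "t \<in> ?I" for t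
    by (rule boundary_flux_integrable[OF cP[OF that] \<gamma>(1) l])
  have bound: "\<bar>indicator slab x * (primitive_from g1 (a t) (\<gamma> t (proj x)) * frechet_derivative l (at (proj x)) e)\<bar>
      \<le> K * L * \<bar>?d x\<bar>" if "t \<in> ?I" for t x
  proof -
    have "\<bar>primitive_from g1 (a t) (\<gamma> t (proj x))\<bar> \<le> K * \<bar>\<gamma> t (proj x) - g1\<bar>"
      by (rule primitive_from_bound[OF at[OF that] K[OF that]])
    also have "\<dots> \<le> K * L" by (rule mult_left_mono[OF b K0])
    finally have "\<bar>primitive_from g1 (a t) (\<gamma> t (proj x))\<bar> * \<bar>?d x\<bar> \<le> K * L * \<bar>?d x\<bar>"
      by (rule mult_right_mono) simp
    then show ?thesis by (simp add: abs_mult mult_ac)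
  qed
  have cont: "continuous_on ?I ?B"
  proof (rule continuous_on_sequentiallyI)
    fix \<tau> :: "nat \<Rightarrow> real" and t assume \<tau>: "\<forall>n. \<tau> n \<in> ?I" "t \<in> ?I" "\<tau> \<longlonglongrightarrow> t"
    show "(\<lambda>n. ?B (\<tau> n)) \<longlonglongrightarrow> ?B t"
      unfolding boundary_flux_def
    proof (rule integral_dominated_convergence[where w = "\<lambda>x. K * L * \<bar>?d x\<bar>"])
      show "integrable lborel (\<lambda>x. K * L * \<bar>?d x\<bar>)" using di by simp
      show "(\<lambda>x. indicator slab x * (primitive_from g1 (a t) (\<gamma> t (proj x)) * frechet_derivative l (at (proj x)) e)) \<in> borel_measurable lborel"
        "(\<lambda>x. indicator slab x * (primitive_from g1 (a (\<tau> n)) (\<gamma> (\<tau> n) (proj x)) * frechet_derivative l (at (proj x)) e)) \<in> borel_measurable lborel" for n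
        by (rule borel_measurable_integrable[OF ii], use \<tau> in simp)+
      show "AE x in lborel. norm (indicator slab x * (primitive_from g1 (a (\<tau> n)) (\<gamma> (\<tau> n) (proj x)) * frechet_derivative l (at (proj x)) e))
          \<le> K * L * \<bar>?d x\<bar>" for n
        using bound[of "\<tau> n"] \<tau>(1) by (intro AE_I2) (simp only: real_norm_def)
      show "AE x in lborel. (\<lambda>n. indicator slab x * (primitive_from g1 (a (\<tau> n)) (\<gamma> (\<tau> n) (proj x)) * frechet_derivative l (at (proj x)) e))
          \<longlonglongrightarrow> indicator slab x * (primitive_from g1 (a t) (\<gamma> t (proj x)) * frechet_derivative l (at (proj x)) e)"
      proof (rule AE_I2)
        fix x
        have "(\<lambda>n. \<gamma> (\<tau> n) (proj x)) \<longlonglongrightarrow> \<gamma> t (proj x)"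
          using continuous_on_tendsto_compose[OF \<gamma>(2) \<tau>(3)] by simp
        then have "(\<lambda>n. (\<tau> n, \<gamma> (\<tau> n) (proj x))) \<longlonglongrightarrow> (t, \<gamma> t (proj x))"
          by (intro tendsto_Pair \<tau>(3))
        from continuous_on_tendsto_compose[OF primitive_from_continuous[OF a] this]
        have "(\<lambda>n. primitive_from g1 (a (\<tau> n)) (\<gamma> (\<tau> n) (proj x))) \<longlonglongrightarrow> primitive_from g1 (a t) (\<gamma> t (proj x))"
          using \<tau>(1,2) by simp
        then show "(\<lambda>n. indicator slab x * (primitive_from g1 (a (\<tau> n)) (\<gamma> (\<tau> n) (proj x)) * frechet_derivative l (at (proj x)) e))
          \<longlonglongrightarrow> indicator slab x * (primitive_from g1 (a t) (\<gamma> t (proj x)) * frechet_derivative l (at (proj x)) e)"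
          by (intro tendsto_mult tendsto_const)
      qed
    qed
  qed
  show ?thesis
  proof (rule integrable_bounded_finite_measure[OF finite_measure_time, where C = "K * L * (\<integral>x. \<bar>?d x\<bar> \<partial>lborel)"])
    show "?B \<in> borel_measurable (lebesgue_on ?I)"
      using continuous_imp_measurable_on_sets_lebesgue[OF cont] by simp
    show "norm (?B t) \<le> K * L * (\<integral>x. \<bar>?d x\<bar> \<partial>lborel)" if "t \<in> space (lebesgue_on ?I)" for t
      unfolding boundary_flux_def real_norm_def
      by (rule abs_integral_mult_le[OF di bound]) (use that in simp)
  qed
qed (simp add: greaterThanLessThan_empty)

text \<open>\<open>R\<close> collects the Laplacian term and all lower order terms. Its bound
  involves the range of \<open>u\<close>, the coefficient bounds and the L1 norms of
  \<open>l\<close>, but no norm of the solution, and is therefore the same for all Dirichlet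
  data.\<close>

lemma flux_representation:
  assumes coef: "coefficient_assumption T \<Omega> C C0 alow aup P" and al: "0 < alow"
    and sol: "weak_solution T \<Omega> P \<gamma> u"
    and rng: "AE t in lebesgue_on {0<..<T}. AE x in lebesgue_on \<Omega>. glow \<le> u t x \<and> u t x \<le> gup"
    and g1: "glow \<le> g1" "g1 \<le> gup" and T: "T > 0"
    and \<gamma>: "\<And>t. continuous_on UNIV (\<gamma> t)" "\<And>x. continuous_on UNIV (\<lambda>t. \<gamma> t x)" "\<And>t x. glow \<le> \<gamma> t x \<and> \<gamma> t x \<le> gup"
    and \<theta>: "\<theta> \<in> test_functions {0<..<T}"
    and l: "smooth l" "\<And>x. x \<notin> ball p (r / 2) \<Longrightarrow> l x = 0"
    and M: "(\<integral>x. \<bar>l x\<bar> \<partial>lebesgue_on \<Omega>) \<le> M" "(\<integral>x. norm (gradient l x) \<partial>lebesgue_on \<Omega>) \<le> M"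
      "(\<integral>x. \<bar>laplacian l x\<bar> \<partial>lebesgue_on \<Omega>) \<le> M"
  obtains R where "integrable (lebesgue_on {0<..<T}) R"
    "\<And>t. t \<in> {0<..<T} \<Longrightarrow> \<bar>R t\<bar> \<le> (\<bar>\<theta> t\<bar> * (aup * (gup - glow) + 2 * C) + \<bar>frechet_derivative \<theta> (at t) 1\<bar> * C) * M"
    "integrable (lebesgue_on {0<..<T}) (\<lambda>t. \<theta> t * boundary_flux (primitive_from g1 (coeff_a P t)) (\<gamma> t) l)"
    "neumann_flux T \<Omega> P u (\<lambda>t x. \<theta> t * l x)
      = (\<integral>t. \<theta> t * boundary_flux (primitive_from g1 (coeff_a P t)) (\<gamma> t) l + R t \<partial>lebesgue_on {0<..<T})"
proof -
  let ?I = "{0<..<T}" and ?M = "lebesgue_on \<Omega>"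
  \<comment> \<open>\<open>u\<close> stays in the range only almost everywhere. Clamping bounds the
    primitive for every argument, as \<open>space_integral_integrable\<close> demands, and alters
    the integrand along \<open>u\<close> only on null sets.\<close>
  let ?cl = "\<lambda>s. max glow (min gup s)"
  let ?A = "\<lambda>t. primitive_from g1 (coeff_a P t)"
  let ?d\<theta> = "\<lambda>t. frechet_derivative \<theta> (at t) 1"
  let ?B = "\<lambda>t. boundary_flux (?A t) (\<gamma> t) l"
  note D = open_domain bounded_domain
  note fin = finite_measure_lebesgue_on_bounded[OF D]
  note co = coefficient_assumptionD[OF coef open_domain]
  have \<Omega>: "\<Omega> \<in> sets lebesgue" using open_domain by auto
  note s\<theta> = test_function_smooth[OF \<theta>]
  have u2: "u \<in> L2_time T (H1 \<Omega>) (H1_norm \<Omega>)" and tr: "AE t in lebesgue_on ?I. has_trace \<Omega> (u t) (\<gamma> t)"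
    using sol unfolding weak_solution_def by blast+
  then have us: "strongly_measurable T (H1 \<Omega>) (H1_norm \<Omega>) u" by (simp add: L2_time_def)
  have cgl: "continuous_on UNIV (gradient l)" and cll: "continuous_on UNIV (laplacian l)" and cl: "continuous_on UNIV l"
    using l(1) by (auto intro: continuous_gradient smooth_laplacian_continuous smooth_continuous_on)
  have il: "integrable ?M l" and igl: "integrable ?M (gradient l)" and ill: "integrable ?M (laplacian l)"
    by (intro integrable_continuous_lebesgue_on cl cgl cll D)+
  obtain K1 where K1: "K1 \<ge> 0" "\<And>x. x \<in> \<Omega> \<Longrightarrow> norm (gradient l x) \<le> K1"
    using continuous_on_imp_bounded_on[OF cgl D(2)] by metis
  obtain K2 where K2: "K2 \<ge> 0" "\<And>x. x \<in> \<Omega> \<Longrightarrow> norm (laplacian l x) \<le> K2"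
    using continuous_on_imp_bounded_on[OF cll D(2)] by metis
  obtain K3 where K3: "K3 \<ge> 0" "\<And>x. x \<in> \<Omega> \<Longrightarrow> norm (l x) \<le> K3"
    using continuous_on_imp_bounded_on[OF cl D(2)] by metis
  have aup: "\<bar>coeff_a P t s\<bar> \<le> aup" if "t \<in> ?I" for t s using co(8)[OF that, of s] al by linarith
  have tI: "T / 2 \<in> ?I" using T by simp
  have aup0: "aup \<ge> 0" using aup[OF tI, of 0] by linarith
  have C0: "C \<ge> 0" using co(7)[OF tI, of 0] by linarith
  have cA: "continuous_on UNIV (coeff_a P t)" if "t \<in> ?I" for t by (rule coeff_a_continuous[OF co(1) that])
  have Ab: "\<bar>?A t (?cl s)\<bar> \<le> aup * (gup - glow)" if "t \<in> ?I" for t s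
  proof -
    have "\<bar>?A t (?cl s)\<bar> \<le> aup * \<bar>?cl s - g1\<bar>" by (rule primitive_from_bound[OF cA[OF that] aup[OF that]])
    also have "\<dots> \<le> aup * (gup - glow)" using g1 by (intro mult_left_mono aup0) auto
    finally show ?thesis .
  qed
  define FE where "FE = (\<lambda>t x s (v::'a). ?A t (?cl s) * laplacian l x)"
  define FB where "FB = (\<lambda>t x s (v::'a). coeff_b P x t s \<bullet> gradient l x)"
  define FC where "FC = (\<lambda>t x s v. coeff_c P x t s v * l x)"
  define FD where "FD = (\<lambda>t x s (v::'a). coeff_d P t s * l x)"
  let ?Dom = "?I \<times> \<Omega> \<times> (UNIV :: real set) \<times> (UNIV :: 'a set)"
  have cx: "continuous_on ?Dom (\<lambda>z. h (fst (snd z)))" if "continuous_on UNIV h" for h :: "'a \<Rightarrow> 'c::topological_space"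
    by (rule continuous_on_compose2[OF that]) (auto intro!: continuous_intros)
  have "continuous_on ?Dom (\<lambda>z. (\<lambda>(t, u). ?A t u) (fst z, ?cl (fst (snd (snd z)))))"
    by (rule continuous_on_compose2[OF primitive_from_continuous[OF co(1)]]) (auto intro!: continuous_intros)
  from continuous_on_mult[OF this cx[OF cll]] have cFE: "continuous_on ?Dom (\<lambda>(t, x, s, v). FE t x s v)"
    by (simp add: FE_def case_prod_beta')
  have "continuous_on ?Dom (\<lambda>z. (\<lambda>(x, t, u). coeff_b P x t u) (fst (snd z), fst z, fst (snd (snd z))))"
    by (rule continuous_on_compose2[OF co(2)]) (auto intro!: continuous_intros)
  from continuous_on_inner[OF this cx[OF cgl]] have cFB: "continuous_on ?Dom (\<lambda>(t, x, s, v). FB t x s v)"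
    by (simp add: FB_def case_prod_beta')
  have "continuous_on ?Dom (\<lambda>z. (\<lambda>(x, t, u, p). coeff_c P x t u p) (fst (snd z), fst z, fst (snd (snd z)), snd (snd (snd z))))"
    by (rule continuous_on_compose2[OF co(3)]) (auto intro!: continuous_intros)
  from continuous_on_mult[OF this cx[OF cl]] have cFC: "continuous_on ?Dom (\<lambda>(t, x, s, v). FC t x s v)"
    by (simp add: FC_def case_prod_beta')
  have "continuous_on ?Dom (\<lambda>z. (\<lambda>(t, u). coeff_d P t u) (fst z, fst (snd (snd z))))"
    by (rule continuous_on_compose2[OF co(4)]) (auto intro!: continuous_intros)
  from continuous_on_mult[OF this cx[OF cl]] have cFD: "continuous_on ?Dom (\<lambda>(t, x, s, v). FD t x s v)"
    by (simp add: FD_def case_prod_beta')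
  have bFE: "\<bar>FE t x s v\<bar> \<le> aup * (gup - glow) * \<bar>laplacian l x\<bar>" if "t \<in> ?I" for t x s v
    unfolding FE_def abs_mult by (intro mult_right_mono Ab that) simp
  have bFB: "\<bar>FB t x s v\<bar> \<le> C * \<bar>norm (gradient l x)\<bar>" if "t \<in> ?I" "x \<in> \<Omega>" for t x s v
  proof -
    have "\<bar>FB t x s v\<bar> \<le> norm (coeff_b P x t s) * norm (gradient l x)"
      unfolding FB_def by (rule Cauchy_Schwarz_ineq2)
    also have "\<dots> \<le> C * norm (gradient l x)" by (intro mult_right_mono co(5) that) simp
    finally show ?thesis by simp
  qed
  have bFC: "\<bar>FC t x s v\<bar> \<le> C * \<bar>l x\<bar>" if "t \<in> ?I" "x \<in> \<Omega>" for t x s v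
    unfolding FC_def abs_mult by (intro mult_right_mono co(6) that) simp
  have bFD: "\<bar>FD t x s v\<bar> \<le> C * \<bar>l x\<bar>" if "t \<in> ?I" for t x s v
    unfolding FD_def abs_mult by (intro mult_right_mono co(7) that) simp
  let ?int = "\<lambda>F t. \<integral>x. F t x (u t x) (weak_grad \<Omega> (u t) x) \<partial>?M"
  have iE: "integrable (lebesgue_on ?I) (?int FE)"
    by (rule space_integral_integrable[OF D cFE _ us, where C = "aup * (gup - glow) * K2"],
        rule order_trans[OF bFE mult_left_mono]) (use K2 aup0 g1 in auto)
  have iB: "integrable (lebesgue_on ?I) (?int FB)"
    by (rule space_integral_integrable[OF D cFB _ us, where C = "C * K1"],
        rule order_trans[OF bFB mult_left_mono]) (use K1 C0 in auto)
  have iC: "integrable (lebesgue_on ?I) (?int FC)"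
    by (rule space_integral_integrable[OF D cFC _ us, where C = "C * K3"],
        rule order_trans[OF bFC mult_left_mono]) (use K3 C0 in auto)
  have iD: "integrable (lebesgue_on ?I) (?int FD)"
    by (rule space_integral_integrable[OF D cFD _ us, where C = "C * K3"],
        rule order_trans[OF bFD mult_left_mono]) (use K3 C0 in auto)
  \<comment> \<open>The minus sign arises because \<open>divergence_identity\<close> expresses the
    gradient term as the boundary flux minus the Laplacian term. In the last term the time
    derivative has fallen on \<theta>.\<close>
  define R where "R = (\<lambda>t. \<theta> t * (- ?int FE t + ?int FB t + ?int FC t) + ?d\<theta> t * ?int FD t)"
  have bdmult: "integrable (lebesgue_on ?I) (\<lambda>t. h t * f t)"
    if h: "smooth h" and f: "integrable (lebesgue_on ?I) f" for h f :: "real \<Rightarrow> real"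
  proof -
    have ch: "continuous_on UNIV h" using h by (rule smooth_continuous_on)
    obtain B where B: "\<And>t. t \<in> ?I \<Longrightarrow> norm (h t) \<le> B" using continuous_on_imp_bounded_on[OF ch, of ?I] by auto
    show ?thesis
    proof (rule Bochner_Integration.integrable_bound[of _ "\<lambda>t. B * f t"])
      show "integrable (lebesgue_on ?I) (\<lambda>t. B * f t)" using f by simp
      show "(\<lambda>t. h t * f t) \<in> borel_measurable (lebesgue_on ?I)"
        by (intro borel_measurable_times borel_measurable_integrable[OF f] borel_measurable_lebesgue_on_borel
            borel_measurable_continuous_onI ch)
      have "\<bar>h t\<bar> \<le> \<bar>B\<bar>" if "t \<in> ?I" for t using B[OF that] by simp
      then show "AE t in lebesgue_on ?I. norm (h t * f t) \<le> norm (B * f t)"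
        by (intro AE_I2) (simp add: abs_mult mult_right_mono)
    qed
  qed
  have iBf: "integrable (lebesgue_on ?I) ?B"
  proof (rule boundary_flux_time_integrable[OF co(1) aup \<gamma>(1,2) _ l])
    show "\<bar>\<gamma> t x - g1\<bar> \<le> gup - glow" for t x using \<gamma>(3)[of t x] g1 by auto
  qed
  have uH: "AE t in lebesgue_on ?I. u t \<in> H1 \<Omega>" using us unfolding strongly_measurable_def by auto
  have tderiv: "AE t in lebesgue_on ?I. AE x in ?M. time_deriv T (H1 \<Omega>) (H1_norm \<Omega>) (\<lambda>t x. \<theta> t * l x) t x = ?d\<theta> t * l x"
    by (rule time_deriv_product[OF D s\<theta> smooth_H1[OF l(1) D]])
  have tin: "AE t in lebesgue_on ?I. t \<in> ?I" by (rule AE_I2) simp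
  have point: "AE t in lebesgue_on ?I. space_form \<Omega> P u (\<lambda>t x. \<theta> t * l x) t + time_form T \<Omega> P u (\<lambda>t x. \<theta> t * l x) t
      = \<theta> t * ?B t + R t"
    using tin uH tr rng tderiv
  proof eventually_elim
    case (elim t)
    note t = elim(1) and uH = elim(2) and trt = elim(3) and rngt = elim(4)
    have um: "u t \<in> borel_measurable ?M" and gm: "weak_grad \<Omega> (u t) \<in> borel_measurable ?M"
      using uH by (auto intro: L2_measurable H1_imp_L2 weak_grad_L2)
    have cFt: "continuous_on (\<Omega> \<times> UNIV \<times> UNIV) (\<lambda>(x, s, v). F t x s v)"
      if "continuous_on ?Dom (\<lambda>(t, x, s, v). F t x s v)" for F :: "real \<Rightarrow> 'a \<Rightarrow> real \<Rightarrow> 'a \<Rightarrow> real"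
    proof -
      have "continuous_on (\<Omega> \<times> (UNIV :: real set) \<times> (UNIV :: 'a set)) (\<lambda>z. (\<lambda>(t, x, s, v). F t x s v) (t, z))"
        by (rule continuous_on_compose2[OF that]) (use t in \<open>auto intro!: continuous_intros\<close>)
      then show ?thesis by (simp add: case_prod_beta')
    qed
    have wg: "AE x in ?M. weak_grad \<Omega> (\<lambda>x. \<theta> t * l x) x = \<theta> t *\<^sub>R gradient l x"
      using weak_grad_cmult[OF D(1) smooth_H1[OF l(1) D], of "\<theta> t"] smooth_weak_grad[OF l(1) D]
      by eventually_elim simp
    have ib: "integrable ?M (\<lambda>x. coeff_b P x t (u t x) \<bullet> gradient l x)"
    proof (rule Bochner_Integration.integrable_bound)
      show "integrable ?M (\<lambda>x. C * norm (gradient l x))" using igl by simp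
      show "(\<lambda>x. coeff_b P x t (u t x) \<bullet> gradient l x) \<in> borel_measurable ?M"
        using composite_measurable[OF D(1) cFt[OF cFB] um gm] by (simp add: FB_def)
      show "AE x in ?M. norm (coeff_b P x t (u t x) \<bullet> gradient l x) \<le> norm (C * norm (gradient l x))"
      proof (rule AE_I2)
        fix x assume "x \<in> space ?M"
        then show "norm (coeff_b P x t (u t x) \<bullet> gradient l x) \<le> norm (C * norm (gradient l x))"
          using bFB[OF t, of x "u t x" 0] C0 by (simp add: FB_def)
      qed
    qed
    have ia: "integrable ?M (\<lambda>x. coeff_a P t (u t x) * (weak_grad \<Omega> (u t) x \<bullet> gradient l x))"
    proof (rule Bochner_Integration.integrable_bound)
      show "integrable ?M (\<lambda>x. aup * K1 * norm (weak_grad \<Omega> (u t) x))"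
        using L2_imp_L1(1)[OF fin weak_grad_L2[OF uH]] by simp
      have "(\<lambda>x. coeff_a P t (u t x)) \<in> borel_measurable ?M"
        by (rule measurable_compose[OF um borel_measurable_continuous_onI[OF cA[OF t]]])
      moreover have "(\<lambda>x. weak_grad \<Omega> (u t) x \<bullet> gradient l x) \<in> borel_measurable ?M"
        by (intro borel_measurable_inner gm borel_measurable_lebesgue_on_borel borel_measurable_continuous_onI cgl)
      ultimately show "(\<lambda>x. coeff_a P t (u t x) * (weak_grad \<Omega> (u t) x \<bullet> gradient l x)) \<in> borel_measurable ?M"
        by (rule borel_measurable_times)
      show "AE x in ?M. norm (coeff_a P t (u t x) * (weak_grad \<Omega> (u t) x \<bullet> gradient l x)) \<le> norm (aup * K1 * norm (weak_grad \<Omega> (u t) x))"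
      proof (rule AE_I2)
        fix x assume "x \<in> space ?M"
        then have "\<bar>weak_grad \<Omega> (u t) x \<bullet> gradient l x\<bar> \<le> norm (weak_grad \<Omega> (u t) x) * K1"
          using Cauchy_Schwarz_ineq2[of "weak_grad \<Omega> (u t) x" "gradient l x"] mult_left_mono[OF K1(2)[of x], of "norm (weak_grad \<Omega> (u t) x)"] by simp
        from mult_mono[OF aup[OF t, of "u t x"] this aup0 abs_ge_zero]
        show "norm (coeff_a P t (u t x) * (weak_grad \<Omega> (u t) x \<bullet> gradient l x)) \<le> norm (aup * K1 * norm (weak_grad \<Omega> (u t) x))"
          using aup0 K1(1) by (simp add: abs_mult mult_ac)
      qed
    qed
    have "(\<integral>x. (coeff_a P t (u t x) *\<^sub>R weak_grad \<Omega> (u t) x + coeff_b P x t (u t x)) \<bullet> weak_grad \<Omega> (\<lambda>x. \<theta> t * l x) x \<partial>?M)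
        = (\<integral>x. \<theta> t * (coeff_a P t (u t x) * (weak_grad \<Omega> (u t) x \<bullet> gradient l x) + coeff_b P x t (u t x) \<bullet> gradient l x) \<partial>?M)"
      by (rule integral_lebesgue_on_cong_AE[OF \<Omega>]) (use wg in eventually_elim, simp add: inner_add_left)
    also have "\<dots> = \<theta> t * ((\<integral>x. coeff_a P t (u t x) * (weak_grad \<Omega> (u t) x \<bullet> gradient l x) \<partial>?M) + ?int FB t)"
      using ia ib by (simp add: FB_def)
    also have "(\<integral>x. coeff_a P t (u t x) * (weak_grad \<Omega> (u t) x \<bullet> gradient l x) \<partial>?M) = ?B t - ?int FE t"
    proof -
      have "(\<integral>x. ?A t (u t x) * laplacian l x \<partial>?M) = ?int FE t"
        unfolding FE_def by (rule integral_lebesgue_on_cong_AE[OF \<Omega>]) (use rngt in eventually_elim, simp)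
      then show ?thesis
        using divergence_identity[OF trt \<gamma>(1) l primitive_from_derivative[OF cA[OF t], of g1] cA[OF t] aup[OF t]]
        unfolding boundary_flux_def by linarith
    qed
    finally have sf: "space_form \<Omega> P u (\<lambda>t x. \<theta> t * l x) t = \<theta> t * ((?B t - ?int FE t) + ?int FB t) + \<theta> t * ?int FC t"
      by (simp add: space_form_def FC_def mult.left_commute)
    have "time_form T \<Omega> P u (\<lambda>t x. \<theta> t * l x) t = (\<integral>x. ?d\<theta> t * FD t x (u t x) (weak_grad \<Omega> (u t) x) \<partial>?M)"
      unfolding time_form_def FD_def
      by (rule integral_lebesgue_on_cong_AE[OF \<Omega>]) (use elim(5) in eventually_elim, simp)
    also have "\<dots> = ?d\<theta> t * ?int FD t" by simp
    finally show ?case unfolding sf R_def by (simp add: algebra_simps)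
  qed
  show ?thesis
  proof (rule that[of R])
    show "integrable (lebesgue_on ?I) R"
      unfolding R_def
      by (intro Bochner_Integration.integrable_add bdmult[OF s\<theta>] bdmult[OF smooth_frechet_derivative[OF s\<theta>]] integrable_minus iE iB iC iD)
    show "integrable (lebesgue_on ?I) (\<lambda>t. \<theta> t * ?B t)" by (rule bdmult[OF s\<theta> iBf])
    show "neumann_flux T \<Omega> P u (\<lambda>t x. \<theta> t * l x) = (\<integral>t. \<theta> t * ?B t + R t \<partial>lebesgue_on ?I)"
      unfolding neumann_flux_def by (rule integral_lebesgue_on_cong_AE[OF _ point]) simp
    fix t assume t: "t \<in> ?I"
    have gg: "0 \<le> aup * (gup - glow)" using aup0 g1 by simp
    have "\<bar>?int FE t\<bar> \<le> aup * (gup - glow) * (\<integral>x. \<bar>laplacian l x\<bar> \<partial>?M)"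
      by (rule abs_integral_mult_le[OF ill bFE[OF t]])
    also have "\<dots> \<le> aup * (gup - glow) * M" by (rule mult_left_mono[OF M(3) gg])
    finally have E: "\<bar>?int FE t\<bar> \<le> aup * (gup - glow) * M" .
    have "\<bar>?int FB t\<bar> \<le> C * (\<integral>x. \<bar>norm (gradient l x)\<bar> \<partial>?M)"
      by (rule abs_integral_mult_le[OF integrable_norm[OF igl] bFB[OF t]]) simp
    also have "\<dots> \<le> C * M" using mult_left_mono[OF M(2) C0] by simp
    finally have B: "\<bar>?int FB t\<bar> \<le> C * M" .
    have "\<bar>?int FC t\<bar> \<le> C * (\<integral>x. \<bar>l x\<bar> \<partial>?M)"
      by (rule abs_integral_mult_le[OF il bFC[OF t]]) simp
    also have "\<dots> \<le> C * M" by (rule mult_left_mono[OF M(1) C0])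
    finally have Cc: "\<bar>?int FC t\<bar> \<le> C * M" .
    have "\<bar>?int FD t\<bar> \<le> C * (\<integral>x. \<bar>l x\<bar> \<partial>?M)"
      by (rule abs_integral_mult_le[OF il bFD[OF t]])
    also have "\<dots> \<le> C * M" by (rule mult_left_mono[OF M(1) C0])
    finally have Dd: "\<bar>?int FD t\<bar> \<le> C * M" .
    have "\<bar>R t\<bar> \<le> \<bar>\<theta> t\<bar> * \<bar>- ?int FE t + ?int FB t + ?int FC t\<bar> + \<bar>?d\<theta> t\<bar> * \<bar>?int FD t\<bar>"
      unfolding R_def by (rule order_trans[OF abs_triangle_ineq]) (simp add: abs_mult)
    also have "\<dots> \<le> \<bar>\<theta> t\<bar> * (aup * (gup - glow) * M + C * M + C * M) + \<bar>?d\<theta> t\<bar> * (C * M)"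
      using E B Cc Dd by (intro add_mono mult_left_mono) auto
    finally show "\<bar>R t\<bar> \<le> (\<bar>\<theta> t\<bar> * (aup * (gup - glow) + 2 * C) + \<bar>?d\<theta> t\<bar> * C) * M"
      by (simp add: algebra_simps)
  qed
qed

end

section \<open>Equal coefficients give equal fluxes\<close>

text \<open>The solution of the first problem takes its values where both \<open>coeff_a\<close>
  agree, so it also solves the second problem, and uniqueness identifies it with the solution
  there.\<close>

lemma flux_eq_if_coefficients_eq:
  fixes \<Omega> :: "'a::euclidean_space set"
  assumes op: "open \<Omega>"
    and co1: "coefficient_assumption T \<Omega> C C0 alow aup P1" and co2: "coefficient_assumption T \<Omega> C C0 alow aup P2"
    and lt: "glow < gup"
    and a: "\<And>t s. t \<in> {0<..<T} \<Longrightarrow> s \<in> {glow<..<gup} \<Longrightarrow> coeff_a P1 t s = coeff_a P2 t s"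
    and b: "\<And>x t s. x \<in> \<Omega> \<Longrightarrow> t \<in> {0<..<T} \<Longrightarrow> coeff_b P1 x t s = coeff_b P2 x t s"
    and c: "\<And>x t s v. x \<in> \<Omega> \<Longrightarrow> t \<in> {0<..<T} \<Longrightarrow> coeff_c P1 x t s v = coeff_c P2 x t s v"
    and d: "\<And>t s. t \<in> {0<..<T} \<Longrightarrow> coeff_d P1 t s = coeff_d P2 t s"
    and init: "AE x in lebesgue_on \<Omega>. init_u P1 x = init_u P2 x"
    and sol1: "weak_solution T \<Omega> P1 g u1" and sol2: "weak_solution T \<Omega> P2 g u2"
    and uniq: "unique_weak_solution T \<Omega> P2 g"
    and rng: "AE t in lebesgue_on {0<..<T}. AE x in lebesgue_on \<Omega>. glow \<le> u1 t x \<and> u1 t x \<le> gup"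
  shows "neumann_flux T \<Omega> P1 u1 \<phi> = neumann_flux T \<Omega> P2 u2 \<phi>"
proof -
  let ?I = "{0<..<T}" and ?M = "lebesgue_on \<Omega>"
  have \<Omega>: "\<Omega> \<in> sets lebesgue" using op by auto
  have tin: "AE t in lebesgue_on ?I. t \<in> ?I" by (rule AE_I2) simp
  have xin: "AE x in ?M. x \<in> \<Omega>" by (rule AE_I2) simp
  \<comment> \<open>A solution may take the end values \<open>glow\<close> and \<open>gup\<close>,
    so the equality is extended to the closed interval by continuity.\<close>
  have ac: "coeff_a P1 t s = coeff_a P2 t s" if t: "t \<in> ?I" and s: "glow \<le> s" "s \<le> gup" for t s
  proof -
    have cl: "closure {glow<..<gup} = {glow..gup}" using lt by (rule closure_greaterThanLessThan)
    have "continuous_on (closure {glow<..<gup}) (\<lambda>s. coeff_a P1 t s - coeff_a P2 t s)"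
      by (rule continuous_on_subset[OF continuous_on_diff[OF coeff_a_continuous[OF coefficient_assumptionD(1)[OF co1 op] t]
            coeff_a_continuous[OF coefficient_assumptionD(1)[OF co2 op] t]]]) simp
    from continuous_constant_on_closure[OF this, of 0 s] have "coeff_a P1 t s - coeff_a P2 t s = 0"
      using a[OF t] s unfolding cl by simp
    then show ?thesis by simp
  qed
  have sf: "AE t in lebesgue_on ?I. \<forall>\<phi>. space_form \<Omega> P1 u1 \<phi> t = space_form \<Omega> P2 u1 \<phi> t"
    using tin rng
  proof eventually_elim
    case (elim t)
    show ?case
    proof
      fix \<phi>
      have "(\<integral>x. (coeff_a P1 t (u1 t x) *\<^sub>R weak_grad \<Omega> (u1 t) x + coeff_b P1 x t (u1 t x)) \<bullet> weak_grad \<Omega> (\<phi> t) x \<partial>?M)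
          = (\<integral>x. (coeff_a P2 t (u1 t x) *\<^sub>R weak_grad \<Omega> (u1 t) x + coeff_b P2 x t (u1 t x)) \<bullet> weak_grad \<Omega> (\<phi> t) x \<partial>?M)"
        by (rule integral_lebesgue_on_cong_AE[OF \<Omega>])
          (use elim(2) xin in eventually_elim, use ac[OF elim(1)] b elim(1) in auto)
      moreover have "(\<integral>x. coeff_c P1 x t (u1 t x) (weak_grad \<Omega> (u1 t) x) * \<phi> t x \<partial>?M)
          = (\<integral>x. coeff_c P2 x t (u1 t x) (weak_grad \<Omega> (u1 t) x) * \<phi> t x \<partial>?M)"
        using c elim(1) by (intro Bochner_Integration.integral_cong) auto
      ultimately show "space_form \<Omega> P1 u1 \<phi> t = space_form \<Omega> P2 u1 \<phi> t"
        unfolding space_form_def by simp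
    qed
  qed
  have tf: "time_form T \<Omega> P1 u \<phi> t = time_form T \<Omega> P2 u \<phi> t" if "t \<in> ?I" for u \<phi> t
    unfolding time_form_def using d[OF that] by simp
  have isf: "(\<integral>t. space_form \<Omega> P1 u1 \<phi> t \<partial>lebesgue_on ?I) = (\<integral>t. space_form \<Omega> P2 u1 \<phi> t \<partial>lebesgue_on ?I)" for \<phi>
    by (rule integral_lebesgue_on_cong_AE) (simp, use sf in eventually_elim, blast)
  have itf: "(\<integral>t. time_form T \<Omega> P1 u1 \<phi> t \<partial>lebesgue_on ?I) = (\<integral>t. time_form T \<Omega> P2 u1 \<phi> t \<partial>lebesgue_on ?I)" for \<phi>
    by (rule Bochner_Integration.integral_cong) (use tf in auto)
  have "AE x in ?M. u1 0 x = init_u P1 x" using sol1 unfolding weak_solution_def by blast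
  then have "AE x in ?M. u1 0 x = init_u P2 x" using init by eventually_elim simp
  then have "weak_solution T \<Omega> P2 g u1"
    using sol1 unfolding weak_solution_def isf itf by blast
  then have eq: "AE x in ?M. u1 t x = u2 t x" if "t \<in> {0..T}" for t
    using uniq sol2 that unfolding unique_weak_solution_def by blast
  have m: "u1 t \<in> borel_measurable ?M" "u2 t \<in> borel_measurable ?M" if "t \<in> {0..T}" for t
    using sol1 sol2 that by (auto simp: weak_solution_def C_time_def L2_def)
  have "space_form \<Omega> P2 u1 \<phi> t + time_form T \<Omega> P2 u1 \<phi> t = space_form \<Omega> P2 u2 \<phi> t + time_form T \<Omega> P2 u2 \<phi> t"
    if "t \<in> ?I" for t
  proof -
    have t: "t \<in> {0..T}" using that by simp
    \<comment> \<open>An equality at every point: representatives that agree almost everywhere share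
      the chosen weak gradient.\<close>
    have wg: "weak_grad \<Omega> (u1 t) = weak_grad \<Omega> (u2 t)"
      by (rule weak_grad_cong_AE[OF op eq[OF t] m[OF t]])
    have "(\<integral>x. (coeff_a P2 t (u1 t x) *\<^sub>R weak_grad \<Omega> (u2 t) x + coeff_b P2 x t (u1 t x)) \<bullet> weak_grad \<Omega> (\<phi> t) x \<partial>?M)
        = (\<integral>x. (coeff_a P2 t (u2 t x) *\<^sub>R weak_grad \<Omega> (u2 t) x + coeff_b P2 x t (u2 t x)) \<bullet> weak_grad \<Omega> (\<phi> t) x \<partial>?M)"
      by (rule integral_lebesgue_on_cong_AE[OF \<Omega>]) (use eq[OF t] in eventually_elim, simp)
    moreover have "(\<integral>x. coeff_c P2 x t (u1 t x) (weak_grad \<Omega> (u2 t) x) * \<phi> t x \<partial>?M)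
        = (\<integral>x. coeff_c P2 x t (u2 t x) (weak_grad \<Omega> (u2 t) x) * \<phi> t x \<partial>?M)"
      by (rule integral_lebesgue_on_cong_AE[OF \<Omega>]) (use eq[OF t] in eventually_elim, simp)
    moreover have "time_form T \<Omega> P2 u1 \<phi> t = time_form T \<Omega> P2 u2 \<phi> t"
      unfolding time_form_def
      by (rule integral_lebesgue_on_cong_AE[OF \<Omega>]) (use eq[OF t] in eventually_elim, simp)
    ultimately show ?thesis unfolding space_form_def wg by simp
  qed
  then have "neumann_flux T \<Omega> P2 u1 \<phi> = neumann_flux T \<Omega> P2 u2 \<phi>"
    unfolding neumann_flux_def by (intro Bochner_Integration.integral_cong) auto
  moreover have "neumann_flux T \<Omega> P1 u1 \<phi> = neumann_flux T \<Omega> P2 u1 \<phi>"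
    unfolding neumann_flux_def
    by (rule integral_lebesgue_on_cong_AE) (simp, use sf tin in eventually_elim, use tf in simp)
  ultimately show ?thesis by simp
qed

section \<open>Equal fluxes give equal coefficients\<close>

text \<open>Maximum and minimum in place of the case distinction make range and continuity
  evident.\<close>

lemma space_bump_eq:
  assumes "\<epsilon> > 0"
  shows "space_bump p \<epsilon> x = max 0 (min 1 (2 - 2 * norm (x - p) / \<epsilon>))"
  using assms by (auto simp: space_bump_def field_simps max_def min_def)

lemma time_bump_le:
  assumes "0 \<le> t1" "t1 < t2" "t2 \<le> T"
  shows "time_bump t1 t2 t \<le> T\<^sup>2 / 4" "0 \<le> time_bump t1 t2 t"
proof -
  have "((t2 - t1) / 2)\<^sup>2 - (t - t1) * (t2 - t) = (t - (t1 + t2) / 2)\<^sup>2"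
    by (simp add: power2_eq_square field_simps)
  then have "(t - t1) * (t2 - t) \<le> ((t2 - t1) / 2)\<^sup>2"
    using zero_le_power2[of "t - (t1 + t2) / 2"] by linarith
  also have "\<dots> \<le> (T / 2)\<^sup>2" using assms by (intro power_mono) auto
  finally show "time_bump t1 t2 t \<le> T\<^sup>2 / 4" by (simp add: time_bump_def power_divide max_def)
qed (simp add: time_bump_def)

lemma exponential_beats_linear:
  fixes c K :: real
  assumes "c > 0"
  shows "\<exists>m\<ge>1. K * (2 * real m + 1) < c * 2 ^ m"
proof -
  have half: "norm (1 / 2 :: real) < 1" by simp
  have "(\<lambda>m. K * (2 * (real m * (1 / 2) ^ m) + (1 / 2) ^ m)) \<longlonglongrightarrow> K * (2 * 0 + 0)"
    by (rule tendsto_mult[OF tendsto_const tendsto_add[OF tendsto_mult[OF tendsto_const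
          powser_times_n_limit_0[OF half]] LIMSEQ_power_zero[OF half]]])
  then have "\<forall>\<^sub>F m in sequentially. K * (2 * (real m * (1 / 2) ^ m) + (1 / 2) ^ m) < c"
    using assms by (intro order_tendstoD(2)) auto
  then obtain n where n: "\<And>m. m \<ge> n \<Longrightarrow> K * (2 * (real m * (1 / 2) ^ m) + (1 / 2) ^ m) < c"
    unfolding eventually_sequentially by blast
  define m where "m = max n 1"
  have "K * (2 * (real m * (1 / 2) ^ m) + (1 / 2) ^ m) * 2 ^ m < c * 2 ^ m"
    using n[of m] by (intro mult_strict_right_mono) (auto simp: m_def)
  also have "K * (2 * (real m * (1 / 2) ^ m) + (1 / 2) ^ m) * 2 ^ m
      = K * (2 * (real m * ((1 / 2) ^ m * 2 ^ m)) + (1 / 2) ^ m * 2 ^ m)"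
    by (simp only: ring_distribs mult.assoc)
  also have "(1 / 2 :: real) ^ m * 2 ^ m = 1" by (simp add: power_mult_distrib[symmetric])
  finally have "K * (2 * real m + 1) < c * 2 ^ m" by simp
  moreover have "m \<ge> 1" by (simp add: m_def)
  ultimately show ?thesis by blast
qed

section \<open>Range and regularity of the probing Dirichlet data\<close>

definition probe_height :: "real \<Rightarrow> real \<Rightarrow> real \<Rightarrow> real \<Rightarrow> real \<Rightarrow> real \<Rightarrow> real" where
  "probe_height N T \<epsilon>\<^sub>0 \<epsilon> g1 g2 = 4 * (g2 - g1) * min 1 (\<epsilon>\<^sub>0 powr ((N - 3) / 2)) / T\<^sup>2 * \<epsilon> powr ((3 - N) / 2)"

lemma probe_eq:
  "probe T \<epsilon>\<^sub>0 p \<epsilon> t1 t2 g1 g2 t (x :: 'a::euclidean_space)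
    = g1 + probe_height (real DIM('a)) T \<epsilon>\<^sub>0 \<epsilon> g1 g2 * space_bump p \<epsilon> x * time_bump t1 t2 t"
  by (simp add: probe_def probe_height_def Let_def)

text \<open>The factor 4/T^2 offsets the bound T^2/4 for the time bump, and the minimum times
  \<epsilon>^((3-N)/2) is at most 1 because \<epsilon> is at most \<open>\<epsilon>\<^sub>0\<close>.
  Thus the probe stays below \<open>g2\<close>.\<close>

lemma probe_height_bounds:
  assumes N: "N \<le> 3" and T: "T > 0" and \<epsilon>: "0 < \<epsilon>" "\<epsilon> \<le> \<epsilon>\<^sub>0" and g: "g1 < g2"
  shows "0 \<le> probe_height N T \<epsilon>\<^sub>0 \<epsilon> g1 g2" "probe_height N T \<epsilon>\<^sub>0 \<epsilon> g1 g2 * (T\<^sup>2 / 4) \<le> g2 - g1"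
proof -
  show "0 \<le> probe_height N T \<epsilon>\<^sub>0 \<epsilon> g1 g2"
    unfolding probe_height_def using g by (intro mult_nonneg_nonneg divide_nonneg_nonneg) auto
  let ?q = "(3 - N) / 2"
  have neg: "(N - 3) / 2 = - ?q" by (simp add: field_simps)
  have "min 1 (\<epsilon>\<^sub>0 powr ((N - 3) / 2)) * \<epsilon> powr ?q \<le> \<epsilon>\<^sub>0 powr (- ?q) * \<epsilon>\<^sub>0 powr ?q"
    unfolding neg using N \<epsilon> by (intro mult_mono powr_mono2) auto
  also have "\<dots> = 1" using \<epsilon> by (simp add: powr_add[symmetric])
  finally have "(g2 - g1) * (min 1 (\<epsilon>\<^sub>0 powr ((N - 3) / 2)) * \<epsilon> powr ?q) \<le> (g2 - g1) * 1"
    using g by (intro mult_left_mono) auto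
  moreover have "probe_height N T \<epsilon>\<^sub>0 \<epsilon> g1 g2 * (T\<^sup>2 / 4) = (g2 - g1) * (min 1 (\<epsilon>\<^sub>0 powr ((N - 3) / 2)) * \<epsilon> powr ?q)"
    using T by (simp add: probe_height_def)
  ultimately show "probe_height N T \<epsilon>\<^sub>0 \<epsilon> g1 g2 * (T\<^sup>2 / 4) \<le> g2 - g1" by simp
qed

lemma probe_range:
  fixes p x :: "'a::euclidean_space"
  assumes N: "DIM('a) \<le> 3" and T: "T > 0" and \<epsilon>: "0 < \<epsilon>" "\<epsilon> \<le> \<epsilon>\<^sub>0" and g: "g1 < g2"
    and t: "0 \<le> t1" "t1 < t2" "t2 \<le> T"
  shows "g1 \<le> probe T \<epsilon>\<^sub>0 p \<epsilon> t1 t2 g1 g2 t x" "probe T \<epsilon>\<^sub>0 p \<epsilon> t1 t2 g1 g2 t x \<le> g2"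
proof -
  let ?h = "probe_height (real DIM('a)) T \<epsilon>\<^sub>0 \<epsilon> g1 g2"
  have N': "real DIM('a) \<le> 3" using N by simp
  note h = probe_height_bounds[OF N' T \<epsilon> g]
  have s: "0 \<le> space_bump p \<epsilon> x" "space_bump p \<epsilon> x \<le> 1" using \<epsilon> by (auto simp: space_bump_eq)
  note tb = time_bump_le[OF t, of t]
  show "g1 \<le> probe T \<epsilon>\<^sub>0 p \<epsilon> t1 t2 g1 g2 t x" unfolding probe_eq using h(1) s(1) tb(2) by simp
  have "?h * space_bump p \<epsilon> x * time_bump t1 t2 t \<le> ?h * 1 * (T\<^sup>2 / 4)"
    by (intro mult_mono mult_left_mono h(1) s tb mult_nonneg_nonneg) auto
  then show "probe T \<epsilon>\<^sub>0 p \<epsilon> t1 t2 g1 g2 t x \<le> g2" unfolding probe_eq using h(2) by simp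
qed

lemma probe_continuous:
  assumes "\<epsilon> > 0"
  shows "continuous_on UNIV (probe T \<epsilon>\<^sub>0 p \<epsilon> t1 t2 g1 g2 t)"
    and "continuous_on UNIV (\<lambda>t. probe T \<epsilon>\<^sub>0 p \<epsilon> t1 t2 g1 g2 t (x :: 'a::euclidean_space))"
  unfolding probe_eq[abs_def] space_bump_eq[OF assms] time_bump_def
  by (intro continuous_intros, use assms in simp, intro continuous_intros)

lemma probe_in_boundary_data:
  fixes \<Omega> :: "'a::euclidean_space set"
  assumes CG: "C\<^sub>G_large T \<Omega> p \<epsilon>\<^sub>0 glow gup C" and N: "DIM('a) \<le> 3" and T: "T > 0"
    and \<epsilon>: "0 < \<epsilon>" "\<epsilon> \<le> \<epsilon>\<^sub>0" and g: "glow \<le> g1" "g1 < g2" "g2 \<le> gup" and t: "0 \<le> t1" "t1 < t2" "t2 \<le> T"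
  shows "probe T \<epsilon>\<^sub>0 p \<epsilon> t1 t2 g1 g2 \<in> boundary_data T \<Omega> glow gup C"
proof -
  have "glow \<le> probe T \<epsilon>\<^sub>0 p \<epsilon> t1 t2 g1 g2 t x \<and> probe T \<epsilon>\<^sub>0 p \<epsilon> t1 t2 g1 g2 t x \<le> gup" for t and x :: 'a
    using probe_range[OF N T \<epsilon> g(2) t, of p t x] g by linarith
  then show ?thesis
    using CG \<epsilon> g t unfolding boundary_data_def C\<^sub>G_large_def by simp
qed

lemma AE_on_open_ex:
  fixes U :: "real set"
  assumes ae: "AE t in lebesgue_on S. P t" and S: "S \<in> sets lebesgue" and U: "open U" "U \<noteq> {}" "U \<subseteq> S"
  shows "\<exists>t\<in>U. P t"
proof (rule ccontr)
  assume "\<not> (\<exists>t\<in>U. P t)"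
  then have "AE t in lebesgue. t \<notin> U"
    using ae U(3) unfolding AE_lebesgue_on[OF S] by (auto elim!: eventually_mono)
  then have "U \<in> null_sets lebesgue" using U(1) by (subst AE_iff_null_sets) auto
  then show False using open_not_negligible[OF U(1,2)] by (simp add: negligible_iff_null_sets)
qed

text \<open>Outside its time interval a probe is constant, so that nonzero constants are square integrable
  on the boundary.\<close>

lemma finite_surface_measure:
  fixes \<Omega> :: "'a::euclidean_space set"
  assumes CG: "C\<^sub>G_large T \<Omega> p \<epsilon>\<^sub>0 glow gup C" and T: "T > 0" and \<epsilon>: "\<epsilon>\<^sub>0 > 0" and g: "glow < gup"
  shows "finite_measure (surface_measure \<Omega>)"
proof -
  \<comment> \<open>A nonzero base value in [\<open>glow\<close>, \<open>gup\<close>): if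
    \<open>glow\<close> is 0, then \<open>gup\<close> is positive and its half serves.\<close>
  define c where "c = (if glow = 0 then gup / 2 else glow)"
  have c: "c \<noteq> 0" "glow \<le> c" "c < gup" using g by (auto simp: c_def)
  let ?p = "probe T \<epsilon>\<^sub>0 p \<epsilon>\<^sub>0 0 (T / 2) c gup"
  have "?p \<in> H1_time T (H1_boundary \<Omega>) (H1_boundary_norm \<Omega>)"
    using CG T \<epsilon> c unfolding C\<^sub>G_large_def by auto
  then have "AE t in lebesgue_on {0<..<T}. ?p t \<in> H1_boundary \<Omega>"
    unfolding H1_time_def L2_time_def strongly_measurable_def by auto
  \<comment> \<open>In the second half of the time interval the time bump vanishes and the probe is
    the constant \<open>c\<close>.\<close>
  then have "\<exists>t\<in>{T/2<..<T}. ?p t \<in> H1_boundary \<Omega>"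
    by (rule AE_on_open_ex) (use T in auto)
  then obtain t where t: "T / 2 < t" "t < T" "?p t \<in> H1_boundary \<Omega>" by auto
  have "(t - 0) * (T / 2 - t) \<le> 0" using t T by (intro mult_nonneg_nonpos) auto
  then have "time_bump 0 (T / 2) t = 0" by (simp add: time_bump_def)
  then have "?p t = (\<lambda>x. c)" by (auto simp: probe_eq)
  then have "integrable (surface_measure \<Omega>) (\<lambda>x. (norm c)\<^sup>2)"
    using t(3) by (simp add: H1_boundary_def L2_def)
  then have "(\<integral>\<^sup>+x. ennreal (norm ((norm c)\<^sup>2)) \<partial>surface_measure \<Omega>) < \<infinity>"
    by (simp only: integrable_iff_bounded)
  then have "ennreal (norm ((norm c)\<^sup>2)) * emeasure (surface_measure \<Omega>) (space (surface_measure \<Omega>)) < \<infinity>"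
    by (simp only: nn_integral_const)
  then have "emeasure (surface_measure \<Omega>) (space (surface_measure \<Omega>)) \<noteq> \<infinity>"
    using c(1) by (auto simp: ennreal_mult_top)
  then show ?thesis by (intro finite_measureI)
qed

section \<open>The contradiction for small bumps\<close>

context flat_boundary_point
begin

text \<open>Were it false, the boundary terms for the pole distance r / 4^m would differ by at least
  a multiple of 2^m, while the remainders leave room only for linear growth in m. Exchanging the two
  problems gives the reverse inequality.\<close>

lemma coefficient_le:
  assumes co1: "coefficient_assumption T \<Omega> C C0 alow aup P1" and co2: "coefficient_assumption T \<Omega> C C0 alow aup P2"
    and al: "0 < alow" and T: "T > 0" and N: "DIM('a) \<le> 3" and r: "r \<le> \<epsilon>\<^sub>0" "r \<le> 1"
    and sols: "\<And>t1 t2 g1 g2 \<epsilon>. 0 \<le> t1 \<Longrightarrow> t1 < t2 \<Longrightarrow> t2 \<le> T \<Longrightarrow> glow \<le> g1 \<Longrightarrow> g1 < g2 \<Longrightarrow> g2 \<le> gup \<Longrightarrow>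
      0 < \<epsilon> \<Longrightarrow> \<epsilon> \<le> \<epsilon>\<^sub>0 \<Longrightarrow> \<exists>u1 u2. weak_solution T \<Omega> P1 (probe T \<epsilon>\<^sub>0 p \<epsilon> t1 t2 g1 g2) u1 \<and>
        weak_solution T \<Omega> P2 (probe T \<epsilon>\<^sub>0 p \<epsilon> t1 t2 g1 g2) u2 \<and>
        (AE t in lebesgue_on {0<..<T}. AE x in lebesgue_on \<Omega>. glow \<le> u1 t x \<and> u1 t x \<le> gup) \<and>
        (AE t in lebesgue_on {0<..<T}. AE x in lebesgue_on \<Omega>. glow \<le> u2 t x \<and> u2 t x \<le> gup) \<and>
        (\<forall>\<theta> l. \<theta> \<in> test_functions {0<..<T} \<longrightarrow> smooth l \<longrightarrow> (\<forall>x. x \<notin> ball p (r / 2) \<longrightarrow> l x = 0) \<longrightarrow>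
          neumann_flux T \<Omega> P1 u1 (\<lambda>t x. \<theta> t * l x) = neumann_flux T \<Omega> P2 u2 (\<lambda>t x. \<theta> t * l x))"
    and t0: "t0 \<in> {0<..<T}" and s0: "s0 \<in> {glow<..<gup}"
  shows "coeff_a P1 t0 s0 \<le> coeff_a P2 t0 s0"
proof (rule ccontr)
  let ?I = "{0<..<T}"
  let ?f = "\<lambda>z. coeff_a P1 (fst z) (snd z) - coeff_a P2 (fst z) (snd z)"
  assume "\<not> coeff_a P1 t0 s0 \<le> coeff_a P2 t0 s0"
  then have f0: "?f (t0, s0) > 0" by simp
  define \<delta> where "\<delta> = ?f (t0, s0) / 2"
  have \<delta>: "\<delta> > 0" "\<delta> < ?f (t0, s0)" using f0 by (auto simp: \<delta>_def)
  note c1 = coefficient_assumptionD[OF co1 open_domain] and c2 = coefficient_assumptionD[OF co2 open_domain]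
  have fc: "continuous_on (?I \<times> UNIV) ?f"
    using continuous_on_diff[OF c1(1) c2(1)] by (simp add: case_prod_beta')
  have "open (?I \<times> (UNIV :: real set))" by (intro open_Times) auto
  moreover have "?I \<times> (UNIV :: real set) \<inter> ?f -` {\<delta><..} = {z \<in> ?I \<times> UNIV. \<delta> < ?f z}" by auto
  ultimately have "open {z \<in> ?I \<times> (UNIV :: real set). \<delta> < ?f z}"
    using continuous_open_preimage[OF fc _ open_greaterThan[of \<delta>]] by metis
  moreover have "(t0, s0) \<in> {z \<in> ?I \<times> (UNIV :: real set). \<delta> < ?f z}" using t0 \<delta>(2) by simp
  ultimately obtain d where d: "d > 0" "ball (t0, s0) d \<subseteq> {z \<in> ?I \<times> (UNIV :: real set). \<delta> < ?f z}"
    unfolding open_contains_ball by blast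
  \<comment> \<open>The entry d/3 ensures 2\<eta> < d, which keeps the square of half side \<eta>
    inside the ball of radius \<open>d\<close>; the other entries keep it inside (0,T) and
    (\<open>glow\<close>, \<open>gup\<close>).\<close>
  define \<eta> where "\<eta> = Min {d / 3, t0 / 2, (T - t0) / 2, (s0 - glow) / 2, (gup - s0) / 2}"
  have \<eta>: "\<eta> > 0" using d t0 s0 by (simp add: \<eta>_def)
  have \<eta>le: "\<eta> \<le> d / 3" "\<eta> \<le> t0 / 2" "\<eta> \<le> (T - t0) / 2" "\<eta> \<le> (s0 - glow) / 2" "\<eta> \<le> (gup - s0) / 2"
    unfolding \<eta>_def by (rule Min_le; simp)+
  define t1 t2 g1 g2 where "t1 = t0 - \<eta>" and "t2 = t0 + \<eta>" and "g1 = s0 - \<eta>" and "g2 = s0 + \<eta>"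
  have tt: "0 < t1" "t1 < t2" "t2 < T" using \<eta> \<eta>le t0 by (auto simp: t1_def t2_def)
  have gg: "glow \<le> g1" "g1 < g2" "g2 \<le> gup" using \<eta> \<eta>le s0 by (auto simp: g1_def g2_def)
  have box: "\<delta> \<le> coeff_a P1 t s - coeff_a P2 t s" if "t1 \<le> t" "t \<le> t2" "g1 \<le> s" "s \<le> g2" for t s
  proof -
    have "dist (t, s) (t0, s0) \<le> \<bar>t - t0\<bar> + \<bar>s - s0\<bar>"
      using sqrt_sum_squares_le_sum_abs[of "t - t0" "s - s0"] by (simp add: dist_Pair_Pair dist_real_def)
    also have "\<dots> \<le> \<eta> + \<eta>" using that by (intro add_mono) (auto simp: t1_def t2_def g1_def g2_def abs_le_iff)
    also have "\<dots> < d" using \<eta> \<eta>le(1) by linarith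
    finally have "(t, s) \<in> ball (t0, s0) d" by (simp add: dist_commute)
    then have "(t, s) \<in> {z \<in> ?I \<times> (UNIV :: real set). \<delta> < ?f z}" by (rule subsetD[OF d(2)])
    then show ?thesis by simp
  qed
  define \<theta> where "\<theta> = box_bump t1 t2"
  have \<theta>: "\<theta> \<in> test_functions ?I" unfolding \<theta>_def using tt by (intro box_bump_test_function) auto
  have \<theta>s: "smooth \<theta>" by (rule test_function_smooth[OF \<theta>])
  have \<theta>0: "\<theta> t \<ge> 0" for t by (simp add: \<theta>_def box_bump_nonneg)
  have \<theta>pos: "\<theta> t > 0 \<longleftrightarrow> t1 < t \<and> t < t2" for t by (simp add: \<theta>_def box_bump_pos_iff)
  obtain X0 where X0: "\<And>t. \<bar>\<theta> t\<bar> \<le> X0" using test_function_bounded[OF \<theta>] by blast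
  obtain X1 where X1: "\<And>t. \<bar>frechet_derivative \<theta> (at t) 1\<bar> \<le> X1"
    using test_function_bounded[OF test_function_frechet_derivative[OF \<theta>]] by metis
  obtain Mb where Mb: "Mb \<ge> 0"
    "\<And>n. (\<integral>x. \<bar>test_fn n x\<bar> \<partial>lebesgue_on \<Omega>) \<le> Mb * real (n + 1)"
    "\<And>n. (\<integral>x. norm (gradient (test_fn n) x) \<partial>lebesgue_on \<Omega>) \<le> Mb * real (n + 1)"
    "\<And>n. (\<integral>x. \<bar>laplacian (test_fn n) x\<bar> \<partial>lebesgue_on \<Omega>) \<le> Mb * real (n + 1)"
    using test_fn_L1_bounds by blast
  obtain c where c: "c > 0"
    "\<And>n W w. n \<ge> 1 \<Longrightarrow> continuous_on UNIV W \<Longrightarrow> (\<And>x. 0 \<le> W x) \<Longrightarrow> (\<And>x. r / 2 ^ n \<le> norm (x - p) \<Longrightarrow> W x = 0) \<Longrightarrow>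
      0 \<le> w \<Longrightarrow> (\<And>x. norm (x - p) \<le> r / 2 ^ n / 2 \<Longrightarrow> w \<le> W x) \<Longrightarrow>
      (\<integral>x. indicator slab x * (W (proj x) * frechet_derivative (test_fn n) (at (proj x)) e) \<partial>lborel) \<le> - (c * w * 2 ^ n)"
    using test_fn_normal_flux by blast
  \<comment> \<open>\<open>X\<close> times n + 1 bounds both remainders at every time, independently
    of the probe.\<close>
  define X where "X = (X0 * (aup * (gup - glow) + 2 * C) + X1 * C) * Mb"
  define TT :: real where "TT = (\<integral>t. \<bar>1\<bar> \<partial>lebesgue_on ?I)"
  define \<tau> where "\<tau> = (\<integral>t. \<theta> t * time_bump t1 t2 t \<partial>lebesgue_on ?I)"
  have ctb: "continuous_on UNIV (\<lambda>t. \<theta> t * time_bump t1 t2 t)"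
    unfolding time_bump_def by (intro continuous_intros smooth_continuous_on[OF \<theta>s])
  have itb: "integrable (lebesgue_on ?I) (\<lambda>t. \<theta> t * time_bump t1 t2 t)"
    by (rule integrable_time_continuous[OF ctb])
  have tbpos: "time_bump t1 t2 t > 0" if "t1 < t" "t < t2" for t
    using that by (simp add: time_bump_def)
  have tb0: "time_bump t1 t2 t \<ge> 0" for t by (simp add: time_bump_def)
  have \<tau>: "\<tau> > 0"
  proof (rule ccontr)
    assume "\<not> \<tau> > 0"
    moreover have nn: "AE t in lebesgue_on ?I. 0 \<le> \<theta> t * time_bump t1 t2 t" using \<theta>0 tb0 by (intro AE_I2) simp
    moreover have "\<tau> \<ge> 0" unfolding \<tau>_def using nn by (rule integral_nonneg_AE)
    ultimately have "\<tau> = 0" by linarith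
    then have "AE t in lebesgue_on ?I. \<theta> t * time_bump t1 t2 t = 0"
      unfolding \<tau>_def using integral_nonneg_eq_0_iff_AE[OF itb nn] by simp
    then have "\<exists>t\<in>{t1<..<t2}. \<theta> t * time_bump t1 t2 t = 0"
      by (rule AE_on_open_ex) (use tt in auto)
    then obtain t where t: "t1 < t" "t < t2" "\<theta> t * time_bump t1 t2 t = 0" by auto
    then show False using \<theta>pos[of t] tbpos[of t] by simp
  qed
  define q where "q = (3 - real DIM('a)) / 2"
  define h0 where "h0 = 4 * (g2 - g1) * min 1 (\<epsilon>\<^sub>0 powr ((real DIM('a) - 3) / 2)) / T\<^sup>2"
  have \<epsilon>0: "\<epsilon>\<^sub>0 > 0" using r r_pos by linarith
  have h0: "h0 > 0" unfolding h0_def using gg T \<epsilon>0 by (intro divide_pos_pos mult_pos_pos) (auto simp: min_def)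
  have key: "c * \<delta> * \<tau> * h0 * sqrt r * 2 ^ m \<le> 2 * X * TT * (2 * real m + 1)" if m: "m \<ge> 1" for m :: nat
  proof -
    \<comment> \<open>An even exponent makes \<open>sqrt \<epsilon>\<close> equal to
      \<open>sqrt r\<close> / 2^m.\<close>
    define n where "n = 2 * m"
    have n: "n \<ge> 1" using m by (simp add: n_def)
    define \<epsilon> where "\<epsilon> = r / 2 ^ n"
    have "\<epsilon> \<le> r" using r_pos by (simp add: \<epsilon>_def divide_le_eq)
    moreover have "\<epsilon> > 0" using r_pos by (simp add: \<epsilon>_def)
    ultimately have \<epsilon>: "\<epsilon> > 0" "\<epsilon> \<le> \<epsilon>\<^sub>0" "\<epsilon> \<le> 1" using r by linarith+
    define \<gamma> :: "real \<Rightarrow> 'a \<Rightarrow> real" where "\<gamma> = probe T \<epsilon>\<^sub>0 p \<epsilon> t1 t2 g1 g2"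
    have tt': "0 \<le> t1" "t2 \<le> T" using tt by auto
    obtain u1 u2 where u: "weak_solution T \<Omega> P1 \<gamma> u1" "weak_solution T \<Omega> P2 \<gamma> u2"
      "AE t in lebesgue_on ?I. AE x in lebesgue_on \<Omega>. glow \<le> u1 t x \<and> u1 t x \<le> gup"
      "AE t in lebesgue_on ?I. AE x in lebesgue_on \<Omega>. glow \<le> u2 t x \<and> u2 t x \<le> gup"
      and flux: "\<And>\<theta> l. \<theta> \<in> test_functions ?I \<Longrightarrow> smooth l \<Longrightarrow> (\<forall>x. x \<notin> ball p (r / 2) \<longrightarrow> l x = 0) \<Longrightarrow>
          neumann_flux T \<Omega> P1 u1 (\<lambda>t x. \<theta> t * l x) = neumann_flux T \<Omega> P2 u2 (\<lambda>t x. \<theta> t * l x)"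
      using sols[OF tt'(1) tt(2) tt'(2) gg \<epsilon>(1,2)] unfolding \<gamma>_def by blast
    have \<gamma>c: "continuous_on UNIV (\<gamma> t)" "continuous_on UNIV (\<lambda>t. \<gamma> t x)" for t x
      unfolding \<gamma>_def by (rule probe_continuous[OF \<epsilon>(1)])+
    have \<gamma>r: "g1 \<le> \<gamma> t x" "\<gamma> t x \<le> g2" for t x
      unfolding \<gamma>_def by (rule probe_range[OF N T \<epsilon>(1,2) gg(2) tt'(1) tt(2) tt'(2)])+
    then have \<gamma>r': "glow \<le> \<gamma> t x \<and> \<gamma> t x \<le> gup" for t x
      using gg by (meson order_trans)
    have g1': "g1 \<le> gup" using gg by linarith
    have ls: "smooth (test_fn n)" by (rule smooth_singular_test[OF r_pos])
    have l0: "test_fn n x = 0" if "x \<notin> ball p (r / 2)" for x by (rule singular_test_outside[OF that r_pos])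
    let ?B = "\<lambda>P t. boundary_flux (primitive_from g1 (coeff_a P t)) (\<gamma> t) (test_fn n)"
    let ?bd = "\<lambda>t. (\<bar>\<theta> t\<bar> * (aup * (gup - glow) + 2 * C) + \<bar>frechet_derivative \<theta> (at t) 1\<bar> * C) * (Mb * real (n + 1))"
    obtain R1 where R1: "integrable (lebesgue_on ?I) R1" "\<And>t. t \<in> ?I \<Longrightarrow> \<bar>R1 t\<bar> \<le> ?bd t"
      "integrable (lebesgue_on ?I) (\<lambda>t. \<theta> t * ?B P1 t)"
      "neumann_flux T \<Omega> P1 u1 (\<lambda>t x. \<theta> t * test_fn n x) = (\<integral>t. \<theta> t * ?B P1 t + R1 t \<partial>lebesgue_on ?I)"
      by (rule flux_representation[OF co1 al u(1) u(3) gg(1) g1' T \<gamma>c \<gamma>r' \<theta> ls l0 Mb(2,3,4)]; (rule that | assumption))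
    obtain R2 where R2: "integrable (lebesgue_on ?I) R2" "\<And>t. t \<in> ?I \<Longrightarrow> \<bar>R2 t\<bar> \<le> ?bd t"
      "integrable (lebesgue_on ?I) (\<lambda>t. \<theta> t * ?B P2 t)"
      "neumann_flux T \<Omega> P2 u2 (\<lambda>t x. \<theta> t * test_fn n x) = (\<integral>t. \<theta> t * ?B P2 t + R2 t \<partial>lebesgue_on ?I)"
      by (rule flux_representation[OF co2 al u(2) u(4) gg(1) g1' T \<gamma>c \<gamma>r' \<theta> ls l0 Mb(2,3,4)]; (rule that | assumption))
    have tI: "T / 2 \<in> ?I" using T by simp
    have Cnn: "C \<ge> 0" using c1(7)[OF tI, of 0] by linarith
    have aupnn: "aup \<ge> 0" using c1(8)[OF tI, of 0] al by linarith
    have Wnn: "aup * (gup - glow) + 2 * C \<ge> 0" using aupnn Cnn gg by simp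
    have bdX: "?bd t \<le> X * real (n + 1) * \<bar>1\<bar>" for t
    proof -
      have "?bd t \<le> (X0 * (aup * (gup - glow) + 2 * C) + X1 * C) * (Mb * real (n + 1))"
        using X0 X1 Wnn Cnn Mb(1) by (intro mult_right_mono add_mono) auto
      then show ?thesis by (simp add: X_def mult_ac)
    qed
    have i1: "integrable (lebesgue_on ?I) (\<lambda>t. 1 :: real)"
      using integrable_time_continuous[OF continuous_on_const] .
    have IR1: "\<bar>\<integral>t. R1 t \<partial>lebesgue_on ?I\<bar> \<le> X * real (n + 1) * TT"
      unfolding TT_def by (rule abs_integral_mult_le[OF i1]) (use order_trans[OF R1(2) bdX] in simp)
    have IR2: "\<bar>\<integral>t. R2 t \<partial>lebesgue_on ?I\<bar> \<le> X * real (n + 1) * TT"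
      unfolding TT_def by (rule abs_integral_mult_le[OF i1]) (use order_trans[OF R2(2) bdX] in simp)
    have "(\<integral>t. \<theta> t * ?B P1 t + R1 t \<partial>lebesgue_on ?I) = (\<integral>t. \<theta> t * ?B P2 t + R2 t \<partial>lebesgue_on ?I)"
      using flux[OF \<theta> ls] l0 R1(4) R2(4) by simp
    then have "(\<integral>t. \<theta> t * ?B P1 t \<partial>lebesgue_on ?I) - (\<integral>t. \<theta> t * ?B P2 t \<partial>lebesgue_on ?I)
        = (\<integral>t. R2 t \<partial>lebesgue_on ?I) - (\<integral>t. R1 t \<partial>lebesgue_on ?I)"
      using R1(1,3) R2(1,3) by simp
    \<comment> \<open>Equal fluxes force the two boundary terms to differ by no more than the two
      remainders.\<close>
    then have low: "- (2 * X * TT * real (n + 1)) \<le> (\<integral>t. \<theta> t * ?B P1 t - \<theta> t * ?B P2 t \<partial>lebesgue_on ?I)"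
      using IR1 IR2 R1(3) R2(3) by (simp add: abs_le_iff algebra_simps)
    define \<kappa> where "\<kappa> = h0 * \<epsilon> powr q"
    have \<kappa>: "\<kappa> \<ge> 0" using h0 by (simp add: \<kappa>_def)
    have \<gamma>eq: "\<gamma> t x = g1 + \<kappa> * space_bump p \<epsilon> x * time_bump t1 t2 t" for t x
      unfolding \<gamma>_def probe_eq probe_height_def \<kappa>_def h0_def q_def ..
    \<comment> \<open>\<theta> confines \<open>t\<close> to the interval where the first coefficient
      exceeds the second by \<delta> on the whole range of the probe. The difference of the
      primitives is then nonnegative, and the sign of the normal derivative produces the
      minus.\<close>
    have up: "\<theta> t * ?B P1 t - \<theta> t * ?B P2 t \<le> - (c * \<delta> * \<kappa> * 2 ^ n) * (\<theta> t * time_bump t1 t2 t)" if t: "t \<in> ?I" for t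
    proof (cases "t1 < t \<and> t < t2")
      case False
      then have "\<theta> t = 0" using \<theta>pos[of t] \<theta>0[of t] by auto
      then show ?thesis by simp
    next
      case True
      let ?A1 = "primitive_from g1 (coeff_a P1 t)" and ?A2 = "primitive_from g1 (coeff_a P2 t)"
      note ca1 = coeff_a_continuous[OF c1(1) t] and ca2 = coeff_a_continuous[OF c2(1) t]
      have cA1: "continuous_on UNIV ?A1" and cA2: "continuous_on UNIV ?A2"
        using primitive_from_derivative[OF ca1] primitive_from_derivative[OF ca2]
        by (auto intro!: continuous_at_imp_continuous_on DERIV_isCont)
      define W where "W = (\<lambda>x. ?A1 (\<gamma> t x) - ?A2 (\<gamma> t x))"
      have Wge: "\<delta> * (\<gamma> t x - g1) \<le> W x" for x
        unfolding W_def using \<gamma>r[of t x] box True by (intro primitive_from_diff_ge ca1 ca2) auto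
      have "?B P1 t - ?B P2 t = (\<integral>x. indicator slab x * (W (proj x) * frechet_derivative (test_fn n) (at (proj x)) e) \<partial>lborel)"
        unfolding boundary_flux_def W_def
        by (subst Bochner_Integration.integral_diff[symmetric, OF boundary_flux_integrable[OF cA1 \<gamma>c(1) ls l0] boundary_flux_integrable[OF cA2 \<gamma>c(1) ls l0]])
          (simp_all add: algebra_simps)
      also have "\<dots> \<le> - (c * (\<delta> * (\<kappa> * time_bump t1 t2 t)) * 2 ^ n)"
      proof (rule c(2)[OF n])
        show "continuous_on UNIV W"
          unfolding W_def using continuous_on_compose2[OF cA1 \<gamma>c(1)] continuous_on_compose2[OF cA2 \<gamma>c(1)]
          by (intro continuous_on_diff) auto
        show "0 \<le> W x" for x
          using Wge[of x] \<gamma>r[of t x] \<delta>(1) mult_nonneg_nonneg[of \<delta> "\<gamma> t x - g1"] by linarith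
        show "W x = 0" if "r / 2 ^ n \<le> norm (x - p)" for x
        proof -
          have "space_bump p \<epsilon> x = 0" using that \<epsilon>(1) by (auto simp: space_bump_def \<epsilon>_def[symmetric])
          then show ?thesis by (simp add: W_def \<gamma>eq primitive_from_base)
        qed
        show "0 \<le> \<delta> * (\<kappa> * time_bump t1 t2 t)" using \<delta> \<kappa> tb0 by simp
        show "\<delta> * (\<kappa> * time_bump t1 t2 t) \<le> W x" if "norm (x - p) \<le> r / 2 ^ n / 2" for x
        proof -
          have "space_bump p \<epsilon> x = 1" using that by (simp add: space_bump_def \<epsilon>_def)
          then show ?thesis using Wge[of x] by (simp add: \<gamma>eq)
        qed
      qed
      finally have "\<theta> t * (?B P1 t - ?B P2 t) \<le> \<theta> t * (- (c * (\<delta> * (\<kappa> * time_bump t1 t2 t)) * 2 ^ n))"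
        by (rule mult_left_mono[OF _ \<theta>0])
      then show ?thesis by (simp add: algebra_simps)
    qed
    have "(\<integral>t. \<theta> t * ?B P1 t - \<theta> t * ?B P2 t \<partial>lebesgue_on ?I)
        \<le> (\<integral>t. - (c * \<delta> * \<kappa> * 2 ^ n) * (\<theta> t * time_bump t1 t2 t) \<partial>lebesgue_on ?I)"
      by (intro integral_mono Bochner_Integration.integrable_diff R1(3) R2(3) integrable_mult_right itb up) simp
    also have "\<dots> = - (c * \<delta> * \<kappa> * 2 ^ n) * \<tau>" by (simp add: \<tau>_def)
    finally have "- (2 * X * TT * real (n + 1)) \<le> - (c * \<delta> * \<kappa> * 2 ^ n) * \<tau>" by (rule order_trans[OF low])
    then have main: "c * \<delta> * \<kappa> * 2 ^ n * \<tau> \<le> 2 * X * TT * real (n + 1)" by (simp del: of_nat_add)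
    have "sqrt r * 2 ^ m = 2 ^ n * sqrt \<epsilon>"
    proof -
      have "sqrt \<epsilon> = sqrt r / 2 ^ m"
        unfolding \<epsilon>_def n_def real_sqrt_divide mult.commute[of 2 m] power_mult real_sqrt_abs by simp
      then show ?thesis by (simp add: n_def mult.commute[of 2 m] power_mult power2_eq_square)
    qed
    also have "sqrt \<epsilon> = \<epsilon> powr (1 / 2)" using \<epsilon>(1) by (simp add: powr_half_sqrt)
    \<comment> \<open>\<open>q\<close> is at most 1/2 as N >= 2, and \<epsilon> is at most 1, so the
      plane is the worst case.\<close>
    also have "2 ^ n * \<epsilon> powr (1 / 2) \<le> 2 ^ n * \<epsilon> powr q"
      using \<epsilon> dim by (intro mult_left_mono powr_mono') (auto simp: q_def)
    finally have "c * \<delta> * \<tau> * h0 * (sqrt r * 2 ^ m) \<le> c * \<delta> * \<tau> * h0 * (2 ^ n * \<epsilon> powr q)"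
      using c(1) \<delta>(1) \<tau> h0 by (intro mult_left_mono) auto
    also have "\<dots> = c * \<delta> * \<kappa> * 2 ^ n * \<tau>" by (simp add: \<kappa>_def mult_ac)
    also have "\<dots> \<le> 2 * X * TT * real (n + 1)" by (rule main)
    finally show ?thesis by (simp add: n_def mult.assoc add.commute)
  qed
  have "c * \<delta> * \<tau> * h0 * sqrt r > 0" using c(1) \<delta>(1) \<tau> h0 r_pos by simp
  from exponential_beats_linear[OF this, of "2 * X * TT"] key show False
    by (meson not_less)
qed

end

section \<open>The equivalence\<close>

theorem theorem2:
  fixes T glow gup C\<^sub>A C\<^sub>0 C\<^sub>G alow aup \<epsilon>\<^sub>0 :: real
    and \<Omega> \<Gamma>' \<Gamma> :: "(real ^ 'n) set" and xbar :: "real ^ 'n" and N_th :: 'n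
    and P1 P2 :: "(real ^ 'n) pde_data"
    and G :: "(real \<Rightarrow> real ^ 'n \<Rightarrow> real) set"
  assumes "CARD('n) \<in> {2, 3}"
    and "T > 0" and "glow < gup"
    and "C\<^sub>A > 0" and "C\<^sub>0 > 0" and "C\<^sub>G > 0" and "alow > 0" and "aup > 0"
    and "geometric_assumption (axis N_th 1) \<Omega> \<Gamma>' \<Gamma> xbar \<epsilon>\<^sub>0"
    and "C\<^sub>G_large T \<Omega> xbar \<epsilon>\<^sub>0 glow gup C\<^sub>G"
    and "G = boundary_data T \<Omega> glow gup C\<^sub>G"
    and "\<forall>P\<in>{P1, P2}. coefficient_assumption T \<Omega> C\<^sub>A C\<^sub>0 alow aup P"
    and "solvability_assumption T \<Omega> G {P1, P2}"
    and "\<forall>P\<in>{P1, P2}. \<forall>g\<in>G. unique_weak_solution T \<Omega> P g"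
    and "\<forall>P\<in>{P1, P2}. \<forall>g\<in>G. AE t in lebesgue_on {0<..<T}. AE x in lebesgue_on \<Omega>.
           glow \<le> the_solution T \<Omega> P g t x \<and> the_solution T \<Omega> P g t x \<le> gup"
    and "\<forall>x\<in>\<Omega>. \<forall>t\<in>{0<..<T}. \<forall>u. coeff_b P1 x t u = coeff_b P2 x t u"
    and "\<forall>x\<in>\<Omega>. \<forall>t\<in>{0<..<T}. \<forall>u p. coeff_c P1 x t u p = coeff_c P2 x t u p"
    and "\<forall>t\<in>{0<..<T}. \<forall>u. coeff_d P1 t u = coeff_d P2 t u"
    and "AE x in lebesgue_on \<Omega>. init_u P1 x = init_u P2 x"
  shows "(\<forall>t\<in>{0<..<T}. \<forall>u\<in>{glow<..<gup}. coeff_a P1 t u = coeff_a P2 t u) \<longleftrightarrow>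
    (\<forall>g\<in>G. flux_vanishes_on T \<Omega> \<Gamma>
       (\<lambda>\<phi>. neumann_flux T \<Omega> P1 (the_solution T \<Omega> P1 g) \<phi>
            - neumann_flux T \<Omega> P2 (the_solution T \<Omega> P2 g) \<phi>))"
    (is "?equal \<longleftrightarrow> ?fluxes")
proof -
  let ?e = "axis N_th 1 :: real ^ 'n" and ?I = "{0<..<T}"
  note T = assms(2) and lt = assms(3) and al = assms(7) and geo = assms(9) and CG = assms(10) and G = assms(11)
  have co: "coefficient_assumption T \<Omega> C\<^sub>A C\<^sub>0 alow aup P1" "coefficient_assumption T \<Omega> C\<^sub>A C\<^sub>0 alow aup P2"
    using assms(12) by auto
  have op: "open \<Omega>" and bdd: "bounded \<Omega>"
    using geo by (auto simp: geometric_assumption_def bounded_lipschitz_domain_def)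
  have sol: "weak_solution T \<Omega> P g (the_solution T \<Omega> P g)" if "P \<in> {P1, P2}" "g \<in> G" for P g
  proof -
    have "\<exists>u. weak_solution T \<Omega> P g u" using assms(14) that unfolding unique_weak_solution_def by blast
    then show ?thesis unfolding the_solution_def by (rule someI_ex)
  qed
  have dims: "DIM(real ^ 'n) \<ge> 2" "DIM(real ^ 'n) \<le> 3" using assms(1) by auto
  show ?thesis
  proof
    assume ?equal
    show ?fluxes
      unfolding flux_vanishes_on_def
    proof (intro ballI impI)
      fix g \<phi> assume g: "g \<in> G"
      have "neumann_flux T \<Omega> P1 (the_solution T \<Omega> P1 g) \<phi> = neumann_flux T \<Omega> P2 (the_solution T \<Omega> P2 g) \<phi>"
        by (rule flux_eq_if_coefficients_eq[OF op co lt _ _ _ _ assms(19) sol sol])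
          (use \<open>?equal\<close> assms(14-18) g in auto)
      then show "neumann_flux T \<Omega> P1 (the_solution T \<Omega> P1 g) \<phi> - neumann_flux T \<Omega> P2 (the_solution T \<Omega> P2 g) \<phi> = 0"
        by simp
    qed
  next
    assume fl: ?fluxes
    have \<epsilon>0: "\<epsilon>\<^sub>0 > 0" and xb: "xbar \<in> \<Gamma>'" and \<Gamma>: "\<Gamma> = ball xbar \<epsilon>\<^sub>0 \<inter> frontier \<Omega>"
      and normal: "\<And>x. x \<in> ball xbar \<epsilon>\<^sub>0 \<inter> frontier \<Omega> \<Longrightarrow> outward_normal \<Omega> x = ?e"
      and sbp: "smooth_boundary_part \<Omega> \<Gamma>'" and ne: "emeasure (surface_measure \<Omega>) \<Gamma>' \<noteq> 0"
      using geo unfolding geometric_assumption_def by auto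
    obtain U \<nu> h where chart: "lipschitz_chart \<Omega> xbar U \<nu> h" "smooth h"
      using sbp xb unfolding smooth_boundary_part_def by blast
    have xf: "xbar \<in> frontier \<Omega>"
      using sbp xb unfolding smooth_boundary_part_def by (auto dest: openin_imp_subset)
    obtain r0 where r0: "0 < r0" "r0 \<le> \<epsilon>\<^sub>0" "\<And>x. x \<in> ball xbar r0 \<Longrightarrow> x \<in> \<Omega> \<longleftrightarrow> x \<bullet> ?e < xbar \<bullet> ?e"
      using flat_boundary_half_ball[OF op chart xf \<epsilon>0 normal] by blast
    \<comment> \<open>The bound by 1 makes every \<epsilon> = r / 2^n at most 1, as the comparison
      of powers of \<epsilon> requires.\<close>
    define r where "r = min r0 1"
    interpret flat_boundary_point \<Omega> ?e xbar r
    proof (rule flat_boundary_point.intro)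
      show "?e \<in> Basis" by (simp add: axis_in_Basis_iff)
      show "x \<in> \<Omega> \<longleftrightarrow> x \<bullet> ?e < xbar \<bullet> ?e" if "x \<in> ball xbar r" for x
        using r0(3)[of x] that by (simp add: r_def)
      show "finite_measure (surface_measure \<Omega>)"
        by (rule finite_surface_measure[OF CG T \<epsilon>0 lt])
    qed (use op bdd dims(1) r0(1) ne in \<open>auto simp: r_def\<close>)
    have r: "r \<le> \<epsilon>\<^sub>0" "r \<le> 1" using r0(2) by (auto simp: r_def)
    have eqflux: "neumann_flux T \<Omega> P1 (the_solution T \<Omega> P1 g) (\<lambda>t x. \<theta> t * l x)
        = neumann_flux T \<Omega> P2 (the_solution T \<Omega> P2 g) (\<lambda>t x. \<theta> t * l x)"
      if g: "g \<in> G" and \<theta>: "\<theta> \<in> test_functions ?I" and l: "smooth l" "\<And>x. x \<notin> ball xbar (r / 2) \<Longrightarrow> l x = 0" for g \<theta> l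
    proof -
      have "(\<lambda>t x. \<theta> t * l x) \<in> H10_time T (H1 \<Omega>) (H1_norm \<Omega>)"
        by (rule product_H10_time[OF op bdd \<theta> smooth_H1[OF l(1) op bdd]])
      \<comment> \<open>A smooth function is its own trace, and \<open>l\<close> vanishes outside a
        ball whose intersection with the boundary lies in \<Gamma>.\<close>
      moreover have "AE t in lebesgue_on ?I. \<exists>\<psi>. has_trace \<Omega> (\<lambda>x. \<theta> t * l x) \<psi> \<and>
          (AE x in surface_measure \<Omega>. x \<notin> \<Gamma> \<longrightarrow> \<psi> x = 0)"
      proof (rule AE_I2, rule exI, rule conjI)
        fix t
        show "has_trace \<Omega> (\<lambda>x. \<theta> t * l x) (\<lambda>x. \<theta> t * l x)"
          by (rule smooth_has_trace[OF smooth_cmult[OF l(1)]])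
        show "AE x in surface_measure \<Omega>. x \<notin> \<Gamma> \<longrightarrow> \<theta> t * l x = 0"
        proof (rule AE_I2, rule impI)
          fix x assume x: "x \<in> space (surface_measure \<Omega>)" "x \<notin> \<Gamma>"
          then have "x \<notin> ball xbar \<epsilon>\<^sub>0" by (simp add: \<Gamma> surface_measure_def space_restrict_space)
          then show "\<theta> t * l x = 0" using l(2)[of x] r r_pos by auto
        qed
      qed
      ultimately show ?thesis using fl g unfolding flux_vanishes_on_def by fastforce
    qed
    \<comment> \<open>Stated for both orders of the two problems, to serve either inequality between
      the coefficients.\<close>
    have sols: "\<exists>u1 u2. weak_solution T \<Omega> P (probe T \<epsilon>\<^sub>0 xbar \<epsilon> t1 t2 g1 g2) u1 \<and>
        weak_solution T \<Omega> P' (probe T \<epsilon>\<^sub>0 xbar \<epsilon> t1 t2 g1 g2) u2 \<and>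
        (AE t in lebesgue_on ?I. AE x in lebesgue_on \<Omega>. glow \<le> u1 t x \<and> u1 t x \<le> gup) \<and>
        (AE t in lebesgue_on ?I. AE x in lebesgue_on \<Omega>. glow \<le> u2 t x \<and> u2 t x \<le> gup) \<and>
        (\<forall>\<theta> l. \<theta> \<in> test_functions ?I \<longrightarrow> smooth l \<longrightarrow> (\<forall>x. x \<notin> ball xbar (r / 2) \<longrightarrow> l x = 0) \<longrightarrow>
          neumann_flux T \<Omega> P u1 (\<lambda>t x. \<theta> t * l x) = neumann_flux T \<Omega> P' u2 (\<lambda>t x. \<theta> t * l x))"
      if PP: "(P, P') \<in> {(P1, P2), (P2, P1)}" and t: "0 \<le> t1" "t1 < t2" "t2 \<le> T" and g: "glow \<le> g1" "g1 < g2" "g2 \<le> gup"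
        and \<epsilon>: "0 < \<epsilon>" "\<epsilon> \<le> \<epsilon>\<^sub>0" for P P' t1 t2 g1 g2 \<epsilon>
    proof -
      have pG: "probe T \<epsilon>\<^sub>0 xbar \<epsilon> t1 t2 g1 g2 \<in> G"
        unfolding G by (rule probe_in_boundary_data[OF CG dims(2) T \<epsilon> g t])
      show ?thesis
      proof (intro exI conjI allI impI)
        show "weak_solution T \<Omega> P (probe T \<epsilon>\<^sub>0 xbar \<epsilon> t1 t2 g1 g2) (the_solution T \<Omega> P (probe T \<epsilon>\<^sub>0 xbar \<epsilon> t1 t2 g1 g2))"
          "weak_solution T \<Omega> P' (probe T \<epsilon>\<^sub>0 xbar \<epsilon> t1 t2 g1 g2) (the_solution T \<Omega> P' (probe T \<epsilon>\<^sub>0 xbar \<epsilon> t1 t2 g1 g2))"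
          using PP by (auto intro!: sol pG)
        show "AE t in lebesgue_on ?I. AE x in lebesgue_on \<Omega>. glow \<le> the_solution T \<Omega> P (probe T \<epsilon>\<^sub>0 xbar \<epsilon> t1 t2 g1 g2) t x \<and>
            the_solution T \<Omega> P (probe T \<epsilon>\<^sub>0 xbar \<epsilon> t1 t2 g1 g2) t x \<le> gup"
          "AE t in lebesgue_on ?I. AE x in lebesgue_on \<Omega>. glow \<le> the_solution T \<Omega> P' (probe T \<epsilon>\<^sub>0 xbar \<epsilon> t1 t2 g1 g2) t x \<and>
            the_solution T \<Omega> P' (probe T \<epsilon>\<^sub>0 xbar \<epsilon> t1 t2 g1 g2) t x \<le> gup"
          using assms(15) pG PP by auto
        fix \<theta> :: "real \<Rightarrow> real" and l :: "real ^ 'n \<Rightarrow> real"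
        assume "\<theta> \<in> test_functions ?I" "smooth l" "\<forall>x. x \<notin> ball xbar (r / 2) \<longrightarrow> l x = 0"
        then show "neumann_flux T \<Omega> P (the_solution T \<Omega> P (probe T \<epsilon>\<^sub>0 xbar \<epsilon> t1 t2 g1 g2)) (\<lambda>t x. \<theta> t * l x)
            = neumann_flux T \<Omega> P' (the_solution T \<Omega> P' (probe T \<epsilon>\<^sub>0 xbar \<epsilon> t1 t2 g1 g2)) (\<lambda>t x. \<theta> t * l x)"
          using eqflux[OF pG, of \<theta> l] PP by auto
      qed
    qed
    show ?equal
    proof (intro ballI antisym)
      fix t u assume t: "t \<in> ?I" and u: "u \<in> {glow<..<gup}"
      show "coeff_a P1 t u \<le> coeff_a P2 t u"
        by (rule coefficient_le[OF co al T dims(2) r sols t u]) auto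
      show "coeff_a P2 t u \<le> coeff_a P1 t u"
        by (rule coefficient_le[OF co(2,1) al T dims(2) r sols t u]) auto
    qed
  qed
qed

end
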